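(* Let $G$ be a second countable almost unimodular group, and let $(\alpha,u)\colon \Delta_G(G)\curvearrowright L(G_1)$ be the cocycle action associated with a normalized section $\sigma\colon\Delta_G(G)\to G$. The following two conditions are equivalent. (i) $(\alpha,u)\colon\Delta_G(G)\curvearrowright L(G_1)$ is centrally ergodic. (ii) $L(G)$ is a factor.
   Context: For a locally compact group $G$ with left Haar measure, $\lambda_\ell^G$ is the left regular representation on $L^2(G)$, $L(G)=\{\lambda_\ell^G(g):g\in G\}''$ is the group von Neumann algebra, $\Delta_G\colon G\to(0,\infty)$ is the modular function and $G_1=\ker\Delta_G$. A locally compact group $G$ is almost unimodular if $G_1$ is open in $G$. The group $\Delta_G(G)\le\mathbb{R}_+=(0,\infty)$ is regarded as a discrete abelian group. Cocycle action associated with a section: let $K=\Delta_G(G)$ and let $\sigma\colon K\to G$ be a section, i.e. $\Delta_G(\sigma(k))=k$ for all $k\in K$, normalized so that $\sigma(1)=e_G$. Define for $k,k_1,k_2\in K$, $h\in G_1$ $$\beta_k(h)=\sigma(k^{-1})^{-1}h\,\sigma(k^{-1}),\qquad c(k_1,k_2)=\sigma(k_1^{-1})^{-1}\sigma(k_2^{-1})^{-1}\sigma(k_2^{-1}k_1^{-1})\in G_1 .$$ Then $\alpha_k\in\mathrm{Aut}(L(G_1))$ is the automorphism determined by $\alpha_k(\lambda_\ell^{G_1}(h))=\lambda_\ell^{G_1}(\beta_k(h))$, and $u(k_1,k_2)=\lambda_\ell^{G_1}(c(k_1,k_2))$. The pair $(\alpha,u)$ is a cocycle action of $K$ on $L(G_1)$,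 i.e. $\alpha_{s}\alpha_{t}=\mathrm{Ad}(u(s,t))\alpha_{st}$, $u(s,t)u(st,r)=\alpha_s(u(t,r))u(s,tr)$, $u(s,1)=u(1,s)=1$. $(\alpha,u)$ is centrally ergodic if $\{x\in Z(L(G_1)):\alpha_k(x)=x\ (k\in K)\}=\mathbb{C}1$, where $Z(\cdot)$ denotes the center. *)

theory Defs
  imports "HOL-Analysis.Analysis" "HOL-Algebra.Coset"
begin

section \<open>The Hilbert space of square-integrable functions\<close>

text \<open>
  The Hilbert space of a measure is the set of a.e.-classes of square-integrable complex
  functions. Functions are total on the type, but their values outside the space of the measure
  affect neither measurability nor a.e. equality. Vectors are the classes, so that equality of
  vectors and of operators is HOL equality; the operations do not depend on the representatives
  picked by \<open>L2_rep\<close>.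
\<close>

definition L2_fun :: "'x measure \<Rightarrow> ('x \<Rightarrow> complex) set" where
  "L2_fun M = {f \<in> borel_measurable M. integrable M (\<lambda>x. (cmod (f x))\<^sup>2)}"

definition L2_rel :: "'x measure \<Rightarrow> (('x \<Rightarrow> complex) \<times> ('x \<Rightarrow> complex)) set" where
  "L2_rel M = {(f, g). f \<in> L2_fun M \<and> g \<in> L2_fun M \<and> (AE x in M. f x = g x)}"

type_synonym 'x l2 = "('x \<Rightarrow> complex) set"

type_synonym 'x l2_op = "'x l2 \<Rightarrow> 'x l2"

definition L2_space :: "'x measure \<Rightarrow> 'x l2 set" where
  "L2_space M = L2_fun M // L2_rel M"

definition L2_class :: "'x measure \<Rightarrow> ('x \<Rightarrow> complex) \<Rightarrow> 'x l2" where
  "L2_class M f = L2_rel M `` {f}"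

definition L2_rep :: "'x l2 \<Rightarrow> 'x \<Rightarrow> complex" where
  "L2_rep X = (SOME f. f \<in> X)"

definition L2_add :: "'x measure \<Rightarrow> 'x l2 \<Rightarrow> 'x l2 \<Rightarrow> 'x l2" where
  "L2_add M X Y = L2_class M (\<lambda>x. L2_rep X x + L2_rep Y x)"

definition L2_scale :: "'x measure \<Rightarrow> complex \<Rightarrow> 'x l2 \<Rightarrow> 'x l2" where
  "L2_scale M a X = L2_class M (\<lambda>x. a * L2_rep X x)"

definition L2_inner :: "'x measure \<Rightarrow> 'x l2 \<Rightarrow> 'x l2 \<Rightarrow> complex" where
  "L2_inner M X Y = (\<integral>x. cnj (L2_rep X x) * L2_rep Y x \<partial>M)"

definition L2_norm :: "'x measure \<Rightarrow> 'x l2 \<Rightarrow> real" where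
  "L2_norm M X = sqrt (\<integral>x. (cmod (L2_rep X x))\<^sup>2 \<partial>M)"


section \<open>Bounded operators and von Neumann algebras\<close>

text \<open>Operators are extensional: \<open>undefined\<close> outside the Hilbert space.\<close>

definition bounded_ops :: "'x measure \<Rightarrow> 'x l2_op set" where
  "bounded_ops M = {T \<in> L2_space M \<rightarrow>\<^sub>E L2_space M.
     (\<forall>X\<in>L2_space M. \<forall>Y\<in>L2_space M. T (L2_add M X Y) = L2_add M (T X) (T Y)) \<and>
     (\<forall>a. \<forall>X\<in>L2_space M. T (L2_scale M a X) = L2_scale M a (T X)) \<and>
     (\<exists>C. \<forall>X\<in>L2_space M. L2_norm M (T X) \<le> C * L2_norm M X)}"

definition op_id :: "'x measure \<Rightarrow> 'x l2_op" where
  "op_id M = (\<lambda>X\<in>L2_space M. X)"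

definition op_add :: "'x measure \<Rightarrow> 'x l2_op \<Rightarrow> 'x l2_op \<Rightarrow> 'x l2_op" where
  "op_add M S T = (\<lambda>X\<in>L2_space M. L2_add M (S X) (T X))"

definition op_scale :: "'x measure \<Rightarrow> complex \<Rightarrow> 'x l2_op \<Rightarrow> 'x l2_op" where
  "op_scale M a T = (\<lambda>X\<in>L2_space M. L2_scale M a (T X))"

definition op_mult :: "'x measure \<Rightarrow> 'x l2_op \<Rightarrow> 'x l2_op \<Rightarrow> 'x l2_op" where
  "op_mult M S T = compose (L2_space M) S T"

definition op_adjoint :: "'x measure \<Rightarrow> 'x l2_op \<Rightarrow> 'x l2_op" where
  "op_adjoint M T = (THE S. S \<in> bounded_ops M \<and>
     (\<forall>X\<in>L2_space M. \<forall>Y\<in>L2_space M. L2_inner M (S X) Y = L2_inner M X (T Y)))"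

definition op_scalars :: "'x measure \<Rightarrow> 'x l2_op set" where
  "op_scalars M = range (\<lambda>a. op_scale M a (op_id M))"

definition commutant :: "'x measure \<Rightarrow> 'x l2_op set \<Rightarrow> 'x l2_op set" where
  "commutant M A = {T \<in> bounded_ops M. \<forall>S\<in>A. op_mult M T S = op_mult M S T}"

definition von_neumann_algebra :: "'x measure \<Rightarrow> 'x l2_op set \<Rightarrow> bool" where
  "von_neumann_algebra M N \<longleftrightarrow>
     N \<subseteq> bounded_ops M \<and> (\<forall>T\<in>N. op_adjoint M T \<in> N) \<and> commutant M (commutant M N) = N"

definition vn_center :: "'x measure \<Rightarrow> 'x l2_op set \<Rightarrow> 'x l2_op set" where
  "vn_center M N = {T \<in> N. \<forall>S\<in>N. op_mult M T S = op_mult M S T}"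

definition vn_factor :: "'x measure \<Rightarrow> 'x l2_op set \<Rightarrow> bool" where
  "vn_factor M N \<longleftrightarrow> von_neumann_algebra M N \<and> vn_center M N = op_scalars M"

definition vn_automorphisms :: "'x measure \<Rightarrow> 'x l2_op set \<Rightarrow> ('x l2_op \<Rightarrow> 'x l2_op) set" where
  "vn_automorphisms M N = {a \<in> extensional N. bij_betw a N N \<and>
     (\<forall>S\<in>N. \<forall>T\<in>N. a (op_add M S T) = op_add M (a S) (a T)) \<and>
     (\<forall>z. \<forall>T\<in>N. a (op_scale M z T) = op_scale M z (a T)) \<and>
     (\<forall>S\<in>N. \<forall>T\<in>N. a (op_mult M S T) = op_mult M (a S) (a T)) \<and>
     (\<forall>T\<in>N. a (op_adjoint M T) = op_adjoint M (a T))}"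

text \<open>
  The ultraweak topology: the weakest one making all functionals
  \<open>T \<mapsto> \<Sum>n. \<langle>\<xi> n, T (\<eta> n)\<rangle>\<close> with square-summable \<open>\<xi>\<close>, \<open>\<eta>\<close> continuous.
\<close>

definition l2_sequences :: "'x measure \<Rightarrow> (nat \<Rightarrow> 'x l2) set" where
  "l2_sequences M = {\<xi>. (\<forall>n. \<xi> n \<in> L2_space M) \<and> summable (\<lambda>n. (L2_norm M (\<xi> n))\<^sup>2)}"

definition ultraweak_topology :: "'x measure \<Rightarrow> 'x l2_op topology" where
  "ultraweak_topology M = topology_generated_by
     {{T \<in> bounded_ops M. (\<Sum>n. L2_inner M (\<xi> n) (T (\<eta> n))) \<in> U} | \<xi> \<eta> U.
        \<xi> \<in> l2_sequences M \<and> \<eta> \<in> l2_sequences M \<and> open U}"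

definition ultraweakly_continuous :: "'x measure \<Rightarrow> 'x l2_op set \<Rightarrow> ('x l2_op \<Rightarrow> 'x l2_op) \<Rightarrow> bool"
  where
  "ultraweakly_continuous M N a \<longleftrightarrow>
     continuous_map (subtopology (ultraweak_topology M) N) (subtopology (ultraweak_topology M) N) a"


section \<open>Locally compact groups and their von Neumann algebras\<close>

definition locally_compact_group :: "('g, 'b) monoid_scheme \<Rightarrow> 'g topology \<Rightarrow> bool" where
  "locally_compact_group G T \<longleftrightarrow>
     group G \<and> topspace T = carrier G \<and>
     continuous_map (prod_topology T T) T (\<lambda>(x, y). x \<otimes>\<^bsub>G\<^esub> y) \<and>
     continuous_map T T (\<lambda>x. inv\<^bsub>G\<^esub> x) \<and>
     Hausdorff_space T \<and> locally_compact_space T"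

definition left_haar_measure :: "('g, 'b) monoid_scheme \<Rightarrow> 'g topology \<Rightarrow> 'g measure \<Rightarrow> bool" where
  "left_haar_measure G T \<mu> \<longleftrightarrow>
     sets \<mu> = sigma_sets (topspace T) {U. openin T U} \<and>
     emeasure \<mu> (space \<mu>) \<noteq> 0 \<and>
     (\<forall>C. compactin T C \<longrightarrow> emeasure \<mu> C < \<infinity>) \<and>
     (\<forall>A\<in>sets \<mu>. emeasure \<mu> A = (INF U\<in>{U. openin T U \<and> A \<subseteq> U}. emeasure \<mu> U)) \<and>
     (\<forall>U. openin T U \<longrightarrow> emeasure \<mu> U = (SUP C\<in>{C. compactin T C \<and> C \<subseteq> U}. emeasure \<mu> C)) \<and>
     (\<forall>g\<in>carrier G. \<forall>A\<in>sets \<mu>. emeasure \<mu> (g <#\<^bsub>G\<^esub> A) = emeasure \<mu> A)"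

text \<open>
  The modular function is normalized by \<open>\<mu> (A g) = \<Delta> g * \<mu> A\<close> for a left Haar measure \<open>\<mu>\<close>.
  It does not depend on the choice of \<open>\<mu>\<close>.
\<close>

definition modular_function :: "('g, 'b) monoid_scheme \<Rightarrow> 'g measure \<Rightarrow> 'g \<Rightarrow> real" where
  "modular_function G \<mu> g =
     (THE c. c > 0 \<and> (\<forall>A\<in>sets \<mu>. emeasure \<mu> (A #>\<^bsub>G\<^esub> g) = ennreal c * emeasure \<mu> A))"

definition modular_range :: "('g, 'b) monoid_scheme \<Rightarrow> 'g measure \<Rightarrow> real set" where
  "modular_range G \<mu> = modular_function G \<mu> ` carrier G"

definition modular_kernel :: "('g, 'b) monoid_scheme \<Rightarrow> 'g measure \<Rightarrow> 'g set" where
  "modular_kernel G \<mu> = {g \<in> carrier G. modular_function G \<mu> g = 1}"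

definition kernel_group :: "('g, 'b) monoid_scheme \<Rightarrow> 'g measure \<Rightarrow> ('g, 'b) monoid_scheme" where
  "kernel_group G \<mu> = G\<lparr>carrier := modular_kernel G \<mu>\<rparr>"

definition kernel_topology ::
    "('g, 'b) monoid_scheme \<Rightarrow> 'g topology \<Rightarrow> 'g measure \<Rightarrow> 'g topology" where
  "kernel_topology G T \<mu> = subtopology T (modular_kernel G \<mu>)"

definition almost_unimodular_group ::
    "('g, 'b) monoid_scheme \<Rightarrow> 'g topology \<Rightarrow> 'g measure \<Rightarrow> bool" where
  "almost_unimodular_group G T \<mu> \<longleftrightarrow>
     locally_compact_group G T \<and> left_haar_measure G T \<mu> \<and> openin T (modular_kernel G \<mu>)"

definition left_regular :: "('g, 'b) monoid_scheme \<Rightarrow> 'g measure \<Rightarrow> 'g \<Rightarrow> 'g l2_op" where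
  "left_regular G \<mu> g =
     (\<lambda>X\<in>L2_space \<mu>. L2_class \<mu> (\<lambda>x. L2_rep X (inv\<^bsub>G\<^esub> g \<otimes>\<^bsub>G\<^esub> x)))"

definition group_vna :: "('g, 'b) monoid_scheme \<Rightarrow> 'g measure \<Rightarrow> 'g l2_op set" where
  "group_vna G \<mu> = commutant \<mu> (commutant \<mu> (left_regular G \<mu> ` carrier G))"


section \<open>The cocycle action associated with a section\<close>

definition normalized_section ::
    "('g, 'b) monoid_scheme \<Rightarrow> 'g measure \<Rightarrow> (real \<Rightarrow> 'g) \<Rightarrow> bool" where
  "normalized_section G \<mu> \<sigma> \<longleftrightarrow>
     (\<forall>k\<in>modular_range G \<mu>. \<sigma> k \<in> carrier G \<and> modular_function G \<mu> (\<sigma> k) = k) \<and> \<sigma> 1 = \<one>\<^bsub>G\<^esub>"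

definition section_conj :: "('g, 'b) monoid_scheme \<Rightarrow> (real \<Rightarrow> 'g) \<Rightarrow> real \<Rightarrow> 'g \<Rightarrow> 'g" where
  "section_conj G \<sigma> k h = inv\<^bsub>G\<^esub> (\<sigma> (inverse k)) \<otimes>\<^bsub>G\<^esub> h \<otimes>\<^bsub>G\<^esub> \<sigma> (inverse k)"

definition section_cocycle :: "('g, 'b) monoid_scheme \<Rightarrow> (real \<Rightarrow> 'g) \<Rightarrow> real \<Rightarrow> real \<Rightarrow> 'g" where
  "section_cocycle G \<sigma> k\<^sub>1 k\<^sub>2 =
     inv\<^bsub>G\<^esub> (\<sigma> (inverse k\<^sub>1)) \<otimes>\<^bsub>G\<^esub> inv\<^bsub>G\<^esub> (\<sigma> (inverse k\<^sub>2)) \<otimes>\<^bsub>G\<^esub> \<sigma> (inverse k\<^sub>2 * inverse k\<^sub>1)"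

text \<open>
  In the following, \<open>\<mu>\<close> is a left Haar measure of \<open>G\<close> and \<open>\<nu>\<close> one of the kernel of the modular
  function. An automorphism is determined by its values on the generators of a von Neumann algebra
  through ultraweak continuity. This continuity holds for every *-automorphism of a von Neumann
  algebra, so naming it in the description does not change the automorphism that is described.
\<close>

definition section_automorphism ::
    "('g, 'b) monoid_scheme \<Rightarrow> 'g measure \<Rightarrow> 'g measure \<Rightarrow> (real \<Rightarrow> 'g) \<Rightarrow>
       real \<Rightarrow> 'g l2_op \<Rightarrow> 'g l2_op" where
  "section_automorphism G \<mu> \<nu> \<sigma> k =
     (THE a. a \<in> vn_automorphisms \<nu> (group_vna (kernel_group G \<mu>) \<nu>) \<and>
        ultraweakly_continuous \<nu> (group_vna (kernel_group G \<mu>) \<nu>) a \<and>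
        (\<forall>h\<in>modular_kernel G \<mu>. a (left_regular (kernel_group G \<mu>) \<nu> h) =
           left_regular (kernel_group G \<mu>) \<nu> (section_conj G \<sigma> k h)))"

definition section_unitary ::
    "('g, 'b) monoid_scheme \<Rightarrow> 'g measure \<Rightarrow> 'g measure \<Rightarrow> (real \<Rightarrow> 'g) \<Rightarrow>
       real \<Rightarrow> real \<Rightarrow> 'g l2_op" where
  "section_unitary G \<mu> \<nu> \<sigma> k\<^sub>1 k\<^sub>2 =
     left_regular (kernel_group G \<mu>) \<nu> (section_cocycle G \<sigma> k\<^sub>1 k\<^sub>2)"

definition section_cocycle_action ::
    "('g, 'b) monoid_scheme \<Rightarrow> 'g measure \<Rightarrow> 'g measure \<Rightarrow> (real \<Rightarrow> 'g) \<Rightarrow>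
       (real \<Rightarrow> 'g l2_op \<Rightarrow> 'g l2_op) \<times> (real \<Rightarrow> real \<Rightarrow> 'g l2_op)" where
  "section_cocycle_action G \<mu> \<nu> \<sigma> =
     (section_automorphism G \<mu> \<nu> \<sigma>, section_unitary G \<mu> \<nu> \<sigma>)"

definition centrally_ergodic ::
    "'k set \<Rightarrow> 'x measure \<Rightarrow> 'x l2_op set \<Rightarrow>
       ('k \<Rightarrow> 'x l2_op \<Rightarrow> 'x l2_op) \<times> ('k \<Rightarrow> 'k \<Rightarrow> 'x l2_op) \<Rightarrow> bool" where
  "centrally_ergodic K M N = (\<lambda>(\<alpha>, u). {x \<in> vn_center M N. \<forall>k\<in>K. \<alpha> k x = x} = op_scalars M)"

end

theory Submission
  imports Defs
begin

text \<open>
  Write \<open>G\<^sub>1\<close> for the kernel of the modular function \<open>\<Delta>\<close>. In terms of modular theory, \<open>L(G\<^sub>1)\<close> is the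
  centralizer of the Plancherel weight of \<open>G\<close>, and a centralizer contains the center. Hence the
  center of \<open>L(G)\<close> consists of the elements of the center of \<open>L(G\<^sub>1)\<close> that commute with the
  translations by \<open>\<sigma> k\<close>, which are the fixed points of \<open>\<alpha>\<close>. The argument given here follows this
  idea, with a computation on convolution products in place of modular theory.

  A central element \<open>x\<close> commutes with left and with right translations. Let \<open>\<Delta>\<close> be constant on the
  sets \<open>A\<close>, \<open>B\<close>, \<open>C\<close>, with values \<open>p\<close>, \<open>q\<close>, \<open>r\<close>, and let \<open>\<tau>(A, B, C)\<close> be the inner product of \<open>1\<^sub>C\<close> with
  \<open>x (1\<^sub>A * 1\<^sub>B)\<close>. Moving translations across \<open>x\<close> gives \<open>\<tau>(A, B, C) = p \<tau>(B, inverse C, inverse A)\<close>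
  (\<open>convolution_form_rotate\<close>). Three rotations lead back to \<open>\<tau>(A, B, C)\<close> with the factor \<open>p q / r\<close>, so
  \<open>\<tau>\<close> vanishes unless \<open>p q = r\<close>. With \<open>A\<close> ranging over subsets of \<open>G\<^sub>1\<close> it follows that \<open>x\<close> maps
  functions supported on a level set of \<open>\<Delta>\<close> to functions supported on the same level set
  (\<open>central_preserves_level_sets\<close>).

  Since \<open>G\<^sub>1\<close> is open and \<open>G\<close> is second countable, the Hilbert space of \<open>G\<close> is a countable direct sum
  of copies of that of \<open>G\<^sub>1\<close>, in two ways: along left cosets and along right cosets (locale
  \<open>measure_fibration\<close>). The corner \<open>z\<close> of a central \<open>x\<close> at \<open>G\<^sub>1\<close> is central in \<open>L(G\<^sub>1)\<close> and invariant
  (\<open>corner_invariant_center\<close>), and \<open>x\<close> is determined by \<open>z\<close> because it preserves the functions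
  supported on \<open>G\<^sub>1\<close> (\<open>central_E\<close>). Conversely, for an invariant central \<open>z\<close>, the block diagonal operator
  along left cosets commutes with \<open>L(G)\<close> (\<open>left_amp_commutant\<close>), the one along right cosets belongs to
  \<open>L(G)\<close> (\<open>right_amp_bicommutant\<close>), and invariance says that the two are equal
  (\<open>left_amp_eq_right_amp\<close>).

  Two further ingredients give meaning to the definite descriptions in the statement. The modular
  function and the comparison of the Haar measures of \<open>G\<close> and \<open>G\<^sub>1\<close> rest on the uniqueness of the Haar
  measure (\<open>haar_unique\<close>). The automorphism \<open>\<alpha>\<^sub>k\<close> exists because it is implemented by a multiple of a
  unitary, and is unique because the translations generate an ultraweakly dense *-algebra, by von
  Neumann's density argument (\<open>bicommutant_approximation\<close>).
\<close>

section \<open>Vectors of the Hilbert space\<close>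

lemma borel_measurable_cnj [measurable]: "cnj \<in> borel_measurable borel"
  by (intro borel_measurable_continuous_onI continuous_intros)

lemma L2_fun_iff:
  "f \<in> L2_fun M \<longleftrightarrow> f \<in> borel_measurable M \<and> (\<integral>\<^sup>+x. ennreal ((cmod (f x))\<^sup>2) \<partial>M) < \<infinity>"
  unfolding L2_fun_def by (auto simp: integrable_iff_bounded)

lemma L2_fun_measurable: "f \<in> L2_fun M \<Longrightarrow> f \<in> borel_measurable M"
  by (simp add: L2_fun_def)

lemma L2_fun_integrable: "f \<in> L2_fun M \<Longrightarrow> integrable M (\<lambda>x. (cmod (f x))\<^sup>2)"
  by (simp add: L2_fun_def)

lemma L2_fun_zero [simp]: "(\<lambda>_. 0) \<in> L2_fun M"
  by (simp add: L2_fun_def)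

lemma L2_fun_add:
  assumes "f \<in> L2_fun M" "g \<in> L2_fun M"
  shows "(\<lambda>x. f x + g x) \<in> L2_fun M"
proof -
  have [measurable]: "f \<in> borel_measurable M" "g \<in> borel_measurable M"
    using assms by (auto simp: L2_fun_def)
  have "integrable M (\<lambda>x. 2 * (cmod (f x))\<^sup>2 + 2 * (cmod (g x))\<^sup>2)"
    using assms by (auto simp: L2_fun_def)
  then have "integrable M (\<lambda>x. (cmod (f x + g x))\<^sup>2)"
  proof (rule Bochner_Integration.integrable_bound)
    have "(cmod (a + b))\<^sup>2 \<le> 2 * (cmod a)\<^sup>2 + 2 * (cmod b)\<^sup>2" for a b :: complex
    proof -
      have "(cmod (a + b))\<^sup>2 \<le> (cmod a + cmod b)\<^sup>2"
        by (simp add: norm_triangle_ineq power_mono)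
      also have "\<dots> \<le> 2 * (cmod a)\<^sup>2 + 2 * (cmod b)\<^sup>2"
        using sum_squares_ge_zero[of "cmod a - cmod b" 0] by (simp add: power2_eq_square algebra_simps)
      finally show ?thesis .
    qed
    then show "AE x in M. norm ((cmod (f x + g x))\<^sup>2) \<le> norm (2 * (cmod (f x))\<^sup>2 + 2 * (cmod (g x))\<^sup>2)"
      by simp
  qed simp
  then show ?thesis by (simp add: L2_fun_def)
qed

lemma L2_fun_scale: "f \<in> L2_fun M \<Longrightarrow> (\<lambda>x. a * f x) \<in> L2_fun M"
  by (auto simp: L2_fun_def norm_mult power_mult_distrib)

lemma L2_fun_diff:
  assumes "f \<in> L2_fun M" "g \<in> L2_fun M"
  shows "(\<lambda>x. f x - g x) \<in> L2_fun M"
  using L2_fun_add[OF assms(1) L2_fun_scale[OF assms(2), of "-1"]] by simp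

lemma L2_fun_dominated:
  assumes "f \<in> L2_fun M" "g \<in> borel_measurable M" "\<And>x. cmod (g x) \<le> cmod (f x)"
  shows "g \<in> L2_fun M"
proof -
  have "integrable M (\<lambda>x. (cmod (g x))\<^sup>2)"
    using L2_fun_integrable[OF assms(1)]
    by (rule Bochner_Integration.integrable_bound) (use assms in \<open>auto simp: power_mono\<close>)
  then show ?thesis using assms by (simp add: L2_fun_def)
qed

lemma L2_fun_cong_AE:
  assumes "f \<in> L2_fun M" "g \<in> borel_measurable M" "AE x in M. f x = g x"
  shows "g \<in> L2_fun M"
proof -
  have "f \<in> borel_measurable M" using assms by (simp add: L2_fun_def)
  have "integrable M (\<lambda>x. (cmod (g x))\<^sup>2) \<longleftrightarrow> integrable M (\<lambda>x. (cmod (f x))\<^sup>2)"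
    by (rule integrable_cong_AE) (use assms \<open>f \<in> borel_measurable M\<close> in auto)
  then show ?thesis using assms by (simp add: L2_fun_def)
qed

lemma L2_fun_mult_integrable:
  assumes "f \<in> L2_fun M" "g \<in> L2_fun M"
  shows "integrable M (\<lambda>x. cnj (f x) * g x)"
proof -
  have [measurable]: "f \<in> borel_measurable M" "g \<in> borel_measurable M"
    using assms by (auto simp: L2_fun_def)
  have "integrable M (\<lambda>x. (cmod (f x))\<^sup>2 + (cmod (g x))\<^sup>2)"
    using assms by (auto simp: L2_fun_def)
  then show ?thesis
  proof (rule Bochner_Integration.integrable_bound)
    have "a * b \<le> a\<^sup>2 + b\<^sup>2" for a b :: real
      using zero_le_power2[of "a - b"] zero_le_power2[of "a + b"]
      unfolding power2_diff power2_sum zero_le_mult_iff using zero_le_power2[of a] zero_le_power2[of b] by linarith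
    then show "AE x in M. norm (cnj (f x) * g x) \<le> norm ((cmod (f x))\<^sup>2 + (cmod (g x))\<^sup>2)"
      by (auto simp: norm_mult)
  qed simp
qed

lemma L2_rel_equiv: "equiv (L2_fun M) (L2_rel M)"
proof (rule equivI)
  show "sym (L2_rel M)" by (auto simp: sym_def L2_rel_def elim: AE_mp)
  show "trans (L2_rel M)"
  proof (rule transI)
    fix f g h assume "(f, g) \<in> L2_rel M" "(g, h) \<in> L2_rel M"
    then show "(f, h) \<in> L2_rel M" unfolding L2_rel_def by (auto intro: AE_mp elim: eventually_elim2)
  qed
qed (auto simp: refl_on_def L2_rel_def)

lemma L2_class_in: "f \<in> L2_fun M \<Longrightarrow> L2_class M f \<in> L2_space M"
  unfolding L2_class_def L2_space_def by (rule quotientI)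

lemma L2_class_eq_iff:
  "f \<in> L2_fun M \<Longrightarrow> g \<in> L2_fun M \<Longrightarrow> L2_class M f = L2_class M g \<longleftrightarrow> (AE x in M. f x = g x)"
  unfolding L2_class_def using eq_equiv_class_iff[OF L2_rel_equiv, of f M g]
  by (auto simp: L2_rel_def)

lemma L2_class_cong:
  "f \<in> L2_fun M \<Longrightarrow> g \<in> L2_fun M \<Longrightarrow> (AE x in M. f x = g x) \<Longrightarrow> L2_class M f = L2_class M g"
  by (simp add: L2_class_eq_iff)

lemma L2_rep_class_rel: "f \<in> L2_fun M \<Longrightarrow> (f, L2_rep (L2_class M f)) \<in> L2_rel M"
proof -
  assume "f \<in> L2_fun M"
  then have "f \<in> L2_class M f" unfolding L2_class_def L2_rel_def by auto
  then have "L2_rep (L2_class M f) \<in> L2_class M f" unfolding L2_rep_def by (rule someI[where P="\<lambda>g. g \<in> L2_class M f"])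
  then show ?thesis by (simp add: L2_class_def)
qed

lemma L2_rep_class: "f \<in> L2_fun M \<Longrightarrow> AE x in M. L2_rep (L2_class M f) x = f x"
  using L2_rep_class_rel[of f M] by (auto simp: L2_rel_def elim: AE_mp)

lemma L2_rep_in: "X \<in> L2_space M \<Longrightarrow> L2_rep X \<in> L2_fun M"
proof -
  assume "X \<in> L2_space M"
  then obtain f where "f \<in> L2_fun M" "X = L2_class M f"
    unfolding L2_space_def L2_class_def by (auto elim: quotientE)
  then show ?thesis using L2_rep_class_rel[of f M] by (simp add: L2_rel_def)
qed

lemma L2_class_rep: "X \<in> L2_space M \<Longrightarrow> L2_class M (L2_rep X) = X"
proof -
  assume "X \<in> L2_space M"
  then obtain f where f: "f \<in> L2_fun M" "X = L2_class M f"
    unfolding L2_space_def L2_class_def by (auto elim: quotientE)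
  have "L2_rep X \<in> L2_fun M" using \<open>X \<in> L2_space M\<close> by (rule L2_rep_in)
  then show ?thesis using f L2_rep_class[OF f(1)] by (simp add: L2_class_eq_iff)
qed

lemma L2_space_measurable [measurable_dest]: "X \<in> L2_space M \<Longrightarrow> L2_rep X \<in> borel_measurable M"
  by (simp add: L2_rep_in L2_fun_measurable)

lemma L2_space_eqI:
  assumes "X \<in> L2_space M" "Y \<in> L2_space M" "AE x in M. L2_rep X x = L2_rep Y x"
  shows "X = Y"
proof -
  have "L2_class M (L2_rep X) = L2_class M (L2_rep Y)"
    using assms by (simp add: L2_class_eq_iff L2_rep_in)
  then show ?thesis using assms by (simp add: L2_class_rep)
qed

definition L2_zero :: "'x measure \<Rightarrow> 'x l2" where
  "L2_zero M = L2_class M (\<lambda>_. 0)"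

definition L2_diff :: "'x measure \<Rightarrow> 'x l2 \<Rightarrow> 'x l2 \<Rightarrow> 'x l2" where
  "L2_diff M X Y = L2_class M (\<lambda>x. L2_rep X x - L2_rep Y x)"

lemma L2_zero_in [simp]: "L2_zero M \<in> L2_space M"
  by (simp add: L2_zero_def L2_class_in)

lemma L2_add_in [simp]: "X \<in> L2_space M \<Longrightarrow> Y \<in> L2_space M \<Longrightarrow> L2_add M X Y \<in> L2_space M"
  by (simp add: L2_add_def L2_class_in L2_fun_add L2_rep_in)

lemma L2_diff_in [simp]: "X \<in> L2_space M \<Longrightarrow> Y \<in> L2_space M \<Longrightarrow> L2_diff M X Y \<in> L2_space M"
  by (simp add: L2_diff_def L2_class_in L2_fun_diff L2_rep_in)

lemma L2_scale_in [simp]: "X \<in> L2_space M \<Longrightarrow> L2_scale M a X \<in> L2_space M"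
  by (simp add: L2_scale_def L2_class_in L2_fun_scale L2_rep_in)

lemma L2_rep_add:
  "X \<in> L2_space M \<Longrightarrow> Y \<in> L2_space M \<Longrightarrow> AE x in M. L2_rep (L2_add M X Y) x = L2_rep X x + L2_rep Y x"
  unfolding L2_add_def by (rule L2_rep_class) (simp add: L2_fun_add L2_rep_in)

lemma L2_rep_diff:
  "X \<in> L2_space M \<Longrightarrow> Y \<in> L2_space M \<Longrightarrow> AE x in M. L2_rep (L2_diff M X Y) x = L2_rep X x - L2_rep Y x"
  unfolding L2_diff_def by (rule L2_rep_class) (simp add: L2_fun_diff L2_rep_in)

lemma L2_rep_scale:
  "X \<in> L2_space M \<Longrightarrow> AE x in M. L2_rep (L2_scale M a X) x = a * L2_rep X x"
  unfolding L2_scale_def by (rule L2_rep_class) (simp add: L2_fun_scale L2_rep_in)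

lemma L2_rep_zero: "AE x in M. L2_rep (L2_zero M) x = 0"
  unfolding L2_zero_def by (rule L2_rep_class) simp

lemma L2_inner_cong:
  assumes "X \<in> L2_space M" "Y \<in> L2_space M" "f \<in> borel_measurable M" "g \<in> borel_measurable M"
    "AE x in M. L2_rep X x = f x" "AE x in M. L2_rep Y x = g x"
  shows "L2_inner M X Y = (\<integral>x. cnj (f x) * g x \<partial>M)"
  unfolding L2_inner_def
proof (rule integral_cong_AE)
  show "AE x in M. cnj (L2_rep X x) * L2_rep Y x = cnj (f x) * g x"
    using assms(5,6) by eventually_elim simp
qed (use assms in measurable)

lemma L2_inner_class:
  assumes "f \<in> L2_fun M" "g \<in> L2_fun M"
  shows "L2_inner M (L2_class M f) (L2_class M g) = (\<integral>x. cnj (f x) * g x \<partial>M)"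
  using assms by (intro L2_inner_cong) (auto simp: L2_class_in L2_rep_class L2_fun_measurable)

lemma L2_norm_nonneg [simp]: "0 \<le> L2_norm M X"
  by (simp add: L2_norm_def)

lemma L2_norm_sq: "(L2_norm M X)\<^sup>2 = (\<integral>x. (cmod (L2_rep X x))\<^sup>2 \<partial>M)"
  by (simp add: L2_norm_def)

lemma L2_inner_self: "L2_inner M X X = of_real ((L2_norm M X)\<^sup>2)"
  unfolding L2_inner_def L2_norm_sq integral_complex_of_real[symmetric]
  by (simp only: complex_norm_square mult.commute)

lemma L2_norm_sq_nn:
  assumes "X \<in> L2_space M"
  shows "ennreal ((L2_norm M X)\<^sup>2) = (\<integral>\<^sup>+x. ennreal ((cmod (L2_rep X x))\<^sup>2) \<partial>M)"
  unfolding L2_norm_sq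
  by (rule nn_integral_eq_integral[symmetric]) (use L2_fun_integrable[OF L2_rep_in[OF assms]] in auto)

lemma L2_norm_sq_nn_class:
  assumes "f \<in> L2_fun M"
  shows "ennreal ((L2_norm M (L2_class M f))\<^sup>2) = (\<integral>\<^sup>+x. ennreal ((cmod (f x))\<^sup>2) \<partial>M)"
proof -
  have "(\<integral>\<^sup>+x. ennreal ((cmod (L2_rep (L2_class M f) x))\<^sup>2) \<partial>M) = (\<integral>\<^sup>+x. ennreal ((cmod (f x))\<^sup>2) \<partial>M)"
  proof (rule nn_integral_cong_AE)
    show "AE x in M. ennreal ((cmod (L2_rep (L2_class M f) x))\<^sup>2) = ennreal ((cmod (f x))\<^sup>2)"
      using L2_rep_class[OF assms] by eventually_elim simp
  qed
  then show ?thesis using L2_norm_sq_nn[OF L2_class_in[OF assms]] by simp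
qed

lemma L2_inner_commute: "L2_inner M X Y = cnj (L2_inner M Y X)"
  unfolding L2_inner_def using Bochner_Integration.integral_cnj[of M "\<lambda>x. cnj (L2_rep Y x) * L2_rep X x"]
  by (simp add: mult.commute)

lemma L2_inner_add_right:
  assumes "X \<in> L2_space M" "Y \<in> L2_space M" "Z \<in> L2_space M"
  shows "L2_inner M Z (L2_add M X Y) = L2_inner M Z X + L2_inner M Z Y"
proof -
  have "L2_inner M Z (L2_add M X Y) = (\<integral>x. cnj (L2_rep Z x) * (L2_rep X x + L2_rep Y x) \<partial>M)"
    by (rule L2_inner_cong) (use assms L2_space_measurable[of _ M] L2_rep_add[of X M Y] in auto)
  then show ?thesis
    using L2_fun_mult_integrable[OF L2_rep_in L2_rep_in, of Z M] assms
    by (simp only: L2_inner_def distrib_left Bochner_Integration.integral_add)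
qed

lemma L2_inner_diff_right:
  assumes "X \<in> L2_space M" "Y \<in> L2_space M" "Z \<in> L2_space M"
  shows "L2_inner M Z (L2_diff M X Y) = L2_inner M Z X - L2_inner M Z Y"
proof -
  have "L2_inner M Z (L2_diff M X Y) = (\<integral>x. cnj (L2_rep Z x) * (L2_rep X x - L2_rep Y x) \<partial>M)"
    by (rule L2_inner_cong) (use assms L2_space_measurable[of _ M] L2_rep_diff[of X M Y] in auto)
  then show ?thesis
    using L2_fun_mult_integrable[OF L2_rep_in L2_rep_in, of Z M] assms
    by (simp only: L2_inner_def right_diff_distrib Bochner_Integration.integral_diff)
qed

lemma L2_inner_scale_right:
  assumes "X \<in> L2_space M" "Z \<in> L2_space M"
  shows "L2_inner M Z (L2_scale M a X) = a * L2_inner M Z X"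
proof -
  have "L2_inner M Z (L2_scale M a X) = (\<integral>x. cnj (L2_rep Z x) * (a * L2_rep X x) \<partial>M)"
    by (rule L2_inner_cong) (use assms L2_space_measurable[of _ M] L2_rep_scale[of X M a] in auto)
  also have "\<dots> = (\<integral>x. a * (cnj (L2_rep Z x) * L2_rep X x) \<partial>M)"
    by (simp add: ac_simps)
  finally show ?thesis by (simp add: L2_inner_def)
qed

lemma L2_inner_zero_right: "Z \<in> L2_space M \<Longrightarrow> L2_inner M Z (L2_zero M) = 0"
  by (subst L2_inner_cong[of _ _ _ "L2_rep Z" "\<lambda>_. 0"]) (auto simp: L2_space_measurable L2_rep_zero)

lemma L2_inner_add_left:
  "\<lbrakk>X \<in> L2_space M; Y \<in> L2_space M; Z \<in> L2_space M\<rbrakk>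
    \<Longrightarrow> L2_inner M (L2_add M X Y) Z = L2_inner M X Z + L2_inner M Y Z"
  by (metis L2_inner_add_right L2_inner_commute complex_cnj_add)

lemma L2_inner_diff_left:
  "\<lbrakk>X \<in> L2_space M; Y \<in> L2_space M; Z \<in> L2_space M\<rbrakk>
    \<Longrightarrow> L2_inner M (L2_diff M X Y) Z = L2_inner M X Z - L2_inner M Y Z"
  by (metis L2_inner_diff_right L2_inner_commute complex_cnj_diff)

lemma L2_inner_scale_left:
  "\<lbrakk>X \<in> L2_space M; Z \<in> L2_space M\<rbrakk>
    \<Longrightarrow> L2_inner M (L2_scale M a X) Z = cnj a * L2_inner M X Z"
  by (metis L2_inner_scale_right L2_inner_commute complex_cnj_mult)

lemma L2_inner_zero_left: "Z \<in> L2_space M \<Longrightarrow> L2_inner M (L2_zero M) Z = 0"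
  by (metis L2_inner_zero_right L2_inner_commute complex_cnj_zero)

lemmas L2_inner_simps = L2_inner_add_right L2_inner_diff_right L2_inner_scale_right
  L2_inner_zero_right L2_inner_add_left L2_inner_diff_left L2_inner_scale_left L2_inner_zero_left

lemma L2_norm_zero [simp]: "L2_norm M (L2_zero M) = 0"
  using L2_inner_self[of M "L2_zero M"] L2_inner_zero_right[of "L2_zero M" M] by simp

lemma L2_norm_eq_zero:
  assumes "X \<in> L2_space M" "L2_norm M X = 0"
  shows "X = L2_zero M"
proof (rule L2_space_eqI)
  have "AE x in M. (cmod (L2_rep X x))\<^sup>2 = 0"
    using assms L2_norm_sq[of M X] L2_fun_integrable[OF L2_rep_in[OF assms(1)]]
    by (subst integral_nonneg_eq_0_iff_AE[symmetric]) auto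
  then show "AE x in M. L2_rep X x = L2_rep (L2_zero M) x"
    using L2_rep_zero[of M] by eventually_elim simp
qed (use assms in auto)

lemma L2_diff_eq_zero:
  assumes "X \<in> L2_space M" "Y \<in> L2_space M" "L2_norm M (L2_diff M X Y) = 0"
  shows "X = Y"
proof (rule L2_space_eqI)
  have "L2_diff M X Y = L2_zero M" using assms by (intro L2_norm_eq_zero) auto
  then show "AE x in M. L2_rep X x = L2_rep Y x"
    using L2_rep_diff[OF assms(1,2)] L2_rep_zero[of M] by (elim AE_mp) (auto intro!: AE_I2)
qed (use assms in auto)

lemma L2_ext_inner:
  assumes "X \<in> L2_space M" "Y \<in> L2_space M"
    and "\<And>Z. Z \<in> L2_space M \<Longrightarrow> L2_inner M Z X = L2_inner M Z Y"
  shows "X = Y"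
proof (rule L2_diff_eq_zero)
  have "L2_inner M (L2_diff M X Y) (L2_diff M X Y) = 0"
    using assms(1,2) assms(3)[of "L2_diff M X Y"] by (simp add: L2_inner_diff_right[of X M Y])
  then show "L2_norm M (L2_diff M X Y) = 0" by (simp add: L2_inner_self)
qed (use assms in auto)

lemma L2_norm_add_scale_sq:
  assumes "X \<in> L2_space M" "Y \<in> L2_space M"
  shows "(L2_norm M (L2_add M X (L2_scale M a Y)))\<^sup>2
    = (L2_norm M X)\<^sup>2 + 2 * Re (a * L2_inner M X Y) + (cmod a)\<^sup>2 * (L2_norm M Y)\<^sup>2"
proof -
  have "complex_of_real ((L2_norm M (L2_add M X (L2_scale M a Y)))\<^sup>2)
    = L2_inner M X X + (a * L2_inner M X Y + cnj (a * L2_inner M X Y)) + cnj a * a * L2_inner M Y Y"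
    using assms L2_inner_commute[of M Y X]
    by (simp add: L2_inner_self[symmetric] L2_inner_simps algebra_simps del: of_real_power)
  also have "\<dots> = complex_of_real ((L2_norm M X)\<^sup>2 + 2 * Re (a * L2_inner M X Y) + (cmod a)\<^sup>2 * (L2_norm M Y)\<^sup>2)"
    unfolding complex_add_cnj by (simp add: L2_inner_self complex_norm_square mult.commute del: of_real_power)
  finally show ?thesis using of_real_eq_iff by blast
qed

lemma L2_diff_alt:
  assumes "X \<in> L2_space M" "Y \<in> L2_space M"
  shows "L2_diff M X Y = L2_add M X (L2_scale M (-1) Y)"
  by (rule L2_ext_inner[of _ M]) (use assms in \<open>auto simp: L2_inner_simps\<close>)

lemma L2_norm_diff_sq:
  assumes "X \<in> L2_space M" "Y \<in> L2_space M"
  shows "(L2_norm M (L2_diff M X Y))\<^sup>2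
    = (L2_norm M X)\<^sup>2 - 2 * Re (L2_inner M X Y) + (L2_norm M Y)\<^sup>2"
  using L2_norm_add_scale_sq[OF assms, of "-1"] L2_diff_alt[OF assms] by simp

lemma L2_norm_scale: 
  assumes "X \<in> L2_space M"
  shows "L2_norm M (L2_scale M a X) = cmod a * L2_norm M X"
proof -
  have "complex_of_real ((L2_norm M (L2_scale M a X))\<^sup>2) = of_real ((cmod a * L2_norm M X)\<^sup>2)"
    using assms
    by (simp add: L2_inner_self[symmetric] L2_inner_simps power_mult_distrib complex_norm_square del: of_real_power)
  then have "(L2_norm M (L2_scale M a X))\<^sup>2 = (cmod a * L2_norm M X)\<^sup>2" using of_real_eq_iff by blast
  then show ?thesis by (rule power2_eq_imp_eq) auto
qed

lemma L2_Cauchy_Schwarz: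
  assumes X: "X \<in> L2_space M" and Y: "Y \<in> L2_space M"
  shows "cmod (L2_inner M X Y) \<le> L2_norm M X * L2_norm M Y"
proof (cases "L2_norm M Y = 0")
  case True
  then have "Y = L2_zero M" using Y by (simp add: L2_norm_eq_zero)
  then show ?thesis using X by (simp add: L2_inner_simps)
next
  case False
  define c where "c = (L2_norm M Y)\<^sup>2"
  have "c > 0" using False by (simp add: c_def)
  define z where "z = L2_inner M X Y"
  have "0 \<le> (L2_norm M (L2_add M X (L2_scale M (- cnj z / c) Y)))\<^sup>2" by simp
  also have "\<dots> = (L2_norm M X)\<^sup>2 - (cmod z)\<^sup>2 / c"
  proof -
    have 1: "- cnj z / c * z = of_real (- ((cmod z)\<^sup>2 / c))"
      using complex_norm_square[of z] by (simp add: mult.commute del: of_real_power)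
    have 2: "(cmod (- cnj z / c))\<^sup>2 * c = (cmod z)\<^sup>2 / c"
      using \<open>c > 0\<close> by (simp add: norm_divide power_divide power2_eq_square)
    show ?thesis
      unfolding L2_norm_add_scale_sq[OF X Y] z_def[symmetric] c_def[symmetric] 1 2 Re_complex_of_real
      by simp
  qed
  finally have "(cmod z)\<^sup>2 \<le> (L2_norm M X)\<^sup>2 * c" using \<open>c > 0\<close> by (simp add: field_simps)
  then have "(cmod z)\<^sup>2 \<le> (L2_norm M X * L2_norm M Y)\<^sup>2" by (simp add: c_def power_mult_distrib)
  then show ?thesis unfolding z_def by (rule power2_le_imp_le) simp
qed

lemma L2_norm_triangle:
  assumes X: "X \<in> L2_space M" and Y: "Y \<in> L2_space M"
  shows "L2_norm M (L2_add M X Y) \<le> L2_norm M X + L2_norm M Y"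
proof (rule power2_le_imp_le)
  have "L2_scale M 1 Y = Y" by (rule L2_ext_inner[of _ M]) (use Y in \<open>auto simp: L2_inner_simps\<close>)
  then have "(L2_norm M (L2_add M X Y))\<^sup>2 = (L2_norm M X)\<^sup>2 + 2 * Re (L2_inner M X Y) + (L2_norm M Y)\<^sup>2"
    using L2_norm_add_scale_sq[OF X Y, of 1] by simp
  moreover have "Re (L2_inner M X Y) \<le> L2_norm M X * L2_norm M Y"
    using L2_Cauchy_Schwarz[OF X Y] complex_Re_le_cmod order_trans by blast
  ultimately show "(L2_norm M (L2_add M X Y))\<^sup>2 \<le> (L2_norm M X + L2_norm M Y)\<^sup>2"
    by (simp add: power2_sum)
qed simp

lemma L2_norm_diff_triangle:
  assumes "X \<in> L2_space M" "Y \<in> L2_space M" "Z \<in> L2_space M"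
  shows "L2_norm M (L2_diff M X Z) \<le> L2_norm M (L2_diff M X Y) + L2_norm M (L2_diff M Y Z)"
proof -
  have "L2_diff M X Z = L2_add M (L2_diff M X Y) (L2_diff M Y Z)"
    by (rule L2_ext_inner[of _ M]) (use assms in \<open>auto simp: L2_inner_simps\<close>)
  then show ?thesis using assms by (simp add: L2_norm_triangle)
qed

section \<open>Completeness and the Riesz representation theorem\<close>

lemma L2_norm_diff_commute:
  assumes "X \<in> L2_space M" "Y \<in> L2_space M"
  shows "L2_norm M (L2_diff M X Y) = L2_norm M (L2_diff M Y X)"
proof -
  have "(L2_norm M (L2_diff M X Y))\<^sup>2 = (L2_norm M (L2_diff M Y X))\<^sup>2"
    using assms L2_inner_commute[of M X Y] by (simp add: L2_norm_diff_sq)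
  then show ?thesis by simp
qed

text \<open>
  The bound says that the increments decay geometrically. It is what integrability of a weighted
  series of squared increments provides at almost every point.
\<close>

lemma convergent_if_weighted_increments_bounded:
  fixes f :: "nat \<Rightarrow> complex"
  assumes "\<And>k. 2 ^ k * (cmod (f (Suc k) - f k))\<^sup>2 \<le> C"
  shows "convergent f"
proof -
  have C: "0 \<le> C" using order_trans[OF _ assms[of 0]] by simp
  have "summable (\<lambda>k. f (Suc k) - f k)"
  proof (rule summable_comparison_test)
    show "\<exists>N. \<forall>k\<ge>N. norm (f (Suc k) - f k) \<le> sqrt C * (1 / sqrt 2) ^ k"
    proof (intro exI allI impI)
      fix k :: nat
      have "(cmod (f (Suc k) - f k))\<^sup>2 \<le> C / 2 ^ k"
        using assms[of k] by (simp add: field_simps)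
      then have "sqrt ((cmod (f (Suc k) - f k))\<^sup>2) \<le> sqrt (C / 2 ^ k)"
        by (simp only: real_sqrt_le_iff)
      then show "norm (f (Suc k) - f k) \<le> sqrt C * (1 / sqrt 2) ^ k"
        by (simp add: real_sqrt_divide real_sqrt_power power_one_over)
    qed
    show "summable (\<lambda>k. sqrt C * (1 / sqrt 2) ^ k)"
      by (intro summable_mult summable_geometric) simp
  qed
  then have "summable (\<lambda>k. f (Suc k) - f k)" .
  then have "convergent (\<lambda>n. \<Sum>k<n. f (Suc k) - f k)" by (simp add: summable_iff_convergent)
  then have "convergent (\<lambda>n. f n - f 0)" by (simp add: sum_lessThan_telescope)
  then have "convergent (\<lambda>n. (f n - f 0) + f 0)" by (rule convergent_add) (rule convergent_const)
  then show ?thesis by simp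
qed

text \<open>
  The Riesz-Fischer theorem. Along a subsequence with increments of norm at most \<open>2\<^sup>-\<^sup>k\<close> the series of
  the squared increments, weighted by \<open>2\<^sup>k\<close>, has a finite integral, so the subsequence converges
  almost everywhere. Fatou's lemma shows that its pointwise limit is also the limit in norm.
\<close>

lemma L2_complete:
  assumes X: "\<And>n. X n \<in> L2_space M"
    and Cauchy: "\<And>e. e > 0 \<Longrightarrow> \<exists>N. \<forall>m\<ge>N. \<forall>n\<ge>N. L2_norm M (L2_diff M (X m) (X n)) < e"
  obtains Y where "Y \<in> L2_space M" "(\<lambda>n. L2_norm M (L2_diff M (X n) Y)) \<longlonglongrightarrow> 0"
proof -
  have "\<forall>k. \<exists>N. \<forall>m\<ge>N. \<forall>n\<ge>N. L2_norm M (L2_diff M (X m) (X n)) < (1/2) ^ k"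
    using Cauchy by simp
  then obtain N where N: "\<And>k m n. m \<ge> N k \<Longrightarrow> n \<ge> N k \<Longrightarrow> L2_norm M (L2_diff M (X m) (X n)) < (1/2) ^ k"
    by metis
  \<comment> \<open>The summand \<open>k\<close> gives \<open>k \<le> r k\<close>; the sum gives \<open>N k \<le> r k\<close> and \<open>N k \<le> r (Suc k)\<close>.\<close>
  define r where "r k = k + (\<Sum>i\<le>k. N i)" for k
  have r_ge: "N k \<le> r k" for k
    unfolding r_def using member_le_sum[of k "{..k}" N] by simp
  have r_Suc: "N k \<le> r (Suc k)" for k
    using r_ge[of k] by (simp add: r_def)
  have r_id: "k \<le> r k" for k by (simp add: r_def)
  define f where "f k = L2_rep (X (r k))" for k
  have f [measurable]: "f k \<in> borel_measurable M" for k
    unfolding f_def using X by (rule L2_space_measurable)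
  have incr: "(\<integral>\<^sup>+x. ennreal ((cmod (f (Suc k) x - f k x))\<^sup>2) \<partial>M) \<le> ennreal ((1/4) ^ k)" for k
  proof -
    have "(\<integral>\<^sup>+x. ennreal ((cmod (f (Suc k) x - f k x))\<^sup>2) \<partial>M)
        = ennreal ((L2_norm M (L2_diff M (X (r (Suc k))) (X (r k))))\<^sup>2)"
      unfolding L2_diff_def f_def by (rule L2_norm_sq_nn_class[symmetric]) (simp add: L2_fun_diff L2_rep_in X)
    also have "\<dots> \<le> ennreal (((1/2) ^ k)\<^sup>2)"
      using N[OF r_Suc r_ge, of k] by (intro ennreal_leI power_mono) auto
    also have "((1/2) ^ k)\<^sup>2 = ((1/4) ^ k :: real)"
      unfolding power_mult[symmetric] mult.commute[of k 2] unfolding power_mult by (simp add: power2_eq_square)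
    finally show ?thesis .
  qed
  have "(\<integral>\<^sup>+x. (\<Sum>k. ennreal (2 ^ k * (cmod (f (Suc k) x - f k x))\<^sup>2)) \<partial>M)
      = (\<Sum>k. \<integral>\<^sup>+x. ennreal (2 ^ k * (cmod (f (Suc k) x - f k x))\<^sup>2) \<partial>M)"
    by (rule nn_integral_suminf) measurable
  also have "\<dots> = (\<Sum>k. ennreal (2 ^ k) * (\<integral>\<^sup>+x. ennreal ((cmod (f (Suc k) x - f k x))\<^sup>2) \<partial>M))"
    by (subst nn_integral_cmult[symmetric]) (auto simp: ennreal_mult)
  also have "\<dots> \<le> (\<Sum>k. ennreal ((1/2) ^ k))"
  proof (intro suminf_le summableI)
    fix k
    have "ennreal (2 ^ k) * (\<integral>\<^sup>+x. ennreal ((cmod (f (Suc k) x - f k x))\<^sup>2) \<partial>M) \<le> ennreal (2 ^ k) * ennreal ((1/4) ^ k)"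
      using incr by (intro mult_left_mono) auto
    also have "\<dots> = ennreal ((1/2) ^ k)"
      by (subst ennreal_mult[symmetric]) (auto simp: power_mult_distrib[symmetric])
    finally show "ennreal (2 ^ k) * (\<integral>\<^sup>+x. ennreal ((cmod (f (Suc k) x - f k x))\<^sup>2) \<partial>M) \<le> ennreal ((1/2) ^ k)" .
  qed
  also have "\<dots> = ennreal (\<Sum>k. (1/2) ^ k)"
    by (rule suminf_ennreal2) (auto simp: summable_geometric)
  finally have "(\<integral>\<^sup>+x. (\<Sum>k. ennreal (2 ^ k * (cmod (f (Suc k) x - f k x))\<^sup>2)) \<partial>M) \<noteq> \<infinity>"
    by (auto simp: top_unique)
  then have "AE x in M. (\<Sum>k. ennreal (2 ^ k * (cmod (f (Suc k) x - f k x))\<^sup>2)) \<noteq> \<infinity>"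
    by (intro nn_integral_noteq_infinite) auto
  then have conv: "AE x in M. convergent (\<lambda>k. f k x)"
  proof eventually_elim
    case (elim x)
    define C where "C = enn2real (\<Sum>k. ennreal (2 ^ k * (cmod (f (Suc k) x - f k x))\<^sup>2))"
    have C0: "C \<ge> 0" by (simp add: C_def)
    have C: "(\<Sum>k. ennreal (2 ^ k * (cmod (f (Suc k) x - f k x))\<^sup>2)) = ennreal C"
      unfolding C_def
      by (rule ennreal_enn2real[symmetric]) (use elim in \<open>simp only: infinity_ennreal_def less_top\<close>)
    have "2 ^ k * (cmod (f (Suc k) x - f k x))\<^sup>2 \<le> C" for k
    proof -
      have "ennreal (2 ^ k * (cmod (f (Suc k) x - f k x))\<^sup>2) \<le> (\<Sum>k. ennreal (2 ^ k * (cmod (f (Suc k) x - f k x))\<^sup>2))"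
        using sum_le_suminf[OF summableI, of "{k}" "\<lambda>k. ennreal (2 ^ k * (cmod (f (Suc k) x - f k x))\<^sup>2)"]
        by (simp only: finite.intros sum.insert sum.empty finite.emptyI empty_iff not_False_eq_True add_0_right zero_le simp_thms)
      then show ?thesis unfolding C by (simp only: ennreal_le_iff[OF C0])
    qed
    then show ?case by (rule convergent_if_weighted_increments_bounded)
  qed
  define h where "h x = lim (\<lambda>k. f k x)" for x
  have h [measurable]: "h \<in> borel_measurable M" unfolding h_def by measurable
  have tail: "(\<integral>\<^sup>+x. ennreal ((cmod (L2_rep (X n) x - h x))\<^sup>2) \<partial>M) \<le> ennreal (e\<^sup>2)"
    if n: "n \<ge> K" and K: "\<And>m n. m \<ge> K \<Longrightarrow> n \<ge> K \<Longrightarrow> L2_norm M (L2_diff M (X m) (X n)) < e" for n K e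
  proof -
    have [measurable]: "L2_rep (X n) \<in> borel_measurable M" using X by (rule L2_space_measurable)
    have "(\<integral>\<^sup>+x. ennreal ((cmod (L2_rep (X n) x - h x))\<^sup>2) \<partial>M)
        = (\<integral>\<^sup>+x. liminf (\<lambda>k. ennreal ((cmod (L2_rep (X n) x - f k x))\<^sup>2)) \<partial>M)"
    proof (rule nn_integral_cong_AE)
      show "AE x in M. ennreal ((cmod (L2_rep (X n) x - h x))\<^sup>2)
          = liminf (\<lambda>k. ennreal ((cmod (L2_rep (X n) x - f k x))\<^sup>2))"
        using conv
      proof eventually_elim
        case (elim x)
        then have "(\<lambda>k. f k x) \<longlonglongrightarrow> h x" by (simp add: h_def convergent_LIMSEQ_iff)
        then have "(\<lambda>k. ennreal ((cmod (L2_rep (X n) x - f k x))\<^sup>2)) \<longlonglongrightarrow> ennreal ((cmod (L2_rep (X n) x - h x))\<^sup>2)"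
          by (intro tendsto_ennrealI tendsto_intros)
        then show ?case by (intro lim_imp_Liminf[symmetric]) auto
      qed
    qed
    also have "\<dots> \<le> liminf (\<lambda>k. \<integral>\<^sup>+x. ennreal ((cmod (L2_rep (X n) x - f k x))\<^sup>2) \<partial>M)"
      by (rule nn_integral_liminf) measurable
    also have "\<dots> \<le> limsup (\<lambda>k. \<integral>\<^sup>+x. ennreal ((cmod (L2_rep (X n) x - f k x))\<^sup>2) \<partial>M)"
      by (rule Liminf_le_Limsup) simp
    also have "\<dots> \<le> ennreal (e\<^sup>2)"
    proof (rule Limsup_bounded)
      show "\<forall>\<^sub>F k in sequentially. (\<integral>\<^sup>+x. ennreal ((cmod (L2_rep (X n) x - f k x))\<^sup>2) \<partial>M) \<le> ennreal (e\<^sup>2)"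
        using eventually_ge_at_top[of K]
      proof eventually_elim
        case (elim k)
        have "(\<integral>\<^sup>+x. ennreal ((cmod (L2_rep (X n) x - f k x))\<^sup>2) \<partial>M)
            = ennreal ((L2_norm M (L2_diff M (X n) (X (r k))))\<^sup>2)"
          unfolding L2_diff_def f_def by (rule L2_norm_sq_nn_class[symmetric]) (simp add: L2_fun_diff L2_rep_in X)
        also have "\<dots> \<le> ennreal (e\<^sup>2)"
          using K[OF n, of "r k"] elim r_id[of k] by (intro ennreal_leI power_mono) auto
        finally show ?case .
      qed
    qed
    finally show ?thesis .
  qed
  obtain K where K: "\<And>m n. m \<ge> K \<Longrightarrow> n \<ge> K \<Longrightarrow> L2_norm M (L2_diff M (X m) (X n)) < 1"
    using Cauchy[of 1] by auto
  have "(\<integral>\<^sup>+x. ennreal ((cmod (L2_rep (X K) x - h x))\<^sup>2) \<partial>M) \<le> ennreal (1\<^sup>2)"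
    by (rule tail[of K K 1]) (use K in auto)
  also have "\<dots> < \<infinity>" by simp
  finally have "(\<lambda>x. L2_rep (X K) x - h x) \<in> L2_fun M"
    using L2_space_measurable[OF X[of K]] unfolding L2_fun_iff by simp
  then have "(\<lambda>x. L2_rep (X K) x - (L2_rep (X K) x - h x)) \<in> L2_fun M"
    by (rule L2_fun_diff[OF L2_rep_in[OF X]])
  then have h_in: "h \<in> L2_fun M" by simp
  show thesis
  proof (rule that[of "L2_class M h"])
    show "L2_class M h \<in> L2_space M" using h_in by (rule L2_class_in)
    show "(\<lambda>n. L2_norm M (L2_diff M (X n) (L2_class M h))) \<longlonglongrightarrow> 0"
    proof (rule LIMSEQ_I)
      fix e :: real assume "e > 0"
      then obtain K where K: "\<And>m n. m \<ge> K \<Longrightarrow> n \<ge> K \<Longrightarrow> L2_norm M (L2_diff M (X m) (X n)) < e / 2"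
        using Cauchy[of "e/2"] by auto
      have "L2_norm M (L2_diff M (X n) (L2_class M h)) \<le> e / 2" if "n \<ge> K" for n
      proof -
        have "ennreal ((L2_norm M (L2_diff M (X n) (L2_class M h)))\<^sup>2)
            = (\<integral>\<^sup>+x. ennreal ((cmod (L2_rep (X n) x - L2_rep (L2_class M h) x))\<^sup>2) \<partial>M)"
          unfolding L2_diff_def by (rule L2_norm_sq_nn_class) (simp add: L2_fun_diff L2_rep_in X L2_class_in h_in)
        also have "\<dots> = (\<integral>\<^sup>+x. ennreal ((cmod (L2_rep (X n) x - h x))\<^sup>2) \<partial>M)"
        proof (rule nn_integral_cong_AE)
          show "AE x in M. ennreal ((cmod (L2_rep (X n) x - L2_rep (L2_class M h) x))\<^sup>2)
              = ennreal ((cmod (L2_rep (X n) x - h x))\<^sup>2)"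
            using L2_rep_class[OF h_in] by eventually_elim simp
        qed
        also have "\<dots> \<le> ennreal ((e / 2)\<^sup>2)" by (rule tail[OF that K])
        finally have "(L2_norm M (L2_diff M (X n) (L2_class M h)))\<^sup>2 \<le> (e / 2)\<^sup>2" by simp
        then show ?thesis by (rule power2_le_imp_le) (use \<open>e > 0\<close> in auto)
      qed
      then show "\<exists>K. \<forall>n\<ge>K. norm (L2_norm M (L2_diff M (X n) (L2_class M h)) - 0) < e"
        using \<open>e > 0\<close> by (intro exI[of _ K]) fastforce
    qed
  qed
qed

definition L2_closed_subspace :: "'x measure \<Rightarrow> 'x l2 set \<Rightarrow> bool" where
  "L2_closed_subspace M V \<longleftrightarrow> V \<subseteq> L2_space M \<and> L2_zero M \<in> V \<and>
     (\<forall>X\<in>V. \<forall>Y\<in>V. L2_add M X Y \<in> V) \<and> (\<forall>a. \<forall>X\<in>V. L2_scale M a X \<in> V) \<and>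
     (\<forall>X Y. (\<forall>n. X n \<in> V) \<longrightarrow> Y \<in> L2_space M \<longrightarrow>
        (\<lambda>n. L2_norm M (L2_diff M (X n) Y)) \<longlonglongrightarrow> 0 \<longrightarrow> Y \<in> V)"

lemma L2_closed_subspace_UNIV: "L2_closed_subspace M (L2_space M)"
  by (auto simp: L2_closed_subspace_def)

text \<open>
  The representing vector minimizes \<open>\<parallel>X\<parallel>\<^sup>2 - 2 Re (\<phi> X)\<close> on \<open>V\<close>. The version for a closed subspace yields
  adjoints, with the whole space for \<open>V\<close>, as well as orthogonal projections, with an inner product
  for \<open>\<phi>\<close>.
\<close>

lemma L2_Riesz:
  assumes V: "L2_closed_subspace M V"
    and add: "\<And>X Y. X \<in> V \<Longrightarrow> Y \<in> V \<Longrightarrow> \<phi> (L2_add M X Y) = \<phi> X + \<phi> Y"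
    and scale: "\<And>a X. X \<in> V \<Longrightarrow> \<phi> (L2_scale M a X) = a * \<phi> X"
    and bound: "\<And>X. X \<in> V \<Longrightarrow> cmod (\<phi> X) \<le> C * L2_norm M X"
  shows "\<exists>U\<in>V. \<forall>X\<in>V. L2_inner M U X = \<phi> X"
proof -
  note V_in = subsetD[OF conjunct1[OF V[unfolded L2_closed_subspace_def]]]
  have V_add: "X \<in> V \<Longrightarrow> Y \<in> V \<Longrightarrow> L2_add M X Y \<in> V" and V_scale: "X \<in> V \<Longrightarrow> L2_scale M a X \<in> V" for X Y a
    using V by (auto simp: L2_closed_subspace_def)
  define J where "J X = (L2_norm M X)\<^sup>2 - 2 * Re (\<phi> X)" for X
  have J_ge: "- (C\<^sup>2) \<le> J X" if "X \<in> V" for X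
  proof -
    have "Re (\<phi> X) \<le> C * L2_norm M X"
      using bound[OF that] complex_Re_le_cmod order_trans by blast
    moreover have "0 \<le> (L2_norm M X - C)\<^sup>2" by simp
    ultimately show ?thesis unfolding J_def power2_diff by (simp add: mult.commute)
  qed
  define m where "m = Inf (J ` V)"
  have bdd: "bdd_below (J ` V)" using J_ge by (intro bdd_belowI2)
  have ne: "V \<noteq> {}" using V by (auto simp: L2_closed_subspace_def)
  have m_le: "m \<le> J X" if "X \<in> V" for X
    unfolding m_def by (rule cInf_lower) (use bdd that in auto)
  have "\<exists>X\<in>V. J X < m + 1 / real (Suc n)" for n
    using cInf_lessD[of "J ` V" "m + 1 / real (Suc n)"] ne by (auto simp: m_def)
  then obtain X where X: "\<And>n. X n \<in> V" "\<And>n. J (X n) < m + 1 / real (Suc n)" by metis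
  note X_in = V_in[OF X(1)]
  \<comment> \<open>Parallelogram law: two almost minimizing vectors are close, since their midpoint cannot beat the infimum.\<close>
  have close: "(L2_norm M (L2_diff M (X i) (X j)))\<^sup>2 \<le> 2 * (1 / real (Suc i)) + 2 * (1 / real (Suc j))" for i j
  proof -
    define Z where "Z = L2_scale M (1/2) (L2_add M (X i) (L2_scale M 1 (X j)))"
    have Zv: "Z \<in> V" unfolding Z_def using X by (intro V_scale V_add)
    have "(L2_norm M Z)\<^sup>2 = ((L2_norm M (X i))\<^sup>2 + 2 * Re (L2_inner M (X i) (X j)) + (L2_norm M (X j))\<^sup>2) / 4"
      using X_in L2_norm_add_scale_sq[OF X_in X_in, of i 1 j]
      by (simp add: Z_def L2_norm_scale power_mult_distrib power_divide)
    moreover have phi_Z: "\<phi> Z = (\<phi> (X i) + \<phi> (X j)) / 2"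
      unfolding Z_def using X by (simp add: add scale V_add V_scale)
    moreover have "Re (\<phi> Z) = (Re (\<phi> (X i)) + Re (\<phi> (X j))) / 2" unfolding phi_Z by simp
    ultimately have "4 * J Z = 2 * J (X i) + 2 * J (X j) - (L2_norm M (L2_diff M (X i) (X j)))\<^sup>2"
      unfolding J_def L2_norm_diff_sq[OF X_in X_in] by simp
    then show ?thesis using m_le[OF Zv] X(2)[of i] X(2)[of j] by linarith
  qed
  obtain U where U: "U \<in> L2_space M" "(\<lambda>n. L2_norm M (L2_diff M (X n) U)) \<longlonglongrightarrow> 0"
  proof (rule L2_complete)
    show "X n \<in> L2_space M" for n by (rule X_in)
    fix e :: real assume "e > 0"
    then obtain K where K: "K > 0" "inverse (real K) < e\<^sup>2 / 4"
      using reals_Archimedean2 ex_inverse_of_nat_less[of "e\<^sup>2/4"] by auto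
    have "L2_norm M (L2_diff M (X i) (X j)) < e" if "i \<ge> K" "j \<ge> K" for i j
    proof -
      have inv: "1 / real (Suc i) < e\<^sup>2 / 4" if "i \<ge> K" for i
      proof -
        have "1 / real (Suc i) \<le> inverse (real K)"
          unfolding inverse_eq_divide using that K(1) by (intro divide_left_mono) auto
        then show ?thesis using K(2) by linarith
      qed
      have "(L2_norm M (L2_diff M (X i) (X j)))\<^sup>2 < e\<^sup>2"
        using close[of i j] inv[OF that(1)] inv[OF that(2)] by linarith
      then show ?thesis by (rule power2_less_imp_less) (use \<open>e > 0\<close> in auto)
    qed
    then show "\<exists>N. \<forall>i\<ge>N. \<forall>j\<ge>N. L2_norm M (L2_diff M (X i) (X j)) < e" by auto
  qed
  have UV: "U \<in> V" using V X U unfolding L2_closed_subspace_def by blast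
  have Re_eq: "Re (L2_inner M U Y) = Re (\<phi> Y)" if Y: "Y \<in> V" for Y
  proof -
    define b where "b = Re (L2_inner M U Y - \<phi> Y)"
    define c where "c = (L2_norm M Y)\<^sup>2"
    have lim: "(\<lambda>n. L2_inner M (X n) Y) \<longlonglongrightarrow> L2_inner M U Y"
    proof (rule Lim_null_comparison[THEN LIM_zero_cancel])
      show "\<forall>\<^sub>F n in sequentially. norm (L2_inner M (X n) Y - L2_inner M U Y)
          \<le> L2_norm M (L2_diff M (X n) U) * L2_norm M Y"
        using L2_Cauchy_Schwarz[of "L2_diff M (X _) U" M Y] X_in U(1) V_in[OF Y]
        by (simp add: L2_inner_diff_left)
      show "(\<lambda>n. L2_norm M (L2_diff M (X n) U) * L2_norm M Y) \<longlonglongrightarrow> 0"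
        using tendsto_mult_right[OF U(2), of "L2_norm M Y"] by simp
    qed
    have quad: "0 \<le> t\<^sup>2 * c + 2 * t * b" for t :: real
    proof (rule tendsto_lowerbound)
      show "(\<lambda>n. 1 / real (Suc n) + t\<^sup>2 * c + 2 * t * Re (L2_inner M (X n) Y - \<phi> Y))
          \<longlonglongrightarrow> t\<^sup>2 * c + 2 * t * b"
        unfolding b_def
        by (rule tendsto_eq_intros LIMSEQ_inverse_real_of_nat[unfolded inverse_eq_divide] lim refl | simp)+
      show "\<forall>\<^sub>F n in sequentially. 0 \<le> 1 / real (Suc n) + t\<^sup>2 * c + 2 * t * Re (L2_inner M (X n) Y - \<phi> Y)"
      proof (rule always_eventually, rule allI)
        fix n
        have "m \<le> J (L2_add M (X n) (L2_scale M (of_real t) Y))"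
          using X Y by (intro m_le V_add V_scale)
        also have "\<dots> = J (X n) + t\<^sup>2 * c + 2 * t * Re (L2_inner M (X n) Y - \<phi> Y)"
          using L2_norm_add_scale_sq[OF X_in V_in[OF Y], of n "of_real t"] X Y
          by (simp add: J_def add scale V_scale c_def algebra_simps)
        finally show "0 \<le> 1 / real (Suc n) + t\<^sup>2 * c + 2 * t * Re (L2_inner M (X n) Y - \<phi> Y)"
          using X(2)[of n] by linarith
      qed
    qed simp
    have "b = 0"
    proof (cases "c = 0")
      case True
      then show ?thesis using quad[of 1] quad[of "-1"] by simp
    next
      case False
      then have "c > 0" by (simp add: c_def)
      have "(- b / c)\<^sup>2 * c + 2 * (- b / c) * b = - (b\<^sup>2 / c)"
        using \<open>c > 0\<close> by (simp add: power2_eq_square field_simps)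
      then have "b\<^sup>2 / c \<le> 0" using quad[of "- b / c"] by simp
      then show ?thesis using \<open>c > 0\<close> by (simp add: divide_le_0_iff)
    qed
    then show ?thesis by (simp add: b_def)
  qed
  have "L2_inner M U Y = \<phi> Y" if Y: "Y \<in> V" for Y
  proof (rule complex_eqI)
    show "Re (L2_inner M U Y) = Re (\<phi> Y)" by (rule Re_eq[OF Y])
    show "Im (L2_inner M U Y) = Im (\<phi> Y)"
      using Re_eq[OF V_scale[OF Y, of "-\<i>"]] Y U(1) V_in[OF Y] by (simp add: scale L2_inner_simps)
  qed
  then show ?thesis using UV by blast
qed

section \<open>Bounded operators, adjoints and commutants\<close>

lemma bounded_ops_in: "T \<in> bounded_ops M \<Longrightarrow> X \<in> L2_space M \<Longrightarrow> T X \<in> L2_space M"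
  by (auto simp: bounded_ops_def)

lemma bounded_ops_add:
  "T \<in> bounded_ops M \<Longrightarrow> X \<in> L2_space M \<Longrightarrow> Y \<in> L2_space M \<Longrightarrow> T (L2_add M X Y) = L2_add M (T X) (T Y)"
  by (auto simp: bounded_ops_def)

lemma bounded_ops_scale:
  "T \<in> bounded_ops M \<Longrightarrow> X \<in> L2_space M \<Longrightarrow> T (L2_scale M a X) = L2_scale M a (T X)"
  by (auto simp: bounded_ops_def)

lemma bounded_ops_diff:
  "T \<in> bounded_ops M \<Longrightarrow> X \<in> L2_space M \<Longrightarrow> Y \<in> L2_space M \<Longrightarrow> T (L2_diff M X Y) = L2_diff M (T X) (T Y)"
  by (simp add: L2_diff_alt bounded_ops_add bounded_ops_scale bounded_ops_in)

lemma bounded_ops_bound: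
  assumes "T \<in> bounded_ops M"
  obtains C where "C \<ge> 0" "\<And>X. X \<in> L2_space M \<Longrightarrow> L2_norm M (T X) \<le> C * L2_norm M X"
proof -
  obtain C where C: "\<forall>X\<in>L2_space M. L2_norm M (T X) \<le> C * L2_norm M X"
    using assms by (auto simp: bounded_ops_def)
  show thesis
  proof (rule that[of "\<bar>C\<bar>"])
    fix X assume "X \<in> L2_space M"
    then have "L2_norm M (T X) \<le> C * L2_norm M X" using C by blast
    also have "\<dots> \<le> \<bar>C\<bar> * L2_norm M X" by (intro mult_right_mono) auto
    finally show "L2_norm M (T X) \<le> \<bar>C\<bar> * L2_norm M X" .
  qed simp
qed

lemma bounded_ops_ext:
  assumes "S \<in> bounded_ops M" "T \<in> bounded_ops M" "\<And>X. X \<in> L2_space M \<Longrightarrow> S X = T X"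
  shows "S = T"
  by (rule extensionalityI[of _ "L2_space M"]) (use assms in \<open>auto simp: bounded_ops_def PiE_def\<close>)

text \<open>
  Linearity is checked weakly: an operator that has an adjoint with respect to the inner product
  is automatically linear.
\<close>

lemma bounded_opsI:
  assumes ext: "T \<in> extensional (L2_space M)"
    and T: "\<And>X. X \<in> L2_space M \<Longrightarrow> T X \<in> L2_space M"
    and bound: "\<And>X. X \<in> L2_space M \<Longrightarrow> L2_norm M (T X) \<le> C * L2_norm M X"
    and S: "\<And>X. X \<in> L2_space M \<Longrightarrow> S X \<in> L2_space M"
    and adj: "\<And>X Y. X \<in> L2_space M \<Longrightarrow> Y \<in> L2_space M \<Longrightarrow> L2_inner M Y (T X) = L2_inner M (S Y) X"
  shows "T \<in> bounded_ops M"
proof -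
  have "T (L2_add M X Y) = L2_add M (T X) (T Y)" if "X \<in> L2_space M" "Y \<in> L2_space M" for X Y
    by (rule L2_ext_inner[of _ M]) (use that T S in \<open>auto simp: L2_inner_simps adj\<close>)
  moreover have "T (L2_scale M a X) = L2_scale M a (T X)" if "X \<in> L2_space M" for X a
    by (rule L2_ext_inner[of _ M]) (use that T S in \<open>auto simp: L2_inner_simps adj\<close>)
  moreover have "\<exists>C. \<forall>X\<in>L2_space M. L2_norm M (T X) \<le> C * L2_norm M X" using bound by blast
  ultimately show ?thesis using ext T unfolding bounded_ops_def PiE_def by auto
qed

lemma op_adjoint_unique_ex:
  assumes T: "T \<in> bounded_ops M"
  shows "\<exists>!S. S \<in> bounded_ops M \<and>
     (\<forall>X\<in>L2_space M. \<forall>Y\<in>L2_space M. L2_inner M (S X) Y = L2_inner M X (T Y))"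
proof -
  obtain C where C: "C \<ge> 0" "\<And>X. X \<in> L2_space M \<Longrightarrow> L2_norm M (T X) \<le> C * L2_norm M X"
    using bounded_ops_bound[OF T] by blast
  have "\<forall>X\<in>L2_space M. \<exists>U\<in>L2_space M. \<forall>Y\<in>L2_space M. L2_inner M U Y = L2_inner M X (T Y)"
  proof
    fix X assume X: "X \<in> L2_space M"
    show "\<exists>U\<in>L2_space M. \<forall>Y\<in>L2_space M. L2_inner M U Y = L2_inner M X (T Y)"
    proof (rule L2_Riesz[OF L2_closed_subspace_UNIV, where C = "L2_norm M X * C"])
      fix Y assume Y: "Y \<in> L2_space M"
      have "cmod (L2_inner M X (T Y)) \<le> L2_norm M X * L2_norm M (T Y)"
        by (rule L2_Cauchy_Schwarz[OF X bounded_ops_in[OF T Y]])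
      also have "\<dots> \<le> L2_norm M X * (C * L2_norm M Y)"
        using C(2)[OF Y] by (intro mult_left_mono) auto
      finally show "cmod (L2_inner M X (T Y)) \<le> L2_norm M X * C * L2_norm M Y" by simp
    qed (use T X in \<open>auto simp: bounded_ops_add bounded_ops_scale bounded_ops_in L2_inner_simps\<close>)
  qed
  then obtain S0 where S0: "\<And>X. X \<in> L2_space M \<Longrightarrow> S0 X \<in> L2_space M"
    "\<And>X Y. X \<in> L2_space M \<Longrightarrow> Y \<in> L2_space M \<Longrightarrow> L2_inner M (S0 X) Y = L2_inner M X (T Y)"
    by metis
  define S where "S = restrict S0 (L2_space M)"
  have S: "S \<in> bounded_ops M"
  proof (rule bounded_opsI[where S = T and C = C])
    fix X assume X: "X \<in> L2_space M"
    have "(L2_norm M (S X))\<^sup>2 = Re (L2_inner M X (T (S0 X)))"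
      unfolding S0(2)[OF X S0(1)[OF X], symmetric] L2_inner_self Re_complex_of_real
      using X by (simp add: S_def)
    also have "\<dots> \<le> L2_norm M X * L2_norm M (T (S0 X))"
      using L2_Cauchy_Schwarz[OF X bounded_ops_in[OF T S0(1)[OF X]]] complex_Re_le_cmod order_trans by blast
    also have "\<dots> \<le> L2_norm M X * (C * L2_norm M (S0 X))"
      using C(2)[OF S0(1)[OF X]] by (intro mult_left_mono) auto
    finally have "L2_norm M (S X) * L2_norm M (S X) \<le> C * L2_norm M X * L2_norm M (S X)"
      using X by (simp add: S_def power2_eq_square ac_simps)
    then show "L2_norm M (S X) \<le> C * L2_norm M X"
      using C(1) by (cases "L2_norm M (S X) = 0") (simp_all add: mult_le_cancel_right less_le)
  next
    fix X Y assume "X \<in> L2_space M" "Y \<in> L2_space M"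
    then show "L2_inner M Y (S X) = L2_inner M (T Y) X"
      using S0(2)[of X Y] L2_inner_commute[of M Y "S0 X"] L2_inner_commute[of M "T Y" X] by (simp add: S_def)
  qed (simp_all add: S_def S0(1) bounded_ops_in[OF T])
  show ?thesis
  proof (rule ex1I[of _ S])
    show "S \<in> bounded_ops M \<and> (\<forall>X\<in>L2_space M. \<forall>Y\<in>L2_space M. L2_inner M (S X) Y = L2_inner M X (T Y))"
      using S S0 by (simp add: S_def)
    fix R assume R: "R \<in> bounded_ops M \<and> (\<forall>X\<in>L2_space M. \<forall>Y\<in>L2_space M. L2_inner M (R X) Y = L2_inner M X (T Y))"
    show "R = S"
    proof (rule bounded_ops_ext)
      fix X assume X: "X \<in> L2_space M"
      show "R X = S X"
      proof (rule L2_ext_inner[of _ M])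
        fix Z assume Z: "Z \<in> L2_space M"
        show "L2_inner M Z (R X) = L2_inner M Z (S X)"
          using L2_inner_commute[of M Z "R X"] L2_inner_commute[of M Z "S X"] R S0(2)[of X Z] X Z
          by (simp add: S_def)
      qed (use R S X bounded_ops_in[of R M X] bounded_ops_in[of S M X] in auto)
    qed (use R S in auto)
  qed
qed

lemma op_adjoint_in: "T \<in> bounded_ops M \<Longrightarrow> op_adjoint M T \<in> bounded_ops M"
  using theI'[OF op_adjoint_unique_ex[of T M]] by (simp add: op_adjoint_def)

lemma op_adjoint_inner:
  "T \<in> bounded_ops M \<Longrightarrow> X \<in> L2_space M \<Longrightarrow> Y \<in> L2_space M
    \<Longrightarrow> L2_inner M (op_adjoint M T X) Y = L2_inner M X (T Y)"
  using theI'[OF op_adjoint_unique_ex[of T M]] by (simp add: op_adjoint_def)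

lemma op_adjoint_inner_right:
  "T \<in> bounded_ops M \<Longrightarrow> X \<in> L2_space M \<Longrightarrow> Y \<in> L2_space M
    \<Longrightarrow> L2_inner M X (op_adjoint M T Y) = L2_inner M (T X) Y"
  by (metis op_adjoint_inner L2_inner_commute)

lemma op_adjoint_eqI:
  assumes "T \<in> bounded_ops M" "S \<in> bounded_ops M"
    "\<And>X Y. X \<in> L2_space M \<Longrightarrow> Y \<in> L2_space M \<Longrightarrow> L2_inner M (S X) Y = L2_inner M X (T Y)"
  shows "op_adjoint M T = S"
  unfolding op_adjoint_def by (rule the1_equality[OF op_adjoint_unique_ex]) (use assms in auto)

lemma op_mult_apply [simp]: "X \<in> L2_space M \<Longrightarrow> op_mult M S T X = S (T X)"
  by (simp add: op_mult_def compose_def)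

lemma op_mult_in:
  assumes S: "S \<in> bounded_ops M" and T: "T \<in> bounded_ops M"
  shows "op_mult M S T \<in> bounded_ops M"
proof -
  obtain C where C: "C \<ge> 0" "\<And>X. X \<in> L2_space M \<Longrightarrow> L2_norm M (S X) \<le> C * L2_norm M X"
    using bounded_ops_bound[OF S] by blast
  obtain D where D: "D \<ge> 0" "\<And>X. X \<in> L2_space M \<Longrightarrow> L2_norm M (T X) \<le> D * L2_norm M X"
    using bounded_ops_bound[OF T] by blast
  show ?thesis
  proof (rule bounded_opsI[where S = "\<lambda>X. op_adjoint M T (op_adjoint M S X)" and C = "C * D"])
    fix X assume X: "X \<in> L2_space M"
    have "L2_norm M (S (T X)) \<le> C * L2_norm M (T X)" by (rule C(2)[OF bounded_ops_in[OF T X]])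
    also have "\<dots> \<le> C * (D * L2_norm M X)" using D(2)[OF X] C(1) by (intro mult_left_mono)
    finally show "L2_norm M (op_mult M S T X) \<le> C * D * L2_norm M X" using X by simp
  qed (use S T in \<open>auto simp: bounded_ops_in op_adjoint_in op_adjoint_inner op_mult_def compose_def\<close>)
qed

lemma op_scale_id_apply [simp]: "X \<in> L2_space M \<Longrightarrow> op_scale M a (op_id M) X = L2_scale M a X"
  by (simp add: op_scale_def op_id_def)

lemma op_scale_in:
  assumes T: "T \<in> bounded_ops M"
  shows "op_scale M a T \<in> bounded_ops M"
proof -
  obtain C where C: "C \<ge> 0" "\<And>X. X \<in> L2_space M \<Longrightarrow> L2_norm M (T X) \<le> C * L2_norm M X"
    using bounded_ops_bound[OF T] by blast
  show ?thesis
  proof (rule bounded_opsI[where S = "\<lambda>X. L2_scale M (cnj a) (op_adjoint M T X)" and C = "cmod a * C"])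
    fix X assume X: "X \<in> L2_space M"
    show "L2_norm M (op_scale M a T X) \<le> cmod a * C * L2_norm M X"
      using C(2)[OF X] X T by (simp add: op_scale_def L2_norm_scale bounded_ops_in mult.assoc mult_left_mono)
  qed (use T in \<open>auto simp: bounded_ops_in op_adjoint_in op_adjoint_inner op_scale_def L2_inner_simps\<close>)
qed

lemma op_add_in:
  assumes S: "S \<in> bounded_ops M" and T: "T \<in> bounded_ops M"
  shows "op_add M S T \<in> bounded_ops M"
proof -
  obtain C where C: "C \<ge> 0" "\<And>X. X \<in> L2_space M \<Longrightarrow> L2_norm M (S X) \<le> C * L2_norm M X"
    using bounded_ops_bound[OF S] by blast
  obtain D where D: "D \<ge> 0" "\<And>X. X \<in> L2_space M \<Longrightarrow> L2_norm M (T X) \<le> D * L2_norm M X"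
    using bounded_ops_bound[OF T] by blast
  show ?thesis
  proof (rule bounded_opsI[where S = "\<lambda>X. L2_add M (op_adjoint M S X) (op_adjoint M T X)" and C = "C + D"])
    fix X assume X: "X \<in> L2_space M"
    have "L2_norm M (L2_add M (S X) (T X)) \<le> L2_norm M (S X) + L2_norm M (T X)"
      by (rule L2_norm_triangle[OF bounded_ops_in[OF S X] bounded_ops_in[OF T X]])
    then show "L2_norm M (op_add M S T X) \<le> (C + D) * L2_norm M X"
      using C(2)[OF X] D(2)[OF X] X by (simp add: op_add_def distrib_right)
  qed (use S T in \<open>auto simp: bounded_ops_in op_adjoint_in op_adjoint_inner op_add_def L2_inner_simps\<close>)
qed

lemma op_id_in: "op_id M \<in> bounded_ops M"
  by (rule bounded_opsI[where S = "\<lambda>X. X" and C = 1]) (auto simp: op_id_def)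

lemma commutant_subset: "commutant M A \<subseteq> bounded_ops M"
  by (auto simp: commutant_def)

lemma commutantD:
  assumes "T \<in> commutant M A" "S \<in> A" "X \<in> L2_space M"
  shows "T (S X) = S (T X)"
proof -
  have "op_mult M T S X = op_mult M S T X" using assms by (simp add: commutant_def)
  then show ?thesis using assms(3) by simp
qed

lemma commutantI:
  assumes "T \<in> bounded_ops M" "A \<subseteq> bounded_ops M"
    and "\<And>S X. S \<in> A \<Longrightarrow> X \<in> L2_space M \<Longrightarrow> T (S X) = S (T X)"
  shows "T \<in> commutant M A"
  unfolding commutant_def
proof (intro CollectI conjI ballI assms(1))
  fix S assume S: "S \<in> A"
  show "op_mult M T S = op_mult M S T"
    by (rule bounded_ops_ext[of _ M]) (use assms S in \<open>auto intro!: op_mult_in\<close>)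
qed

lemma subset_bicommutant: "A \<subseteq> bounded_ops M \<Longrightarrow> A \<subseteq> commutant M (commutant M A)"
  by (auto simp: commutant_def)

lemma commutant_antimono: "A \<subseteq> B \<Longrightarrow> commutant M B \<subseteq> commutant M A"
  by (auto simp: commutant_def)

lemma triple_commutant:
  assumes "A \<subseteq> bounded_ops M"
  shows "commutant M (commutant M (commutant M A)) = commutant M A"
  using subset_bicommutant[OF assms] subset_bicommutant[OF commutant_subset[of M A]]
    commutant_antimono by blast

lemma commutant_adjoint:
  assumes A: "A \<subseteq> bounded_ops M" "\<And>S. S \<in> A \<Longrightarrow> op_adjoint M S \<in> A"
    and T: "T \<in> commutant M A"
  shows "op_adjoint M T \<in> commutant M A"
proof (rule commutantI)
  have T_in: "T \<in> bounded_ops M" using T commutant_subset by blast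
  then show "op_adjoint M T \<in> bounded_ops M" by (rule op_adjoint_in)
  fix S X assume S: "S \<in> A" and X: "X \<in> L2_space M"
  have S_in: "S \<in> bounded_ops M" using S A by blast
  show "op_adjoint M T (S X) = S (op_adjoint M T X)"
  proof (rule L2_ext_inner[of _ M])
    fix Z assume Z: "Z \<in> L2_space M"
    have "L2_inner M Z (S (op_adjoint M T X)) = L2_inner M (T (op_adjoint M S Z)) X"
      using S_in T_in X Z
      by (simp add: op_adjoint_inner[OF S_in Z, symmetric] op_adjoint_inner_right op_adjoint_in bounded_ops_in)
    also have "\<dots> = L2_inner M (op_adjoint M S (T Z)) X"
      using commutantD[OF T A(2)[OF S] Z] by simp
    also have "\<dots> = L2_inner M Z (op_adjoint M T (S X))"
      using S_in T_in X Z by (simp add: op_adjoint_inner op_adjoint_inner_right bounded_ops_in)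
    finally show "L2_inner M Z (op_adjoint M T (S X)) = L2_inner M Z (S (op_adjoint M T X))" by simp
  qed (use S_in T_in X in \<open>simp_all add: bounded_ops_in op_adjoint_in\<close>)
qed (use A in auto)

lemma bicommutant_von_neumann_algebra:
  assumes A: "A \<subseteq> bounded_ops M" "\<And>S. S \<in> A \<Longrightarrow> op_adjoint M S \<in> A"
  shows "von_neumann_algebra M (commutant M (commutant M A))"
  unfolding von_neumann_algebra_def
  using commutant_subset triple_commutant[OF commutant_subset[of M A]]
    commutant_adjoint[OF commutant_subset commutant_adjoint[OF A]] by blast

lemma op_scalars_subset_commutant:
  assumes "A \<subseteq> bounded_ops M"
  shows "op_scalars M \<subseteq> commutant M A"
  unfolding op_scalars_def
proof clarify
  fix a show "op_scale M a (op_id M) \<in> commutant M A"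
    by (rule commutantI) (use assms in \<open>auto intro: op_scale_in op_id_in simp: bounded_ops_in bounded_ops_scale subset_iff\<close>)
qed

lemma vn_center_bicommutant:
  assumes "A \<subseteq> bounded_ops M"
  shows "vn_center M (commutant M (commutant M A)) = commutant M (commutant M A) \<inter> commutant M A"
  using subset_bicommutant[OF assms] unfolding vn_center_def
  by (auto simp: commutant_def)

section \<open>Orthogonal projections\<close>

text \<open>
  The projection of \<open>X\<close> represents the restriction to \<open>V\<close> of the inner product with \<open>X\<close>. The last
  property is the one needed below: a subspace that is invariant under \<open>S\<close> and its adjoint reduces \<open>S\<close>.
\<close>

lemma L2_projection:
  assumes V: "L2_closed_subspace M V"
  obtains P where "P \<in> bounded_ops M" "\<And>X. X \<in> L2_space M \<Longrightarrow> P X \<in> V" "\<And>X. X \<in> V \<Longrightarrow> P X = X"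
    "\<And>S X. \<lbrakk>S \<in> bounded_ops M; \<And>Y. Y \<in> V \<Longrightarrow> S Y \<in> V; \<And>Y. Y \<in> V \<Longrightarrow> op_adjoint M S Y \<in> V;
       X \<in> L2_space M\<rbrakk> \<Longrightarrow> P (S X) = S (P X)"
proof -
  have V_in: "X \<in> V \<Longrightarrow> X \<in> L2_space M" for X using V by (auto simp: L2_closed_subspace_def)
  have V_diff: "X \<in> V \<Longrightarrow> Y \<in> V \<Longrightarrow> L2_diff M X Y \<in> V" for X Y
    using V V_in by (simp add: L2_diff_alt L2_closed_subspace_def)
  have "\<forall>X\<in>L2_space M. \<exists>U\<in>V. \<forall>Y\<in>V. L2_inner M U Y = L2_inner M X Y"
  proof
    fix X assume X: "X \<in> L2_space M"
    show "\<exists>U\<in>V. \<forall>Y\<in>V. L2_inner M U Y = L2_inner M X Y"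
      by (rule L2_Riesz[OF V, where C = "L2_norm M X"])
        (use X V_in in \<open>auto simp: L2_inner_simps L2_Cauchy_Schwarz\<close>)
  qed
  then obtain p where p: "\<And>X. X \<in> L2_space M \<Longrightarrow> p X \<in> V"
    "\<And>X Y. X \<in> L2_space M \<Longrightarrow> Y \<in> V \<Longrightarrow> L2_inner M (p X) Y = L2_inner M X Y"
    by metis
  have uniq: "U = U'" if "U \<in> V" "U' \<in> V" "\<And>Y. Y \<in> V \<Longrightarrow> L2_inner M U Y = L2_inner M U' Y" for U U'
  proof (rule L2_diff_eq_zero)
    have "L2_inner M (L2_diff M U U') (L2_diff M U U') = 0"
      using that(3)[OF V_diff[OF that(1,2)]] V_in[OF that(1)] V_in[OF that(2)]
      by (simp add: L2_inner_diff_left[of U M U'])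
    then show "L2_norm M (L2_diff M U U') = 0" by (simp add: L2_inner_self)
  qed (use that V_in in auto)
  define P where "P = restrict p (L2_space M)"
  have sym: "L2_inner M Z (p X) = L2_inner M (p Z) X" if "X \<in> L2_space M" "Z \<in> L2_space M" for X Z
    using p(2)[OF that(2) p(1)[OF that(1)]] p(2)[OF that(1) p(1)[OF that(2)]]
    by (metis L2_inner_commute)
  have P: "P \<in> bounded_ops M"
  proof (rule bounded_opsI[where S = p and C = 1])
    fix X assume X: "X \<in> L2_space M"
    have "(L2_norm M (p X))\<^sup>2 = Re (L2_inner M X (p X))"
      unfolding p(2)[OF X p(1)[OF X], symmetric] L2_inner_self Re_complex_of_real ..
    also have "\<dots> \<le> L2_norm M X * L2_norm M (p X)"
      using L2_Cauchy_Schwarz[OF X V_in[OF p(1)[OF X]]] complex_Re_le_cmod order_trans by blast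
    finally have "L2_norm M (p X) * L2_norm M (p X) \<le> L2_norm M X * L2_norm M (p X)"
      by (simp add: power2_eq_square)
    then have "L2_norm M (p X) \<le> L2_norm M X"
      by (cases "L2_norm M (p X) = 0") (simp_all add: mult_le_cancel_right less_le)
    then show "L2_norm M (P X) \<le> 1 * L2_norm M X" using X by (simp add: P_def)
  next
    fix X Y assume "X \<in> L2_space M" "Y \<in> L2_space M"
    then show "L2_inner M Y (P X) = L2_inner M (p Y) X" using sym[of X Y] by (simp only: P_def restrict_apply if_True)
  qed (use p(1) V_in in \<open>simp_all add: P_def\<close>)
  show thesis
  proof (rule that[OF P])
    show "P X \<in> V" if "X \<in> L2_space M" for X using that p by (simp add: P_def)
    show "P X = X" if "X \<in> V" for X
      by (rule uniq) (use that p V_in in \<open>simp_all add: P_def\<close>)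
    fix S X assume S: "S \<in> bounded_ops M" and SV: "\<And>Y. Y \<in> V \<Longrightarrow> S Y \<in> V"
      and SV': "\<And>Y. Y \<in> V \<Longrightarrow> op_adjoint M S Y \<in> V" and X: "X \<in> L2_space M"
    note SX = bounded_ops_in[OF S X]
    have "p (S X) = S (p X)"
    proof (rule uniq)
      fix Y assume Y: "Y \<in> V"
      have "L2_inner M (p (S X)) Y = L2_inner M X (op_adjoint M S Y)"
        using p(2)[OF SX Y] op_adjoint_inner_right[OF S X V_in[OF Y]] by simp
      also have "\<dots> = L2_inner M (p X) (op_adjoint M S Y)"
        using p(2)[OF X SV'[OF Y]] by simp
      also have "\<dots> = L2_inner M (S (p X)) Y"
        using op_adjoint_inner_right[OF S V_in[OF p(1)[OF X]] V_in[OF Y]] by simp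
      finally show "L2_inner M (p (S X)) Y = L2_inner M (S (p X)) Y" .
    qed (use p SX X SV in auto)
    then show "P (S X) = S (P X)" using X SX by (simp add: P_def)
  qed
qed

section \<open>Block diagonal operators over a countable fibration\<close>

text \<open>
  The measure \<open>M'\<close> splits into countably many copies of \<open>M\<close>, the fibres of \<open>\<kappa>\<close>, each scaled by a
  weight \<open>c k\<close>. Hence its Hilbert space is a direct sum of copies of the Hilbert space of \<open>M\<close>.
  Three such splittings are used: the product of \<open>M\<close> with the natural numbers, and the partition
  of a group into left or right translates of a subgroup.
\<close>

locale measure_fibration =
  fixes M :: "'x measure" and M' :: "'y measure" and I :: "'i set" and \<kappa> :: "'y \<Rightarrow> 'i"
    and e :: "'i \<Rightarrow> 'x \<Rightarrow> 'y" and d :: "'y \<Rightarrow> 'x" and c :: "'i \<Rightarrow> real"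
  assumes countable_I: "countable I"
    and \<kappa>_measurable: "\<kappa> \<in> measurable M' (count_space I)"
    and e_measurable: "k \<in> I \<Longrightarrow> e k \<in> measurable M M'"
    and d_measurable: "d \<in> measurable M' M"
    and e_d: "y \<in> space M' \<Longrightarrow> e (\<kappa> y) (d y) = y"
    and \<kappa>_e: "k \<in> I \<Longrightarrow> w \<in> space M \<Longrightarrow> \<kappa> (e k w) = k"
    and d_e: "k \<in> I \<Longrightarrow> w \<in> space M \<Longrightarrow> d (e k w) = w"
    and c_pos: "k \<in> I \<Longrightarrow> 0 < c k"
    and emeasure_fibre: "k \<in> I \<Longrightarrow> A \<in> sets M' \<Longrightarrow> (\<And>y. y \<in> A \<Longrightarrow> \<kappa> y = k)
      \<Longrightarrow> emeasure M' A = ennreal (c k) * emeasure M (e k -` A \<inter> space M)"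
begin

lemma \<kappa>_in: "y \<in> space M' \<Longrightarrow> \<kappa> y \<in> I"
  using measurable_space[OF \<kappa>_measurable] by simp

lemma fibre_sets [measurable]: "k \<in> I \<Longrightarrow> {y \<in> space M'. \<kappa> y = k} \<in> sets M'"
  using measurable_sets[OF \<kappa>_measurable, of "{k}"] by (simp add: vimage_def Int_def conj_commute)

lemma fibre_measure:
  assumes k: "k \<in> I"
  shows "density M' (indicator {y \<in> space M'. \<kappa> y = k}) = density (distr M M' (e k)) (\<lambda>_. ennreal (c k))"
proof (rule measure_eqI)
  note [measurable] = e_measurable[OF k] fibre_sets[OF k]
  fix A assume "A \<in> sets (density M' (indicator {y \<in> space M'. \<kappa> y = k}))"
  then have A [measurable]: "A \<in> sets M'" by simp
  have "emeasure (density M' (indicator {y \<in> space M'. \<kappa> y = k})) A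
      = (\<integral>\<^sup>+y. indicator ({y \<in> space M'. \<kappa> y = k} \<inter> A) y \<partial>M')"
    by (simp add: emeasure_density indicator_inter_arith)
  also have "\<dots> = emeasure M' ({y \<in> space M'. \<kappa> y = k} \<inter> A)" by simp
  also have "\<dots> = ennreal (c k) * emeasure M (e k -` ({y \<in> space M'. \<kappa> y = k} \<inter> A) \<inter> space M)"
    by (rule emeasure_fibre[OF k]) auto
  also have "e k -` ({y \<in> space M'. \<kappa> y = k} \<inter> A) \<inter> space M = e k -` A \<inter> space M"
    using \<kappa>_e[OF k] measurable_space[OF e_measurable[OF k]] by auto
  also have "ennreal (c k) * emeasure M (e k -` A \<inter> space M)
      = emeasure (density (distr M M' (e k)) (\<lambda>_. ennreal (c k))) A"
    by (simp add: emeasure_density nn_integral_cmult emeasure_distr)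
  finally show "emeasure (density M' (indicator {y \<in> space M'. \<kappa> y = k})) A = \<dots>" .
qed simp

lemma nn_integral_fibre:
  assumes k: "k \<in> I" and f [measurable]: "f \<in> borel_measurable M'"
  shows "(\<integral>\<^sup>+y. f y * indicator {y \<in> space M'. \<kappa> y = k} y \<partial>M') = ennreal (c k) * (\<integral>\<^sup>+w. f (e k w) \<partial>M)"
proof -
  note [measurable] = e_measurable[OF k] fibre_sets[OF k]
  have "(\<integral>\<^sup>+y. f y * indicator {y \<in> space M'. \<kappa> y = k} y \<partial>M')
      = (\<integral>\<^sup>+y. f y \<partial>density M' (indicator {y \<in> space M'. \<kappa> y = k}))"
    by (simp add: nn_integral_density mult.commute)
  also have "\<dots> = ennreal (c k) * (\<integral>\<^sup>+w. f (e k w) \<partial>M)"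
    unfolding fibre_measure[OF k] by (simp add: nn_integral_density nn_integral_distr nn_integral_cmult)
  finally show ?thesis .
qed

lemma integral_fibre:
  fixes f :: "'y \<Rightarrow> complex"
  assumes k: "k \<in> I" and f [measurable]: "f \<in> borel_measurable M'"
  shows "(\<integral>y. indicator {y \<in> space M'. \<kappa> y = k} y *\<^sub>R f y \<partial>M') = c k *\<^sub>R (\<integral>w. f (e k w) \<partial>M)"
proof -
  note [measurable] = e_measurable[OF k] fibre_sets[OF k]
  have "(\<integral>y. indicator {y \<in> space M'. \<kappa> y = k} y *\<^sub>R f y \<partial>M')
      = (\<integral>y. f y \<partial>density M' (\<lambda>y. ennreal (indicator {y \<in> space M'. \<kappa> y = k} y)))"
    by (rule integral_density[symmetric]) auto
  also have "density M' (\<lambda>y. ennreal (indicator {y \<in> space M'. \<kappa> y = k} y))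
      = density (distr M M' (e k)) (\<lambda>_. ennreal (c k))"
    using fibre_measure[OF k] by (simp add: ennreal_indicator)
  also have "(\<integral>y. f y \<partial>density (distr M M' (e k)) (\<lambda>_. ennreal (c k))) = c k *\<^sub>R (\<integral>w. f (e k w) \<partial>M)"
    using c_pos[OF k] by (simp add: integral_density integral_distr less_imp_le)
  finally show ?thesis .
qed

lemma AE_fibre:
  assumes k: "k \<in> I" and ae: "AE y in M'. Q y"
  shows "AE w in M. Q (e k w)"
proof -
  note [measurable] = e_measurable[OF k] fibre_sets[OF k]
  have "AE y in density M' (indicator {y \<in> space M'. \<kappa> y = k}). Q y"
    using ae by (subst AE_density) auto
  then have "AE y in distr M M' (e k). Q y"
    unfolding fibre_measure[OF k] using c_pos[OF k] by (subst (asm) AE_density) auto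
  then show ?thesis by (rule AE_distrD[OF e_measurable[OF k]])
qed

lemma nn_integral_fibres:
  assumes f [measurable]: "f \<in> borel_measurable M'"
  shows "(\<integral>\<^sup>+y. f y \<partial>M') = (\<integral>\<^sup>+k. ennreal (c k) * (\<integral>\<^sup>+w. f (e k w) \<partial>M) \<partial>count_space I)"
proof -
  have "(\<integral>\<^sup>+y. f y \<partial>M') = (\<integral>\<^sup>+y. (\<integral>\<^sup>+k. f y * indicator {y \<in> space M'. \<kappa> y = k} y \<partial>count_space I) \<partial>M')"
  proof (rule nn_integral_cong)
    fix y assume y: "y \<in> space M'"
    have "(\<integral>\<^sup>+k. f y * indicator {y \<in> space M'. \<kappa> y = k} y \<partial>count_space I)
        = (\<integral>\<^sup>+k. f y * indicator {\<kappa> y} k \<partial>count_space I)"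
      using y by (intro nn_integral_cong) (auto simp: indicator_def)
    also have "\<dots> = f y" using \<kappa>_in[OF y] by (simp add: nn_integral_cmult)
    finally show "f y = (\<integral>\<^sup>+k. f y * indicator {y \<in> space M'. \<kappa> y = k} y \<partial>count_space I)" by simp
  qed
  also have "\<dots> = (\<integral>\<^sup>+k. (\<integral>\<^sup>+y. f y * indicator {y \<in> space M'. \<kappa> y = k} y \<partial>M') \<partial>count_space I)"
    by (rule nn_integral_count_space_nn_integral[OF countable_I]) (auto intro: fibre_sets)
  also have "\<dots> = (\<integral>\<^sup>+k. ennreal (c k) * (\<integral>\<^sup>+w. f (e k w) \<partial>M) \<partial>count_space I)"
    by (rule nn_integral_cong) (simp add: nn_integral_fibre)
  finally show ?thesis .
qed

definition emb :: "'i \<Rightarrow> 'x l2 \<Rightarrow> 'y l2" where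
  "emb k X = L2_class M' (\<lambda>y. if \<kappa> y = k then L2_rep X (d y) else 0)"

definition slice :: "'i \<Rightarrow> 'y l2 \<Rightarrow> 'x l2" where
  "slice k F = L2_class M (\<lambda>w. L2_rep F (e k w))"

text \<open>The tensor product of \<open>T\<close> with the identity on the index set of the fibres.\<close>

definition amp :: "'x l2_op \<Rightarrow> 'y l2_op" where
  "amp T = (\<lambda>F\<in>L2_space M'. L2_class M' (\<lambda>y. L2_rep (T (slice (\<kappa> y) F)) (d y)))"

lemma fibrewise_measurable:
  assumes "\<And>k. k \<in> I \<Longrightarrow> g k \<in> borel_measurable M"
  shows "(\<lambda>y. (g (\<kappa> y) (d y) :: complex)) \<in> borel_measurable M'"
  by (rule measurable_compose_countable'[OF measurable_compose[OF d_measurable assms] \<kappa>_measurable countable_I])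

lemma emb_fun:
  assumes k: "k \<in> I" and f: "f \<in> L2_fun M"
  shows "(\<lambda>y. if \<kappa> y = k then f (d y) else 0) \<in> L2_fun M'"
proof -
  have m: "(\<lambda>y. if \<kappa> y = k then f (d y) else 0) \<in> borel_measurable M'"
    by (rule fibrewise_measurable[of "\<lambda>j w. if j = k then f w else 0"])
      (use L2_fun_measurable[OF f] in auto)
  have "(\<integral>\<^sup>+y. ennreal ((cmod (if \<kappa> y = k then f (d y) else 0))\<^sup>2) \<partial>M')
      = (\<integral>\<^sup>+y. ennreal ((cmod (if \<kappa> y = k then f (d y) else 0))\<^sup>2)
          * indicator {y \<in> space M'. \<kappa> y = k} y \<partial>M')"
    by (intro nn_integral_cong) (auto simp: indicator_def)
  also have "\<dots> = ennreal (c k) * (\<integral>\<^sup>+w. ennreal ((cmod (if \<kappa> (e k w) = k then f (d (e k w)) else 0))\<^sup>2) \<partial>M)"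
    by (rule nn_integral_fibre[OF k]) (use m in measurable)
  also have "(\<integral>\<^sup>+w. ennreal ((cmod (if \<kappa> (e k w) = k then f (d (e k w)) else 0))\<^sup>2) \<partial>M)
      = (\<integral>\<^sup>+w. ennreal ((cmod (f w))\<^sup>2) \<partial>M)"
    by (rule nn_integral_cong) (simp add: \<kappa>_e d_e k)
  also have "ennreal (c k) * \<dots> < \<infinity>"
    using f by (simp add: L2_fun_iff ennreal_mult_less_top)
  finally show ?thesis using m by (simp add: L2_fun_iff)
qed

lemma slice_nn:
  assumes k: "k \<in> I" and F: "F \<in> L2_space M'"
  shows "ennreal (c k) * (\<integral>\<^sup>+w. ennreal ((cmod (L2_rep F (e k w)))\<^sup>2) \<partial>M) \<le> ennreal ((L2_norm M' F)\<^sup>2)"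
proof -
  have "ennreal (c k) * (\<integral>\<^sup>+w. ennreal ((cmod (L2_rep F (e k w)))\<^sup>2) \<partial>M)
      = (\<integral>\<^sup>+y. ennreal ((cmod (L2_rep F y))\<^sup>2) * indicator {y \<in> space M'. \<kappa> y = k} y \<partial>M')"
    using L2_space_measurable[OF F] by (intro nn_integral_fibre[OF k, symmetric]) auto
  also have "\<dots> \<le> (\<integral>\<^sup>+y. ennreal ((cmod (L2_rep F y))\<^sup>2) \<partial>M')"
    by (intro nn_integral_mono) (auto simp: indicator_def)
  finally show ?thesis by (simp add: L2_norm_sq_nn[OF F])
qed

lemma slice_fun:
  assumes k: "k \<in> I" and F: "F \<in> L2_space M'"
  shows "(\<lambda>w. L2_rep F (e k w)) \<in> L2_fun M"
proof -
  have "ennreal (c k) * (\<integral>\<^sup>+w. ennreal ((cmod (L2_rep F (e k w)))\<^sup>2) \<partial>M) < \<infinity>"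
    using slice_nn[OF k F] by (auto simp: le_less_trans)
  then have "(\<integral>\<^sup>+w. ennreal ((cmod (L2_rep F (e k w)))\<^sup>2) \<partial>M) < \<infinity>"
    using c_pos[OF k] by (auto simp: ennreal_mult_less_top)
  then show ?thesis
    using measurable_compose[OF e_measurable[OF k] L2_space_measurable[OF F]] by (simp add: L2_fun_iff)
qed

lemma emb_in: "k \<in> I \<Longrightarrow> X \<in> L2_space M \<Longrightarrow> emb k X \<in> L2_space M'"
  unfolding emb_def by (intro L2_class_in emb_fun L2_rep_in)

lemma slice_in: "k \<in> I \<Longrightarrow> F \<in> L2_space M' \<Longrightarrow> slice k F \<in> L2_space M"
  unfolding slice_def by (intro L2_class_in slice_fun)

lemma inner_emb_right:
  assumes k: "k \<in> I" and F: "F \<in> L2_space M'" and X: "X \<in> L2_space M"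
  shows "L2_inner M' F (emb k X) = c k * L2_inner M (slice k F) X"
proof -
  define g where "g y = (if \<kappa> y = k then L2_rep X (d y) else 0)" for y
  have g: "g \<in> L2_fun M'" unfolding g_def by (rule emb_fun[OF k L2_rep_in[OF X]])
  note [measurable] = L2_space_measurable[OF F] L2_fun_measurable[OF g]
  have "L2_inner M' F (emb k X) = (\<integral>y. cnj (L2_rep F y) * g y \<partial>M')"
    unfolding emb_def g_def[symmetric]
    by (rule L2_inner_cong) (use F g in \<open>auto simp: L2_class_in L2_rep_class\<close>)
  also have "\<dots> = (\<integral>y. indicator {y \<in> space M'. \<kappa> y = k} y *\<^sub>R (cnj (L2_rep F y) * g y) \<partial>M')"
    by (rule Bochner_Integration.integral_cong) (auto simp: indicator_def g_def)
  also have "\<dots> = c k *\<^sub>R (\<integral>w. cnj (L2_rep F (e k w)) * g (e k w) \<partial>M)"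
    by (rule integral_fibre[OF k]) measurable
  also have "(\<integral>w. cnj (L2_rep F (e k w)) * g (e k w) \<partial>M) = (\<integral>w. cnj (L2_rep F (e k w)) * L2_rep X w \<partial>M)"
    by (rule Bochner_Integration.integral_cong) (auto simp: g_def \<kappa>_e d_e k)
  also have "\<dots> = L2_inner M (slice k F) X"
    unfolding slice_def
    by (rule L2_inner_cong[symmetric])
      (use slice_fun[OF k F] X L2_space_measurable[OF X] in \<open>auto simp: L2_class_in L2_rep_class L2_fun_measurable\<close>)
  finally show ?thesis by (simp add: scaleR_conv_of_real)
qed

lemma inner_emb_left:
  assumes "k \<in> I" "F \<in> L2_space M'" "X \<in> L2_space M"
  shows "L2_inner M' (emb k X) F = c k * L2_inner M X (slice k F)"
  using inner_emb_right[OF assms] L2_inner_commute[of M' "emb k X" F] L2_inner_commute[of M X "slice k F"] by simp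

lemma inner_slice:
  assumes "k \<in> I" "F \<in> L2_space M'" "X \<in> L2_space M"
  shows "L2_inner M X (slice k F) = inverse (complex_of_real (c k)) * L2_inner M' (emb k X) F"
  using inner_emb_left[OF assms] c_pos[OF assms(1)] by simp

lemma slice_add:
  assumes "k \<in> I" "F \<in> L2_space M'" "F' \<in> L2_space M'"
  shows "slice k (L2_add M' F F') = L2_add M (slice k F) (slice k F')"
  by (rule L2_ext_inner[of _ M])
    (use assms in \<open>simp_all add: slice_in inner_slice L2_inner_simps emb_in distrib_left\<close>)

lemma slice_scale:
  assumes "k \<in> I" "F \<in> L2_space M'"
  shows "slice k (L2_scale M' a F) = L2_scale M a (slice k F)"
  by (rule L2_ext_inner[of _ M])
    (use assms in \<open>simp_all add: slice_in inner_slice L2_inner_simps emb_in\<close>)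

lemma slice_diff:
  assumes "k \<in> I" "F \<in> L2_space M'" "F' \<in> L2_space M'"
  shows "slice k (L2_diff M' F F') = L2_diff M (slice k F) (slice k F')"
  by (rule L2_ext_inner[of _ M])
    (use assms in \<open>simp_all add: slice_in inner_slice L2_inner_simps emb_in right_diff_distrib\<close>)

lemma norm_slices:
  assumes F: "F \<in> L2_space M'"
  shows "ennreal ((L2_norm M' F)\<^sup>2) = (\<integral>\<^sup>+k. ennreal (c k * (L2_norm M (slice k F))\<^sup>2) \<partial>count_space I)"
proof -
  have "ennreal ((L2_norm M' F)\<^sup>2)
      = (\<integral>\<^sup>+k. ennreal (c k) * (\<integral>\<^sup>+w. ennreal ((cmod (L2_rep F (e k w)))\<^sup>2) \<partial>M) \<partial>count_space I)"
    unfolding L2_norm_sq_nn[OF F] using L2_space_measurable[OF F] by (intro nn_integral_fibres) auto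
  also have "\<dots> = (\<integral>\<^sup>+k. ennreal (c k * (L2_norm M (slice k F))\<^sup>2) \<partial>count_space I)"
    using F by (intro nn_integral_cong)
      (simp add: slice_def L2_norm_sq_nn_class[OF slice_fun, symmetric] ennreal_mult less_imp_le[OF c_pos])
  finally show ?thesis .
qed

lemma norm_slice_le:
  assumes "k \<in> I" "F \<in> L2_space M'"
  shows "c k * (L2_norm M (slice k F))\<^sup>2 \<le> (L2_norm M' F)\<^sup>2"
proof -
  have "ennreal (c k * (L2_norm M (slice k F))\<^sup>2) \<le> ennreal ((L2_norm M' F)\<^sup>2)"
    using slice_nn[OF assms] assms c_pos[OF assms(1)]
    by (simp add: slice_def L2_norm_sq_nn_class[OF slice_fun, symmetric] ennreal_mult)
  then show ?thesis by simp
qed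

lemma slices_ext:
  assumes F: "F \<in> L2_space M'" and F': "F' \<in> L2_space M'" and eq: "\<And>k. k \<in> I \<Longrightarrow> slice k F = slice k F'"
  shows "F = F'"
proof (rule L2_diff_eq_zero[OF F F'])
  have "L2_norm M (slice k (L2_diff M' F F')) = 0" if "k \<in> I" for k
  proof -
    have "L2_inner M (slice k (L2_diff M' F F')) (slice k (L2_diff M' F F')) = 0"
      using that F F' eq[OF that]
      by (simp add: slice_diff L2_inner_diff_right[of "slice k F'" M "slice k F'"] slice_in)
    then show ?thesis by (simp add: L2_inner_self)
  qed
  then have "ennreal ((L2_norm M' (L2_diff M' F F'))\<^sup>2) = (\<integral>\<^sup>+k. 0 \<partial>count_space I)"
    unfolding norm_slices[OF L2_diff_in[OF F F']] by (intro nn_integral_cong) simp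
  then show "L2_norm M' (L2_diff M' F F') = 0" by (simp add: ennreal_eq_0_iff)
qed

lemma slice_emb:
  assumes k: "k \<in> I" and j: "j \<in> I" and X: "X \<in> L2_space M"
  shows "slice j (emb k X) = (if j = k then X else L2_zero M)"
proof (rule L2_space_eqI)
  have "AE w in M. L2_rep (emb k X) (e j w) = (if \<kappa> (e j w) = k then L2_rep X (d (e j w)) else 0)"
    unfolding emb_def by (rule AE_fibre[OF j L2_rep_class[OF emb_fun[OF k L2_rep_in[OF X]]]])
  moreover have "AE w in M. w \<in> space M" by simp
  ultimately show "AE w in M. L2_rep (slice j (emb k X)) w = L2_rep (if j = k then X else L2_zero M) w"
    using L2_rep_class[OF slice_fun[OF j emb_in[OF k X]], folded slice_def] L2_rep_zero[of M]
    by eventually_elim (auto simp: \<kappa>_e d_e j k)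
qed (use assms in \<open>auto simp: slice_in emb_in\<close>)

lemma slice_class:
  assumes k: "k \<in> I" and f: "f \<in> L2_fun M'"
  shows "(\<lambda>w. f (e k w)) \<in> L2_fun M" "slice k (L2_class M' f) = L2_class M (\<lambda>w. f (e k w))"
proof -
  note F = L2_class_in[OF f]
  have ae: "AE w in M. L2_rep (L2_class M' f) (e k w) = f (e k w)"
    by (rule AE_fibre[OF k L2_rep_class[OF f]])
  show fe: "(\<lambda>w. f (e k w)) \<in> L2_fun M"
    by (rule L2_fun_cong_AE[OF slice_fun[OF k F] measurable_compose[OF e_measurable[OF k] L2_fun_measurable[OF f]] ae])
  show "slice k (L2_class M' f) = L2_class M (\<lambda>w. f (e k w))"
    unfolding slice_def by (rule L2_class_cong[OF slice_fun[OF k F] fe ae])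
qed

lemma emb_class:
  assumes k: "k \<in> I" and f: "f \<in> L2_fun M"
  shows "emb k (L2_class M f) = L2_class M' (\<lambda>y. if \<kappa> y = k then f (d y) else 0)"
proof (rule slices_ext)
  note X = L2_class_in[OF f] and g = emb_fun[OF k f]
  show "emb k (L2_class M f) \<in> L2_space M'" by (rule emb_in[OF k X])
  show "L2_class M' (\<lambda>y. if \<kappa> y = k then f (d y) else 0) \<in> L2_space M'" by (rule L2_class_in[OF g])
  fix j assume j: "j \<in> I"
  have "slice j (L2_class M' (\<lambda>y. if \<kappa> y = k then f (d y) else 0)) = (if j = k then L2_class M f else L2_zero M)"
    unfolding slice_class(2)[OF j g] L2_zero_def if_distrib[of "L2_class M", symmetric]
  proof (rule L2_class_cong[OF slice_class(1)[OF j g]])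
    show "AE w in M. (if \<kappa> (e j w) = k then f (d (e j w)) else 0) = (if j = k then f else (\<lambda>_. 0)) w"
      by (rule AE_I2) (simp add: \<kappa>_e d_e j k)
  qed (simp add: f)
  then show "slice j (emb k (L2_class M f)) = slice j (L2_class M' (\<lambda>y. if \<kappa> y = k then f (d y) else 0))"
    by (simp add: slice_emb[OF k j X])
qed

lemma emb_norm:
  assumes k: "k \<in> I" and X: "X \<in> L2_space M"
  shows "(L2_norm M' (emb k X))\<^sup>2 = c k * (L2_norm M X)\<^sup>2"
proof -
  have "complex_of_real ((L2_norm M' (emb k X))\<^sup>2) = of_real (c k * (L2_norm M X)\<^sup>2)"
    unfolding L2_inner_self[symmetric] inner_emb_right[OF k emb_in[OF k X] X] slice_emb[OF k k X]
    by (simp add: L2_inner_self)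
  then show ?thesis using of_real_eq_iff by blast
qed

text \<open>
  The embedded copies span a dense subspace. Instead of expanding vectors into series, the adjoints
  of the two operators are compared slice by slice.
\<close>

lemma emb_operator_ext:
  assumes Y: "Y \<in> bounded_ops M'" and Z: "Z \<in> bounded_ops M'"
    and eq: "\<And>k X. k \<in> I \<Longrightarrow> X \<in> L2_space M \<Longrightarrow> Y (emb k X) = Z (emb k X)"
  shows "Y = Z"
proof (rule bounded_ops_ext[OF Y Z])
  fix F assume F: "F \<in> L2_space M'"
  have adj: "op_adjoint M' Y G = op_adjoint M' Z G" if G: "G \<in> L2_space M'" for G
  proof (rule slices_ext)
    fix k assume k: "k \<in> I"
    note YG = bounded_ops_in[OF op_adjoint_in[OF Y] G] and ZG = bounded_ops_in[OF op_adjoint_in[OF Z] G]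
    show "slice k (op_adjoint M' Y G) = slice k (op_adjoint M' Z G)"
    proof (rule L2_ext_inner[of _ M])
      fix X assume X: "X \<in> L2_space M"
      show "L2_inner M X (slice k (op_adjoint M' Y G)) = L2_inner M X (slice k (op_adjoint M' Z G))"
        using op_adjoint_inner_right[OF Y emb_in[OF k X] G] op_adjoint_inner_right[OF Z emb_in[OF k X] G]
        by (simp add: inner_slice k X YG ZG eq)
    qed (use k YG ZG in \<open>simp_all add: slice_in\<close>)
  qed (use G Y Z in \<open>simp_all add: bounded_ops_in op_adjoint_in\<close>)
  show "Y F = Z F"
  proof (rule L2_ext_inner[of _ M'])
    fix G assume G: "G \<in> L2_space M'"
    show "L2_inner M' G (Y F) = L2_inner M' G (Z F)"
      using op_adjoint_inner[OF Y G F] op_adjoint_inner[OF Z G F] adj[OF G] by simp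
  qed (use F Y Z in \<open>simp_all add: bounded_ops_in\<close>)
qed

lemma operator_slices_bound:
  assumes F: "F \<in> L2_space M'" and C: "\<And>X. X \<in> L2_space M \<Longrightarrow> L2_norm M (T X) \<le> C * L2_norm M X"
  shows "(\<integral>\<^sup>+k. ennreal (c k * (L2_norm M (T (slice k F)))\<^sup>2) \<partial>count_space I) \<le> ennreal ((C * L2_norm M' F)\<^sup>2)"
proof -
  have "(\<integral>\<^sup>+k. ennreal (c k * (L2_norm M (T (slice k F)))\<^sup>2) \<partial>count_space I)
      \<le> (\<integral>\<^sup>+k. ennreal (C\<^sup>2) * ennreal (c k * (L2_norm M (slice k F))\<^sup>2) \<partial>count_space I)"
  proof (rule nn_integral_mono)
    fix k assume "k \<in> space (count_space I)"
    then have k: "k \<in> I" by simp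
    have "(L2_norm M (T (slice k F)))\<^sup>2 \<le> (C * L2_norm M (slice k F))\<^sup>2"
      by (rule power_mono[OF C[OF slice_in[OF k F]] L2_norm_nonneg])
    then have "c k * (L2_norm M (T (slice k F)))\<^sup>2 \<le> c k * (C * L2_norm M (slice k F))\<^sup>2"
      by (rule mult_left_mono) (simp add: less_imp_le c_pos k)
    also have "\<dots> = C\<^sup>2 * (c k * (L2_norm M (slice k F))\<^sup>2)"
      by (simp add: power_mult_distrib)
    finally show "ennreal (c k * (L2_norm M (T (slice k F)))\<^sup>2) \<le> ennreal (C\<^sup>2) * ennreal (c k * (L2_norm M (slice k F))\<^sup>2)"
      by (subst ennreal_mult[symmetric]) (simp_all add: ennreal_leI less_imp_le c_pos k)
  qed
  also have "\<dots> = ennreal (C\<^sup>2) * ennreal ((L2_norm M' F)\<^sup>2)"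
    by (simp add: nn_integral_cmult norm_slices[OF F])
  also have "\<dots> = ennreal ((C * L2_norm M' F)\<^sup>2)" by (simp add: ennreal_mult power_mult_distrib)
  finally show ?thesis .
qed

lemma amp_fun:
  assumes T: "T \<in> bounded_ops M" and F: "F \<in> L2_space M'"
  shows "(\<lambda>y. L2_rep (T (slice (\<kappa> y) F)) (d y)) \<in> L2_fun M'"
proof -
  obtain C where C: "\<And>X. X \<in> L2_space M \<Longrightarrow> L2_norm M (T X) \<le> C * L2_norm M X"
    using bounded_ops_bound[OF T] by blast
  have Ts: "T (slice k F) \<in> L2_space M" if "k \<in> I" for k
    by (rule bounded_ops_in[OF T slice_in[OF that F]])
  have m [measurable]: "(\<lambda>y. L2_rep (T (slice (\<kappa> y) F)) (d y)) \<in> borel_measurable M'"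
    by (rule fibrewise_measurable[of "\<lambda>k. L2_rep (T (slice k F))"]) (rule L2_space_measurable[OF Ts])
  have "(\<integral>\<^sup>+y. ennreal ((cmod (L2_rep (T (slice (\<kappa> y) F)) (d y)))\<^sup>2) \<partial>M')
      = (\<integral>\<^sup>+k. ennreal (c k) * (\<integral>\<^sup>+w. ennreal ((cmod (L2_rep (T (slice (\<kappa> (e k w)) F)) (d (e k w))))\<^sup>2) \<partial>M) \<partial>count_space I)"
    by (rule nn_integral_fibres) measurable
  also have "\<dots> = (\<integral>\<^sup>+k. ennreal (c k) * (\<integral>\<^sup>+w. ennreal ((cmod (L2_rep (T (slice k F)) w))\<^sup>2) \<partial>M) \<partial>count_space I)"
    by (intro nn_integral_cong arg_cong2[where f = "(*)"] refl) (simp add: \<kappa>_e d_e)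
  also have "\<dots> = (\<integral>\<^sup>+k. ennreal (c k * (L2_norm M (T (slice k F)))\<^sup>2) \<partial>count_space I)"
    by (intro nn_integral_cong) (simp add: L2_norm_sq_nn[OF Ts, symmetric] ennreal_mult less_imp_le[OF c_pos])
  also have "\<dots> \<le> ennreal ((C * L2_norm M' F)\<^sup>2)" by (rule operator_slices_bound[OF F C])
  also have "\<dots> < \<infinity>" by simp
  finally show ?thesis using m by (simp add: L2_fun_iff)
qed

lemma amp_mem: "T \<in> bounded_ops M \<Longrightarrow> F \<in> L2_space M' \<Longrightarrow> amp T F \<in> L2_space M'"
  by (simp add: amp_def L2_class_in amp_fun)

lemma slice_amp:
  assumes T: "T \<in> bounded_ops M" and F: "F \<in> L2_space M'" and k: "k \<in> I"
  shows "slice k (amp T F) = T (slice k F)"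
proof (rule L2_space_eqI)
  have "AE w in M. L2_rep (amp T F) (e k w) = L2_rep (T (slice (\<kappa> (e k w)) F)) (d (e k w))"
    using AE_fibre[OF k L2_rep_class[OF amp_fun[OF T F]]] F by (simp add: amp_def)
  moreover have "AE w in M. w \<in> space M" by simp
  ultimately show "AE w in M. L2_rep (slice k (amp T F)) w = L2_rep (T (slice k F)) w"
    using L2_rep_class[OF slice_fun[OF k amp_mem[OF T F]], folded slice_def]
    by eventually_elim (simp add: \<kappa>_e d_e k)
qed (simp_all add: slice_in[OF k amp_mem[OF T F]] bounded_ops_in[OF T slice_in[OF k F]])

lemma amp_in:
  assumes T: "T \<in> bounded_ops M"
  shows "amp T \<in> bounded_ops M'"
proof -
  obtain C where C: "C \<ge> 0" "\<And>X. X \<in> L2_space M \<Longrightarrow> L2_norm M (T X) \<le> C * L2_norm M X"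
    using bounded_ops_bound[OF T] by blast
  have add: "amp T (L2_add M' F G) = L2_add M' (amp T F) (amp T G)"
    if "F \<in> L2_space M'" "G \<in> L2_space M'" for F G
    by (rule slices_ext)
      (simp_all add: that slice_amp[OF T] amp_mem[OF T] slice_add bounded_ops_add[OF T] slice_in)
  have scale: "amp T (L2_scale M' a F) = L2_scale M' a (amp T F)" if "F \<in> L2_space M'" for F a
    by (rule slices_ext)
      (simp_all add: that slice_amp[OF T] amp_mem[OF T] slice_scale bounded_ops_scale[OF T] slice_in)
  have bound: "L2_norm M' (amp T F) \<le> C * L2_norm M' F" if F: "F \<in> L2_space M'" for F
  proof (rule power2_le_imp_le)
    have "ennreal ((L2_norm M' (amp T F))\<^sup>2) = (\<integral>\<^sup>+k. ennreal (c k * (L2_norm M (T (slice k F)))\<^sup>2) \<partial>count_space I)"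
      unfolding norm_slices[OF amp_mem[OF T F]] by (intro nn_integral_cong) (simp add: slice_amp[OF T F])
    also have "\<dots> \<le> ennreal ((C * L2_norm M' F)\<^sup>2)" by (rule operator_slices_bound[OF F C(2)])
    finally show "(L2_norm M' (amp T F))\<^sup>2 \<le> (C * L2_norm M' F)\<^sup>2" by simp
  qed (simp add: C(1))
  have "amp T \<in> L2_space M' \<rightarrow>\<^sub>E L2_space M'"
    using amp_mem[OF T] by (auto simp: amp_def)
  with add scale bound show ?thesis unfolding bounded_ops_def by blast
qed

lemma amp_emb:
  assumes T: "T \<in> bounded_ops M" and k: "k \<in> I" and X: "X \<in> L2_space M"
  shows "amp T (emb k X) = emb k (T X)"
proof (rule slices_ext)
  have T0: "T (L2_zero M) = L2_zero M"
  proof -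
    have "L2_scale M 0 (L2_zero M) = L2_zero M"
      by (rule L2_ext_inner[of _ M]) (simp_all add: L2_inner_simps)
    moreover have "L2_scale M 0 (T (L2_zero M)) = L2_zero M"
      by (rule L2_ext_inner[of _ M]) (simp_all add: L2_inner_simps bounded_ops_in[OF T])
    ultimately show ?thesis using bounded_ops_scale[OF T L2_zero_in, of 0] by simp
  qed
  fix j assume j: "j \<in> I"
  show "slice j (amp T (emb k X)) = slice j (emb k (T X))"
    by (simp add: slice_amp[OF T emb_in[OF k X] j] slice_emb[OF k j X] slice_emb[OF k j bounded_ops_in[OF T X]] T0)
qed (simp_all add: amp_mem[OF T emb_in[OF k X]] emb_in[OF k bounded_ops_in[OF T X]])

text \<open>
  The entries \<open>slice j \<circ> Y \<circ> emb k\<close> of the matrix of \<open>Y\<close> commute with \<open>A\<close>, hence with every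
  \<open>T\<close> in the bicommutant of \<open>A\<close>; an operator is determined by its entries.
\<close>

lemma amp_bicommutant_commute:
  assumes A: "A \<subseteq> bounded_ops M" and T: "T \<in> commutant M (commutant M A)"
    and Y: "Y \<in> bounded_ops M'"
    and comm: "\<And>S F. S \<in> A \<Longrightarrow> F \<in> L2_space M' \<Longrightarrow> Y (amp S F) = amp S (Y F)"
    and F: "F \<in> L2_space M'"
  shows "Y (amp T F) = amp T (Y F)"
proof -
  have T': "T \<in> bounded_ops M" using T commutant_subset by blast
  define y where "y j k = (\<lambda>X\<in>L2_space M. slice j (Y (emb k X)))" for j k
  have y: "y j k \<in> commutant M A" if j: "j \<in> I" and k: "k \<in> I" for j k
  proof (rule commutantI)
    note Yemb = bounded_ops_in[OF Y emb_in[OF k]]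
    obtain C where C: "C \<ge> 0" "\<And>F. F \<in> L2_space M' \<Longrightarrow> L2_norm M' (Y F) \<le> C * L2_norm M' F"
      using bounded_ops_bound[OF Y] by blast
    show "y j k \<in> bounded_ops M"
    proof (rule bounded_opsI[where C = "C * sqrt (c k / c j)"
          and S = "\<lambda>Z. L2_scale M (c k / c j) (slice k (op_adjoint M' Y (emb j Z)))"])
      fix X assume X: "X \<in> L2_space M"
      have "c j * (L2_norm M (slice j (Y (emb k X))))\<^sup>2 \<le> (L2_norm M' (Y (emb k X)))\<^sup>2"
        by (rule norm_slice_le[OF j Yemb[OF X]])
      also have "\<dots> \<le> (C * L2_norm M' (emb k X))\<^sup>2"
        by (rule power_mono[OF C(2)[OF emb_in[OF k X]] L2_norm_nonneg])
      also have "\<dots> = C\<^sup>2 * (c k * (L2_norm M X)\<^sup>2)"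
        by (simp add: power_mult_distrib emb_norm[OF k X])
      also have "\<dots> = c j * (C * sqrt (c k / c j) * L2_norm M X)\<^sup>2"
        using c_pos[OF j] c_pos[OF k] by (simp add: power_mult_distrib)
      finally have "(L2_norm M (slice j (Y (emb k X))))\<^sup>2 \<le> (C * sqrt (c k / c j) * L2_norm M X)\<^sup>2"
        by (rule mult_left_le_imp_le[OF _ c_pos[OF j]])
      then have "L2_norm M (slice j (Y (emb k X))) \<le> C * sqrt (c k / c j) * L2_norm M X"
        by (rule power2_le_imp_le) (simp add: C(1) less_imp_le[OF c_pos[OF j]] less_imp_le[OF c_pos[OF k]])
      then show "L2_norm M (y j k X) \<le> C * sqrt (c k / c j) * L2_norm M X"
        using X by (simp add: y_def)
    next
      fix X Z assume X: "X \<in> L2_space M" and Z: "Z \<in> L2_space M"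
      have "L2_inner M Z (slice j (Y (emb k X))) = inverse (complex_of_real (c j)) * L2_inner M' (emb j Z) (Y (emb k X))"
        by (rule inner_slice[OF j Yemb[OF X] Z])
      also have "L2_inner M' (emb j Z) (Y (emb k X)) = L2_inner M' (op_adjoint M' Y (emb j Z)) (emb k X)"
        by (rule op_adjoint_inner[OF Y emb_in[OF j Z] emb_in[OF k X], symmetric])
      also have "\<dots> = c k * L2_inner M (slice k (op_adjoint M' Y (emb j Z))) X"
        by (rule inner_emb_right[OF k bounded_ops_in[OF op_adjoint_in[OF Y] emb_in[OF j Z]] X])
      finally show "L2_inner M Z (y j k X)
          = L2_inner M (L2_scale M (c k / c j) (slice k (op_adjoint M' Y (emb j Z)))) X"
        using X by (simp add: y_def L2_inner_scale_left
            slice_in[OF k bounded_ops_in[OF op_adjoint_in[OF Y] emb_in[OF j Z]]] divide_inverse ac_simps)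
    qed (simp_all add: y_def slice_in[OF j Yemb] slice_in[OF k bounded_ops_in[OF op_adjoint_in[OF Y] emb_in[OF j]]])
    fix S X assume S: "S \<in> A" and X: "X \<in> L2_space M"
    have S': "S \<in> bounded_ops M" using S A by blast
    have "slice j (Y (emb k (S X))) = slice j (amp S (Y (emb k X)))"
      by (simp add: amp_emb[OF S' k X, symmetric] comm[OF S emb_in[OF k X]])
    then show "y j k (S X) = S (y j k X)"
      using X by (simp add: y_def bounded_ops_in[OF S'] slice_amp[OF S' Yemb[OF X] j])
  qed (rule A)
  have "op_mult M' Y (amp T) = op_mult M' (amp T) Y"
  proof (rule emb_operator_ext)
    show "op_mult M' Y (amp T) \<in> bounded_ops M'" "op_mult M' (amp T) Y \<in> bounded_ops M'"
      by (simp_all add: op_mult_in Y amp_in T')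
    fix k X assume k: "k \<in> I" and X: "X \<in> L2_space M"
    note YX = bounded_ops_in[OF Y emb_in[OF k X]] and YTX = bounded_ops_in[OF Y emb_in[OF k bounded_ops_in[OF T' X]]]
    have "Y (emb k (T X)) = amp T (Y (emb k X))"
    proof (rule slices_ext[OF YTX amp_mem[OF T' YX]])
      fix j assume j: "j \<in> I"
      show "slice j (Y (emb k (T X))) = slice j (amp T (Y (emb k X)))"
        using commutantD[OF T y[OF j k] X] X
        by (simp add: y_def slice_amp[OF T' YX j] bounded_ops_in[OF T'])
    qed
    then show "op_mult M' Y (amp T) (emb k X) = op_mult M' (amp T) Y (emb k X)"
      by (simp add: emb_in[OF k X] amp_emb[OF T' k X])
  qed
  from arg_cong[OF this, of "\<lambda>Z. Z F"] show ?thesis using F by simp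
qed

lemma op_adjoint_amp:
  assumes T: "T \<in> bounded_ops M"
  shows "op_adjoint M' (amp T) = amp (op_adjoint M T)"
proof (rule emb_operator_ext)
  note T' = op_adjoint_in[OF T]
  show "op_adjoint M' (amp T) \<in> bounded_ops M'" by (rule op_adjoint_in[OF amp_in[OF T]])
  show "amp (op_adjoint M T) \<in> bounded_ops M'" by (rule amp_in[OF T'])
  fix k X assume k: "k \<in> I" and X: "X \<in> L2_space M"
  note EX = emb_in[OF k X] and AX = bounded_ops_in[OF op_adjoint_in[OF amp_in[OF T]] emb_in[OF k X]]
  show "op_adjoint M' (amp T) (emb k X) = amp (op_adjoint M T) (emb k X)"
  proof (rule L2_ext_inner[OF AX amp_mem[OF T' EX]])
    fix F assume F: "F \<in> L2_space M'"
    have "L2_inner M' F (op_adjoint M' (amp T) (emb k X)) = L2_inner M' (amp T F) (emb k X)"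
      by (rule op_adjoint_inner_right[OF amp_in[OF T] F EX])
    also have "\<dots> = c k * L2_inner M (slice k F) (op_adjoint M T X)"
      by (simp add: inner_emb_right[OF k amp_mem[OF T F] X] slice_amp[OF T F k]
          op_adjoint_inner_right[OF T slice_in[OF k F] X])
    also have "\<dots> = L2_inner M' F (amp (op_adjoint M T) (emb k X))"
      by (simp add: amp_emb[OF T' k X] inner_emb_right[OF k F bounded_ops_in[OF T' X]])
    finally show "L2_inner M' F (op_adjoint M' (amp T) (emb k X)) = L2_inner M' F (amp (op_adjoint M T) (emb k X))" .
  qed
qed

end

section \<open>Ultraweak density and uniqueness of automorphisms\<close>

lemma l2_sequences_bounded_op:
  assumes "\<eta> \<in> l2_sequences M" "T \<in> bounded_ops M"
  shows "(\<lambda>n. T (\<eta> n)) \<in> l2_sequences M"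
proof -
  obtain C where C: "C \<ge> 0" "\<And>X. X \<in> L2_space M \<Longrightarrow> L2_norm M (T X) \<le> C * L2_norm M X"
    using bounded_ops_bound[OF assms(2)] by blast
  have \<eta>: "\<eta> n \<in> L2_space M" for n using assms(1) by (simp add: l2_sequences_def)
  have "summable (\<lambda>n. C\<^sup>2 * (L2_norm M (\<eta> n))\<^sup>2)"
    using assms(1) by (intro summable_mult) (simp add: l2_sequences_def)
  then have "summable (\<lambda>n. (L2_norm M (T (\<eta> n)))\<^sup>2)"
  proof (rule summable_comparison_test[rotated], intro exI allI impI)
    fix n
    have "(L2_norm M (T (\<eta> n)))\<^sup>2 \<le> (C * L2_norm M (\<eta> n))\<^sup>2"
      by (rule power_mono[OF C(2)[OF \<eta>] L2_norm_nonneg])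
    then show "norm ((L2_norm M (T (\<eta> n)))\<^sup>2) \<le> C\<^sup>2 * (L2_norm M (\<eta> n))\<^sup>2"
      by (simp add: power_mult_distrib)
  qed
  then show ?thesis by (simp add: l2_sequences_def \<eta> bounded_ops_in[OF assms(2)])
qed

lemma l2_sequences_inner_summable:
  assumes "\<xi> \<in> l2_sequences M" "\<eta> \<in> l2_sequences M"
  shows "summable (\<lambda>n. L2_inner M (\<xi> n) (\<eta> n))"
proof (rule summable_comparison_test)
  show "\<exists>N. \<forall>n\<ge>N. norm (L2_inner M (\<xi> n) (\<eta> n)) \<le> (L2_norm M (\<xi> n))\<^sup>2 + (L2_norm M (\<eta> n))\<^sup>2"
  proof (intro exI allI impI)
    fix n
    have "norm (L2_inner M (\<xi> n) (\<eta> n)) \<le> L2_norm M (\<xi> n) * L2_norm M (\<eta> n)"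
      using assms by (intro L2_Cauchy_Schwarz) (simp_all add: l2_sequences_def)
    also have "\<dots> \<le> (L2_norm M (\<xi> n))\<^sup>2 + (L2_norm M (\<eta> n))\<^sup>2"
      using zero_le_power2[of "L2_norm M (\<xi> n) - L2_norm M (\<eta> n)"]
        zero_le_power2[of "L2_norm M (\<xi> n)"] zero_le_power2[of "L2_norm M (\<eta> n)"]
      unfolding power2_diff by linarith
    finally show "norm (L2_inner M (\<xi> n) (\<eta> n)) \<le> (L2_norm M (\<xi> n))\<^sup>2 + (L2_norm M (\<eta> n))\<^sup>2" .
  qed
  show "summable (\<lambda>n. (L2_norm M (\<xi> n))\<^sup>2 + (L2_norm M (\<eta> n))\<^sup>2)"
    using assms by (intro summable_add) (simp_all add: l2_sequences_def)
qed

lemma interleave_l2_sequences: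
  assumes "\<eta> \<in> l2_sequences M" "\<eta>' \<in> l2_sequences M"
  shows "(\<lambda>n. if even n then \<eta> (n div 2) else \<eta>' (n div 2)) \<in> l2_sequences M"
proof -
  define f where "f n = (L2_norm M (if even n then \<eta> (n div 2) else \<eta>' (n div 2)))\<^sup>2" for n
  have split: "sum f {..<2 * N} = (\<Sum>n<N. (L2_norm M (\<eta> n))\<^sup>2) + (\<Sum>n<N. (L2_norm M (\<eta>' n))\<^sup>2)" for N
    by (induction N) (simp_all add: f_def)
  have "sum f {..<N} \<le> (\<Sum>n. (L2_norm M (\<eta> n))\<^sup>2) + (\<Sum>n. (L2_norm M (\<eta>' n))\<^sup>2)" for N
  proof -
    have "sum f {..<N} \<le> sum f {..<2 * N}" by (rule sum_mono2) (auto simp: f_def)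
    also have "\<dots> \<le> (\<Sum>n. (L2_norm M (\<eta> n))\<^sup>2) + (\<Sum>n. (L2_norm M (\<eta>' n))\<^sup>2)"
      unfolding split using assms by (intro add_mono sum_le_suminf) (simp_all add: l2_sequences_def)
    finally show ?thesis .
  qed
  then have "summable f" by (intro summableI_nonneg_bounded) (simp_all add: f_def)
  then show ?thesis using assms unfolding l2_sequences_def f_def by simp
qed

text \<open>
  The ultraweak topology is coarser than the topology of strong convergence on square-summable
  sequences. Finitely many such sequences can be interleaved, so one sequence describes a
  neighbourhood.
\<close>

lemma ultraweak_neighbourhood:
  assumes "openin (ultraweak_topology M) W" "T \<in> W" "T \<in> bounded_ops M"
  obtains \<eta> \<epsilon> where "\<eta> \<in> l2_sequences M" "\<epsilon> > 0"
    "\<And>S. S \<in> bounded_ops M \<Longrightarrow> (\<And>N. (\<Sum>n<N. (L2_norm M (L2_diff M (S (\<eta> n)) (T (\<eta> n))))\<^sup>2) \<le> \<epsilon>) \<Longrightarrow> S \<in> W"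
proof -
  let ?close = "\<lambda>\<eta> \<epsilon> S. \<forall>N. (\<Sum>n<N. (L2_norm M (L2_diff M (S (\<eta> n)) (T (\<eta> n))))\<^sup>2) \<le> \<epsilon>"
  define nbhd where "nbhd W \<longleftrightarrow> (\<exists>\<eta>\<in>l2_sequences M. \<exists>\<epsilon>>0. \<forall>S\<in>bounded_ops M. ?close \<eta> \<epsilon> S \<longrightarrow> S \<in> W)" for W
  let ?B = "{{T \<in> bounded_ops M. (\<Sum>n. L2_inner M (\<xi> n) (T (\<eta> n))) \<in> U} | \<xi> \<eta> U.
        \<xi> \<in> l2_sequences M \<and> \<eta> \<in> l2_sequences M \<and> open U}"
  have "generate_topology_on ?B W"
    using assms(1) unfolding ultraweak_topology_def openin_topology_generated_by_iff .
  then have "T \<in> W \<longrightarrow> nbhd W"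
  proof induction
    case Empty
    show ?case by simp
  next
    case (Int W1 W2)
    show ?case
    proof
      assume "T \<in> W1 \<inter> W2"
      then have "nbhd W1" "nbhd W2" using Int.IH by auto
      then obtain \<eta>1 \<eta>2 where
        1: "\<eta>1 \<in> l2_sequences M" "\<exists>\<epsilon>>0. \<forall>S\<in>bounded_ops M. ?close \<eta>1 \<epsilon> S \<longrightarrow> S \<in> W1" and
        2: "\<eta>2 \<in> l2_sequences M" "\<exists>\<epsilon>>0. \<forall>S\<in>bounded_ops M. ?close \<eta>2 \<epsilon> S \<longrightarrow> S \<in> W2"
        unfolding nbhd_def by (elim bexE)
      from 1(2) obtain \<epsilon>1 where \<epsilon>1: "\<epsilon>1 > 0" "\<forall>S\<in>bounded_ops M. ?close \<eta>1 \<epsilon>1 S \<longrightarrow> S \<in> W1"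
        by (elim exE conjE)
      from 2(2) obtain \<epsilon>2 where \<epsilon>2: "\<epsilon>2 > 0" "\<forall>S\<in>bounded_ops M. ?close \<eta>2 \<epsilon>2 S \<longrightarrow> S \<in> W2"
        by (elim exE conjE)
      define \<eta> where "\<eta> n = (if even n then \<eta>1 (n div 2) else \<eta>2 (n div 2))" for n
      have \<eta>: "\<eta> \<in> l2_sequences M" unfolding \<eta>_def by (rule interleave_l2_sequences[OF 1(1) 2(1)])
      have "S \<in> W1 \<inter> W2" if S: "S \<in> bounded_ops M" and close: "?close \<eta> (min \<epsilon>1 \<epsilon>2) S" for S
      proof -
        have eq: "(\<Sum>n<2 * N. (L2_norm M (L2_diff M (S (\<eta> n)) (T (\<eta> n))))\<^sup>2)
          = (\<Sum>n<N. (L2_norm M (L2_diff M (S (\<eta>1 n)) (T (\<eta>1 n))))\<^sup>2)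
            + (\<Sum>n<N. (L2_norm M (L2_diff M (S (\<eta>2 n)) (T (\<eta>2 n))))\<^sup>2)" for N
          by (induction N) (simp_all add: \<eta>_def)
        have nonneg: "0 \<le> (\<Sum>n<N. (L2_norm M (L2_diff M (S (\<zeta> n)) (T (\<zeta> n))))\<^sup>2)" for N \<zeta>
          by (rule sum_nonneg) simp
        have "?close \<eta>1 \<epsilon>1 S" "?close \<eta>2 \<epsilon>2 S"
        proof safe
          fix N
          show "(\<Sum>n<N. (L2_norm M (L2_diff M (S (\<eta>1 n)) (T (\<eta>1 n))))\<^sup>2) \<le> \<epsilon>1"
            using close[rule_format, of "2 * N"] nonneg[of \<eta>2 N] unfolding eq by linarith
          show "(\<Sum>n<N. (L2_norm M (L2_diff M (S (\<eta>2 n)) (T (\<eta>2 n))))\<^sup>2) \<le> \<epsilon>2"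
            using close[rule_format, of "2 * N"] nonneg[of \<eta>1 N] unfolding eq by linarith
        qed
        then show ?thesis using bspec[OF \<epsilon>1(2) S] bspec[OF \<epsilon>2(2) S] by simp
      qed
      then show "nbhd (W1 \<inter> W2)"
        unfolding nbhd_def using \<eta> \<epsilon>1(1) \<epsilon>2(1) by (intro bexI[of _ \<eta>] exI[of _ "min \<epsilon>1 \<epsilon>2"]) simp_all
    qed
  next
    case (UN K)
    show ?case
    proof
      assume "T \<in> \<Union>K"
      then obtain W where "W \<in> K" "nbhd W" using UN.IH by auto
      then obtain \<eta> \<epsilon> where "\<eta> \<in> l2_sequences M" "\<epsilon> > 0" "\<forall>S\<in>bounded_ops M. ?close \<eta> \<epsilon> S \<longrightarrow> S \<in> W"
        unfolding nbhd_def by (elim bexE exE conjE)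
      then show "nbhd (\<Union>K)"
        unfolding nbhd_def using \<open>W \<in> K\<close> by (intro bexI[of _ \<eta>] exI[of _ \<epsilon>] conjI ballI impI UnionI[of W]) simp_all
    qed
  next
    case (Basis W)
    then obtain \<xi> \<eta> U where W: "W = {T \<in> bounded_ops M. (\<Sum>n. L2_inner M (\<xi> n) (T (\<eta> n))) \<in> U}"
      and \<xi>: "\<xi> \<in> l2_sequences M" and \<eta>: "\<eta> \<in> l2_sequences M" and U: "open U" by auto
    show ?case
    proof
      assume "T \<in> W"
      then obtain r where r: "r > 0" "ball (\<Sum>n. L2_inner M (\<xi> n) (T (\<eta> n))) r \<subseteq> U"
        using U W open_contains_ball by blast
      define K where "K = (\<Sum>n. (L2_norm M (\<xi> n))\<^sup>2)"
      have sum_\<xi>: "summable (\<lambda>n. (L2_norm M (\<xi> n))\<^sup>2)" using \<xi> by (simp add: l2_sequences_def)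
      have K: "0 \<le> K" unfolding K_def by (rule suminf_nonneg[OF sum_\<xi>]) simp
      \<comment> \<open>Chosen for the Cauchy-Schwarz estimate: \<open>K * \<epsilon> \<le> (r / 2)\<^sup>2\<close>.\<close>
      define \<epsilon> where "\<epsilon> = (r / 2)\<^sup>2 / (K + 1)"
      have \<epsilon>: "\<epsilon> > 0" using r(1) K by (simp add: \<epsilon>_def)
      have K\<epsilon>: "K * \<epsilon> \<le> (r / 2)\<^sup>2"
      proof -
        have "K * \<epsilon> \<le> (K + 1) * \<epsilon>" using \<epsilon> by simp
        then show ?thesis using K by (simp add: \<epsilon>_def)
      qed
      have \<xi>_in: "\<xi> n \<in> L2_space M" and \<eta>_in: "\<eta> n \<in> L2_space M" for n
        using \<xi> \<eta> by (simp_all add: l2_sequences_def)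
      have "S \<in> W" if S: "S \<in> bounded_ops M" and close: "?close \<eta> \<epsilon> S" for S
      proof -
        let ?D = "\<lambda>n. L2_diff M (S (\<eta> n)) (T (\<eta> n))"
        have S\<eta>: "S (\<eta> n) \<in> L2_space M" and T\<eta>: "T (\<eta> n) \<in> L2_space M" for n
          by (rule bounded_ops_in[OF S \<eta>_in], rule bounded_ops_in[OF assms(3) \<eta>_in])
        have D: "?D n \<in> L2_space M" for n by (simp add: S\<eta> T\<eta>)
        have sS: "summable (\<lambda>n. L2_inner M (\<xi> n) (S (\<eta> n)))" and sT: "summable (\<lambda>n. L2_inner M (\<xi> n) (T (\<eta> n)))"
          by (rule l2_sequences_inner_summable[OF \<xi> l2_sequences_bounded_op[OF \<eta> S]],
              rule l2_sequences_inner_summable[OF \<xi> l2_sequences_bounded_op[OF \<eta> assms(3)]])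
        have "(\<lambda>n. L2_inner M (\<xi> n) (?D n)) = (\<lambda>n. L2_inner M (\<xi> n) (S (\<eta> n)) - L2_inner M (\<xi> n) (T (\<eta> n)))"
          by (simp add: L2_inner_diff_right S\<eta> T\<eta> \<xi>_in)
        then have sD: "(\<lambda>n. L2_inner M (\<xi> n) (?D n)) sums
            ((\<Sum>n. L2_inner M (\<xi> n) (S (\<eta> n))) - (\<Sum>n. L2_inner M (\<xi> n) (T (\<eta> n))))"
          using sums_diff[OF summable_sums[OF sS] summable_sums[OF sT]] by simp
        have "norm (\<Sum>n<N. L2_inner M (\<xi> n) (?D n)) \<le> r / 2" for N
        proof (rule power2_le_imp_le)
          have "norm (\<Sum>n<N. L2_inner M (\<xi> n) (?D n)) \<le> (\<Sum>n<N. L2_norm M (\<xi> n) * L2_norm M (?D n))"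
            by (rule sum_norm_le) (rule L2_Cauchy_Schwarz[OF \<xi>_in D])
          then have "(norm (\<Sum>n<N. L2_inner M (\<xi> n) (?D n)))\<^sup>2 \<le> (\<Sum>n<N. L2_norm M (\<xi> n) * L2_norm M (?D n))\<^sup>2"
            by (rule power_mono) simp
          also have "\<dots> \<le> (\<Sum>n<N. (L2_norm M (\<xi> n))\<^sup>2) * (\<Sum>n<N. (L2_norm M (?D n))\<^sup>2)"
            by (rule Cauchy_Schwarz_ineq_sum)
          also have "\<dots> \<le> K * \<epsilon>"
            unfolding K_def using close sum_\<xi> K[unfolded K_def]
            by (intro mult_mono sum_le_suminf sum_nonneg) auto
          also note K\<epsilon>
          finally show "(norm (\<Sum>n<N. L2_inner M (\<xi> n) (?D n)))\<^sup>2 \<le> (r / 2)\<^sup>2" .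
        qed (use r in simp)
        then have "norm ((\<Sum>n. L2_inner M (\<xi> n) (S (\<eta> n))) - (\<Sum>n. L2_inner M (\<xi> n) (T (\<eta> n)))) \<le> r / 2"
          using tendsto_norm[OF sD[unfolded sums_def]] by (intro LIMSEQ_le_const2) auto
        then have "(\<Sum>n. L2_inner M (\<xi> n) (S (\<eta> n))) \<in> ball (\<Sum>n. L2_inner M (\<xi> n) (T (\<eta> n))) r"
          using r(1) by (simp add: dist_norm norm_minus_commute)
        then show ?thesis using r(2) S W by blast
      qed
      then show "nbhd W"
        unfolding nbhd_def using \<eta> \<epsilon> by (intro bexI[of _ \<eta>] exI[of _ \<epsilon>] conjI ballI impI)
    qed
  qed
  then obtain \<eta> \<epsilon> where "\<eta> \<in> l2_sequences M" "\<epsilon> > 0" "\<forall>S\<in>bounded_ops M. ?close \<eta> \<epsilon> S \<longrightarrow> S \<in> W"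
    unfolding nbhd_def using assms(2) by (elim impE bexE exE conjE)
  then show thesis by (intro that[of \<eta> \<epsilon>]) simp_all
qed

definition star_subalgebra :: "'x measure \<Rightarrow> 'x l2_op set \<Rightarrow> bool" where
  "star_subalgebra M A \<longleftrightarrow> A \<subseteq> bounded_ops M \<and> op_id M \<in> A \<and>
     (\<forall>S\<in>A. \<forall>T\<in>A. op_add M S T \<in> A \<and> op_mult M S T \<in> A) \<and>
     (\<forall>z. \<forall>T\<in>A. op_scale M z T \<in> A) \<and> (\<forall>T\<in>A. op_adjoint M T \<in> A)"

lemma nat_fibration:
  assumes "sigma_finite_measure M"
  shows "measure_fibration M (count_space UNIV \<Otimes>\<^sub>M M) (UNIV :: nat set) fst Pair snd (\<lambda>_. 1)"
proof
  interpret sigma_finite_measure M by fact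
  fix k :: nat and A assume A: "A \<in> sets (count_space UNIV \<Otimes>\<^sub>M M)" and k: "\<And>y. y \<in> A \<Longrightarrow> fst y = k"
  have "emeasure (count_space UNIV \<Otimes>\<^sub>M M) A = (\<integral>\<^sup>+x. emeasure M (Pair x -` A) \<partial>count_space UNIV)"
    by (rule emeasure_pair_measure_alt[OF A])
  also have "\<dots> = (\<integral>\<^sup>+x. emeasure M (Pair k -` A) * indicator {k} x \<partial>count_space UNIV)"
  proof (rule nn_integral_cong)
    fix x :: nat
    show "emeasure M (Pair x -` A) = emeasure M (Pair k -` A) * indicator {k} x"
    proof (cases "x = k")
      case False
      then have "Pair x -` A = {}" using k by fastforce
      then show ?thesis using False by simp
    qed simp
  qed
  also have "\<dots> = emeasure M (Pair k -` A)" by (simp add: nn_integral_cmult)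
  also have "Pair k -` A = Pair k -` A \<inter> space M"
    using sets.sets_into_space[OF A] by (auto simp: space_pair_measure)
  finally show "emeasure (count_space UNIV \<Otimes>\<^sub>M M) A = ennreal 1 * emeasure M (Pair k -` A \<inter> space M)" by simp
qed (auto simp: space_pair_measure)

text \<open>
  This is von Neumann's density argument. The sequence \<open>\<eta>\<close> is a single vector \<open>H\<close> of the amplified
  Hilbert space; the projection onto the closure of \<open>A H\<close> commutes with the amplification of \<open>A\<close>,
  hence with that of \<open>T\<close>, so that \<open>T H\<close> lies in the closure of \<open>A H\<close>.
\<close>

lemma bicommutant_approximation:
  assumes sf: "sigma_finite_measure M" and A: "star_subalgebra M A"
    and T: "T \<in> commutant M (commutant M A)" and \<eta>: "\<eta> \<in> l2_sequences M" and \<epsilon>: "\<epsilon> > 0"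
  obtains S where "S \<in> A" "\<And>N. (\<Sum>n<N. (L2_norm M (L2_diff M (S (\<eta> n)) (T (\<eta> n))))\<^sup>2) \<le> \<epsilon>"
proof -
  define M' where "M' = (count_space (UNIV :: nat set) \<Otimes>\<^sub>M M)"
  interpret measure_fibration M M' "UNIV :: nat set" fst Pair snd "\<lambda>_. 1"
    unfolding M'_def by (rule nat_fibration[OF sf])
  have A_in: "S \<in> bounded_ops M" if "S \<in> A" for S using A that by (auto simp: star_subalgebra_def)
  have T_in: "T \<in> bounded_ops M" using T commutant_subset by blast
  have \<eta>_in: "\<eta> n \<in> L2_space M" for n using \<eta> by (simp add: l2_sequences_def)
  define h where "h y = L2_rep (\<eta> (fst y)) (snd y)" for y
  have h_meas [measurable]: "h \<in> borel_measurable M'"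
    unfolding h_def by (rule fibrewise_measurable[of "\<lambda>n. L2_rep (\<eta> n)"]) (rule L2_space_measurable[OF \<eta>_in])
  have "(\<integral>\<^sup>+y. ennreal ((cmod (h y))\<^sup>2) \<partial>M') = (\<integral>\<^sup>+n. ennreal ((L2_norm M (\<eta> n))\<^sup>2) \<partial>count_space UNIV)"
    by (subst nn_integral_fibres, measurable) (simp add: h_def L2_norm_sq_nn[OF \<eta>_in])
  also have "\<dots> = (\<Sum>n. ennreal ((L2_norm M (\<eta> n))\<^sup>2))" by (rule nn_integral_count_space_nat)
  also have "\<dots> = ennreal (\<Sum>n. (L2_norm M (\<eta> n))\<^sup>2)"
    using \<eta> by (intro suminf_ennreal2) (simp_all add: l2_sequences_def)
  also have "\<dots> < \<infinity>" by simp
  finally have h_in: "h \<in> L2_fun M'" using h_meas by (simp add: L2_fun_iff)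
  define H where "H = L2_class M' h"
  have H: "H \<in> L2_space M'" unfolding H_def by (rule L2_class_in[OF h_in])
  have slice_H: "slice n H = \<eta> n" for n
  proof (rule L2_space_eqI[OF slice_in[OF UNIV_I H] \<eta>_in])
    have "AE w in M. L2_rep H (n, w) = h (n, w)"
      unfolding H_def using AE_fibre[OF UNIV_I L2_rep_class[OF h_in], of n] .
    then show "AE w in M. L2_rep (slice n H) w = L2_rep (\<eta> n) w"
      using L2_rep_class[OF slice_fun[OF UNIV_I H], of n, folded slice_def]
      by eventually_elim (simp add: h_def)
  qed
  define V where "V = {F \<in> L2_space M'. \<forall>\<delta>>0. \<exists>S\<in>A. L2_norm M' (L2_diff M' F (amp S H)) < \<delta>}"
  have V_in: "F \<in> L2_space M'" if "F \<in> V" for F using that by (simp add: V_def)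
  have V_D: "\<exists>S\<in>A. L2_norm M' (L2_diff M' F (amp S H)) < \<delta>" if "F \<in> V" "\<delta> > 0" for F \<delta>
    using that by (simp add: V_def)
  have AH: "amp S H \<in> L2_space M'" if "S \<in> A" for S by (rule amp_mem[OF A_in[OF that] H])
  have AH_V: "amp S H \<in> V" if "S \<in> A" for S
  proof -
    have "L2_norm M' (L2_diff M' (amp S H) (amp S H)) = 0"
      using L2_norm_diff_sq[OF AH[OF that] AH[OF that]] by (simp add: L2_inner_self del: of_real_power)
    then show ?thesis using that AH[OF that] unfolding V_def by force
  qed
  have V: "L2_closed_subspace M' V"
    unfolding L2_closed_subspace_def
  proof (intro conjI ballI allI impI)
    show "V \<subseteq> L2_space M'" by (auto simp: V_def)
    have "op_scale M 0 (op_id M) \<in> A" using A by (simp add: star_subalgebra_def)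
    moreover have "amp (op_scale M 0 (op_id M)) H = L2_zero M'"
    proof (rule slices_ext[OF _ L2_zero_in])
      fix n
      have "slice n (amp (op_scale M 0 (op_id M)) H) = L2_scale M 0 (\<eta> n)"
        using slice_amp[OF op_scale_in[OF op_id_in] H UNIV_I, of n 0] by (simp add: slice_H \<eta>_in)
      moreover have "slice n (L2_scale M' 0 H) = L2_scale M 0 (\<eta> n)"
        using slice_scale[OF UNIV_I H] by (simp add: slice_H)
      moreover have "L2_scale M' 0 H = L2_zero M'"
        by (rule L2_ext_inner[of _ M']) (simp_all add: H L2_inner_simps)
      ultimately show "slice n (amp (op_scale M 0 (op_id M)) H) = slice n (L2_zero M')" by simp
    qed (rule amp_mem[OF op_scale_in[OF op_id_in] H])
    ultimately show "L2_zero M' \<in> V" using AH_V[of "op_scale M 0 (op_id M)"] by simp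
  next
    fix F G assume F: "F \<in> V" and G: "G \<in> V"
    note FG = V_in[OF F] V_in[OF G]
    have "\<exists>S\<in>A. L2_norm M' (L2_diff M' (L2_add M' F G) (amp S H)) < \<delta>" if \<delta>: "\<delta> > 0" for \<delta>
    proof -
      obtain S where S: "S \<in> A" "L2_norm M' (L2_diff M' F (amp S H)) < \<delta> / 2"
        using V_D[OF F half_gt_zero[OF \<delta>]] by (elim bexE)
      obtain R where R: "R \<in> A" "L2_norm M' (L2_diff M' G (amp R H)) < \<delta> / 2"
        using V_D[OF G half_gt_zero[OF \<delta>]] by (elim bexE)
      have SR: "op_add M S R \<in> A" using A S R by (simp add: star_subalgebra_def)
      have "amp (op_add M S R) H = L2_add M' (amp S H) (amp R H)"
      proof (rule slices_ext[OF AH[OF SR] L2_add_in[OF AH[OF S(1)] AH[OF R(1)]]])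
        fix n
        show "slice n (amp (op_add M S R) H) = slice n (L2_add M' (amp S H) (amp R H))"
          using slice_amp[OF A_in[OF SR] H UNIV_I, of n] slice_amp[OF A_in[OF S(1)] H UNIV_I, of n]
            slice_amp[OF A_in[OF R(1)] H UNIV_I, of n] slice_add[OF UNIV_I AH[OF S(1)] AH[OF R(1)], of n]
          by (simp add: slice_H op_add_def \<eta>_in)
      qed
      moreover have "L2_diff M' (L2_add M' F G) (L2_add M' (amp S H) (amp R H))
          = L2_add M' (L2_diff M' F (amp S H)) (L2_diff M' G (amp R H))"
        by (rule L2_ext_inner[of _ M']) (simp_all add: FG AH S R L2_inner_simps)
      moreover have "L2_norm M' (L2_add M' (L2_diff M' F (amp S H)) (L2_diff M' G (amp R H)))
          \<le> L2_norm M' (L2_diff M' F (amp S H)) + L2_norm M' (L2_diff M' G (amp R H))"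
        by (rule L2_norm_triangle) (simp_all add: FG AH S R)
      ultimately show ?thesis using S(2) R(2) SR by (intro bexI[of _ "op_add M S R"]) auto
    qed
    then show "L2_add M' F G \<in> V" using FG by (simp add: V_def)
  next
    fix F a assume F: "F \<in> V"
    note F' = V_in[OF F]
    have "\<exists>S\<in>A. L2_norm M' (L2_diff M' (L2_scale M' a F) (amp S H)) < \<delta>" if \<delta>: "\<delta> > 0" for \<delta>
    proof -
      have "\<delta> / (cmod a + 1) > 0" using \<delta> by (simp add: add_nonneg_pos)
      from V_D[OF F this] obtain S where S: "S \<in> A" "L2_norm M' (L2_diff M' F (amp S H)) < \<delta> / (cmod a + 1)"
        by (elim bexE)
      have aS: "op_scale M a S \<in> A" using A S by (simp add: star_subalgebra_def)
      have "amp (op_scale M a S) H = L2_scale M' a (amp S H)"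
      proof (rule slices_ext[OF AH[OF aS] L2_scale_in[OF AH[OF S(1)]]])
        fix n
        show "slice n (amp (op_scale M a S) H) = slice n (L2_scale M' a (amp S H))"
          using slice_amp[OF A_in[OF aS] H UNIV_I, of n] slice_amp[OF A_in[OF S(1)] H UNIV_I, of n]
            slice_scale[OF UNIV_I AH[OF S(1)], of n]
          by (simp add: slice_H op_scale_def \<eta>_in)
      qed
      moreover have "L2_diff M' (L2_scale M' a F) (L2_scale M' a (amp S H)) = L2_scale M' a (L2_diff M' F (amp S H))"
        by (rule L2_ext_inner[of _ M']) (simp_all add: F' AH S L2_inner_simps right_diff_distrib)
      moreover have "L2_norm M' (L2_scale M' a (L2_diff M' F (amp S H))) = cmod a * L2_norm M' (L2_diff M' F (amp S H))"
        by (rule L2_norm_scale) (simp add: F' AH S)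
      moreover have "cmod a * L2_norm M' (L2_diff M' F (amp S H)) < \<delta>"
      proof -
        have "(cmod a + 1) * L2_norm M' (L2_diff M' F (amp S H)) < \<delta>"
          using S(2) by (simp add: pos_less_divide_eq add_nonneg_pos mult.commute)
        moreover have "cmod a * L2_norm M' (L2_diff M' F (amp S H)) \<le> (cmod a + 1) * L2_norm M' (L2_diff M' F (amp S H))"
          by (rule mult_right_mono) auto
        ultimately show ?thesis by linarith
      qed
      ultimately show ?thesis using aS by (intro bexI[of _ "op_scale M a S"]) auto
    qed
    then show "L2_scale M' a F \<in> V" using F' by (simp add: V_def)
  next
    fix X and Y assume X: "\<forall>n. X n \<in> V" and Y: "Y \<in> L2_space M'"
      and lim: "(\<lambda>n. L2_norm M' (L2_diff M' (X n) Y)) \<longlonglongrightarrow> 0"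
    have "\<exists>S\<in>A. L2_norm M' (L2_diff M' Y (amp S H)) < \<delta>" if \<delta>: "\<delta> > 0" for \<delta>
    proof -
      obtain n where n: "L2_norm M' (L2_diff M' (X n) Y) < \<delta> / 2"
        using LIMSEQ_D[OF lim, of "\<delta> / 2"] \<delta> by auto
      have Xn: "X n \<in> V" using X by simp
      obtain S where S: "S \<in> A" "L2_norm M' (L2_diff M' (X n) (amp S H)) < \<delta> / 2"
        using V_D[OF Xn half_gt_zero[OF \<delta>]] by (elim bexE)
      have "L2_norm M' (L2_diff M' Y (amp S H))
          \<le> L2_norm M' (L2_diff M' Y (X n)) + L2_norm M' (L2_diff M' (X n) (amp S H))"
        by (rule L2_norm_diff_triangle[OF Y V_in[OF Xn] AH[OF S(1)]])
      also have "L2_norm M' (L2_diff M' Y (X n)) = L2_norm M' (L2_diff M' (X n) Y)"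
        by (rule L2_norm_diff_commute[OF Y V_in[OF Xn]])
      finally show ?thesis using n S by (intro bexI[of _ S]) auto
    qed
    then show "Y \<in> V" using Y by (simp add: V_def)
  qed
  have invariant: "amp R F \<in> V" if R: "R \<in> A" and F: "F \<in> V" for R F
  proof -
    note F' = V_in[OF F] and AR = amp_in[OF A_in[OF R]]
    obtain C where C: "C \<ge> 0" "\<And>F. F \<in> L2_space M' \<Longrightarrow> L2_norm M' (amp R F) \<le> C * L2_norm M' F"
      using bounded_ops_bound[OF AR] by blast
    have "\<exists>S\<in>A. L2_norm M' (L2_diff M' (amp R F) (amp S H)) < \<delta>" if \<delta>: "\<delta> > 0" for \<delta>
    proof -
      have "\<delta> / (C + 1) > 0" using \<delta> C(1) by simp
      from V_D[OF F this] obtain S where S: "S \<in> A" "L2_norm M' (L2_diff M' F (amp S H)) < \<delta> / (C + 1)"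
        by (elim bexE)
      have RS: "op_mult M R S \<in> A" using A R S by (simp add: star_subalgebra_def)
      have "amp (op_mult M R S) H = amp R (amp S H)"
      proof (rule slices_ext[OF AH[OF RS] bounded_ops_in[OF AR AH[OF S(1)]]])
        fix n
        show "slice n (amp (op_mult M R S) H) = slice n (amp R (amp S H))"
          using slice_amp[OF A_in[OF RS] H UNIV_I, of n] slice_amp[OF A_in[OF S(1)] H UNIV_I, of n]
            slice_amp[OF A_in[OF R] AH[OF S(1)] UNIV_I, of n]
          by (simp add: slice_H \<eta>_in)
      qed
      then have "L2_diff M' (amp R F) (amp (op_mult M R S) H) = amp R (L2_diff M' F (amp S H))"
        by (simp add: bounded_ops_diff[OF AR F' AH[OF S(1)]])
      moreover have "L2_norm M' (amp R (L2_diff M' F (amp S H))) \<le> C * L2_norm M' (L2_diff M' F (amp S H))"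
        by (rule C(2)) (simp add: F' AH S)
      moreover have "C * L2_norm M' (L2_diff M' F (amp S H)) < \<delta>"
      proof -
        have "(C + 1) * L2_norm M' (L2_diff M' F (amp S H)) < \<delta>"
          using S(2) C(1) by (simp add: pos_less_divide_eq mult.commute)
        moreover have "C * L2_norm M' (L2_diff M' F (amp S H)) \<le> (C + 1) * L2_norm M' (L2_diff M' F (amp S H))"
          by (rule mult_right_mono) auto
        ultimately show ?thesis by linarith
      qed
      ultimately show ?thesis using RS by (intro bexI[of _ "op_mult M R S"]) auto
    qed
    then show ?thesis using bounded_ops_in[OF AR F'] by (simp add: V_def)
  qed
  obtain P where P: "P \<in> bounded_ops M'" "\<And>F. F \<in> L2_space M' \<Longrightarrow> P F \<in> V" "\<And>F. F \<in> V \<Longrightarrow> P F = F"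
    "\<And>S F. \<lbrakk>S \<in> bounded_ops M'; \<And>Y. Y \<in> V \<Longrightarrow> S Y \<in> V; \<And>Y. Y \<in> V \<Longrightarrow> op_adjoint M' S Y \<in> V;
       F \<in> L2_space M'\<rbrakk> \<Longrightarrow> P (S F) = S (P F)"
    using L2_projection[OF V] by blast
  have "P (amp T H) = amp T (P H)"
  proof (rule amp_bicommutant_commute[OF _ T P(1) _ H])
    show "A \<subseteq> bounded_ops M" using A by (simp add: star_subalgebra_def)
    fix S F assume S: "S \<in> A" and F: "F \<in> L2_space M'"
    have S': "op_adjoint M S \<in> A" using A S by (simp add: star_subalgebra_def)
    show "P (amp S F) = amp S (P F)"
      by (rule P(4)[OF amp_in[OF A_in[OF S]] _ _ F])
        (simp_all add: invariant[OF S] op_adjoint_amp[OF A_in[OF S]] invariant[OF S'])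
  qed
  moreover have "H \<in> V"
  proof -
    have id: "op_id M \<in> A" using A by (simp add: star_subalgebra_def)
    have "amp (op_id M) H = H"
    proof (rule slices_ext[OF AH[OF id] H])
      fix n show "slice n (amp (op_id M) H) = slice n H"
        using slice_amp[OF op_id_in H UNIV_I, of n] by (simp add: slice_H op_id_def \<eta>_in)
    qed
    then show ?thesis using AH_V[OF id] by simp
  qed
  ultimately have "amp T H \<in> V" using P(2)[OF amp_mem[OF T_in H]] P(3)[of H] by simp
  from V_D[OF this real_sqrt_gt_zero[OF \<epsilon>]] obtain S
    where S: "S \<in> A" "L2_norm M' (L2_diff M' (amp T H) (amp S H)) < sqrt \<epsilon>"
    by (elim bexE)
  show thesis
  proof (rule that[OF S(1)])
    fix N
    define D where "D = L2_diff M' (amp T H) (amp S H)"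
    have D: "D \<in> L2_space M'" unfolding D_def by (simp add: AH[OF S(1)] amp_mem[OF T_in H])
    have sl: "L2_norm M (slice n D) = L2_norm M (L2_diff M (S (\<eta> n)) (T (\<eta> n)))" for n
      using slice_diff[OF UNIV_I amp_mem[OF T_in H] AH[OF S(1)], of n] slice_amp[OF T_in H UNIV_I, of n]
        slice_amp[OF A_in[OF S(1)] H UNIV_I, of n]
        L2_norm_diff_commute[OF bounded_ops_in[OF T_in \<eta>_in] bounded_ops_in[OF A_in[OF S(1)] \<eta>_in], of n n]
      by (simp add: D_def slice_H)
    have "ennreal (\<Sum>n<N. (L2_norm M (slice n D))\<^sup>2) = (\<Sum>n<N. ennreal ((L2_norm M (slice n D))\<^sup>2))"
      by (rule sum_ennreal[symmetric]) simp
    also have "\<dots> \<le> (\<Sum>n. ennreal ((L2_norm M (slice n D))\<^sup>2))" by (rule sum_le_suminf) auto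
    also have "\<dots> = ennreal ((L2_norm M' D)\<^sup>2)"
      unfolding norm_slices[OF D] nn_integral_count_space_nat by simp
    also have "\<dots> \<le> ennreal \<epsilon>"
    proof (rule ennreal_leI)
      have "(L2_norm M' D)\<^sup>2 \<le> (sqrt \<epsilon>)\<^sup>2" using S(2) by (intro power_mono) (auto simp: D_def)
      then show "(L2_norm M' D)\<^sup>2 \<le> \<epsilon>" using \<epsilon> by simp
    qed
    finally show "(\<Sum>n<N. (L2_norm M (L2_diff M (S (\<eta> n)) (T (\<eta> n))))\<^sup>2) \<le> \<epsilon>"
      using \<epsilon> by (simp add: sl)
  qed
qed

lemma commutant_star_subalgebra:
  assumes A: "A \<subseteq> bounded_ops M" "\<And>S. S \<in> A \<Longrightarrow> op_adjoint M S \<in> A"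
  shows "star_subalgebra M (commutant M A)"
proof -
  have in_b: "T \<in> bounded_ops M" if "T \<in> commutant M A" for T using that commutant_subset by blast
  have A_b: "R \<in> bounded_ops M" if "R \<in> A" for R using that A by blast
  have id: "op_id M \<in> commutant M A"
    by (rule commutantI[OF op_id_in A(1)]) (simp add: op_id_def bounded_ops_in[OF A_b])
  have add: "op_add M S T \<in> commutant M A" if S: "S \<in> commutant M A" and T: "T \<in> commutant M A" for S T
  proof (rule commutantI[OF op_add_in[OF in_b[OF S] in_b[OF T]] A(1)])
    fix R X assume R: "R \<in> A" and X: "X \<in> L2_space M"
    show "op_add M S T (R X) = R (op_add M S T X)"
      using commutantD[OF S R X] commutantD[OF T R X] X
      by (simp add: op_add_def bounded_ops_in[OF A_b[OF R]]
          bounded_ops_add[OF A_b[OF R] bounded_ops_in[OF in_b[OF S]] bounded_ops_in[OF in_b[OF T]]])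
  qed
  have mult: "op_mult M S T \<in> commutant M A" if S: "S \<in> commutant M A" and T: "T \<in> commutant M A" for S T
  proof (rule commutantI[OF op_mult_in[OF in_b[OF S] in_b[OF T]] A(1)])
    fix R X assume R: "R \<in> A" and X: "X \<in> L2_space M"
    show "op_mult M S T (R X) = R (op_mult M S T X)"
      using commutantD[OF S R bounded_ops_in[OF in_b[OF T] X]] commutantD[OF T R X] X
      by (simp add: bounded_ops_in[OF A_b[OF R]])
  qed
  have scale: "op_scale M z T \<in> commutant M A" if T: "T \<in> commutant M A" for z T
  proof (rule commutantI[OF op_scale_in[OF in_b[OF T]] A(1)])
    fix R X assume R: "R \<in> A" and X: "X \<in> L2_space M"
    show "op_scale M z T (R X) = R (op_scale M z T X)"
      using commutantD[OF T R X] X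
      by (simp add: op_scale_def bounded_ops_in[OF A_b[OF R]]
          bounded_ops_scale[OF A_b[OF R] bounded_ops_in[OF in_b[OF T]]])
  qed
  show ?thesis
    unfolding star_subalgebra_def
    using commutant_subset[of M A] id add mult scale commutant_adjoint[OF A] by simp
qed

lemma ultraweak_basis:
  assumes "\<xi> \<in> l2_sequences M" "\<eta> \<in> l2_sequences M" "open U"
  shows "openin (ultraweak_topology M) {T \<in> bounded_ops M. (\<Sum>n. L2_inner M (\<xi> n) (T (\<eta> n))) \<in> U}"
  unfolding ultraweak_topology_def by (rule topology_generated_by_Basis) (use assms in blast)

lemma topspace_ultraweak: "topspace (ultraweak_topology M) = bounded_ops M"
proof
  show "topspace (ultraweak_topology M) \<subseteq> bounded_ops M"
    unfolding ultraweak_topology_def topology_generated_by_topspace by auto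
  have "(\<lambda>_. L2_zero M) \<in> l2_sequences M" by (simp add: l2_sequences_def)
  from openin_subset[OF ultraweak_basis[OF this this open_UNIV]]
  show "bounded_ops M \<subseteq> topspace (ultraweak_topology M)" by simp
qed

text \<open>
  The set on which the two automorphisms agree is a *-algebra with the same bicommutant as \<open>L\<close>,
  so every element of the von Neumann algebra is an ultraweak limit of points of agreement.
\<close>

lemma vn_automorphism_eqI:
  assumes sf: "sigma_finite_measure M"
    and L: "L \<subseteq> bounded_ops M" "\<And>S. S \<in> L \<Longrightarrow> op_adjoint M S \<in> L" "op_id M \<in> L"
    and N: "N = commutant M (commutant M L)"
    and a: "a \<in> vn_automorphisms M N" "ultraweakly_continuous M N a"
    and b: "b \<in> vn_automorphisms M N" "ultraweakly_continuous M N b"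
    and agree: "\<And>S. S \<in> L \<Longrightarrow> a S = b S"
  shows "a = b"
proof -
  have N_b: "N \<subseteq> bounded_ops M" unfolding N by (rule commutant_subset)
  have L_N: "L \<subseteq> N" unfolding N by (rule subset_bicommutant[OF L(1)])
  have N_star: "star_subalgebra M N"
    unfolding N by (rule commutant_star_subalgebra[OF commutant_subset commutant_adjoint[OF L(1,2)]])
  have aN: "a T \<in> N" and bN: "b T \<in> N" if "T \<in> N" for T
    using a(1) b(1) that by (auto simp: vn_automorphisms_def bij_betw_def)
  define A where "A = {T \<in> N. a T = b T}"
  have A_star: "star_subalgebra M A"
    using N_star a(1) b(1) agree[OF L(3)] unfolding star_subalgebra_def A_def vn_automorphisms_def by auto
  have L_A: "L \<subseteq> A" using L_N agree by (auto simp: A_def)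
  have "commutant M A = commutant M L"
  proof
    show "commutant M A \<subseteq> commutant M L" by (rule commutant_antimono[OF L_A])
    have "commutant M N \<subseteq> commutant M A" by (rule commutant_antimono) (auto simp: A_def)
    then show "commutant M L \<subseteq> commutant M A" unfolding N triple_commutant[OF L(1)] .
  qed
  then have N_A: "N = commutant M (commutant M A)" by (simp add: N)
  have "a T = b T" if T: "T \<in> N" for T
  proof (rule bounded_ops_ext)
    fix Y assume Y: "Y \<in> L2_space M"
    have bd: "a S \<in> bounded_ops M" "b S \<in> bounded_ops M" if "S \<in> N" for S using aN bN that N_b by auto
    show "a T Y = b T Y"
    proof (rule L2_ext_inner[OF bounded_ops_in[OF bd(1)[OF T] Y] bounded_ops_in[OF bd(2)[OF T] Y]], rule ccontr)
      fix X assume X: "X \<in> L2_space M" and ne: "L2_inner M X (a T Y) \<noteq> L2_inner M X (b T Y)"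
      obtain U W where UW: "open U" "open W" "L2_inner M X (a T Y) \<in> U" "L2_inner M X (b T Y) \<in> W" "U \<inter> W = {}"
        using hausdorff[OF ne] by blast
      define \<xi> where "\<xi> n = (if n = 0 then X else L2_zero M)" for n :: nat
      define \<eta> where "\<eta> n = (if n = 0 then Y else L2_zero M)" for n :: nat
      have seq: "\<xi> \<in> l2_sequences M" "\<eta> \<in> l2_sequences M"
        using X Y by (auto simp: l2_sequences_def \<xi>_def \<eta>_def intro!: summable_finite[of "{0}"] split: if_splits)
      have single: "(\<Sum>n. L2_inner M (\<xi> n) (S (\<eta> n))) = L2_inner M X (S Y)" if S: "S \<in> bounded_ops M" for S
      proof -
        have "L2_inner M (\<xi> n) (S (\<eta> n)) = 0" if "n \<noteq> 0" for n
          using that bounded_ops_in[OF S L2_zero_in] by (simp add: \<xi>_def \<eta>_def L2_inner_zero_left)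
        then show ?thesis
          using suminf_finite[of "{0}" "\<lambda>n. L2_inner M (\<xi> n) (S (\<eta> n))"] by (simp add: \<xi>_def \<eta>_def)
      qed
      have opn: "openin (subtopology (ultraweak_topology M) N) {S \<in> N. L2_inner M X (f S Y) \<in> Z}"
        if f: "ultraweakly_continuous M N f" "\<And>S. S \<in> N \<Longrightarrow> f S \<in> N" and Z: "open Z" for f Z
      proof -
        let ?O = "{T \<in> bounded_ops M. (\<Sum>n. L2_inner M (\<xi> n) (T (\<eta> n))) \<in> Z}"
        have "openin (subtopology (ultraweak_topology M) N) (?O \<inter> N)"
          by (rule openin_subtopology_Int[OF ultraweak_basis[OF seq Z]])
        from openin_continuous_map_preimage[OF f(1)[unfolded ultraweakly_continuous_def] this]
        have "openin (subtopology (ultraweak_topology M) N)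
            {S \<in> topspace (subtopology (ultraweak_topology M) N). f S \<in> ?O \<inter> N}" .
        also have "{S \<in> topspace (subtopology (ultraweak_topology M) N). f S \<in> ?O \<inter> N}
            = {S \<in> N. L2_inner M X (f S Y) \<in> Z}"
        proof -
          have "f S \<in> ?O \<inter> N \<longleftrightarrow> L2_inner M X (f S Y) \<in> Z" if "S \<in> N" for S
            using f(2)[OF that] N_b by (auto simp: single)
          then show ?thesis using N_b by (auto simp: topspace_ultraweak)
        qed
        finally show ?thesis .
      qed
      have "openin (subtopology (ultraweak_topology M) N)
          ({S \<in> N. L2_inner M X (a S Y) \<in> U} \<inter> {S \<in> N. L2_inner M X (b S Y) \<in> W})"
        by (intro openin_Int opn a b aN bN UW)
      then obtain W' where W': "openin (ultraweak_topology M) W'"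
        "{S \<in> N. L2_inner M X (a S Y) \<in> U} \<inter> {S \<in> N. L2_inner M X (b S Y) \<in> W} = W' \<inter> N"
        by (auto simp: openin_subtopology)
      have "T \<in> W' \<inter> N" unfolding W'(2)[symmetric] using T UW by simp
      then obtain \<zeta> \<epsilon> where \<zeta>: "\<zeta> \<in> l2_sequences M" "\<epsilon> > 0"
        "\<And>S. S \<in> bounded_ops M \<Longrightarrow> (\<And>N. (\<Sum>n<N. (L2_norm M (L2_diff M (S (\<zeta> n)) (T (\<zeta> n))))\<^sup>2) \<le> \<epsilon>) \<Longrightarrow> S \<in> W'"
        using ultraweak_neighbourhood[OF W'(1), of T] T N_b by blast
      obtain S where S: "S \<in> A" "\<And>N. (\<Sum>n<N. (L2_norm M (L2_diff M (S (\<zeta> n)) (T (\<zeta> n))))\<^sup>2) \<le> \<epsilon>"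
        using bicommutant_approximation[OF sf A_star _ \<zeta>(1,2), of T] T N_A by metis
      have SN: "S \<in> N" "a S = b S" using S(1) by (auto simp: A_def)
      have "S \<in> W' \<inter> N" using \<zeta>(3)[of S] S(2) SN N_b by auto
      then have "L2_inner M X (a S Y) \<in> U" "L2_inner M X (b S Y) \<in> W" unfolding W'(2)[symmetric] by auto
      then show False using SN(2) UW(5) by auto
    qed
  qed (use aN[OF T] bN[OF T] N_b in auto)
  then show ?thesis
    using a(1) b(1) by (intro extensionalityI[of a N b]) (auto simp: vn_automorphisms_def)
qed

section \<open>Automorphisms implemented by similarities\<close>

text \<open>
  Conjugation by \<open>V\<close> maps the commutant of \<open>L\<close> into itself, because conjugation by \<open>U\<close> maps \<open>L\<close> into
  itself.
\<close>

lemma conjugate_bicommutant: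
  assumes U: "U \<in> bounded_ops M" and V: "V \<in> bounded_ops M"
    and UV: "\<And>X. X \<in> L2_space M \<Longrightarrow> U (V X) = X" and VU: "\<And>X. X \<in> L2_space M \<Longrightarrow> V (U X) = X"
    and L: "L \<subseteq> bounded_ops M" "\<And>S. S \<in> L \<Longrightarrow> op_mult M U (op_mult M S V) \<in> L"
    and T: "T \<in> commutant M (commutant M L)"
  shows "op_mult M U (op_mult M T V) \<in> commutant M (commutant M L)"
proof (rule commutantI[OF _ commutant_subset])
  have T_b: "T \<in> bounded_ops M" using T commutant_subset by blast
  show "op_mult M U (op_mult M T V) \<in> bounded_ops M" by (intro op_mult_in U V T_b)
  fix R X assume R: "R \<in> commutant M L" and X: "X \<in> L2_space M"
  have R_b: "R \<in> bounded_ops M" using R commutant_subset by blast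
  have "op_mult M V (op_mult M R U) \<in> commutant M L"
  proof (rule commutantI[OF _ L(1)])
    show "op_mult M V (op_mult M R U) \<in> bounded_ops M" by (intro op_mult_in U V R_b)
    fix S Y assume S: "S \<in> L" and Y: "Y \<in> L2_space M"
    have S_b: "S \<in> bounded_ops M" using S L by blast
    note mem = bounded_ops_in[OF U] bounded_ops_in[OF V] bounded_ops_in[OF S_b] bounded_ops_in[OF R_b]
    have "R (U (S Y)) = R (op_mult M U (op_mult M S V) (U Y))"
      using Y by (simp add: mem VU)
    also have "\<dots> = op_mult M U (op_mult M S V) (R (U Y))"
      by (rule commutantD[OF R L(2)[OF S]]) (simp add: mem Y)
    finally show "op_mult M V (op_mult M R U) (S Y) = S (op_mult M V (op_mult M R U) Y)"
      using Y by (simp add: mem VU)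
  qed
  note comm = commutantD[OF T this, of "V X"]
  note mem = bounded_ops_in[OF U] bounded_ops_in[OF V] bounded_ops_in[OF T_b] bounded_ops_in[OF R_b]
  have "T (V (R X)) = V (R (U (T (V X))))" using comm X by (simp add: mem UV)
  then show "op_mult M U (op_mult M T V) (R X) = R (op_mult M U (op_mult M T V) X)"
    using X by (simp add: mem UV)
qed

text \<open>
  \<open>U\<close> is a multiple of a unitary with inverse \<open>V\<close>, so its adjoint is a multiple of \<open>V\<close>; the
  multiples cancel in the conjugation. It is ultraweakly continuous since it only moves the sequences
  that define the basic open sets.
\<close>

lemma conjugation_automorphism:
  assumes U: "U \<in> bounded_ops M" and V: "V \<in> bounded_ops M"
    and UV: "\<And>X. X \<in> L2_space M \<Longrightarrow> U (V X) = X" and VU: "\<And>X. X \<in> L2_space M \<Longrightarrow> V (U X) = X"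
    and sim: "\<And>X Y. X \<in> L2_space M \<Longrightarrow> Y \<in> L2_space M \<Longrightarrow> L2_inner M (U X) (U Y) = of_real c * L2_inner M X Y"
    and L: "L \<subseteq> bounded_ops M" "\<And>S. S \<in> L \<Longrightarrow> op_mult M U (op_mult M S V) \<in> L"
      "\<And>S. S \<in> L \<Longrightarrow> op_mult M V (op_mult M S U) \<in> L"
      "\<And>S. S \<in> L \<Longrightarrow> op_adjoint M S \<in> L"
    and N: "N = commutant M (commutant M L)"
  defines "a \<equiv> (\<lambda>T\<in>N. op_mult M U (op_mult M T V))"
  shows "a \<in> vn_automorphisms M N" "ultraweakly_continuous M N a"
proof -
  have N_b: "T \<in> bounded_ops M" if "T \<in> N" for T using that commutant_subset unfolding N by blast
  have N_star: "star_subalgebra M N"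
    unfolding N by (rule commutant_star_subalgebra[OF commutant_subset commutant_adjoint[OF L(1,4)]])
  have aN: "a T \<in> N" if "T \<in> N" for T
    using conjugate_bicommutant[OF U V UV VU L(1,2)] that by (simp add: a_def N)
  have inv: "op_mult M V (op_mult M T U) \<in> N" if "T \<in> N" for T
    using conjugate_bicommutant[OF V U VU UV L(1,3)] that by (simp add: N)
  note mem = bounded_ops_in[OF U] bounded_ops_in[OF V] bounded_ops_in[OF N_b]
  have "bij_betw a N N"
  proof (rule bij_betwI[where g = "\<lambda>T. op_mult M V (op_mult M T U)"])
    fix T assume T: "T \<in> N"
    show "op_mult M V (op_mult M (a T) U) = T"
      by (rule bounded_ops_ext[of _ M]) (simp_all add: T a_def op_mult_in U V N_b mem UV VU)
    show "a (op_mult M V (op_mult M T U)) = T"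
      by (rule bounded_ops_ext[of _ M]) (simp_all add: T a_def inv op_mult_in U V N_b mem UV VU)
  qed (use aN inv in auto)
  moreover have "a (op_add M S T) = op_add M (a S) (a T)" if "S \<in> N" "T \<in> N" for S T
  proof (rule bounded_ops_ext[of _ M])
    have ST: "op_add M S T \<in> N" using that N_star by (simp add: star_subalgebra_def)
    then show "a (op_add M S T) \<in> bounded_ops M" by (intro N_b aN)
    show "op_add M (a S) (a T) \<in> bounded_ops M" by (intro op_add_in N_b aN that)
    show "a (op_add M S T) X = op_add M (a S) (a T) X" if "X \<in> L2_space M" for X
      using that \<open>S \<in> N\<close> \<open>T \<in> N\<close> ST by (simp add: a_def op_add_def mem bounded_ops_add[OF U])
  qed
  moreover have "a (op_scale M z T) = op_scale M z (a T)" if "T \<in> N" for z T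
  proof (rule bounded_ops_ext[of _ M])
    have zT: "op_scale M z T \<in> N" using that N_star by (simp add: star_subalgebra_def)
    then show "a (op_scale M z T) \<in> bounded_ops M" by (intro N_b aN)
    show "op_scale M z (a T) \<in> bounded_ops M" by (intro op_scale_in N_b aN that)
    show "a (op_scale M z T) X = op_scale M z (a T) X" if "X \<in> L2_space M" for X
      using that \<open>T \<in> N\<close> zT by (simp add: a_def op_scale_def mem bounded_ops_scale[OF U])
  qed
  moreover have "a (op_mult M S T) = op_mult M (a S) (a T)" if "S \<in> N" "T \<in> N" for S T
  proof (rule bounded_ops_ext[of _ M])
    have ST: "op_mult M S T \<in> N" using that N_star by (simp add: star_subalgebra_def)
    then show "a (op_mult M S T) \<in> bounded_ops M" by (intro N_b aN)
    show "op_mult M (a S) (a T) \<in> bounded_ops M" by (intro op_mult_in N_b aN that)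
    show "a (op_mult M S T) X = op_mult M (a S) (a T) X" if "X \<in> L2_space M" for X
      using that \<open>S \<in> N\<close> \<open>T \<in> N\<close> ST by (simp add: a_def mem VU)
  qed
  moreover have "a (op_adjoint M T) = op_adjoint M (a T)" if T: "T \<in> N" for T
  proof (rule op_adjoint_eqI[symmetric])
    have T': "op_adjoint M T \<in> N" using T N_star by (simp add: star_subalgebra_def)
    show "a T \<in> bounded_ops M" "a (op_adjoint M T) \<in> bounded_ops M" by (intro N_b aN T T')+
    fix X Y assume X: "X \<in> L2_space M" and Y: "Y \<in> L2_space M"
    have "L2_inner M (U (op_adjoint M T (V X))) (U (V Y)) = L2_inner M (U (V X)) (U (T (V Y)))"
      using X Y by (simp only: sim mem T T' op_adjoint_inner[OF N_b[OF T]])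
    then show "L2_inner M (a (op_adjoint M T) X) Y = L2_inner M X (a T Y)"
      using X Y T T' by (simp add: a_def UV)
  qed
  ultimately show "a \<in> vn_automorphisms M N"
    unfolding vn_automorphisms_def by (simp add: a_def)
  have "continuous_map (subtopology (ultraweak_topology M) N) (ultraweak_topology M) a"
    unfolding ultraweak_topology_def
  proof (rule continuous_on_generated_topo)
    show "a ` topspace (subtopology (topology_generated_by {{T \<in> bounded_ops M. (\<Sum>n. L2_inner M (\<xi> n) (T (\<eta> n))) \<in> W} | \<xi> \<eta> W.
          \<xi> \<in> l2_sequences M \<and> \<eta> \<in> l2_sequences M \<and> open W}) N)
        \<subseteq> \<Union> {{T \<in> bounded_ops M. (\<Sum>n. L2_inner M (\<xi> n) (T (\<eta> n))) \<in> W} | \<xi> \<eta> W.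
          \<xi> \<in> l2_sequences M \<and> \<eta> \<in> l2_sequences M \<and> open W}"
      unfolding topology_generated_by_topspace[symmetric] ultraweak_topology_def[symmetric] topspace_subtopology topspace_ultraweak
      using N_b aN by auto
  next
    fix O' assume "O' \<in> {{T \<in> bounded_ops M. (\<Sum>n. L2_inner M (\<xi> n) (T (\<eta> n))) \<in> W} | \<xi> \<eta> W.
          \<xi> \<in> l2_sequences M \<and> \<eta> \<in> l2_sequences M \<and> open W}"
    then obtain \<xi> \<eta> W where O': "O' = {T \<in> bounded_ops M. (\<Sum>n. L2_inner M (\<xi> n) (T (\<eta> n))) \<in> W}"
      and \<xi>: "\<xi> \<in> l2_sequences M" and \<eta>: "\<eta> \<in> l2_sequences M" and W: "open W" by auto
    let ?O = "{T \<in> bounded_ops M. (\<Sum>n. L2_inner M (op_adjoint M U (\<xi> n)) (T (V (\<eta> n)))) \<in> W}"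
    have "openin (subtopology (ultraweak_topology M) N) (?O \<inter> N)"
      by (rule openin_subtopology_Int[OF ultraweak_basis[OF l2_sequences_bounded_op[OF \<xi> op_adjoint_in[OF U]]
            l2_sequences_bounded_op[OF \<eta> V] W]])
    also have "?O \<inter> N = a -` O' \<inter> topspace (subtopology (ultraweak_topology M) N)"
    proof -
      have "L2_inner M (\<xi> n) (a T (\<eta> n)) = L2_inner M (op_adjoint M U (\<xi> n)) (T (V (\<eta> n)))" if T: "T \<in> N" for T n
      proof -
        have "\<xi> n \<in> L2_space M" "\<eta> n \<in> L2_space M" using \<xi> \<eta> by (auto simp: l2_sequences_def)
        then show ?thesis using T by (simp add: a_def op_adjoint_inner[OF U] mem)
      qed
      then show ?thesis
        using N_b N_b[OF aN] by (auto simp: O' topspace_ultraweak)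
    qed
    finally show "openin (subtopology (topology_generated_by {{T \<in> bounded_ops M. (\<Sum>n. L2_inner M (\<xi> n) (T (\<eta> n))) \<in> W} | \<xi> \<eta> W.
          \<xi> \<in> l2_sequences M \<and> \<eta> \<in> l2_sequences M \<and> open W}) N)
        (a -` O' \<inter> topspace (subtopology (topology_generated_by {{T \<in> bounded_ops M. (\<Sum>n. L2_inner M (\<xi> n) (T (\<eta> n))) \<in> W} | \<xi> \<eta> W.
          \<xi> \<in> l2_sequences M \<and> \<eta> \<in> l2_sequences M \<and> open W}) N))"
      by (simp only: ultraweak_topology_def)
  qed
  then show "ultraweakly_continuous M N a"
    unfolding ultraweakly_continuous_def
    by (rule continuous_map_into_subtopology) (use aN in \<open>auto simp: topspace_ultraweak\<close>)
qed

section \<open>Pullback operators\<close>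

text \<open>
  A map of this kind induces \<open>sqrt c\<close> times an isometry on the Hilbert space. Left translations, right
  translations and conjugations of a group are instances.
\<close>

definition scales_measure :: "'x measure \<Rightarrow> ('x \<Rightarrow> 'x) \<Rightarrow> real \<Rightarrow> bool" where
  "scales_measure M \<theta> c \<longleftrightarrow> \<theta> \<in> measurable M M \<and> 0 < c \<and>
     (\<forall>A\<in>sets M. emeasure M (\<theta> -` A \<inter> space M) = ennreal c * emeasure M A)"

definition pullback :: "'x measure \<Rightarrow> ('x \<Rightarrow> 'x) \<Rightarrow> 'x l2_op" where
  "pullback M \<theta> = (\<lambda>X\<in>L2_space M. L2_class M (\<lambda>x. L2_rep X (\<theta> x)))"

lemma scales_measure_measurable: "scales_measure M \<theta> c \<Longrightarrow> \<theta> \<in> measurable M M"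
  by (simp add: scales_measure_def)

lemma scales_measure_emeasure:
  "scales_measure M \<theta> c \<Longrightarrow> A \<in> sets M \<Longrightarrow> emeasure M (\<theta> -` A \<inter> space M) = ennreal c * emeasure M A"
  by (simp add: scales_measure_def)

lemma scales_measure_distr:
  assumes "scales_measure M \<theta> c"
  shows "distr M M \<theta> = density M (\<lambda>_. ennreal c)"
proof (rule measure_eqI)
  fix A assume "A \<in> sets (distr M M \<theta>)"
  then show "emeasure (distr M M \<theta>) A = emeasure (density M (\<lambda>_. ennreal c)) A"
    using assms by (simp add: scales_measure_def emeasure_distr emeasure_density nn_integral_cmult)
qed simp

lemma scales_measure_nn_integral:
  assumes \<theta>: "scales_measure M \<theta> c" and f [measurable]: "f \<in> borel_measurable M"
  shows "(\<integral>\<^sup>+x. f (\<theta> x) \<partial>M) = ennreal c * (\<integral>\<^sup>+x. f x \<partial>M)"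
proof -
  note [measurable] = scales_measure_measurable[OF \<theta>]
  have "(\<integral>\<^sup>+x. f (\<theta> x) \<partial>M) = (\<integral>\<^sup>+x. f x \<partial>distr M M \<theta>)" by (simp add: nn_integral_distr)
  then show ?thesis
    unfolding scales_measure_distr[OF \<theta>] by (simp add: nn_integral_density nn_integral_cmult)
qed

lemma scales_measure_integral:
  fixes f :: "'x \<Rightarrow> complex"
  assumes \<theta>: "scales_measure M \<theta> c" and f [measurable]: "f \<in> borel_measurable M"
  shows "(\<integral>x. f (\<theta> x) \<partial>M) = of_real c * (\<integral>x. f x \<partial>M)"
proof -
  note [measurable] = scales_measure_measurable[OF \<theta>]
  have "(\<integral>x. f (\<theta> x) \<partial>M) = (\<integral>x. f x \<partial>distr M M \<theta>)" by (simp add: integral_distr)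
  also have "\<dots> = (\<integral>x. c *\<^sub>R f x \<partial>M)"
    unfolding scales_measure_distr[OF \<theta>] using \<theta> by (intro integral_density) (simp_all add: scales_measure_def)
  finally show ?thesis by (simp add: scaleR_conv_of_real)
qed

lemma scales_measure_AE:
  assumes \<theta>: "scales_measure M \<theta> c" and ae: "AE x in M. Q x"
  shows "AE x in M. Q (\<theta> x)"
proof (rule AE_distrD[OF scales_measure_measurable[OF \<theta>]])
  show "AE x in distr M M \<theta>. Q x"
    unfolding scales_measure_distr[OF \<theta>] using ae by (subst AE_density) auto
qed

lemma pullback_fun:
  assumes \<theta>: "scales_measure M \<theta> c" and f: "f \<in> L2_fun M"
  shows "(\<lambda>x. f (\<theta> x)) \<in> L2_fun M"
proof -
  note [measurable] = scales_measure_measurable[OF \<theta>] L2_fun_measurable[OF f]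
  have "(\<integral>\<^sup>+x. ennreal ((cmod (f (\<theta> x)))\<^sup>2) \<partial>M) = ennreal c * (\<integral>\<^sup>+x. ennreal ((cmod (f x))\<^sup>2) \<partial>M)"
    by (rule scales_measure_nn_integral[OF \<theta>, of "\<lambda>x. ennreal ((cmod (f x))\<^sup>2)"]) measurable
  also have "\<dots> < \<infinity>" using f by (simp add: L2_fun_iff ennreal_mult_less_top)
  finally show ?thesis by (simp add: L2_fun_iff)
qed

lemma pullback_mem: "scales_measure M \<theta> c \<Longrightarrow> X \<in> L2_space M \<Longrightarrow> pullback M \<theta> X \<in> L2_space M"
  by (simp add: pullback_def L2_class_in pullback_fun[OF _ L2_rep_in])

lemma pullback_rep:
  "scales_measure M \<theta> c \<Longrightarrow> X \<in> L2_space M \<Longrightarrow> AE x in M. L2_rep (pullback M \<theta> X) x = L2_rep X (\<theta> x)"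
  using L2_rep_class[OF pullback_fun[OF _ L2_rep_in]] by (simp add: pullback_def)

lemma pullback_class:
  assumes \<theta>: "scales_measure M \<theta> c" and f: "f \<in> L2_fun M"
  shows "pullback M \<theta> (L2_class M f) = L2_class M (\<lambda>x. f (\<theta> x))"
proof (rule L2_space_eqI)
  show "AE x in M. L2_rep (pullback M \<theta> (L2_class M f)) x = L2_rep (L2_class M (\<lambda>x. f (\<theta> x))) x"
    using pullback_rep[OF \<theta> L2_class_in[OF f]] scales_measure_AE[OF \<theta> L2_rep_class[OF f]]
      L2_rep_class[OF pullback_fun[OF \<theta> f]] by eventually_elim simp
qed (simp_all add: pullback_mem[OF \<theta>] L2_class_in f pullback_fun[OF \<theta> f])

lemma pullback_inner:
  assumes \<theta>: "scales_measure M \<theta> c" and X: "X \<in> L2_space M" and Y: "Y \<in> L2_space M"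
  shows "L2_inner M (pullback M \<theta> X) (pullback M \<theta> Y) = of_real c * L2_inner M X Y"
proof -
  note [measurable] = scales_measure_measurable[OF \<theta>] L2_space_measurable[OF X] L2_space_measurable[OF Y]
  have "L2_inner M (pullback M \<theta> X) (pullback M \<theta> Y) = (\<integral>x. cnj (L2_rep X (\<theta> x)) * L2_rep Y (\<theta> x) \<partial>M)"
    by (rule L2_inner_cong) (simp_all add: pullback_mem[OF \<theta>] X Y pullback_rep[OF \<theta>])
  also have "\<dots> = of_real c * L2_inner M X Y"
    unfolding L2_inner_def
    by (rule scales_measure_integral[OF \<theta>, of "\<lambda>x. cnj (L2_rep X x) * L2_rep Y x"]) measurable
  finally show ?thesis .
qed

lemma pullback_in:
  assumes \<theta>: "scales_measure M \<theta> c"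
  shows "pullback M \<theta> \<in> bounded_ops M"
proof -
  have add: "pullback M \<theta> (L2_add M X Y) = L2_add M (pullback M \<theta> X) (pullback M \<theta> Y)"
    if X: "X \<in> L2_space M" and Y: "Y \<in> L2_space M" for X Y
  proof (rule L2_space_eqI)
    show "AE x in M. L2_rep (pullback M \<theta> (L2_add M X Y)) x = L2_rep (L2_add M (pullback M \<theta> X) (pullback M \<theta> Y)) x"
      using pullback_rep[OF \<theta> L2_add_in[OF X Y]] scales_measure_AE[OF \<theta> L2_rep_add[OF X Y]]
        pullback_rep[OF \<theta> X] pullback_rep[OF \<theta> Y] L2_rep_add[OF pullback_mem[OF \<theta> X] pullback_mem[OF \<theta> Y]]
      by eventually_elim simp
  qed (simp_all add: pullback_mem[OF \<theta>] X Y)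
  have scale: "pullback M \<theta> (L2_scale M a X) = L2_scale M a (pullback M \<theta> X)" if X: "X \<in> L2_space M" for X a
  proof (rule L2_space_eqI)
    show "AE x in M. L2_rep (pullback M \<theta> (L2_scale M a X)) x = L2_rep (L2_scale M a (pullback M \<theta> X)) x"
      using pullback_rep[OF \<theta> L2_scale_in[OF X], of a] scales_measure_AE[OF \<theta> L2_rep_scale[OF X, of a]]
        pullback_rep[OF \<theta> X] L2_rep_scale[OF pullback_mem[OF \<theta> X], of a]
      by eventually_elim simp
  qed (simp_all add: pullback_mem[OF \<theta>] X)
  have "L2_norm M (pullback M \<theta> X) \<le> sqrt c * L2_norm M X" if X: "X \<in> L2_space M" for X
  proof (rule power2_le_imp_le)
    have c: "0 < c" using \<theta> by (simp add: scales_measure_def)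
    have "complex_of_real ((L2_norm M (pullback M \<theta> X))\<^sup>2) = of_real ((sqrt c * L2_norm M X)\<^sup>2)"
      using pullback_inner[OF \<theta> X X] c by (simp add: L2_inner_self power_mult_distrib)
    then have "(L2_norm M (pullback M \<theta> X))\<^sup>2 = (sqrt c * L2_norm M X)\<^sup>2" using of_real_eq_iff by blast
    then show "(L2_norm M (pullback M \<theta> X))\<^sup>2 \<le> (sqrt c * L2_norm M X)\<^sup>2" by simp
    show "0 \<le> sqrt c * L2_norm M X" using c by simp
  qed
  moreover have "pullback M \<theta> \<in> L2_space M \<rightarrow>\<^sub>E L2_space M"
    using pullback_mem[OF \<theta>] by (auto simp: pullback_def)
  ultimately show ?thesis using add scale unfolding bounded_ops_def by blast
qed

lemma pullback_pullback:
  assumes \<theta>: "scales_measure M \<theta> c" and \<theta>': "scales_measure M \<theta>' c'" and X: "X \<in> L2_space M"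
  shows "pullback M \<theta> (pullback M \<theta>' X) = pullback M (\<lambda>x. \<theta>' (\<theta> x)) X"
proof -
  have "pullback M \<theta> (pullback M \<theta>' X) = L2_class M (\<lambda>x. L2_rep X (\<theta>' (\<theta> x)))"
    using pullback_class[OF \<theta> pullback_fun[OF \<theta>' L2_rep_in[OF X]]] X by (simp add: pullback_def)
  then show ?thesis using X by (simp add: pullback_def)
qed

lemma pullback_cong:
  assumes \<theta>: "scales_measure M \<theta> c" and eq: "\<And>x. x \<in> space M \<Longrightarrow> \<theta>' x = \<theta> x" and X: "X \<in> L2_space M"
  shows "pullback M \<theta>' X = pullback M \<theta> X"
proof -
  have "(\<lambda>x. L2_rep X (\<theta>' x)) \<in> L2_fun M"
  proof (rule L2_fun_cong_AE[OF pullback_fun[OF \<theta> L2_rep_in[OF X]]])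
    have "(\<lambda>x. L2_rep X (\<theta> x)) \<in> borel_measurable M"
      using L2_fun_measurable[OF pullback_fun[OF \<theta> L2_rep_in[OF X]]] .
    then show "(\<lambda>x. L2_rep X (\<theta>' x)) \<in> borel_measurable M"
      by (rule measurable_cong[THEN iffD1, rotated]) (simp add: eq)
  qed (simp add: eq)
  then show ?thesis
    using X by (simp add: pullback_def L2_class_eq_iff pullback_fun[OF \<theta> L2_rep_in] eq)
qed

lemma pullback_ident:
  assumes "X \<in> L2_space M" "\<And>x. x \<in> space M \<Longrightarrow> \<theta> x = x"
  shows "pullback M \<theta> X = X"
proof -
  have "scales_measure M (\<lambda>x. x) 1" by (simp add: scales_measure_def sets.Int_space_eq2)
  from pullback_cong[OF this, of \<theta> X] assms show ?thesis
    by (simp add: pullback_def L2_class_rep)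
qed

section \<open>Haar measures of measurable groups\<close>

text \<open>
  The measure-theoretic properties of a Haar measure on a second countable group. They pass to the
  kernel of the modular function and to right translates of the measure more easily than topological
  ones.
\<close>

locale haar_group = group G for G (structure) +
  fixes \<mu> :: "'a measure"
  assumes space_haar: "space \<mu> = carrier G"
    and sigma_finite_haar: "sigma_finite_measure \<mu>"
    and mult_measurable_pair: "(\<lambda>p. fst p \<otimes> snd p) \<in> measurable (\<mu> \<Otimes>\<^sub>M \<mu>) \<mu>"
    and inv_measurable: "(\<lambda>x. inv x) \<in> measurable \<mu> \<mu>"
    and left_invariant: "g \<in> carrier G \<Longrightarrow> A \<in> sets \<mu> \<Longrightarrow> emeasure \<mu> (g <# A) = emeasure \<mu> A"
    and haar_nonzero: "emeasure \<mu> (space \<mu>) \<noteq> 0"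
begin

lemma mult_measurable [measurable (raw)]:
  assumes "f \<in> measurable N \<mu>" "g \<in> measurable N \<mu>"
  shows "(\<lambda>x. f x \<otimes> g x) \<in> measurable N \<mu>"
  using measurable_compose[OF measurable_Pair[OF assms] mult_measurable_pair] by simp

lemma inv_measurable_comp [measurable (raw)]:
  assumes "f \<in> measurable N \<mu>"
  shows "(\<lambda>x. inv (f x)) \<in> measurable N \<mu>"
  using measurable_compose[OF assms inv_measurable] .

lemma const_measurable [measurable]: "g \<in> carrier G \<Longrightarrow> (\<lambda>_. g) \<in> measurable N \<mu>"
  by (simp add: space_haar)

lemma translate_measurable [measurable]:
  assumes "g \<in> carrier G"
  shows "(\<lambda>x. g \<otimes> x) \<in> measurable \<mu> \<mu>" "(\<lambda>x. x \<otimes> g) \<in> measurable \<mu> \<mu>"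
  using assms by measurable

lemma left_translate_vimage:
  assumes g: "g \<in> carrier G" and A: "A \<subseteq> carrier G"
  shows "(\<lambda>x. g \<otimes> x) -` A \<inter> space \<mu> = inv g <# A"
proof (intro Set.set_eqI iffI)
  fix x assume "x \<in> (\<lambda>x. g \<otimes> x) -` A \<inter> space \<mu>"
  then have x: "x \<in> space \<mu>" and gx: "g \<otimes> x \<in> A" by auto
  have "x = inv g \<otimes> (g \<otimes> x)" using g x by (simp add: space_haar m_assoc[symmetric])
  then show "x \<in> inv g <# A" using gx by (auto simp: l_coset_def)
next
  fix x assume "x \<in> inv g <# A"
  then obtain a where a: "a \<in> A" "x = inv g \<otimes> a" by (auto simp: l_coset_def)
  then have "a \<in> carrier G" using A by auto
  then show "x \<in> (\<lambda>x. g \<otimes> x) -` A \<inter> space \<mu>" using a g by (simp add: space_haar m_assoc[symmetric])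
qed

lemma right_translate_vimage:
  assumes g: "g \<in> carrier G" and A: "A \<subseteq> carrier G"
  shows "(\<lambda>x. x \<otimes> g) -` A \<inter> space \<mu> = A #> inv g"
proof (intro Set.set_eqI iffI)
  fix x assume "x \<in> (\<lambda>x. x \<otimes> g) -` A \<inter> space \<mu>"
  then have x: "x \<in> space \<mu>" and xg: "x \<otimes> g \<in> A" by auto
  have "x = (x \<otimes> g) \<otimes> inv g" using g x by (simp add: space_haar m_assoc)
  then show "x \<in> A #> inv g" using xg by (auto simp: r_coset_def)
next
  fix x assume "x \<in> A #> inv g"
  then obtain a where a: "a \<in> A" "x = a \<otimes> inv g" by (auto simp: r_coset_def)
  then have "a \<in> carrier G" using A by auto
  then show "x \<in> (\<lambda>x. x \<otimes> g) -` A \<inter> space \<mu>" using a g by (simp add: space_haar m_assoc)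
qed

lemma sets_carrier: "A \<in> sets \<mu> \<Longrightarrow> A \<subseteq> carrier G"
  using sets.sets_into_space space_haar by blast

lemma scales_left: "g \<in> carrier G \<Longrightarrow> scales_measure \<mu> (\<lambda>x. g \<otimes> x) 1"
  unfolding scales_measure_def
  by (auto simp: translate_measurable left_translate_vimage sets_carrier left_invariant)

lemma nn_integral_left:
  "g \<in> carrier G \<Longrightarrow> f \<in> borel_measurable \<mu> \<Longrightarrow> (\<integral>\<^sup>+x. f (g \<otimes> x) \<partial>\<mu>) = (\<integral>\<^sup>+x. f x \<partial>\<mu>)"
  using scales_measure_nn_integral[OF scales_left] by simp

end

text \<open>
  The classical double integral identity behind the uniqueness of the Haar measure: substitute
  \<open>x \<mapsto> inv y x\<close> and then \<open>y \<mapsto> x y\<close>.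
\<close>

lemma haar_double_integral:
  assumes \<mu>: "haar_group G \<mu>" and \<nu>: "haar_group G \<nu>" and sets_eq: "sets \<nu> = sets \<mu>"
    and f [measurable]: "f \<in> borel_measurable \<mu>" and g [measurable]: "g \<in> borel_measurable \<mu>"
  shows "(\<integral>\<^sup>+x. f x * (\<integral>\<^sup>+y. g (y \<otimes>\<^bsub>G\<^esub> x) \<partial>\<nu>) \<partial>\<mu>) = (\<integral>\<^sup>+x. g x \<partial>\<mu>) * (\<integral>\<^sup>+y. f (inv\<^bsub>G\<^esub> y) \<partial>\<nu>)"
proof -
  interpret \<mu>: haar_group G \<mu> by fact
  interpret \<nu>: haar_group G \<nu> by fact
  interpret P: pair_sigma_finite \<mu> \<nu>
    by (intro pair_sigma_finite.intro \<mu>.sigma_finite_haar \<nu>.sigma_finite_haar)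
  have id [measurable]: "(\<lambda>x. x) \<in> measurable \<nu> \<mu>" by (simp add: measurable_cong_sets[OF sets_eq refl])
  have snd_m [measurable]: "snd \<in> measurable (\<mu> \<Otimes>\<^sub>M \<nu>) \<mu>"
    using measurable_compose[OF measurable_snd id] by simp
  have f' [measurable]: "f \<in> borel_measurable \<nu>" and g' [measurable]: "g \<in> borel_measurable \<nu>"
    using f g by (simp_all add: measurable_cong_sets[OF sets_eq refl])
  have mult\<nu>: "(\<lambda>y. y \<otimes>\<^bsub>G\<^esub> x) \<in> measurable \<nu> \<mu>" "(\<lambda>y. inv\<^bsub>G\<^esub> y) \<in> measurable \<nu> \<mu>"
    "(\<lambda>y. inv\<^bsub>G\<^esub> y \<otimes>\<^bsub>G\<^esub> x) \<in> measurable \<nu> \<mu>" if "x \<in> carrier G" for x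
    using that id by measurable
  have "(\<integral>\<^sup>+x. f x * (\<integral>\<^sup>+y. g (y \<otimes>\<^bsub>G\<^esub> x) \<partial>\<nu>) \<partial>\<mu>)
      = (\<integral>\<^sup>+x. (\<integral>\<^sup>+y. f x * g (y \<otimes>\<^bsub>G\<^esub> x) \<partial>\<nu>) \<partial>\<mu>)"
    by (intro nn_integral_cong nn_integral_cmult[symmetric] measurable_compose[OF mult\<nu>(1) g])
      (simp add: \<mu>.space_haar)
  also have "\<dots> = (\<integral>\<^sup>+y. (\<integral>\<^sup>+x. f x * g (y \<otimes>\<^bsub>G\<^esub> x) \<partial>\<mu>) \<partial>\<nu>)"
    by (rule P.Fubini'[symmetric]) measurable
  also have "\<dots> = (\<integral>\<^sup>+y. (\<integral>\<^sup>+x. f (inv\<^bsub>G\<^esub> y \<otimes>\<^bsub>G\<^esub> x) * g x \<partial>\<mu>) \<partial>\<nu>)"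
  proof (rule nn_integral_cong)
    fix y assume "y \<in> space \<nu>"
    then have y: "y \<in> carrier G" by (simp add: \<nu>.space_haar)
    have "(\<integral>\<^sup>+x. f (inv\<^bsub>G\<^esub> y \<otimes>\<^bsub>G\<^esub> x) * g x \<partial>\<mu>) = (\<integral>\<^sup>+x. f (inv\<^bsub>G\<^esub> y \<otimes>\<^bsub>G\<^esub> (y \<otimes>\<^bsub>G\<^esub> x)) * g (y \<otimes>\<^bsub>G\<^esub> x) \<partial>\<mu>)"
      using y by (intro \<mu>.nn_integral_left[of y "\<lambda>x. f (inv\<^bsub>G\<^esub> y \<otimes>\<^bsub>G\<^esub> x) * g x", symmetric])
        (auto intro!: borel_measurable_times_ennreal measurable_compose[OF _ f] \<mu>.translate_measurable g)
    also have "\<dots> = (\<integral>\<^sup>+x. f x * g (y \<otimes>\<^bsub>G\<^esub> x) \<partial>\<mu>)"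
      using y by (intro nn_integral_cong) (simp add: \<mu>.space_haar \<mu>.m_assoc[symmetric])
    finally show "(\<integral>\<^sup>+x. f x * g (y \<otimes>\<^bsub>G\<^esub> x) \<partial>\<mu>) = (\<integral>\<^sup>+x. f (inv\<^bsub>G\<^esub> y \<otimes>\<^bsub>G\<^esub> x) * g x \<partial>\<mu>)" by simp
  qed
  also have "\<dots> = (\<integral>\<^sup>+x. (\<integral>\<^sup>+y. f (inv\<^bsub>G\<^esub> y \<otimes>\<^bsub>G\<^esub> x) * g x \<partial>\<nu>) \<partial>\<mu>)"
    by (rule P.Fubini') measurable
  also have "\<dots> = (\<integral>\<^sup>+x. g x * (\<integral>\<^sup>+y. f (inv\<^bsub>G\<^esub> y) \<partial>\<nu>) \<partial>\<mu>)"
  proof (rule nn_integral_cong)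
    fix x assume "x \<in> space \<mu>"
    then have x: "x \<in> carrier G" by (simp add: \<mu>.space_haar)
    have "(\<integral>\<^sup>+y. f (inv\<^bsub>G\<^esub> y \<otimes>\<^bsub>G\<^esub> x) * g x \<partial>\<nu>) = g x * (\<integral>\<^sup>+y. f (inv\<^bsub>G\<^esub> y \<otimes>\<^bsub>G\<^esub> x) \<partial>\<nu>)"
      unfolding mult.commute[of _ "g x"] by (rule nn_integral_cmult) (rule measurable_compose[OF mult\<nu>(3)[OF x] f])
    also have "(\<integral>\<^sup>+y. f (inv\<^bsub>G\<^esub> y \<otimes>\<^bsub>G\<^esub> x) \<partial>\<nu>) = (\<integral>\<^sup>+y. f (inv\<^bsub>G\<^esub> (x \<otimes>\<^bsub>G\<^esub> y) \<otimes>\<^bsub>G\<^esub> x) \<partial>\<nu>)"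
      by (rule \<nu>.nn_integral_left[OF x measurable_compose[OF mult\<nu>(3)[OF x] f], symmetric])
    also have "\<dots> = (\<integral>\<^sup>+y. f (inv\<^bsub>G\<^esub> y) \<partial>\<nu>)"
      using x by (intro nn_integral_cong) (simp add: \<nu>.space_haar \<mu>.inv_mult_group \<mu>.m_assoc)
    finally show "(\<integral>\<^sup>+y. f (inv\<^bsub>G\<^esub> y \<otimes>\<^bsub>G\<^esub> x) * g x \<partial>\<nu>) = g x * (\<integral>\<^sup>+y. f (inv\<^bsub>G\<^esub> y) \<partial>\<nu>)" .
  qed
  also have "\<dots> = (\<integral>\<^sup>+x. g x \<partial>\<mu>) * (\<integral>\<^sup>+y. f (inv\<^bsub>G\<^esub> y) \<partial>\<nu>)"
    by (rule nn_integral_multc) measurable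
  finally show ?thesis .
qed

text \<open>
  Take the constant 1 for the second function in the double integral identity: its left side vanishes
  if the first function is the indicator of a null set.
\<close>

lemma haar_null_inverse:
  assumes \<mu>: "haar_group G \<mu>" and \<nu>: "haar_group G \<nu>" and sets_eq: "sets \<nu> = sets \<mu>"
    and A [measurable]: "A \<in> sets \<mu>" and null: "emeasure \<mu> A = 0"
  shows "emeasure \<nu> {x \<in> space \<nu>. inv\<^bsub>G\<^esub> x \<in> A} = 0"
proof -
  interpret \<mu>: haar_group G \<mu> by fact
  interpret \<nu>: haar_group G \<nu> by fact
  have A' [measurable]: "A \<in> sets \<nu>" by (simp add: sets_eq)
  note [measurable] = \<nu>.inv_measurable
  have "(\<integral>\<^sup>+x. indicator A x * (\<integral>\<^sup>+y. 1 \<partial>\<nu>) \<partial>\<mu>) = (\<integral>\<^sup>+x. indicator A x \<partial>\<mu>) * (\<integral>\<^sup>+y. 1 \<partial>\<nu>)"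
    by (rule nn_integral_multc) measurable
  then have "0 = emeasure \<mu> (space \<mu>) * (\<integral>\<^sup>+y. indicator A (inv\<^bsub>G\<^esub> y) \<partial>\<nu>)"
    using haar_double_integral[OF \<mu> \<nu> sets_eq, of "indicator A" "\<lambda>_. 1"] null by simp
  moreover have "(\<integral>\<^sup>+y. indicator A (inv\<^bsub>G\<^esub> y) \<partial>\<nu>) = emeasure \<nu> {x \<in> space \<nu>. inv\<^bsub>G\<^esub> x \<in> A}"
  proof -
    have "(\<integral>\<^sup>+y. indicator A (inv\<^bsub>G\<^esub> y) \<partial>\<nu>) = (\<integral>\<^sup>+y. indicator {x \<in> space \<nu>. inv\<^bsub>G\<^esub> x \<in> A} y \<partial>\<nu>)"
      by (rule nn_integral_cong) (simp add: indicator_def)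
    then show ?thesis by simp
  qed
  ultimately show ?thesis using \<mu>.haar_nonzero by (simp add: mult_zero_left eq_commute[of 0])
qed

text \<open>
  A right translation is a left translation conjugated by the inversion.
\<close>

lemma (in haar_group) null_right_translate:
  assumes A [measurable]: "A \<in> sets \<mu>" and null: "emeasure \<mu> A = 0" and g: "g \<in> carrier G"
  shows "emeasure \<mu> {x \<in> space \<mu>. x \<otimes> g \<in> A} = 0"
proof -
  have h: "haar_group G \<mu>" by unfold_locales
  note [measurable] = inv_measurable translate_measurable[OF g]
  let ?A' = "{x \<in> space \<mu>. inv x \<in> A}"
  have A': "emeasure \<mu> ?A' = 0" by (rule haar_null_inverse[OF h h refl A null])
  have A'_sets [measurable]: "?A' \<in> sets \<mu>" by measurable
  let ?B = "(\<lambda>x. inv g \<otimes> x) -` ?A' \<inter> space \<mu>"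
  have "\<forall>A\<in>sets \<mu>. emeasure \<mu> ((\<lambda>x. inv g \<otimes> x) -` A \<inter> space \<mu>) = ennreal 1 * emeasure \<mu> A"
    using scales_left[of "inv g"] g unfolding scales_measure_def by blast
  from bspec[OF this A'_sets] have "emeasure \<mu> ?B = 0" unfolding A' by simp
  moreover have "?B \<in> sets \<mu>"
    using g by (intro measurable_sets[OF translate_measurable(1)] A'_sets) simp
  ultimately have "emeasure \<mu> {x \<in> space \<mu>. inv x \<in> ?B} = 0"
    using haar_null_inverse[OF h h refl] by blast
  also have "{x \<in> space \<mu>. inv x \<in> ?B} = {x \<in> space \<mu>. x \<otimes> g \<in> A}"
    using g by (auto simp: space_haar inv_mult_group)
  finally show ?thesis .
qed

text \<open>
  The density of \<open>\<nu>\<close> with respect to \<open>\<mu>\<close> is left invariant up to null sets. By Fubini some right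
  translate of it is almost everywhere constant, and right translations preserve null sets.
\<close>

theorem haar_unique:
  assumes \<mu>: "haar_group G \<mu>" and \<nu>: "haar_group G \<nu>" and sets_eq: "sets \<nu> = sets \<mu>"
  obtains c where "c > 0" "\<And>A. A \<in> sets \<mu> \<Longrightarrow> emeasure \<nu> A = ennreal c * emeasure \<mu> A"
proof -
  interpret \<mu>: haar_group G \<mu> by fact
  interpret \<nu>: haar_group G \<nu> by fact
  interpret S: sigma_finite_measure \<mu> by (rule \<mu>.sigma_finite_haar)
  interpret S': sigma_finite_measure \<nu> by (rule \<nu>.sigma_finite_haar)
  interpret P: pair_sigma_finite \<mu> \<mu> by unfold_locales
  have sp: "space \<nu> = space \<mu>" using sets_eq by (rule sets_eq_imp_space_eq)
  have ac: "absolutely_continuous \<mu> \<nu>"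
    unfolding absolutely_continuous_def
  proof
    fix A assume "A \<in> null_sets \<mu>"
    then have A: "A \<in> sets \<mu>" "emeasure \<mu> A = 0" by auto
    let ?B = "{x \<in> space \<nu>. inv\<^bsub>G\<^esub> x \<in> A}"
    have B: "?B \<in> sets \<nu>"
      using measurable_sets[OF \<nu>.inv_measurable, of A] A(1) sets_eq by (simp add: vimage_def Int_def conj_commute)
    have "emeasure \<nu> {x \<in> space \<nu>. inv\<^bsub>G\<^esub> x \<in> ?B} = 0"
      by (rule haar_null_inverse[OF \<nu> \<nu> refl B haar_null_inverse[OF \<mu> \<nu> sets_eq A]])
    also have "{x \<in> space \<nu>. inv\<^bsub>G\<^esub> x \<in> ?B} = A"
      using \<mu>.sets_carrier[OF A(1)] by (auto simp: \<nu>.space_haar)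
    finally show "A \<in> null_sets \<nu>" using A sets_eq by auto
  qed
  obtain h where h [measurable]: "h \<in> borel_measurable \<mu>" and dens: "density \<mu> h = \<nu>"
    using S.Radon_Nikodym[OF ac sets_eq] by blast
  have inv: "AE x in \<mu>. h (g \<otimes>\<^bsub>G\<^esub> x) = h x" if g: "g \<in> carrier G" for g
  proof -
    note [measurable] = \<mu>.translate_measurable[OF g]
    have "density \<mu> (\<lambda>x. h (g \<otimes>\<^bsub>G\<^esub> x)) = density \<mu> h"
    proof (rule measure_eqI)
      fix A assume "A \<in> sets (density \<mu> (\<lambda>x. h (g \<otimes>\<^bsub>G\<^esub> x)))"
      then have A [measurable]: "A \<in> sets \<mu>" by simp
      let ?A = "(\<lambda>x. inv\<^bsub>G\<^esub> g \<otimes>\<^bsub>G\<^esub> x) -` A \<inter> space \<mu>"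
      have A' [measurable]: "?A \<in> sets \<mu>"
        using g by (intro measurable_sets[OF \<mu>.translate_measurable(1)] A) simp
      have "emeasure (density \<mu> (\<lambda>x. h (g \<otimes>\<^bsub>G\<^esub> x))) A = (\<integral>\<^sup>+x. h (g \<otimes>\<^bsub>G\<^esub> x) * indicator A x \<partial>\<mu>)"
        by (rule emeasure_density) measurable
      also have "\<dots> = (\<integral>\<^sup>+x. h (g \<otimes>\<^bsub>G\<^esub> x) * indicator ?A (g \<otimes>\<^bsub>G\<^esub> x) \<partial>\<mu>)"
        using g by (intro nn_integral_cong)
          (simp add: \<mu>.space_haar \<mu>.m_assoc[symmetric] indicator_def)
      also have "\<dots> = (\<integral>\<^sup>+x. h x * indicator ?A x \<partial>\<mu>)"
        by (rule \<mu>.nn_integral_left[OF g, of "\<lambda>x. h x * indicator ?A x"]) measurable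
      also have "\<dots> = emeasure \<nu> ?A" unfolding dens[symmetric] by (rule emeasure_density[symmetric]) measurable
      also have "\<dots> = emeasure \<nu> A"
        using \<nu>.scales_left[of "inv\<^bsub>G\<^esub> g"] g A sets_eq by (simp add: scales_measure_def sp)
      finally show "emeasure (density \<mu> (\<lambda>x. h (g \<otimes>\<^bsub>G\<^esub> x))) A = emeasure (density \<mu> h) A" by (simp add: dens)
    qed simp
    then show ?thesis by (subst (asm) S.density_unique_iff) simp_all
  qed
  have "AE g in \<mu>. AE x in \<mu>. h (g \<otimes>\<^bsub>G\<^esub> x) = h x"
    by (rule AE_I2) (simp add: \<mu>.space_haar inv)
  then have "AE x in \<mu>. AE g in \<mu>. h (g \<otimes>\<^bsub>G\<^esub> x) = h x"
    by (subst P.AE_commute) measurable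
  moreover have "\<not> (AE x in \<mu>. False)"
    using \<mu>.haar_nonzero by (simp add: AE_iff_measurable[OF sets.top])
  ultimately have "\<exists>x\<in>space \<mu>. AE g in \<mu>. h (g \<otimes>\<^bsub>G\<^esub> x) = h x"
    using AE_mp[of "\<lambda>x. AE g in \<mu>. h (g \<otimes>\<^bsub>G\<^esub> x) = h x" \<mu> "\<lambda>_. False"] AE_I2[of \<mu>] by blast
  then obtain x where x: "x \<in> carrier G" "AE g in \<mu>. h (g \<otimes>\<^bsub>G\<^esub> x) = h x"
    by (auto simp: \<mu>.space_haar)
  have h_const: "AE y in \<mu>. h y = h x"
  proof -
    note [measurable] = \<mu>.translate_measurable[OF x(1)]
    let ?N = "{y \<in> space \<mu>. h y \<noteq> h x}" and ?N' = "{g \<in> space \<mu>. h (g \<otimes>\<^bsub>G\<^esub> x) \<noteq> h x}"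
    have "emeasure \<mu> ?N' = 0"
      using x(2) by (subst (asm) AE_iff_measurable[OF _ refl]) simp_all
    then have "emeasure \<mu> {y \<in> space \<mu>. y \<otimes>\<^bsub>G\<^esub> inv\<^bsub>G\<^esub> x \<in> ?N'} = 0"
      by (intro \<mu>.null_right_translate) (use x in auto)
    also have "{y \<in> space \<mu>. y \<otimes>\<^bsub>G\<^esub> inv\<^bsub>G\<^esub> x \<in> ?N'} = ?N"
      using x(1) by (auto simp: \<mu>.space_haar \<mu>.m_assoc)
    finally show ?thesis by (subst AE_iff_measurable[OF _ refl]) simp_all
  qed
  have \<nu>_eq: "emeasure \<nu> A = h x * emeasure \<mu> A" if [measurable]: "A \<in> sets \<mu>" for A
  proof -
    have "emeasure \<nu> A = (\<integral>\<^sup>+y. h y * indicator A y \<partial>\<mu>)"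
      unfolding dens[symmetric] by (rule emeasure_density) measurable
    also have "\<dots> = (\<integral>\<^sup>+y. h x * indicator A y \<partial>\<mu>)"
      by (rule nn_integral_cong_AE) (use h_const in eventually_elim, simp)
    also have "\<dots> = h x * emeasure \<mu> A" by (simp add: nn_integral_cmult)
    finally show ?thesis .
  qed
  have "h x \<noteq> 0" using \<nu>_eq[of "space \<mu>"] \<nu>.haar_nonzero sp by auto
  moreover have "h x \<noteq> \<infinity>"
  proof
    assume inf: "h x = \<infinity>"
    obtain A :: "nat \<Rightarrow> 'a set" where A: "range A \<subseteq> sets \<nu>" "(\<Union>i. A i) = space \<nu>" "\<And>i. emeasure \<nu> (A i) \<noteq> \<infinity>"
      using S'.sigma_finite by metis
    have "emeasure \<nu> (A i) = 0" for i
    proof -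
      have "A i \<in> sets \<mu>" using A(1) sets_eq by auto
      from \<nu>_eq[OF this] A(3)[of i] show ?thesis unfolding inf by (auto simp: ennreal_top_mult split: if_splits)
    qed
    then have "emeasure \<nu> (\<Union>i. A i) = 0" using A(1) by (intro emeasure_UN_eq_0) auto
    then show False using A(2) \<nu>.haar_nonzero by simp
  qed
  ultimately have "0 < enn2real (h x)" "ennreal (enn2real (h x)) = h x"
    by (auto simp: enn2real_positive_iff less_top zero_less_iff_neq_zero)
  then show thesis using that[of "enn2real (h x)"] \<nu>_eq by simp
qed

section \<open>The modular function\<close>

context haar_group
begin

interpretation sigma_finite_measure \<mu> by (rule sigma_finite_haar)

text \<open>
  A right translate of a Haar measure is again left invariant; the modular function is the
  proportionality factor provided by uniqueness.
\<close>

lemma haar_group_right_translate: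
  assumes g: "g \<in> carrier G"
  shows "haar_group G (distr \<mu> \<mu> (\<lambda>x. x \<otimes> g))"
proof -
  note m = translate_measurable[OF g]
  let ?D = "distr \<mu> \<mu> (\<lambda>x. x \<otimes> g)"
  obtain A :: "nat \<Rightarrow> 'a set" where A: "range A \<subseteq> sets \<mu>" "(\<Union>i. A i) = space \<mu>" "\<And>i. emeasure \<mu> (A i) \<noteq> \<infinity>"
    using sigma_finite by metis
  have sf: "sigma_finite_measure ?D"
  proof
    let ?B = "\<lambda>i. (\<lambda>x. x \<otimes> inv g) -` A i \<inter> space \<mu>"
    have B: "?B i \<in> sets \<mu>" for i
      using A(1) g by (intro measurable_sets[OF translate_measurable(2)]) auto
    have "emeasure ?D (?B i) \<noteq> \<infinity>" for i
    proof -
      have "A i \<subseteq> carrier G" using A(1) sets_carrier by auto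
      then have "(\<lambda>x. x \<otimes> g) -` ?B i \<inter> space \<mu> = A i"
        using g by (auto simp: space_haar m_assoc)
      then show ?thesis using emeasure_distr[OF m(2) B] A(3) by simp
    qed
    moreover have "(\<Union>i. ?B i) = space \<mu>"
    proof -
      have "x \<in> (\<Union>i. ?B i)" if x: "x \<in> space \<mu>" for x
      proof -
        have "x \<otimes> inv g \<in> (\<Union>i. A i)" using x g A(2) by (simp add: space_haar)
        then show ?thesis using x by auto
      qed
      then show ?thesis by auto
    qed
    ultimately show "\<exists>C. countable C \<and> C \<subseteq> sets ?D \<and> \<Union> C = space ?D \<and> (\<forall>a\<in>C. emeasure ?D a \<noteq> \<infinity>)"
      using B by (intro exI[of _ "range ?B"]) auto
  qed
  have pm: "measurable (?D \<Otimes>\<^sub>M ?D) ?D = measurable (\<mu> \<Otimes>\<^sub>M \<mu>) \<mu>"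
    by (intro measurable_cong_sets sets_pair_measure_cong) simp_all
  have im: "measurable ?D ?D = measurable \<mu> \<mu>" by (intro measurable_cong_sets) simp_all
  show ?thesis
  proof (intro haar_group.intro haar_group_axioms.intro is_group)
    show "space ?D = carrier G" by (simp add: space_haar)
    show "(\<lambda>p. fst p \<otimes> snd p) \<in> measurable (?D \<Otimes>\<^sub>M ?D) ?D" unfolding pm by (rule mult_measurable_pair)
    show "(\<lambda>x. inv x) \<in> measurable ?D ?D" unfolding im by (rule inv_measurable)
    show "sigma_finite_measure ?D" by (rule sf)
    fix h A assume h: "h \<in> carrier G" and "A \<in> sets ?D"
    then have A: "A \<in> sets \<mu>" by simp
    have hA: "h <# A \<in> sets \<mu>"
    proof -
      have "(\<lambda>x. inv h \<otimes> x) -` A \<inter> space \<mu> \<in> sets \<mu>"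
        using h by (intro measurable_sets[OF translate_measurable(1)] A) simp
      then show ?thesis using left_translate_vimage[of "inv h" A] h sets_carrier[OF A] by simp
    qed
    have "(\<lambda>x. x \<otimes> g) -` (h <# A) \<inter> space \<mu> = h <# ((\<lambda>x. x \<otimes> g) -` A \<inter> space \<mu>)"
    proof -
      have "(h <# A) #> inv g = h <# (A #> inv g)"
        using sets_carrier[OF A] g h by (force simp: l_coset_def r_coset_def m_assoc)
      then show ?thesis
        using right_translate_vimage[OF g sets_carrier[OF A]] right_translate_vimage[OF g sets_carrier[OF hA]] by simp
    qed
    then show "emeasure ?D (h <# A) = emeasure ?D A"
      using emeasure_distr[OF m(2) hA] emeasure_distr[OF m(2) A] left_invariant[OF h measurable_sets[OF m(2) A]] by simp
  next
    have "(\<lambda>x. x \<otimes> g) -` space \<mu> \<inter> space \<mu> = space \<mu>" using g by (auto simp: space_haar)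
    then show "emeasure ?D (space ?D) \<noteq> 0"
      using emeasure_distr[OF m(2) sets.top] haar_nonzero by simp
  qed
qed

lemma finite_positive_set:
  obtains B where "B \<in> sets \<mu>" "emeasure \<mu> B \<noteq> 0" "emeasure \<mu> B \<noteq> \<infinity>"
proof -
  obtain A :: "nat \<Rightarrow> 'a set" where A: "range A \<subseteq> sets \<mu>" "(\<Union>i. A i) = space \<mu>" "\<And>i. emeasure \<mu> (A i) \<noteq> \<infinity>"
    using sigma_finite by metis
  have "\<exists>i. emeasure \<mu> (A i) \<noteq> 0"
  proof (rule ccontr)
    assume "\<not> (\<exists>i. emeasure \<mu> (A i) \<noteq> 0)"
    then have "emeasure \<mu> (\<Union>i. A i) = 0" using A(1) by (intro emeasure_UN_eq_0) auto
    then show False using A(2) haar_nonzero by simp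
  qed
  then show thesis using A that by blast
qed

lemma ennreal_scale_unique:
  assumes "B \<in> sets \<mu>" "emeasure \<mu> B \<noteq> 0" "emeasure \<mu> B \<noteq> \<infinity>" "0 < a" "0 < b"
    "ennreal a * emeasure \<mu> B = ennreal b * emeasure \<mu> B"
  shows "a = b"
  using assms by (auto simp: mult.commute[of _ "emeasure \<mu> B"] ennreal_mult_cancel_left)

lemma modular_function_unique:
  assumes g: "g \<in> carrier G"
  shows "\<exists>!c. c > 0 \<and> (\<forall>A\<in>sets \<mu>. emeasure \<mu> (A #> g) = ennreal c * emeasure \<mu> A)"
proof -
  have h: "haar_group G \<mu>" by unfold_locales
  have ig: "inv g \<in> carrier G" using g by simp
  obtain c where c: "c > 0" "\<And>A. A \<in> sets \<mu> \<Longrightarrow> emeasure (distr \<mu> \<mu> (\<lambda>x. x \<otimes> inv g)) A = ennreal c * emeasure \<mu> A"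
    using haar_unique[OF h haar_group_right_translate[OF ig]] by auto
  have eq: "emeasure \<mu> (A #> g) = ennreal c * emeasure \<mu> A" if A: "A \<in> sets \<mu>" for A
    using c(2)[OF A] right_translate_vimage[OF ig sets_carrier[OF A]] g
    by (simp add: emeasure_distr[OF translate_measurable(2)[OF ig] A])
  obtain B where B: "B \<in> sets \<mu>" "emeasure \<mu> B \<noteq> 0" "emeasure \<mu> B \<noteq> \<infinity>" by (rule finite_positive_set)
  show ?thesis
  proof (rule ex1I[of _ c])
    fix b assume "b > 0 \<and> (\<forall>A\<in>sets \<mu>. emeasure \<mu> (A #> g) = ennreal b * emeasure \<mu> A)"
    then show "b = c" using ennreal_scale_unique[OF B, of b c] c(1) eq[OF B(1)] B(1) by auto
  qed (use c eq in auto)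
qed

abbreviation \<Delta> :: "'a \<Rightarrow> real" where "\<Delta> \<equiv> modular_function G \<mu>"

lemma modular_pos:
  assumes "g \<in> carrier G"
  shows "0 < \<Delta> g"
  unfolding modular_function_def using theI'[OF modular_function_unique[OF assms]] by (rule conjunct1)

lemma emeasure_right:
  assumes "g \<in> carrier G" "A \<in> sets \<mu>"
  shows "emeasure \<mu> (A #> g) = ennreal (\<Delta> g) * emeasure \<mu> A"
  unfolding modular_function_def
  using conjunct2[OF theI'[OF modular_function_unique[OF assms(1)]]] assms(2) by (rule bspec)

lemma modular_eqI:
  assumes "g \<in> carrier G" "0 < c" "\<And>A. A \<in> sets \<mu> \<Longrightarrow> emeasure \<mu> (A #> g) = ennreal c * emeasure \<mu> A"
  shows "\<Delta> g = c"
  unfolding modular_function_def by (rule the1_equality[OF modular_function_unique]) (use assms in auto)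

lemma right_coset_sets: "g \<in> carrier G \<Longrightarrow> A \<in> sets \<mu> \<Longrightarrow> A #> g \<in> sets \<mu>"
  using right_translate_vimage[of "inv g" A] measurable_sets[OF translate_measurable(2)[of "inv g"], of A]
  by (simp add: sets_carrier)

lemma modular_mult:
  assumes g: "g \<in> carrier G" and h: "h \<in> carrier G"
  shows "\<Delta> (g \<otimes> h) = \<Delta> g * \<Delta> h"
proof (rule modular_eqI)
  fix A assume A: "A \<in> sets \<mu>"
  have "A #> (g \<otimes> h) = (A #> g) #> h" using coset_mult_assoc[OF sets_carrier[OF A] g h] by simp
  then show "emeasure \<mu> (A #> (g \<otimes> h)) = ennreal (\<Delta> g * \<Delta> h) * emeasure \<mu> A"
    using g h A modular_pos[OF g] modular_pos[OF h]
    by (simp add: emeasure_right right_coset_sets ennreal_mult mult_ac)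
qed (use g h modular_pos in auto)

lemma modular_one: "\<Delta> \<one> = 1"
  by (rule modular_eqI) (auto simp: coset_mult_one sets_carrier)

lemma modular_inv:
  assumes g: "g \<in> carrier G"
  shows "\<Delta> (inv g) = inverse (\<Delta> g)"
proof -
  have "\<Delta> (inv g) * \<Delta> g = 1" using modular_mult[of "inv g" g] g modular_one by simp
  then show ?thesis by (metis inverse_unique mult.commute)
qed

lemma scales_right:
  assumes g: "g \<in> carrier G"
  shows "scales_measure \<mu> (\<lambda>x. x \<otimes> g) (inverse (\<Delta> g))"
  unfolding scales_measure_def
proof (intro conjI ballI)
  fix A assume A: "A \<in> sets \<mu>"
  show "emeasure \<mu> ((\<lambda>x. x \<otimes> g) -` A \<inter> space \<mu>) = ennreal (inverse (\<Delta> g)) * emeasure \<mu> A"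
    using emeasure_right[of "inv g" A] A g by (simp add: right_translate_vimage sets_carrier modular_inv)
qed (use translate_measurable[OF g] modular_pos[OF g] in auto)

text \<open>
  The double integral identity for two indicators, where the inner integral on the left is the measure
  of a right translate of \<open>B\<close> and therefore a multiple of the measure of \<open>B\<close>.
\<close>

lemma emeasure_inverse:
  assumes C: "C \<in> sets \<mu>" and r: "\<And>x. x \<in> C \<Longrightarrow> \<Delta> x = r" "r > 0"
  shows "emeasure \<mu> {x \<in> space \<mu>. inv x \<in> C} = ennreal (inverse r) * emeasure \<mu> C"
proof -
  have h: "haar_group G \<mu>" by unfold_locales
  obtain B where B: "B \<in> sets \<mu>" "emeasure \<mu> B \<noteq> 0" "emeasure \<mu> B \<noteq> \<infinity>" by (rule finite_positive_set)
  have inner: "(\<integral>\<^sup>+y. indicator B (y \<otimes> x) \<partial>\<mu>) = ennreal (inverse (\<Delta> x)) * emeasure \<mu> B" if x: "x \<in> carrier G" for x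
    using scales_measure_nn_integral[OF scales_right[OF x], of "indicator B"] B(1) by simp
  have "(\<integral>\<^sup>+x. indicator C x * (\<integral>\<^sup>+y. indicator B (y \<otimes> x) \<partial>\<mu>) \<partial>\<mu>)
      = (\<integral>\<^sup>+x. (ennreal (inverse r) * emeasure \<mu> B) * indicator C x \<partial>\<mu>)"
  proof (rule nn_integral_cong)
    fix x assume "x \<in> space \<mu>"
    then show "indicator C x * (\<integral>\<^sup>+y. indicator B (y \<otimes> x) \<partial>\<mu>) = (ennreal (inverse r) * emeasure \<mu> B) * indicator C x"
      using inner[of x] r(1)[of x] by (cases "x \<in> C") (simp_all add: space_haar)
  qed
  also have "\<dots> = (ennreal (inverse r) * emeasure \<mu> B) * emeasure \<mu> C"
    using C by (simp add: nn_integral_cmult)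
  finally have "emeasure \<mu> B * (\<integral>\<^sup>+y. indicator C (inv y) \<partial>\<mu>) = (ennreal (inverse r) * emeasure \<mu> B) * emeasure \<mu> C"
    using haar_double_integral[OF h h refl, of "indicator C" "indicator B"] B(1) C by simp
  then have "emeasure \<mu> B * (\<integral>\<^sup>+y. indicator C (inv y) \<partial>\<mu>) = emeasure \<mu> B * (ennreal (inverse r) * emeasure \<mu> C)"
    by (simp add: ac_simps)
  then have "(\<integral>\<^sup>+y. indicator C (inv y) \<partial>\<mu>) = ennreal (inverse r) * emeasure \<mu> C"
    using B by (simp add: ennreal_mult_cancel_left)
  moreover have "(\<integral>\<^sup>+y. indicator C (inv y) \<partial>\<mu>) = (\<integral>\<^sup>+y. indicator {x \<in> space \<mu>. inv x \<in> C} y \<partial>\<mu>)"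
    by (rule nn_integral_cong) (simp add: indicator_def)
  moreover have "{x \<in> space \<mu>. inv x \<in> C} \<in> sets \<mu>"
    using measurable_sets[OF inv_measurable C] by (simp add: vimage_def Int_def conj_commute)
  ultimately show ?thesis by simp
qed

end

section \<open>Left and right translation operators\<close>

context haar_group
begin

definition right_translation :: "'a \<Rightarrow> 'a l2_op" where
  "right_translation g = pullback \<mu> (\<lambda>x. x \<otimes> inv g)"

abbreviation \<Lambda> :: "'a \<Rightarrow> 'a l2_op" where "\<Lambda> \<equiv> left_regular G \<mu>"
abbreviation left_operators :: "'a l2_op set" where "left_operators \<equiv> \<Lambda> ` carrier G"

lemma left_regular_pullback: "\<Lambda> g = pullback \<mu> (\<lambda>x. inv g \<otimes> x)"
  by (simp add: left_regular_def pullback_def)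

lemma scales_left_inv: "g \<in> carrier G \<Longrightarrow> scales_measure \<mu> (\<lambda>x. inv g \<otimes> x) 1"
  by (simp add: scales_left)

lemma scales_right_inv: "g \<in> carrier G \<Longrightarrow> scales_measure \<mu> (\<lambda>x. x \<otimes> inv g) (\<Delta> g)"
  using scales_right[of "inv g"] by (simp add: modular_inv)

lemma left_in: "g \<in> carrier G \<Longrightarrow> \<Lambda> g \<in> bounded_ops \<mu>"
  unfolding left_regular_pullback by (rule pullback_in[OF scales_left_inv])

lemma right_in: "g \<in> carrier G \<Longrightarrow> right_translation g \<in> bounded_ops \<mu>"
  unfolding right_translation_def by (rule pullback_in[OF scales_right_inv])

lemma left_left:
  assumes "g \<in> carrier G" "h \<in> carrier G" "X \<in> L2_space \<mu>"
  shows "\<Lambda> g (\<Lambda> h X) = \<Lambda> (g \<otimes> h) X"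
  unfolding left_regular_pullback pullback_pullback[OF scales_left_inv[OF assms(1)] scales_left_inv[OF assms(2)] assms(3)]
  by (rule pullback_cong[OF scales_left_inv])
    (use assms in \<open>simp_all add: space_haar inv_mult_group m_assoc\<close>)

lemma left_one: "X \<in> L2_space \<mu> \<Longrightarrow> \<Lambda> \<one> X = X"
  unfolding left_regular_pullback by (rule pullback_ident) (simp_all add: space_haar)

lemma left_inverse:
  assumes "g \<in> carrier G" "X \<in> L2_space \<mu>"
  shows "\<Lambda> g (\<Lambda> (inv g) X) = X" "\<Lambda> (inv g) (\<Lambda> g X) = X"
  using assms by (simp_all add: left_left left_one)

lemma left_inner:
  assumes "g \<in> carrier G" "X \<in> L2_space \<mu>" "Y \<in> L2_space \<mu>"
  shows "L2_inner \<mu> (\<Lambda> g X) (\<Lambda> g Y) = L2_inner \<mu> X Y"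
  unfolding left_regular_pullback using pullback_inner[OF scales_left_inv[OF assms(1)] assms(2,3)] by simp

lemma right_inner:
  assumes "g \<in> carrier G" "X \<in> L2_space \<mu>" "Y \<in> L2_space \<mu>"
  shows "L2_inner \<mu> (right_translation g X) (right_translation g Y) = of_real (\<Delta> g) * L2_inner \<mu> X Y"
  unfolding right_translation_def by (rule pullback_inner[OF scales_right_inv[OF assms(1)] assms(2,3)])

lemma right_inverse:
  assumes "g \<in> carrier G" "X \<in> L2_space \<mu>"
  shows "right_translation g (right_translation (inv g) X) = X"
    "right_translation (inv g) (right_translation g X) = X"
proof -
  have *: "right_translation a (right_translation (inv a) X) = X" if a: "a \<in> carrier G" for a
    unfolding right_translation_def pullback_pullback[OF scales_right_inv[OF a] scales_right_inv[OF inv_closed[OF a]] assms(2)]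
    by (rule pullback_ident[OF assms(2)]) (use a in \<open>simp add: space_haar m_assoc\<close>)
  show "right_translation g (right_translation (inv g) X) = X" by (rule *[OF assms(1)])
  show "right_translation (inv g) (right_translation g X) = X" using *[of "inv g"] assms(1) by simp
qed

lemma left_right:
  assumes g: "g \<in> carrier G" and h: "h \<in> carrier G" and X: "X \<in> L2_space \<mu>"
  shows "right_translation h (\<Lambda> g X) = \<Lambda> g (right_translation h X)"
proof -
  note sl = scales_left_inv[OF g] and sr = scales_right_inv[OF h]
  have "scales_measure \<mu> (\<lambda>x. inv g \<otimes> x \<otimes> inv h) (\<Delta> h)"
  proof -
    have "distr \<mu> \<mu> (\<lambda>x. inv g \<otimes> x \<otimes> inv h) = distr (distr \<mu> \<mu> (\<lambda>x. inv g \<otimes> x)) \<mu> (\<lambda>x. x \<otimes> inv h)"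
      using g h by (subst distr_distr) (simp_all add: translate_measurable comp_def)
    also have "distr \<mu> \<mu> (\<lambda>x. inv g \<otimes> x) = \<mu>"
      unfolding scales_measure_distr[OF sl] by (simp add: density_1)
    finally have eq: "distr \<mu> \<mu> (\<lambda>x. inv g \<otimes> x \<otimes> inv h) = distr \<mu> \<mu> (\<lambda>x. x \<otimes> inv h)" .
    have m: "(\<lambda>x. inv g \<otimes> x \<otimes> inv h) \<in> measurable \<mu> \<mu>" using g h by measurable
    show ?thesis
      using sr emeasure_distr[OF m] emeasure_distr[OF scales_measure_measurable[OF sr]] m eq
      by (simp add: scales_measure_def)
  qed
  then show ?thesis
    unfolding left_regular_pullback right_translation_def pullback_pullback[OF sl sr X] pullback_pullback[OF sr sl X]
    by (rule pullback_cong[OF _ _ X]) (use g h in \<open>simp add: space_haar m_assoc\<close>)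
qed

lemma left_operators_bounded: "left_operators \<subseteq> bounded_ops \<mu>"
  using left_in by auto

lemma left_adjoint: "g \<in> carrier G \<Longrightarrow> op_adjoint \<mu> (\<Lambda> g) = \<Lambda> (inv g)"
proof (rule op_adjoint_eqI)
  fix X Y assume g: "g \<in> carrier G" and X: "X \<in> L2_space \<mu>" and Y: "Y \<in> L2_space \<mu>"
  have "L2_inner \<mu> (\<Lambda> g (\<Lambda> (inv g) X)) (\<Lambda> g Y) = L2_inner \<mu> (\<Lambda> (inv g) X) Y"
    by (rule left_inner[OF g bounded_ops_in[OF left_in[OF inv_closed[OF g]] X] Y])
  then show "L2_inner \<mu> (\<Lambda> (inv g) X) Y = L2_inner \<mu> X (\<Lambda> g Y)"
    by (simp add: left_inverse(1)[OF g X])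
qed (simp_all add: left_in)

lemma left_operators_adjoint: "S \<in> left_operators \<Longrightarrow> op_adjoint \<mu> S \<in> left_operators"
  by (auto simp: left_adjoint)

lemma op_id_left_operators: "op_id \<mu> \<in> left_operators"
proof -
  have "op_id \<mu> = \<Lambda> \<one>"
    by (rule bounded_ops_ext[OF op_id_in left_in]) (simp_all add: left_one op_id_def)
  then show ?thesis by simp
qed

lemma right_commutant: "g \<in> carrier G \<Longrightarrow> right_translation g \<in> commutant \<mu> left_operators"
  by (rule commutantI[OF right_in left_operators_bounded]) (auto simp: left_right)

section \<open>Rotation of convolution products\<close>

definition inverse_set :: "'a set \<Rightarrow> 'a set" where
  "inverse_set A = {x \<in> space \<mu>. inv x \<in> A}"

lemma inverse_set_inverse_set: "A \<in> sets \<mu> \<Longrightarrow> inverse_set (inverse_set A) = A"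
  using sets_carrier[of A] by (auto simp: inverse_set_def space_haar)

definition level_set :: "real \<Rightarrow> 'a set \<Rightarrow> bool" where
  "level_set r A \<longleftrightarrow> A \<in> sets \<mu> \<and> emeasure \<mu> A < \<infinity> \<and> 0 < r \<and> (\<forall>x\<in>A. \<Delta> x = r)"

lemma level_set_inverse:
  assumes "level_set r A"
  shows "level_set (inverse r) (inverse_set A)"
proof -
  have "inverse_set A = (\<lambda>x. inv x) -` A \<inter> space \<mu>" by (auto simp: inverse_set_def)
  moreover have "A \<in> sets \<mu>" using assms by (simp add: level_set_def)
  ultimately have "inverse_set A \<in> sets \<mu>" using measurable_sets[OF inv_measurable, of A] by argo
  moreover have "emeasure \<mu> (inverse_set A) < \<infinity>"
    unfolding inverse_set_def using assms
    by (subst emeasure_inverse[of A r]) (auto simp: level_set_def ennreal_mult_less_top)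
  moreover have "\<Delta> x = inverse r" if "x \<in> inverse_set A" for x
    using that assms modular_inv[of x] by (auto simp: inverse_set_def level_set_def space_haar)
  ultimately show ?thesis using assms by (simp add: level_set_def)
qed

definition ind :: "'a set \<Rightarrow> 'a l2" where
  "ind A = L2_class \<mu> (indicator A)"

lemma ind_fun:
  assumes "A \<in> sets \<mu>" "emeasure \<mu> A < \<infinity>"
  shows "(indicator A :: 'a \<Rightarrow> complex) \<in> L2_fun \<mu>"
proof -
  have "(\<integral>\<^sup>+x. ennreal ((cmod (indicator A x))\<^sup>2) \<partial>\<mu>) = (\<integral>\<^sup>+x. indicator A x \<partial>\<mu>)"
    by (rule nn_integral_cong) (simp add: indicator_def)
  then show ?thesis using assms by (simp add: L2_fun_iff)
qed

lemma ind_in: "level_set r A \<Longrightarrow> ind A \<in> L2_space \<mu>"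
  unfolding ind_def level_set_def by (intro L2_class_in ind_fun) auto

interpretation sigma_finite_measure \<mu> by (rule sigma_finite_haar)
interpretation pair_sigma_finite \<mu> \<mu> by unfold_locales

text \<open>
  On \<open>E\<close> the bound \<open>|g| \<le> |g|\<^sup>2 + 1\<close> applies, and the sections of \<open>E\<close> over \<open>A\<close> have bounded measure.
\<close>

lemma integrable_indicator_pair:
  fixes g :: "'a \<Rightarrow> complex"
  assumes g: "g \<in> L2_fun \<mu>" and A: "A \<in> sets \<mu>" "emeasure \<mu> A < \<infinity>" and E: "E \<in> sets (\<mu> \<Otimes>\<^sub>M \<mu>)"
    and D: "\<And>y. y \<in> A \<Longrightarrow> emeasure \<mu> {w \<in> space \<mu>. (y, w) \<in> E} \<le> ennreal D"
  shows "integrable (\<mu> \<Otimes>\<^sub>M \<mu>) (\<lambda>(y, w). indicator A y * (g w * indicator E (y, w)))"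
proof (rule integrableI_bounded)
  have [measurable]: "g \<in> borel_measurable \<mu>" "A \<in> sets \<mu>" "E \<in> sets (\<mu> \<Otimes>\<^sub>M \<mu>)"
    using g A E by (simp_all add: L2_fun_measurable)
  show meas: "(\<lambda>(y, w). indicator A y * (g w * indicator E (y, w))) \<in> borel_measurable (\<mu> \<Otimes>\<^sub>M \<mu>)"
    by measurable
  define N where "N = (\<integral>\<^sup>+w. ennreal ((cmod (g w))\<^sup>2) \<partial>\<mu>)"
  have N: "N < \<infinity>" using g by (simp add: N_def L2_fun_iff)
  have "(\<integral>\<^sup>+p. ennreal (norm (case p of (y, w) \<Rightarrow> indicator A y * (g w * indicator E (y, w)))) \<partial>(\<mu> \<Otimes>\<^sub>M \<mu>))
      = (\<integral>\<^sup>+y. (\<integral>\<^sup>+w. ennreal (norm (indicator A y * (g w * indicator E (y, w)))) \<partial>\<mu>) \<partial>\<mu>)"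
    using sigma_finite_measure.nn_integral_fst[OF sigma_finite_haar, of "\<lambda>p. ennreal (norm (indicator A (fst p) * (g (snd p) * indicator E p)))" \<mu>]
    by (simp add: case_prod_beta)
  also have "\<dots> \<le> (\<integral>\<^sup>+y. (N + ennreal D) * indicator A y \<partial>\<mu>)"
  proof (rule nn_integral_mono)
    fix y assume y: "y \<in> space \<mu>"
    show "(\<integral>\<^sup>+w. ennreal (norm (indicator A y * (g w * indicator E (y, w)))) \<partial>\<mu>) \<le> (N + ennreal D) * indicator A y"
    proof (cases "y \<in> A")
      case True
      have le: "t \<le> t\<^sup>2 + 1" for t :: real
      proof -
        have "0 \<le> (t - 1)\<^sup>2 + t\<^sup>2" by simp
        then show ?thesis by (simp add: power2_diff)
      qed
      have "(\<integral>\<^sup>+w. ennreal (norm (indicator A y * (g w * indicator E (y, w)))) \<partial>\<mu>)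
          \<le> (\<integral>\<^sup>+w. ennreal ((cmod (g w))\<^sup>2) + indicator {w \<in> space \<mu>. (y, w) \<in> E} w \<partial>\<mu>)"
      proof (rule nn_integral_mono)
        fix w assume w: "w \<in> space \<mu>"
        show "ennreal (norm (indicator A y * (g w * indicator E (y, w))))
            \<le> ennreal ((cmod (g w))\<^sup>2) + indicator {w \<in> space \<mu>. (y, w) \<in> E} w"
        proof (cases "(y, w) \<in> E")
          case True
          then have "ennreal (norm (indicator A y * (g w * indicator E (y, w)))) \<le> ennreal ((cmod (g w))\<^sup>2 + 1)"
            using le[of "cmod (g w)"] by (intro ennreal_leI) (simp add: \<open>y \<in> A\<close>)
          then show ?thesis using True w by simp
        qed simp
      qed
      also have "\<dots> = N + emeasure \<mu> {w \<in> space \<mu>. (y, w) \<in> E}"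
        using y by (subst nn_integral_add) (simp_all add: N_def)
      also have "\<dots> \<le> N + ennreal D" using D[OF True] by (rule add_left_mono)
      finally show ?thesis using True by simp
    qed simp
  qed
  also have "\<dots> = (N + ennreal D) * emeasure \<mu> A" by (simp add: nn_integral_cmult)
  also have "\<dots> < \<infinity>" using N A by (simp add: ennreal_mult_less_top)
  finally show "(\<integral>\<^sup>+p. ennreal (norm (case p of (y, w) \<Rightarrow> indicator A y * (g w * indicator E (y, w)))) \<partial>(\<mu> \<Otimes>\<^sub>M \<mu>)) < \<infinity>" .
qed

lemma Fubini_indicator:
  fixes g :: "'a \<Rightarrow> complex"
  assumes g: "g \<in> L2_fun \<mu>" and A: "A \<in> sets \<mu>" "emeasure \<mu> A < \<infinity>" and E: "E \<in> sets (\<mu> \<Otimes>\<^sub>M \<mu>)"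
    and D: "\<And>y. y \<in> A \<Longrightarrow> emeasure \<mu> {w \<in> space \<mu>. (y, w) \<in> E} \<le> ennreal D"
  shows "(\<integral>y. indicator A y * (\<integral>w. g w * indicator E (y, w) \<partial>\<mu>) \<partial>\<mu>)
    = (\<integral>w. g w * (\<integral>y. indicator A y * indicator E (y, w) \<partial>\<mu>) \<partial>\<mu>)"
proof -
  note int = integrable_indicator_pair[OF assms]
  have "(\<integral>y. indicator A y * (\<integral>w. g w * indicator E (y, w) \<partial>\<mu>) \<partial>\<mu>)
      = (\<integral>y. (\<integral>w. indicator A y * (g w * indicator E (y, w)) \<partial>\<mu>) \<partial>\<mu>)"
    by simp
  also have "\<dots> = (\<integral>w. (\<integral>y. indicator A y * (g w * indicator E (y, w)) \<partial>\<mu>) \<partial>\<mu>)"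
    by (rule Fubini_integral[OF int, symmetric])
  also have "\<dots> = (\<integral>w. (\<integral>y. g w * (indicator A y * indicator E (y, w)) \<partial>\<mu>) \<partial>\<mu>)"
    by (simp add: mult.left_commute)
  finally show ?thesis by simp
qed

lemma level_set_translate_measure:
  assumes r: "level_set r A" and g: "g \<in> carrier G"
  shows "emeasure \<mu> {w \<in> space \<mu>. g \<otimes> w \<in> A} = emeasure \<mu> A"
    and "emeasure \<mu> {w \<in> space \<mu>. w \<otimes> g \<in> A} = ennreal (inverse (\<Delta> g)) * emeasure \<mu> A"
proof -
  have A: "A \<in> sets \<mu>" using r by (simp add: level_set_def)
  have "{w \<in> space \<mu>. g \<otimes> w \<in> A} = (\<lambda>w. g \<otimes> w) -` A \<inter> space \<mu>"
    "{w \<in> space \<mu>. w \<otimes> g \<in> A} = (\<lambda>w. w \<otimes> g) -` A \<inter> space \<mu>" by auto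
  then show "emeasure \<mu> {w \<in> space \<mu>. g \<otimes> w \<in> A} = emeasure \<mu> A"
    "emeasure \<mu> {w \<in> space \<mu>. w \<otimes> g \<in> A} = ennreal (inverse (\<Delta> g)) * emeasure \<mu> A"
    using scales_left[OF g] scales_right[OF g] A by (simp_all add: scales_measure_def)
qed

text \<open>
  Formally this is the matrix coefficient of \<open>x\<close> at \<open>1\<^sub>A * 1\<^sub>B\<close> and \<open>1\<^sub>C\<close>. For the
  Plancherel weight \<open>\<phi>\<close> of the group it equals \<open>\<phi> (C\<^sup>* x A B)\<close>, and the modular property of \<open>\<phi>\<close>
  allows the three factors to be rotated at the price of a scalar.
\<close>

definition convolution_form :: "'a l2_op \<Rightarrow> 'a set \<Rightarrow> 'a set \<Rightarrow> 'a set \<Rightarrow> complex" where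
  "convolution_form x A B C
    = (\<integral>y. indicator A y * L2_inner \<mu> (op_adjoint \<mu> x (ind C)) (\<Lambda> y (ind B)) \<partial>\<mu>)"

lemma left_ind:
  assumes A: "level_set r A" and g: "g \<in> carrier G"
  shows "\<Lambda> g (ind A) = L2_class \<mu> (\<lambda>w. indicator A (inv g \<otimes> w))"
    and "(\<lambda>w. indicator A (inv g \<otimes> w) :: complex) \<in> L2_fun \<mu>"
proof -
  have A': "indicator A \<in> L2_fun \<mu>" using A by (intro ind_fun) (auto simp: level_set_def)
  show "\<Lambda> g (ind A) = L2_class \<mu> (\<lambda>w. indicator A (inv g \<otimes> w))"
    unfolding left_regular_pullback ind_def by (rule pullback_class[OF scales_left_inv[OF g] A'])
  show "(\<lambda>w. indicator A (inv g \<otimes> w) :: complex) \<in> L2_fun \<mu>" by (rule pullback_fun[OF scales_left_inv[OF g] A'])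
qed

lemma right_ind:
  assumes A: "level_set r A" and g: "g \<in> carrier G"
  shows "right_translation g (ind A) = L2_class \<mu> (\<lambda>w. indicator A (w \<otimes> inv g))"
    and "(\<lambda>w. indicator A (w \<otimes> inv g) :: complex) \<in> L2_fun \<mu>"
proof -
  have A': "indicator A \<in> L2_fun \<mu>" using A by (intro ind_fun) (auto simp: level_set_def)
  show "right_translation g (ind A) = L2_class \<mu> (\<lambda>w. indicator A (w \<otimes> inv g))"
    unfolding right_translation_def ind_def by (rule pullback_class[OF scales_right_inv[OF g] A'])
  show "(\<lambda>w. indicator A (w \<otimes> inv g) :: complex) \<in> L2_fun \<mu>" by (rule pullback_fun[OF scales_right_inv[OF g] A'])
qed

lemma inner_class_left:
  assumes f: "f \<in> L2_fun \<mu>" and X: "X \<in> L2_space \<mu>"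
  shows "L2_inner \<mu> (L2_class \<mu> f) X = (\<integral>w. cnj (f w) * L2_rep X w \<partial>\<mu>)"
    and "L2_inner \<mu> X (L2_class \<mu> f) = (\<integral>w. cnj (L2_rep X w) * f w \<partial>\<mu>)"
  by (rule L2_inner_cong;
      use f X in \<open>simp add: L2_class_in L2_rep_class L2_fun_measurable L2_space_measurable\<close>)+

lemma convolution_form_left:
  assumes x: "x \<in> bounded_ops \<mu>" and x_left: "\<forall>g\<in>carrier G. \<forall>X\<in>L2_space \<mu>. x (\<Lambda> g X) = \<Lambda> g (x X)"
    and B: "level_set q B" and C: "level_set r C" and y: "y \<in> carrier G"
  shows "L2_inner \<mu> (op_adjoint \<mu> x (ind C)) (\<Lambda> y (ind B))
    = (\<integral>w. L2_rep (x (ind B)) w * indicator C (y \<otimes> w) \<partial>\<mu>)"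
proof -
  note iB = ind_in[OF B] and iC = ind_in[OF C]
  note xB = bounded_ops_in[OF x iB] and iy = inv_closed[OF y]
  have "L2_inner \<mu> (op_adjoint \<mu> x (ind C)) (\<Lambda> y (ind B)) = L2_inner \<mu> (\<Lambda> y (\<Lambda> (inv y) (ind C))) (\<Lambda> y (x (ind B)))"
    unfolding op_adjoint_inner[OF x iC bounded_ops_in[OF left_in[OF y] iB]] x_left[rule_format, OF y iB] left_inverse(1)[OF y iC] ..
  also have "\<dots> = L2_inner \<mu> (\<Lambda> (inv y) (ind C)) (x (ind B))"
    by (rule left_inner[OF y bounded_ops_in[OF left_in[OF iy] iC] xB])
  also have "\<dots> = (\<integral>w. cnj (indicator C (inv (inv y) \<otimes> w)) * L2_rep (x (ind B)) w \<partial>\<mu>)"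
    unfolding left_ind(1)[OF C iy] by (rule inner_class_left(1)[OF left_ind(2)[OF C iy] xB])
  also have "\<dots> = (\<integral>w. L2_rep (x (ind B)) w * indicator C (y \<otimes> w) \<partial>\<mu>)"
    using y by (intro Bochner_Integration.integral_cong) (simp_all add: indicator_def)
  finally show ?thesis .
qed

text \<open>
  Both sides are computed by Fubini; left and right translations by elements of the group move
  the operator \<open>x\<close> out of the way.
\<close>

lemma convolution_form_rotate:
  assumes x: "x \<in> bounded_ops \<mu>" and x_left: "\<forall>g\<in>carrier G. \<forall>X\<in>L2_space \<mu>. x (\<Lambda> g X) = \<Lambda> g (x X)"
    and x_right: "\<forall>g\<in>carrier G. \<forall>X\<in>L2_space \<mu>. x (right_translation g X) = right_translation g (x X)"
    and A: "level_set p A" and B: "level_set q B" and C: "level_set r C"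
  shows "convolution_form x A B C = of_real p * convolution_form x B (inverse_set C) (inverse_set A)"
proof -
  note A' = level_set_inverse[OF A] and C' = level_set_inverse[OF C]
  have sets [measurable]: "A \<in> sets \<mu>" "B \<in> sets \<mu>" "C \<in> sets \<mu>"
    and fin: "emeasure \<mu> A < \<infinity>" "emeasure \<mu> B < \<infinity>" "emeasure \<mu> C < \<infinity>"
    and pos: "p > 0" "q > 0" "r > 0"
    and val: "\<And>a. a \<in> A \<Longrightarrow> \<Delta> a = p" "\<And>c. c \<in> C \<Longrightarrow> \<Delta> c = r"
    using A B C by (auto simp: level_set_def)
  have carr: "\<And>a. a \<in> A \<Longrightarrow> a \<in> carrier G" "\<And>b. b \<in> B \<Longrightarrow> b \<in> carrier G" "\<And>c. c \<in> C \<Longrightarrow> c \<in> carrier G"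
    using sets sets_carrier by blast+
  have enn: "t = ennreal (enn2real t)" if "t < \<infinity>" for t using that by simp
  define \<eta> where "\<eta> = L2_rep (x (ind B))"
  define \<zeta> where "\<zeta> w = cnj (L2_rep (op_adjoint \<mu> x (ind (inverse_set A))) w)" for w
  note x' = op_adjoint_in[OF x]
  have \<eta>: "\<eta> \<in> L2_fun \<mu>" unfolding \<eta>_def by (rule L2_rep_in[OF bounded_ops_in[OF x ind_in[OF B]]])
  have \<zeta>: "\<zeta> \<in> L2_fun \<mu>"
    using L2_rep_in[OF bounded_ops_in[OF x' ind_in[OF A']]] unfolding \<zeta>_def L2_fun_def
    by (auto intro: measurable_compose[OF _ borel_measurable_cnj])
  \<comment> \<open>The supports of the four integrands through which the computation passes.\<close>
  define E1 where "E1 = {p \<in> space (\<mu> \<Otimes>\<^sub>M \<mu>). fst p \<otimes> snd p \<in> C}"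
  define E2 where "E2 = {p \<in> space (\<mu> \<Otimes>\<^sub>M \<mu>). fst p \<otimes> inv (snd p) \<in> A}"
  define E3 where "E3 = {p \<in> space (\<mu> \<Otimes>\<^sub>M \<mu>). snd p \<otimes> fst p \<in> B}"
  define E4 where "E4 = {p \<in> space (\<mu> \<Otimes>\<^sub>M \<mu>). inv (snd p) \<otimes> fst p \<in> C}"
  have E [measurable]: "E1 \<in> sets (\<mu> \<Otimes>\<^sub>M \<mu>)" "E2 \<in> sets (\<mu> \<Otimes>\<^sub>M \<mu>)" "E3 \<in> sets (\<mu> \<Otimes>\<^sub>M \<mu>)" "E4 \<in> sets (\<mu> \<Otimes>\<^sub>M \<mu>)"
    unfolding E1_def E2_def E3_def E4_def by measurable
  have ind_E: "(indicator E1 (y, w) :: complex) = indicator C (y \<otimes> w)"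
    "(indicator E2 (y, w) :: complex) = indicator A (y \<otimes> inv w)"
    "(indicator E3 (y, w) :: complex) = indicator B (w \<otimes> y)"
    "(indicator E4 (y, w) :: complex) = indicator C (inv w \<otimes> y)"
    if "y \<in> carrier G" "w \<in> carrier G" for y w
    using that by (simp_all add: E1_def E2_def E3_def E4_def indicator_def space_pair_measure space_haar)
  have inv_ind: "(indicator (inverse_set S) w :: complex) = indicator S (inv w)" if "w \<in> carrier G" for S w
    using that by (simp add: inverse_set_def indicator_def space_haar)
  have cnj_ind: "cnj (indicator S w) = indicator S w" for S and w :: 'a by (simp add: indicator_def)
  have "convolution_form x A B C = (\<integral>y. indicator A y * (\<integral>w. \<eta> w * indicator E1 (y, w) \<partial>\<mu>) \<partial>\<mu>)"
    unfolding convolution_form_def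
  proof (rule Bochner_Integration.integral_cong[OF refl])
    fix y assume "y \<in> space \<mu>"
    then have y: "y \<in> carrier G" by (simp add: space_haar)
    have "(\<integral>w. \<eta> w * indicator C (y \<otimes> w) \<partial>\<mu>) = (\<integral>w. \<eta> w * indicator E1 (y, w) \<partial>\<mu>)"
      by (rule Bochner_Integration.integral_cong) (simp_all add: ind_E y space_haar)
    then show "indicator A y * L2_inner \<mu> (op_adjoint \<mu> x (ind C)) (\<Lambda> y (ind B))
        = indicator A y * (\<integral>w. \<eta> w * indicator E1 (y, w) \<partial>\<mu>)"
      using convolution_form_left[OF x x_left B C y] by (simp add: \<eta>_def)
  qed
  also have "\<dots> = (\<integral>w. \<eta> w * (\<integral>y. indicator A y * indicator E1 (y, w) \<partial>\<mu>) \<partial>\<mu>)"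
  proof (rule Fubini_indicator[OF \<eta> sets(1) fin(1) E(1)])
    fix y assume y: "y \<in> A"
    then have "{w \<in> space \<mu>. (y, w) \<in> E1} = {w \<in> space \<mu>. y \<otimes> w \<in> C}"
      using carr by (auto simp: E1_def space_pair_measure space_haar)
    then show "emeasure \<mu> {w \<in> space \<mu>. (y, w) \<in> E1} \<le> ennreal (enn2real (emeasure \<mu> C))"
      using level_set_translate_measure(1)[OF C carr(1)[OF y]] enn[OF fin(3)] by simp
  qed
  also have "\<dots> = (\<integral>w. \<eta> w * (of_real (p / r) * (\<integral>y. indicator C y * indicator E2 (y, w) \<partial>\<mu>)) \<partial>\<mu>)"
  proof (rule Bochner_Integration.integral_cong[OF refl])
    fix w assume "w \<in> space \<mu>"
    then have w: "w \<in> carrier G" by (simp add: space_haar)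
    define f :: "'a \<Rightarrow> complex" where "f y = indicator A (y \<otimes> inv w) * indicator C y" for y
    have [measurable]: "f \<in> borel_measurable \<mu>" unfolding f_def using w by measurable
    have "(\<integral>y. indicator A y * indicator E1 (y, w) \<partial>\<mu>) = (\<integral>y. f (y \<otimes> w) \<partial>\<mu>)"
      using w by (intro Bochner_Integration.integral_cong) (simp_all add: f_def ind_E space_haar m_assoc)
    also have "\<dots> = of_real (inverse (\<Delta> w)) * (\<integral>y. f y \<partial>\<mu>)"
      by (rule scales_measure_integral[OF scales_right[OF w]]) measurable
    also have "(\<integral>y. f y \<partial>\<mu>) = (\<integral>y. indicator C y * indicator E2 (y, w) \<partial>\<mu>)"
      using w by (intro Bochner_Integration.integral_cong) (simp_all add: f_def ind_E space_haar)
    \<comment> \<open>Where the integrand is nonzero, \<open>\<Delta> w = r / p\<close>.\<close>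
    also have "of_real (inverse (\<Delta> w)) * \<dots> = of_real (p / r) * (\<integral>y. indicator C y * indicator E2 (y, w) \<partial>\<mu>)"
    proof (cases "inverse (\<Delta> w) = p / r")
      case False
      have "indicator C y * indicator E2 (y, w) = (0 :: complex)" if y: "y \<in> space \<mu>" for y
      proof (rule ccontr)
        assume "indicator C y * indicator E2 (y, w) \<noteq> (0 :: complex)"
        then have "y \<in> C" "y \<otimes> inv w \<in> A" by (auto simp: E2_def indicator_def split: if_splits)
        then have "p = r * inverse (\<Delta> w)"
          using modular_mult[of y "inv w"] modular_inv[OF w] val carr w by auto
        then show False using False pos by (simp add: field_simps)
      qed
      then have "(\<integral>y. indicator C y * indicator E2 (y, w) \<partial>\<mu>) = (\<integral>y. 0 \<partial>\<mu> :: complex)"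
        by (intro Bochner_Integration.integral_cong) simp_all
      then show ?thesis by simp
    qed simp
    finally show "\<eta> w * (\<integral>y. indicator A y * indicator E1 (y, w) \<partial>\<mu>)
        = \<eta> w * (of_real (p / r) * (\<integral>y. indicator C y * indicator E2 (y, w) \<partial>\<mu>))" by simp
  qed
  also have "\<dots> = of_real (p / r) * (\<integral>w. \<eta> w * (\<integral>y. indicator C y * indicator E2 (y, w) \<partial>\<mu>) \<partial>\<mu>)"
    unfolding mult.left_commute[of "\<eta> _" "of_real (p / r)"] by simp
  also have "(\<integral>w. \<eta> w * (\<integral>y. indicator C y * indicator E2 (y, w) \<partial>\<mu>) \<partial>\<mu>)
      = (\<integral>y. indicator C y * (\<integral>w. \<eta> w * indicator E2 (y, w) \<partial>\<mu>) \<partial>\<mu>)"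
  proof (rule Fubini_indicator[OF \<eta> sets(3) fin(3) E(2), symmetric])
    fix y assume y: "y \<in> C"
    have "{w \<in> space \<mu>. (y, w) \<in> E2} = {w \<in> space \<mu>. w \<otimes> inv y \<in> inverse_set A}"
      using carr(3)[OF y] by (auto simp: E2_def inverse_set_def space_pair_measure space_haar inv_mult_group)
    then have "emeasure \<mu> {w \<in> space \<mu>. (y, w) \<in> E2} = ennreal (inverse (\<Delta> (inv y))) * emeasure \<mu> (inverse_set A)"
      using level_set_translate_measure(2)[OF A' inv_closed[OF carr(3)[OF y]]] by simp
    also have "\<dots> = ennreal r * emeasure \<mu> (inverse_set A)"
      using modular_inv[OF carr(3)[OF y]] val(2)[OF y] by simp
    also have "\<dots> = ennreal (enn2real (ennreal r * emeasure \<mu> (inverse_set A)))"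
      using A' by (intro enn) (simp add: ennreal_mult_less_top level_set_def)
    finally show "emeasure \<mu> {w \<in> space \<mu>. (y, w) \<in> E2} \<le> ennreal (enn2real (ennreal r * emeasure \<mu> (inverse_set A)))"
      by simp
  qed
  also have "\<dots> = (\<integral>y. of_real r * (indicator C y * (\<integral>w. \<zeta> w * indicator E3 (y, w) \<partial>\<mu>)) \<partial>\<mu>)"
  proof (rule Bochner_Integration.integral_cong[OF refl])
    fix y assume "y \<in> space \<mu>"
    then have y: "y \<in> carrier G" and iy: "inv y \<in> carrier G" by (simp_all add: space_haar)
    note iA = ind_in[OF A'] and iB = ind_in[OF B]
    note xB = bounded_ops_in[OF x iB] and RB = bounded_ops_in[OF right_in[OF iy] iB]
    have "(\<integral>w. \<eta> w * indicator E2 (y, w) \<partial>\<mu>)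
        = (\<integral>w. cnj (indicator (inverse_set A) (w \<otimes> inv y)) * L2_rep (x (ind B)) w \<partial>\<mu>)"
      using y by (intro Bochner_Integration.integral_cong)
        (simp_all add: ind_E inv_ind cnj_ind space_haar \<eta>_def inv_mult_group)
    also have "\<dots> = L2_inner \<mu> (right_translation y (ind (inverse_set A))) (x (ind B))"
      unfolding right_ind(1)[OF A' y] by (rule inner_class_left(1)[OF right_ind(2)[OF A' y] xB, symmetric])
    also have "\<dots> = L2_inner \<mu> (right_translation y (ind (inverse_set A))) (right_translation y (right_translation (inv y) (x (ind B))))"
      by (simp add: right_inverse(1)[OF y xB])
    also have "\<dots> = of_real (\<Delta> y) * L2_inner \<mu> (ind (inverse_set A)) (right_translation (inv y) (x (ind B)))"
      by (rule right_inner[OF y iA bounded_ops_in[OF right_in[OF iy] xB]])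
    also have "L2_inner \<mu> (ind (inverse_set A)) (right_translation (inv y) (x (ind B)))
        = L2_inner \<mu> (op_adjoint \<mu> x (ind (inverse_set A))) (right_translation (inv y) (ind B))"
      by (simp add: x_right[rule_format, OF iy iB, symmetric] op_adjoint_inner[OF x iA RB])
    also have "\<dots> = (\<integral>w. cnj (L2_rep (op_adjoint \<mu> x (ind (inverse_set A))) w) * indicator B (w \<otimes> inv (inv y)) \<partial>\<mu>)"
      unfolding right_ind(1)[OF B iy]
      by (rule inner_class_left(2)[OF right_ind(2)[OF B iy] bounded_ops_in[OF x' iA]])
    also have "\<dots> = (\<integral>w. \<zeta> w * indicator E3 (y, w) \<partial>\<mu>)"
      using y by (intro Bochner_Integration.integral_cong) (simp_all add: ind_E space_haar \<zeta>_def)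
    finally show "indicator C y * (\<integral>w. \<eta> w * indicator E2 (y, w) \<partial>\<mu>)
        = of_real r * (indicator C y * (\<integral>w. \<zeta> w * indicator E3 (y, w) \<partial>\<mu>))"
      using val(2)[of y] by (cases "y \<in> C") simp_all
  qed
  also have "\<dots> = of_real r * (\<integral>y. indicator C y * (\<integral>w. \<zeta> w * indicator E3 (y, w) \<partial>\<mu>) \<partial>\<mu>)" by simp
  also have "(\<integral>y. indicator C y * (\<integral>w. \<zeta> w * indicator E3 (y, w) \<partial>\<mu>) \<partial>\<mu>)
      = (\<integral>w. \<zeta> w * (\<integral>y. indicator C y * indicator E3 (y, w) \<partial>\<mu>) \<partial>\<mu>)"
  proof (rule Fubini_indicator[OF \<zeta> sets(3) fin(3) E(3)])
    fix y assume y: "y \<in> C"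
    have "{w \<in> space \<mu>. (y, w) \<in> E3} = {w \<in> space \<mu>. w \<otimes> y \<in> B}"
      using carr(3)[OF y] by (auto simp: E3_def space_pair_measure space_haar)
    then have "emeasure \<mu> {w \<in> space \<mu>. (y, w) \<in> E3} = ennreal (inverse r) * emeasure \<mu> B"
      using level_set_translate_measure(2)[OF B carr(3)[OF y]] val(2)[OF y] by simp
    also have "\<dots> = ennreal (enn2real (ennreal (inverse r) * emeasure \<mu> B))"
      using fin by (intro enn) (simp add: ennreal_mult_less_top)
    finally show "emeasure \<mu> {w \<in> space \<mu>. (y, w) \<in> E3} \<le> ennreal (enn2real (ennreal (inverse r) * emeasure \<mu> B))"
      by simp
  qed
  also have "\<dots> = (\<integral>w. \<zeta> w * (\<integral>y. indicator B y * indicator E4 (y, w) \<partial>\<mu>) \<partial>\<mu>)"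
  proof (rule Bochner_Integration.integral_cong[OF refl])
    fix w assume "w \<in> space \<mu>"
    then have w: "w \<in> carrier G" by (simp add: space_haar)
    define f :: "'a \<Rightarrow> complex" where "f y = indicator B y * indicator C (inv w \<otimes> y)" for y
    have [measurable]: "f \<in> borel_measurable \<mu>" unfolding f_def using w by measurable
    have "(\<integral>y. indicator C y * indicator E3 (y, w) \<partial>\<mu>) = (\<integral>y. f (w \<otimes> y) \<partial>\<mu>)"
      using w by (intro Bochner_Integration.integral_cong) (simp_all add: f_def ind_E space_haar m_assoc[symmetric])
    also have "\<dots> = of_real 1 * (\<integral>y. f y \<partial>\<mu>)"
      by (rule scales_measure_integral[OF scales_left[OF w]]) measurable
    also have "\<dots> = (\<integral>y. indicator B y * indicator E4 (y, w) \<partial>\<mu>)"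
      using w unfolding of_real_1 mult_1_left
      by (intro Bochner_Integration.integral_cong) (simp_all add: f_def ind_E space_haar)
    finally show "\<zeta> w * (\<integral>y. indicator C y * indicator E3 (y, w) \<partial>\<mu>)
        = \<zeta> w * (\<integral>y. indicator B y * indicator E4 (y, w) \<partial>\<mu>)" by simp
  qed
  also have "\<dots> = (\<integral>y. indicator B y * (\<integral>w. \<zeta> w * indicator E4 (y, w) \<partial>\<mu>) \<partial>\<mu>)"
  proof (rule Fubini_indicator[OF \<zeta> sets(2) fin(2) E(4), symmetric])
    fix y assume y: "y \<in> B"
    have "{w \<in> space \<mu>. (y, w) \<in> E4} = {w \<in> space \<mu>. inv y \<otimes> w \<in> inverse_set C}"
      using carr(2)[OF y] by (auto simp: E4_def inverse_set_def space_pair_measure space_haar inv_mult_group)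
    then show "emeasure \<mu> {w \<in> space \<mu>. (y, w) \<in> E4} \<le> ennreal (enn2real (emeasure \<mu> (inverse_set C)))"
      using level_set_translate_measure(1)[OF C' inv_closed[OF carr(2)[OF y]]] C'
        enn[of "emeasure \<mu> (inverse_set C)"] by (simp add: level_set_def)
  qed
  also have "\<dots> = convolution_form x B (inverse_set C) (inverse_set A)"
    unfolding convolution_form_def
  proof (rule Bochner_Integration.integral_cong[OF refl])
    fix y assume "y \<in> space \<mu>"
    then have y: "y \<in> carrier G" by (simp add: space_haar)
    have "(\<integral>w. \<zeta> w * indicator E4 (y, w) \<partial>\<mu>)
        = (\<integral>w. cnj (L2_rep (op_adjoint \<mu> x (ind (inverse_set A))) w) * indicator (inverse_set C) (inv y \<otimes> w) \<partial>\<mu>)"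
      using y by (intro Bochner_Integration.integral_cong)
        (simp_all add: ind_E inv_ind space_haar \<zeta>_def inv_mult_group)
    also have "\<dots> = L2_inner \<mu> (op_adjoint \<mu> x (ind (inverse_set A))) (\<Lambda> y (ind (inverse_set C)))"
      unfolding left_ind(1)[OF C' y]
      by (rule inner_class_left(2)[OF left_ind(2)[OF C' y] bounded_ops_in[OF x' ind_in[OF A']], symmetric])
    finally show "indicator B y * (\<integral>w. \<zeta> w * indicator E4 (y, w) \<partial>\<mu>)
        = indicator B y * L2_inner \<mu> (op_adjoint \<mu> x (ind (inverse_set A))) (\<Lambda> y (ind (inverse_set C)))" by simp
  qed
  finally show ?thesis using pos by simp
qed

text \<open>
  Three rotations return to the same form with the factor \<open>p q / r\<close>.
\<close>

lemma convolution_form_zero: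
  assumes x: "x \<in> bounded_ops \<mu>" and x_left: "\<forall>g\<in>carrier G. \<forall>X\<in>L2_space \<mu>. x (\<Lambda> g X) = \<Lambda> g (x X)"
    and x_right: "\<forall>g\<in>carrier G. \<forall>X\<in>L2_space \<mu>. x (right_translation g X) = right_translation g (x X)"
    and A: "level_set p A" and B: "level_set q B" and C: "level_set r C" and ne: "p * q \<noteq> r"
  shows "convolution_form x A B C = 0"
proof -
  note rot = convolution_form_rotate[OF x x_left x_right]
  note A' = level_set_inverse[OF A] and B' = level_set_inverse[OF B] and C' = level_set_inverse[OF C]
  have inv2: "inverse_set (inverse_set A) = A" "inverse_set (inverse_set B) = B" "inverse_set (inverse_set C) = C"
    using A B C by (simp_all add: inverse_set_inverse_set level_set_def)
  have "convolution_form x A B C = of_real p * (of_real q * (of_real (inverse r) * convolution_form x A B C))"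
    using rot[OF A B C] rot[OF B C' A'] rot[OF C' A B'] unfolding inv2 by simp
  then have "(1 - of_real (p * q * inverse r)) * convolution_form x A B C = 0"
    by (simp add: algebra_simps)
  moreover have "p * q * inverse r \<noteq> 1" using ne C by (auto simp: level_set_def field_simps)
  then have "1 - complex_of_real (p * q * inverse r) \<noteq> 0" by (metis of_real_eq_1_iff right_minus_eq)
  ultimately show ?thesis by (simp only: mult_eq_0_iff simp_thms)
qed

end

section \<open>Central elements respect the level sets of the modular function\<close>

context haar_group
begin

interpretation sigma_finite_measure \<mu> by (rule sigma_finite_haar)
interpretation PP: pair_sigma_finite \<mu> \<mu> by unfold_locales

lemma zero_if_integrals_zero:
  assumes S: "S \<in> sets \<mu>" and \<eta>: "\<eta> \<in> L2_fun \<mu>"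
    and zero: "\<And>B. B \<in> sets \<mu> \<Longrightarrow> B \<subseteq> S \<Longrightarrow> emeasure \<mu> B < \<infinity> \<Longrightarrow> (\<integral>w. indicator B w * \<eta> w \<partial>\<mu>) = 0"
  shows "AE w in \<mu>. w \<in> S \<longrightarrow> \<eta> w = 0"
proof -
  obtain E :: "nat \<Rightarrow> 'a set" where E: "range E \<subseteq> sets \<mu>" "(\<Union>i. E i) = space \<mu>" "\<And>i. emeasure \<mu> (E i) \<noteq> \<infinity>"
    using sigma_finite by metis
  have "AE w in \<mu>. indicator (S \<inter> E n) w * \<eta> w = 0" for n
  proof (rule density_zero)
    have En: "E n \<in> sets \<mu>" using E(1) by auto
    have le: "emeasure \<mu> (A \<inter> (S \<inter> E n)) < \<infinity>" if "A \<in> sets \<mu>" for A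
    proof -
      have "emeasure \<mu> (A \<inter> (S \<inter> E n)) \<le> emeasure \<mu> (E n)" by (rule emeasure_mono) (use En in auto)
      then show ?thesis using E(3)[of n] by (simp add: le_less_trans top.not_eq_extremum)
    qed
    have "(indicator (S \<inter> E n) :: 'a \<Rightarrow> complex) \<in> L2_fun \<mu>"
      using le[OF sets.top] S En sets.sets_into_space[OF S] by (intro ind_fun) (auto simp: Int_absorb1 le_infI1)
    from L2_fun_mult_integrable[OF this \<eta>]
    show "integrable \<mu> (\<lambda>w. indicator (S \<inter> E n) w * \<eta> w)"
      by (rule Bochner_Integration.integrable_cong[THEN iffD1, rotated 2]) (simp_all add: indicator_def)
    fix A assume A: "A \<in> sets \<mu>"
    have "(LINT w:A|\<mu>. indicator (S \<inter> E n) w * \<eta> w) = (\<integral>w. indicator (A \<inter> (S \<inter> E n)) w * \<eta> w \<partial>\<mu>)"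
      unfolding set_lebesgue_integral_def
      by (rule Bochner_Integration.integral_cong) (auto simp: indicator_def)
    also have "\<dots> = 0" using le[OF A] A S En by (intro zero) auto
    finally show "(LINT w:A|\<mu>. indicator (S \<inter> E n) w * \<eta> w) = 0" .
  qed
  then have "AE w in \<mu>. \<forall>n. indicator (S \<inter> E n) w * \<eta> w = 0" unfolding AE_all_countable by blast
  then show ?thesis
  proof (rule AE_mp, intro AE_I2 impI)
    fix w assume w: "w \<in> space \<mu>" "\<forall>n. indicator (S \<inter> E n) w * \<eta> w = 0" "w \<in> S"
    then obtain n where "w \<in> E n" using E(2) by auto
    then show "\<eta> w = 0" using w by (auto simp: indicator_def dest: spec[of _ n])
  qed
qed

text \<open>
  The vanishing of \<open>convolution_form\<close> says that \<open>\<eta> = x 1\<^sub>B\<close>, as a function of the second of two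
  variables, integrates to zero over sheared rectangles. These generate all measurable sets of the
  product. Hence for almost every \<open>y\<close> in the kernel, \<open>\<eta>\<close> vanishes at almost every \<open>w\<close> for which \<open>y w\<close>
  lies in the level set, and a single such \<open>y\<close> suffices, as it preserves the level set.
\<close>

lemma indicator_level_zero:
  assumes x: "x \<in> bounded_ops \<mu>" and x_left: "\<forall>g\<in>carrier G. \<forall>X\<in>L2_space \<mu>. x (\<Lambda> g X) = \<Lambda> g (x X)"
    and x_right: "\<forall>g\<in>carrier G. \<forall>X\<in>L2_space \<mu>. x (right_translation g X) = right_translation g (x X)"
    and level_sets: "\<And>r. {w \<in> space \<mu>. \<Delta> w = r} \<in> sets \<mu>"
    and kernel: "emeasure \<mu> {w \<in> space \<mu>. \<Delta> w = 1} \<noteq> 0"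
    and B: "level_set q B" and ne: "q \<noteq> r"
  shows "AE w in \<mu>. \<Delta> w = r \<longrightarrow> L2_rep (x (ind B)) w = 0"
proof (cases "r > 0")
  case False
  show ?thesis
    by (rule AE_I2) (use False modular_pos in \<open>force simp: space_haar\<close>)
next
  case r: True
  define \<eta> where "\<eta> = L2_rep (x (ind B))"
  have \<eta>: "\<eta> \<in> L2_fun \<mu>" unfolding \<eta>_def by (rule L2_rep_in[OF bounded_ops_in[OF x ind_in[OF B]]])
  have [measurable]: "\<eta> \<in> borel_measurable \<mu>" by (rule L2_fun_measurable[OF \<eta>])
  obtain E :: "nat \<Rightarrow> 'a set" where E: "range E \<subseteq> sets \<mu>" "(\<Union>i. E i) = space \<mu>" "\<And>i. emeasure \<mu> (E i) \<noteq> \<infinity>"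
    using sigma_finite by metis
  have lev: "level_set s ({w \<in> space \<mu>. \<Delta> w = s} \<inter> E n)" if "s > 0" for s n
  proof -
    have En: "E n \<in> sets \<mu>" using E(1) by auto
    have "emeasure \<mu> ({w \<in> space \<mu>. \<Delta> w = s} \<inter> E n) \<le> emeasure \<mu> (E n)" by (rule emeasure_mono) (use En in auto)
    then have "emeasure \<mu> ({w \<in> space \<mu>. \<Delta> w = s} \<inter> E n) < \<infinity>"
      using E(3)[of n] by (simp add: le_less_trans top.not_eq_extremum)
    then show ?thesis using that En level_sets by (auto simp: level_set_def)
  qed
  have "\<exists>n. emeasure \<mu> ({w \<in> space \<mu>. \<Delta> w = 1} \<inter> E n) \<noteq> 0"
  proof (rule ccontr)
    assume "\<not> ?thesis"
    then have "emeasure \<mu> (\<Union>n. {w \<in> space \<mu>. \<Delta> w = 1} \<inter> E n) = 0"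
      using E(1) level_sets by (intro emeasure_UN_eq_0) auto
    moreover have "(\<Union>n. {w \<in> space \<mu>. \<Delta> w = 1} \<inter> E n) = {w \<in> space \<mu>. \<Delta> w = 1}" using E(2) by auto
    ultimately show False using kernel by simp
  qed
  then obtain n0 where n0: "emeasure \<mu> ({w \<in> space \<mu>. \<Delta> w = 1} \<inter> E n0) \<noteq> 0" by blast
  define A where "A = {w \<in> space \<mu>. \<Delta> w = 1} \<inter> E n0"
  have A: "level_set 1 A" unfolding A_def by (rule lev) simp
  have A_sets [measurable]: "A \<in> sets \<mu>" and A_fin: "emeasure \<mu> A < \<infinity>" using A by (auto simp: level_set_def)
  have "AE y in \<mu>. AE w in \<mu>. indicator A y * (\<eta> w * indicator C (y \<otimes> w)) = 0" if C: "level_set r C" for C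
  proof -
    let ?P = "\<mu> \<Otimes>\<^sub>M \<mu>"
    have C_sets [measurable]: "C \<in> sets \<mu>" and C_fin: "emeasure \<mu> C < \<infinity>" using C by (auto simp: level_set_def)
    define v :: "'a \<times> 'a \<Rightarrow> complex" where "v p = indicator A (fst p) * (\<eta> (snd p) * indicator C (fst p \<otimes> snd p))" for p
    have v_meas [measurable]: "v \<in> borel_measurable ?P" unfolding v_def by measurable
    define E1 where "E1 = {p \<in> space ?P. fst p \<otimes> snd p \<in> C}"
    have [measurable]: "E1 \<in> sets ?P" unfolding E1_def by measurable
    have v_int: "integrable ?P v"
    proof -
      have "integrable ?P (\<lambda>(y, w). indicator A y * (\<eta> w * indicator E1 (y, w)))"
      proof (rule integrable_indicator_pair[OF \<eta> A_sets A_fin])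
        fix y assume "y \<in> A"
        then have y: "y \<in> carrier G" using sets_carrier[OF A_sets] by auto
        then have "{w \<in> space \<mu>. (y, w) \<in> E1} = {w \<in> space \<mu>. y \<otimes> w \<in> C}"
          by (auto simp: E1_def space_pair_measure space_haar)
        then show "emeasure \<mu> {w \<in> space \<mu>. (y, w) \<in> E1} \<le> ennreal (enn2real (emeasure \<mu> C))"
          using level_set_translate_measure(1)[OF C y] C_fin by simp
      qed measurable
      then show ?thesis
        by (rule Bochner_Integration.integrable_cong[THEN iffD1, rotated 2])
          (simp_all add: v_def E1_def indicator_def split_beta)
    qed
    \<comment> \<open>The preimage under the shear \<open>(y, w) \<mapsto> (y, y w)\<close>, which is an isomorphism of measurable spaces.\<close>
    let ?S = "\<lambda>F. {p \<in> space ?P. (fst p, fst p \<otimes> snd p) \<in> F}"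
    have S_sets: "?S F \<in> sets ?P" if [measurable]: "F \<in> sets ?P" for F by measurable
    have sub_int: "set_integrable ?P F v" if "F \<in> sets ?P" for F
      using v_int that unfolding set_integrable_def by (rule integrable_mult_indicator[rotated])
    have rect: "(LINT p:?S (F1 \<times> F2)|?P. v p) = 0" if F [measurable]: "F1 \<in> sets \<mu>" "F2 \<in> sets \<mu>" for F1 F2
    proof -
      have fin: "emeasure \<mu> (F1 \<inter> A) < \<infinity>" "emeasure \<mu> (F2 \<inter> C) < \<infinity>"
        using emeasure_mono[of "F1 \<inter> A" A \<mu>] emeasure_mono[of "F2 \<inter> C" C \<mu>] A_fin C_fin
        by (auto intro: le_less_trans)
      have lA: "level_set 1 (F1 \<inter> A)" and lC: "level_set r (F2 \<inter> C)"
        using A C fin by (auto simp: level_set_def)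
      have S: "?S (F1 \<times> F2) \<in> sets ?P" by (rule S_sets) measurable
      have "(LINT p:?S (F1 \<times> F2)|?P. v p) = (\<integral>y. (\<integral>w. indicator (?S (F1 \<times> F2)) (y, w) *\<^sub>R v (y, w) \<partial>\<mu>) \<partial>\<mu>)"
        unfolding set_lebesgue_integral_def
        using sub_int[OF S] by (intro PP.integral_fst'[symmetric]) (simp add: set_integrable_def)
      also have "\<dots> = convolution_form x (F1 \<inter> A) B (F2 \<inter> C)"
        unfolding convolution_form_def
      proof (rule Bochner_Integration.integral_cong[OF refl])
        fix y assume "y \<in> space \<mu>"
        then have y: "y \<in> carrier G" by (simp add: space_haar)
        have "(\<integral>w. indicator (?S (F1 \<times> F2)) (y, w) *\<^sub>R v (y, w) \<partial>\<mu>)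
            = (\<integral>w. indicator (F1 \<inter> A) y * (\<eta> w * indicator (F2 \<inter> C) (y \<otimes> w)) \<partial>\<mu>)"
          using y by (intro Bochner_Integration.integral_cong)
            (auto simp: v_def indicator_def space_pair_measure space_haar)
        then show "(\<integral>w. indicator (?S (F1 \<times> F2)) (y, w) *\<^sub>R v (y, w) \<partial>\<mu>)
            = indicator (F1 \<inter> A) y * L2_inner \<mu> (op_adjoint \<mu> x (ind (F2 \<inter> C))) (\<Lambda> y (ind B))"
          using convolution_form_left[OF x x_left B lC y] by (simp add: \<eta>_def)
      qed
      also have "\<dots> = 0" by (rule convolution_form_zero[OF x x_left x_right lA B lC]) (use ne in simp)
      finally show ?thesis .
    qed
    have all: "(LINT p:?S F|?P. v p) = 0" if "F \<in> sets ?P" for F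
      using Int_stable_pair_measure_generator[of \<mu> \<mu>] pair_measure_closed[of \<mu> \<mu>] that[unfolded sets_pair_measure]
    proof (induction rule: sigma_sets_induct_disjoint)
      case (basic F)
      then show ?case using rect by auto
    next
      case empty
      show ?case by (simp add: set_lebesgue_integral_def)
    next
      case (compl F)
      then have F: "F \<in> sets ?P" by (simp add: sets_pair_measure)
      have F': "space \<mu> \<times> space \<mu> - F \<in> sets ?P" using F by (metis sets.compl_sets space_pair_measure)
      have eq: "?S (space \<mu> \<times> space \<mu>) = ?S F \<union> ?S (space \<mu> \<times> space \<mu> - F)"
        by (auto simp: space_pair_measure space_haar)
      have "(LINT p:?S (space \<mu> \<times> space \<mu>)|?P. v p)
          = (LINT p:?S F|?P. v p) + (LINT p:?S (space \<mu> \<times> space \<mu> - F)|?P. v p)"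
        unfolding eq by (rule set_integral_Un[OF _ sub_int[OF S_sets[OF F]] sub_int[OF S_sets[OF F']]]) auto
      then show ?case using rect[OF sets.top sets.top] compl by simp
    next
      case (union F)
      then have F: "F i \<in> sets ?P" for i by (auto simp: sets_pair_measure)
      have eq: "?S (\<Union>i. F i) = (\<Union>i. ?S (F i))" by auto
      have "(LINT p:?S (\<Union>i. F i)|?P. v p) = (\<Sum>i. (LINT p:?S (F i)|?P. v p))"
        unfolding eq
      proof (rule lebesgue_integral_countable_add[OF S_sets[OF F]])
        show "?S (F i) \<inter> ?S (F j) = {}" if "i \<noteq> j" for i j
          using union(1) that by (auto simp: disjoint_family_on_def)
        show "set_integrable ?P (\<Union>i. ?S (F i)) v" by (intro sub_int sets.countable_UN) (use S_sets[OF F] in auto)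
      qed
      then show ?case using union by simp
    qed
    have "AE p in ?P. v p = 0"
    proof (rule PP.P.density_zero[OF v_int])
      fix F assume [measurable]: "F \<in> sets ?P"
      let ?F = "{p \<in> space ?P. (fst p, inv (fst p) \<otimes> snd p) \<in> F}"
      have "?S ?F = F"
        using sets.sets_into_space[OF \<open>F \<in> sets ?P\<close>]
        by (auto simp: space_pair_measure space_haar m_assoc[symmetric])
      moreover have "?F \<in> sets ?P" by measurable
      ultimately show "set_lebesgue_integral ?P F v = 0" using all[of ?F] by simp
    qed
    from PP.AE_pair[OF this] show ?thesis by (simp add: v_def)
  qed
  note each = this[OF lev[OF r]]
  have ae: "AE y in \<mu>. AE w in \<mu>. \<forall>n. indicator A y * (\<eta> w * indicator ({w \<in> space \<mu>. \<Delta> w = r} \<inter> E n) (y \<otimes> w)) = 0"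
    unfolding AE_all_countable using each by blast
  have "\<exists>y\<in>A. AE w in \<mu>. \<forall>n. indicator A y * (\<eta> w * indicator ({w \<in> space \<mu>. \<Delta> w = r} \<inter> E n) (y \<otimes> w)) = 0"
  proof (rule ccontr)
    assume "\<not> ?thesis"
    then have "AE y in \<mu>. y \<notin> A" using ae by (elim AE_mp) (auto intro!: AE_I2)
    then have "emeasure \<mu> A = 0" using A_sets by (simp add: AE_iff_measurable[OF A_sets] sets.sets_into_space[OF A_sets] subset_eq Collect_conj_eq Int_absorb1 flip: Int_def)
    then show False using n0 by (simp add: A_def)
  qed
  then obtain y where y: "y \<in> A"
    "AE w in \<mu>. \<forall>n. indicator A y * (\<eta> w * indicator ({w \<in> space \<mu>. \<Delta> w = r} \<inter> E n) (y \<otimes> w)) = 0" by blast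
  have yc: "y \<in> carrier G" "\<Delta> y = 1" using y(1) by (auto simp: A_def space_haar)
  show ?thesis
    using y(2)
  proof (rule AE_mp, intro AE_I2 impI)
    fix w assume w: "w \<in> space \<mu>" "\<Delta> w = r"
      and zero: "\<forall>n. indicator A y * (\<eta> w * indicator ({w \<in> space \<mu>. \<Delta> w = r} \<inter> E n) (y \<otimes> w)) = 0"
    have "y \<otimes> w \<in> space \<mu>" using yc w by (simp add: space_haar)
    then obtain n where "y \<otimes> w \<in> E n" using E(2) by auto
    moreover have "\<Delta> (y \<otimes> w) = r" using modular_mult[of y w] yc w by (simp add: space_haar)
    ultimately have "\<eta> w = 0" using spec[OF zero, of n] y(1) yc w by (auto simp: space_haar)
    then show "L2_rep (x (ind B)) w = 0" by (simp add: \<eta>_def)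
  qed
qed

text \<open>
  Passage from indicators to arbitrary vectors by duality: the adjoint of \<open>x\<close> maps the part \<open>z\<close> of \<open>x X\<close>
  on the level set of \<open>r\<close> to a function with vanishing integrals over the subsets of finite measure of
  the level set of \<open>q\<close>. Hence \<open>z\<close> is orthogonal to \<open>x X\<close>.
\<close>

theorem central_preserves_level_sets:
  assumes x: "x \<in> bounded_ops \<mu>" and x_left: "\<forall>g\<in>carrier G. \<forall>X\<in>L2_space \<mu>. x (\<Lambda> g X) = \<Lambda> g (x X)"
    and x_right: "\<forall>g\<in>carrier G. \<forall>X\<in>L2_space \<mu>. x (right_translation g X) = right_translation g (x X)"
    and level_sets: "\<And>r. {w \<in> space \<mu>. \<Delta> w = r} \<in> sets \<mu>"
    and kernel: "emeasure \<mu> {w \<in> space \<mu>. \<Delta> w = 1} \<noteq> 0"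
    and X: "X \<in> L2_space \<mu>" "AE w in \<mu>. \<Delta> w \<noteq> q \<longrightarrow> L2_rep X w = 0" and ne: "q \<noteq> r"
  shows "AE w in \<mu>. \<Delta> w = r \<longrightarrow> L2_rep (x X) w = 0"
proof -
  note xX = bounded_ops_in[OF x X(1)] and x' = op_adjoint_in[OF x]
  define z where "z w = indicator {w \<in> space \<mu>. \<Delta> w = r} w * L2_rep (x X) w" for w
  have z: "z \<in> L2_fun \<mu>"
  proof (rule L2_fun_dominated[OF L2_rep_in[OF xX]])
    show "z \<in> borel_measurable \<mu>"
      unfolding z_def using level_sets[of r] L2_space_measurable[OF xX] by measurable
  qed (simp add: z_def indicator_def)
  note Z = L2_class_in[OF z]
  note x'Z = bounded_ops_in[OF x' Z]
  define \<eta> where "\<eta> w = cnj (L2_rep (op_adjoint \<mu> x (L2_class \<mu> z)) w)" for w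
  have \<eta>: "\<eta> \<in> L2_fun \<mu>"
    using L2_rep_in[OF x'Z] unfolding \<eta>_def L2_fun_def by (auto intro: measurable_compose[OF _ borel_measurable_cnj])
  have "AE w in \<mu>. w \<in> {w \<in> space \<mu>. \<Delta> w = q} \<longrightarrow> \<eta> w = 0"
  proof (rule zero_if_integrals_zero[OF level_sets \<eta>])
    fix B assume B: "B \<in> sets \<mu>" "B \<subseteq> {w \<in> space \<mu>. \<Delta> w = q}" "emeasure \<mu> B < \<infinity>"
    show "(\<integral>w. indicator B w * \<eta> w \<partial>\<mu>) = 0"
    proof (cases "B = {}")
      case False
      then have "q > 0" using B(2) modular_pos by (auto simp: space_haar)
      then have lB: "level_set q B" using B by (auto simp: level_set_def)
      note xB = bounded_ops_in[OF x ind_in[OF lB]]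
      have "(\<integral>w. indicator B w * \<eta> w \<partial>\<mu>) = L2_inner \<mu> (op_adjoint \<mu> x (L2_class \<mu> z)) (ind B)"
        unfolding ind_def inner_class_left(2)[OF ind_fun[OF B(1,3)] x'Z] by (simp add: \<eta>_def mult.commute)
      also have "\<dots> = L2_inner \<mu> (L2_class \<mu> z) (x (ind B))" by (rule op_adjoint_inner[OF x Z ind_in[OF lB]])
      also have "\<dots> = (\<integral>w. cnj (z w) * L2_rep (x (ind B)) w \<partial>\<mu>)" by (rule inner_class_left(1)[OF z xB])
      also have "\<dots> = 0"
      proof (rule integral_eq_zero_AE)
        show "AE w in \<mu>. cnj (z w) * L2_rep (x (ind B)) w = 0"
          using indicator_level_zero[OF x x_left x_right level_sets kernel lB ne]
          by eventually_elim (simp add: z_def indicator_def)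
      qed
      finally show ?thesis .
    qed simp
  qed
  then have adj_zero: "AE w in \<mu>. \<Delta> w = q \<longrightarrow> \<eta> w = 0"
    using AE_space by eventually_elim auto
  have "(\<integral>w. cnj (z w) * L2_rep (x X) w \<partial>\<mu>) = L2_inner \<mu> (L2_class \<mu> z) (x X)"
    by (rule inner_class_left(1)[OF z xX, symmetric])
  also have "\<dots> = L2_inner \<mu> (op_adjoint \<mu> x (L2_class \<mu> z)) X" by (rule op_adjoint_inner[OF x Z X(1), symmetric])
  also have "\<dots> = 0"
    unfolding L2_inner_def
  proof (rule integral_eq_zero_AE)
    show "AE w in \<mu>. cnj (L2_rep (op_adjoint \<mu> x (L2_class \<mu> z)) w) * L2_rep X w = 0"
      using adj_zero X(2) by eventually_elim (auto simp: \<eta>_def)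
  qed
  also have "(\<integral>w. cnj (z w) * L2_rep (x X) w \<partial>\<mu>) = (\<integral>w. cnj (z w) * z w \<partial>\<mu>)"
    by (rule Bochner_Integration.integral_cong) (simp_all add: z_def indicator_def)
  finally have "L2_inner \<mu> (L2_class \<mu> z) (L2_class \<mu> z) = 0" by (simp add: L2_inner_class[OF z z])
  then have "L2_norm \<mu> (L2_class \<mu> z) = 0" by (simp add: L2_inner_self)
  then have "L2_class \<mu> z = L2_class \<mu> (\<lambda>_. 0)" using L2_norm_eq_zero[OF Z] by (simp add: L2_zero_def)
  then have "AE w in \<mu>. z w = 0" using L2_class_eq_iff[OF z L2_fun_zero] by simp
  then show ?thesis
    using AE_space by eventually_elim (auto simp: z_def)
qed

end

section \<open>Haar measures of second countable locally compact groups\<close>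

lemma borel_space:
  assumes "sets m = sigma_sets (topspace T) {U. openin T U}"
  shows "space m = topspace T" "\<And>U. openin T U \<Longrightarrow> U \<in> sets m"
proof -
  have sub: "{U. openin T U} \<subseteq> Pow (topspace T)" using openin_subset by auto
  have "sets m = sets (sigma (topspace T) {U. openin T U})" using assms sub by simp
  from sets_eq_imp_space_eq[OF this] sub show "space m = topspace T" by simp
  show "U \<in> sets m" if "openin T U" for U using that assms by (auto intro: sigma_sets.Basic)
qed

lemma borel_measurableI:
  assumes m: "sets m = sigma_sets (topspace T) {U. openin T U}"
    and f: "f \<in> space m' \<rightarrow> topspace T" "\<And>U. openin T U \<Longrightarrow> f -` U \<inter> space m' \<in> sets m'"
  shows "f \<in> measurable m' m"
proof -
  have sub: "{U. openin T U} \<subseteq> Pow (topspace T)" using openin_subset by auto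
  have "measurable m' m = measurable m' (sigma (topspace T) {U. openin T U})"
    using m sub by (intro measurable_cong_sets) simp_all
  moreover have "f \<in> measurable m' (sigma (topspace T) {U. openin T U})"
    by (rule measurable_sigma_sets[of _ "topspace T" "{U. openin T U}"]) (use sub f in auto)
  ultimately show ?thesis by simp
qed

text \<open>
  A countable base makes every open subset of the product a countable union of open rectangles, hence
  product measurable; the relatively compact members of the base give sigma-finiteness.
\<close>

lemma haar_group_locally_compact:
  assumes lc: "locally_compact_group H T" and sc: "second_countable T" and haar: "left_haar_measure H T m"
  shows "haar_group H m"
proof -
  interpret group H using lc by (simp add: locally_compact_group_def)
  have m: "sets m = sigma_sets (topspace T) {U. openin T U}" using haar by (simp add: left_haar_measure_def)
  note sp = borel_space(1)[OF m] and op = borel_space(2)[OF m]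
  have top: "topspace T = carrier H" using lc by (simp add: locally_compact_group_def)
  obtain \<B> where \<B>: "countable \<B>" "\<And>V. V \<in> \<B> \<Longrightarrow> openin T V"
    "\<And>U x. openin T U \<Longrightarrow> x \<in> U \<Longrightarrow> \<exists>V\<in>\<B>. x \<in> V \<and> V \<subseteq> U"
    using sc unfolding second_countable_def by metis
  have prod: "W \<in> sets (m \<Otimes>\<^sub>M m)" if W: "openin (prod_topology T T) W" for W
  proof -
    have W_eq: "W = (\<Union>p\<in>{p \<in> \<B> \<times> \<B>. fst p \<times> snd p \<subseteq> W}. fst p \<times> snd p)"
    proof (rule antisym)
      show "W \<subseteq> (\<Union>p\<in>{p \<in> \<B> \<times> \<B>. fst p \<times> snd p \<subseteq> W}. fst p \<times> snd p)"
      proof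
        fix z assume "z \<in> W"
        then obtain x y where z: "z = (x, y)" "(x, y) \<in> W" by (cases z) auto
        obtain U V where "openin T U" "openin T V" "x \<in> U" "y \<in> V" "U \<times> V \<subseteq> W"
          using W[unfolded openin_prod_topology_alt, rule_format, OF z(2)] by (elim exE conjE)
        moreover obtain U' where "U' \<in> \<B>" "x \<in> U'" "U' \<subseteq> U"
          using \<B>(3)[OF \<open>openin T U\<close> \<open>x \<in> U\<close>] by (elim bexE conjE)
        moreover obtain V' where "V' \<in> \<B>" "y \<in> V'" "V' \<subseteq> V"
          using \<B>(3)[OF \<open>openin T V\<close> \<open>y \<in> V\<close>] by (elim bexE conjE)
        ultimately show "z \<in> (\<Union>p\<in>{p \<in> \<B> \<times> \<B>. fst p \<times> snd p \<subseteq> W}. fst p \<times> snd p)"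
          unfolding z(1) by (intro UN_I[of "(U', V')"]) auto
      qed
    qed auto
    have "countable {p \<in> \<B> \<times> \<B>. fst p \<times> snd p \<subseteq> W}"
      using \<B>(1) by (intro countable_subset[OF _ countable_SIGMA[of \<B> "\<lambda>_. \<B>"]]) auto
    moreover have "fst p \<times> snd p \<in> sets (m \<Otimes>\<^sub>M m)" if "p \<in> \<B> \<times> \<B>" for p
      using that \<B>(2) op by (intro pair_measureI) auto
    ultimately have "(\<Union>p\<in>{p \<in> \<B> \<times> \<B>. fst p \<times> snd p \<subseteq> W}. fst p \<times> snd p) \<in> sets (m \<Otimes>\<^sub>M m)"
      by (intro sets.countable_UN'') auto
    then show ?thesis by (subst W_eq)
  qed
  show ?thesis
  proof (intro haar_group.intro haar_group_axioms.intro is_group)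
    show "space m = carrier H" using sp top by simp
    have cont: "continuous_map (prod_topology T T) T (\<lambda>p. fst p \<otimes>\<^bsub>H\<^esub> snd p)"
      using lc unfolding locally_compact_group_def case_prod_beta' by blast
    show "(\<lambda>p. fst p \<otimes>\<^bsub>H\<^esub> snd p) \<in> measurable (m \<Otimes>\<^sub>M m) m"
    proof (rule borel_measurableI[OF m])
      fix U assume "openin T U"
      from openin_continuous_map_preimage[OF cont this]
      have "openin (prod_topology T T) ((\<lambda>p. fst p \<otimes>\<^bsub>H\<^esub> snd p) -` U \<inter> space (m \<Otimes>\<^sub>M m))"
        by (simp add: space_pair_measure sp vimage_def Int_def conj_commute)
      then show "(\<lambda>p. fst p \<otimes>\<^bsub>H\<^esub> snd p) -` U \<inter> space (m \<Otimes>\<^sub>M m) \<in> sets (m \<Otimes>\<^sub>M m)" by (rule prod)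
    qed (auto simp: space_pair_measure sp top)
    have inv: "continuous_map T T (\<lambda>x. inv\<^bsub>H\<^esub> x)" using lc by (simp add: locally_compact_group_def)
    show "(\<lambda>x. inv\<^bsub>H\<^esub> x) \<in> measurable m m"
    proof (rule borel_measurableI[OF m])
      fix U assume "openin T U"
      from openin_continuous_map_preimage[OF inv this]
      have "openin T ((\<lambda>x. inv\<^bsub>H\<^esub> x) -` U \<inter> space m)"
        by (simp add: sp vimage_def Int_def conj_commute)
      then show "(\<lambda>x. inv\<^bsub>H\<^esub> x) -` U \<inter> space m \<in> sets m" by (rule op)
    qed (auto simp: sp top)
    show "emeasure m (space m) \<noteq> 0" using haar by (simp add: left_haar_measure_def)
    show "emeasure m (g <#\<^bsub>H\<^esub> A) = emeasure m A" if "g \<in> carrier H" "A \<in> sets m" for g A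
      using haar that by (simp add: left_haar_measure_def)
    show "sigma_finite_measure m"
    proof
      define \<C> where "\<C> = {V \<in> \<B>. \<exists>K. compactin T K \<and> V \<subseteq> K}"
      have cover: "\<Union>\<C> = topspace T"
      proof (rule antisym)
        show "\<Union>\<C> \<subseteq> topspace T" using \<B>(2) openin_subset by (fastforce simp: \<C>_def)
        show "topspace T \<subseteq> \<Union>\<C>"
        proof
          fix x assume "x \<in> topspace T"
          then obtain U K where UK: "openin T U" "compactin T K" "x \<in> U" "U \<subseteq> K"
            using lc unfolding locally_compact_group_def locally_compact_space_def by metis
          then obtain V where "V \<in> \<B>" "x \<in> V" "V \<subseteq> U" using \<B>(3) by metis
          then show "x \<in> \<Union>\<C>" using UK by (auto simp: \<C>_def)
        qed
      qed
      have "emeasure m V \<noteq> \<infinity>" if V: "V \<in> \<C>" for V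
      proof -
        obtain K where K: "compactin T K" "V \<subseteq> K" using V by (auto simp: \<C>_def)
        have "closedin T K"
          using lc K by (intro compactin_imp_closedin) (simp_all add: locally_compact_group_def)
        then have "openin T (topspace T - K)" "K \<subseteq> topspace T" by (auto simp: closedin_def)
        then have "topspace T - (topspace T - K) \<in> sets m" using op sp by (metis sets.compl_sets)
        then have "K \<in> sets m" using \<open>K \<subseteq> topspace T\<close> by (simp add: double_diff)
        then have "emeasure m V \<le> emeasure m K" using K by (intro emeasure_mono)
        also have "\<dots> < \<infinity>" using haar K by (simp add: left_haar_measure_def)
        finally show ?thesis by simp
      qed
      moreover have "countable \<C>" using \<B>(1) by (simp add: \<C>_def)
      moreover have "\<C> \<subseteq> sets m" using \<B>(2) op by (auto simp: \<C>_def)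
      ultimately show "\<exists>A. countable A \<and> A \<subseteq> sets m \<and> \<Union> A = space m \<and> (\<forall>a\<in>A. emeasure m a \<noteq> \<infinity>)"
        using cover sp by (intro exI[of _ \<C>]) auto
    qed
  qed
qed

context haar_group
begin

abbreviation G1 :: "'a set" where "G1 \<equiv> modular_kernel G \<mu>"
abbreviation K1 :: "real set" where "K1 \<equiv> modular_range G \<mu>"

lemma G1_iff: "g \<in> G1 \<longleftrightarrow> g \<in> carrier G \<and> \<Delta> g = 1"
  by (simp add: modular_kernel_def)

lemma G1_subgroup: "subgroup G1 G"
proof (rule subgroupI)
  have "\<one> \<in> G1" by (simp add: G1_iff modular_one)
  then show "G1 \<noteq> {}" by auto
qed (auto simp: G1_iff modular_inv modular_mult)

lemma kernel_carrier [simp]: "carrier (kernel_group G \<mu>) = G1"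
  and kernel_mult [simp]: "x \<otimes>\<^bsub>kernel_group G \<mu>\<^esub> y = x \<otimes> y"
  by (simp_all add: kernel_group_def)

lemma kernel_inv: "x \<in> G1 \<Longrightarrow> inv\<^bsub>kernel_group G \<mu>\<^esub> x = inv x"
  unfolding kernel_group_def using m_inv_consistent[OF G1_subgroup] by simp

lemma kernel_is_group: "group (kernel_group G \<mu>)"
  unfolding kernel_group_def by (rule subgroup.subgroup_is_group[OF G1_subgroup is_group])

lemma kernel_locally_compact:
  assumes lc: "locally_compact_group G T" and op: "openin T G1"
  shows "locally_compact_group (kernel_group G \<mu>) (kernel_topology G T \<mu>)"
  unfolding locally_compact_group_def
proof (intro conjI)
  have sub: "G1 \<subseteq> topspace T" using op by (rule openin_subset)
  show "group (kernel_group G \<mu>)" by (rule kernel_is_group)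
  show "topspace (kernel_topology G T \<mu>) = carrier (kernel_group G \<mu>)"
    using sub by (auto simp: kernel_topology_def)
  have "continuous_map (subtopology (prod_topology T T) (G1 \<times> G1)) T (\<lambda>(x, y). x \<otimes> y)"
    using lc by (intro continuous_map_from_subtopology) (simp add: locally_compact_group_def)
  then have "continuous_map (subtopology (prod_topology T T) (G1 \<times> G1)) (subtopology T G1) (\<lambda>(x, y). x \<otimes> y)"
    by (rule continuous_map_into_subtopology) (auto simp: G1_iff modular_mult)
  then show "continuous_map (prod_topology (kernel_topology G T \<mu>) (kernel_topology G T \<mu>)) (kernel_topology G T \<mu>)
      (\<lambda>(x, y). x \<otimes>\<^bsub>kernel_group G \<mu>\<^esub> y)"
    by (simp add: kernel_topology_def subtopology_Times)
  have "continuous_map (subtopology T G1) T (\<lambda>x. inv x)"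
    using lc by (intro continuous_map_from_subtopology) (simp add: locally_compact_group_def)
  then have "continuous_map (subtopology T G1) (subtopology T G1) (\<lambda>x. inv x)"
    by (rule continuous_map_into_subtopology) (auto simp: G1_iff modular_inv)
  then show "continuous_map (kernel_topology G T \<mu>) (kernel_topology G T \<mu>) (\<lambda>x. inv\<^bsub>kernel_group G \<mu>\<^esub> x)"
    unfolding kernel_topology_def by (rule continuous_map_eq) (simp add: kernel_inv)
  show "Hausdorff_space (kernel_topology G T \<mu>)"
    using lc by (simp add: kernel_topology_def locally_compact_group_def Hausdorff_space_subtopology)
  show "locally_compact_space (kernel_topology G T \<mu>)"
    unfolding kernel_topology_def
    using lc op by (intro locally_compact_space_open_subset) (simp_all add: locally_compact_group_def)
qed

lemma level_set_coset:
  assumes s: "s \<in> carrier G"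
  shows "{w \<in> carrier G. \<Delta> w = \<Delta> s} = {w \<in> carrier G. inv s \<otimes> w \<in> G1}"
  using s modular_pos[OF s] by (auto simp: G1_iff modular_mult modular_inv field_simps)

lemma level_open:
  assumes lc: "locally_compact_group G T" and op: "openin T G1"
  shows "openin T {w \<in> carrier G. \<Delta> w = r}"
proof (cases "r \<in> K1")
  case False
  then have "{w \<in> carrier G. \<Delta> w = r} = {}" by (auto simp: modular_range_def)
  then show ?thesis by (simp only: openin_empty)
next
  case True
  then obtain s where s: "s \<in> carrier G" "r = \<Delta> s" by (auto simp: modular_range_def)
  have top: "topspace T = carrier G" using lc by (simp add: locally_compact_group_def)
  have "continuous_map T (prod_topology T T) (\<lambda>w. (inv s, w))"
    using s top by (intro continuous_map_pairedI) simp_all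
  from continuous_map_compose[OF this, of T "\<lambda>(x, y). x \<otimes> y"]
  have "continuous_map T T (\<lambda>w. inv s \<otimes> w)" using lc by (simp add: locally_compact_group_def comp_def)
  from openin_continuous_map_preimage[OF this op] show ?thesis
    using level_set_coset[OF s(1)] s(2) top by simp
qed

text \<open>
  The values of the modular function index a cover of the group by nonempty, disjoint, open level sets.
  Such a cover has no proper subcover, while second countable spaces are Lindelof.
\<close>

lemma range_countable:
  assumes lc: "locally_compact_group G T" and op: "openin T G1" and sc: "second_countable T"
  shows "countable K1"
proof -
  have top: "topspace T = carrier G" using lc by (simp add: locally_compact_group_def)
  let ?F = "\<lambda>k. {w \<in> carrier G. \<Delta> w = k}"
  have lindelof: "Lindelof_space T" using sc by (rule second_countable_imp_Lindelof_space)
  have cover: "\<Union>(?F ` K1) = topspace T" by (auto simp: top modular_range_def)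
  have opens: "openin T U" if "U \<in> ?F ` K1" for U using that level_open[OF lc op] by auto
  have "\<exists>\<V>. countable \<V> \<and> \<V> \<subseteq> ?F ` K1 \<and> \<Union>\<V> = topspace T"
    by (rule Lindelof_spaceD[OF lindelof opens cover])
  then obtain \<V> where \<V>: "countable \<V>" "\<V> \<subseteq> ?F ` K1" "\<Union>\<V> = topspace T"
    by (elim exE conjE)
  have "K1 \<subseteq> (\<lambda>V. \<Delta> (SOME w. w \<in> V)) ` \<V>"
  proof
    fix k assume "k \<in> K1"
    then obtain w where w: "w \<in> carrier G" "\<Delta> w = k" by (auto simp: modular_range_def)
    then obtain V where V: "V \<in> \<V>" "w \<in> V" using \<V>(3) top by auto
    then have VF: "V = ?F k" using \<V>(2) w by auto
    have some: "(SOME w. w \<in> V) \<in> V" using V(2) by (rule someI[of "\<lambda>w. w \<in> V"])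
    have "v \<in> V \<Longrightarrow> \<Delta> v = k" for v unfolding VF by blast
    from this[OF some] have "k = \<Delta> (SOME w. w \<in> V)" by (rule sym)
    then show "k \<in> (\<lambda>V. \<Delta> (SOME w. w \<in> V)) ` \<V>" by (rule rev_image_eqI[OF V(1)])
  qed
  then show ?thesis using \<V>(1) by (meson countable_image countable_subset)
qed

end

text \<open>
  The measure-theoretic content of almost unimodularity: on the kernel of the modular function the two
  Haar measures are proportional, and the kernel has countably many cosets, all measurable.
\<close>

locale kernel_section = haar_group +
  fixes \<nu> :: "'a measure" and \<sigma> :: "real \<Rightarrow> 'a" and c :: real
  assumes kernel_haar: "haar_group (kernel_group G \<mu>) \<nu>"
    and sets_\<nu>: "sets \<nu> = sets (restrict_space \<mu> G1)"
    and c_positive: "0 < c"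
    and emeasure_kernel: "A \<in> sets \<nu> \<Longrightarrow> emeasure \<mu> A = ennreal c * emeasure \<nu> A"
    and countable_range: "countable K1"
    and level_measurable: "{w \<in> carrier G. \<Delta> w = r} \<in> sets \<mu>"
    and normalized: "normalized_section G \<mu> \<sigma>"

text \<open>
  The constant comes from the uniqueness of the Haar measure of the kernel, applied to the restriction
  of \<open>\<mu>\<close>. This restriction is nonzero, since countably many cosets of the kernel cover the group.
\<close>

lemma kernel_section_almost_unimodular:
  fixes G (structure)
  assumes au: "almost_unimodular_group G T \<mu>" and sc: "second_countable T"
    and \<nu>: "left_haar_measure (kernel_group G \<mu>) (kernel_topology G T \<mu>) \<nu>"
    and sec: "normalized_section G \<mu> \<sigma>"
  obtains c where "kernel_section G \<mu> \<nu> \<sigma> c"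
proof -
  have lc: "locally_compact_group G T" and op: "openin T (modular_kernel G \<mu>)" and haar: "left_haar_measure G T \<mu>"
    using au unfolding almost_unimodular_group_def by blast+
  interpret haar_group G \<mu> by (rule haar_group_locally_compact[OF lc sc haar])
  have top: "topspace T = carrier G" using lc by (simp add: locally_compact_group_def)
  have m: "sets \<mu> = sigma_sets (topspace T) {U. openin T U}" using haar by (simp add: left_haar_measure_def)
  note lck = kernel_locally_compact[OF lc op]
  have sck: "second_countable (kernel_topology G T \<mu>)"
    using sc by (simp add: kernel_topology_def second_countable_subtopology)
  have hk: "haar_group (kernel_group G \<mu>) \<nu>" by (rule haar_group_locally_compact[OF lck sck \<nu>])
  interpret k: haar_group "kernel_group G \<mu>" \<nu> by (rule hk)
  have G1: "G1 \<in> sets \<mu>" using borel_space(2)[OF m op] .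
  have G1_sub: "G1 \<subseteq> carrier G" by (auto simp: G1_iff)
  have tk: "topspace (kernel_topology G T \<mu>) = G1" using G1_sub top by (auto simp: kernel_topology_def)
  have sets_R: "sets (restrict_space \<mu> G1) = sets \<nu>"
  proof -
    have "sets \<nu> = sigma_sets G1 ((\<inter>) G1 ` {U. openin T U})"
    proof -
      have "{U. openin (kernel_topology G T \<mu>) U} = (\<inter>) G1 ` {U. openin T U}"
        by (auto simp: kernel_topology_def openin_subtopology)
      then show ?thesis using \<nu> tk by (simp add: left_haar_measure_def)
    qed
    also have "\<dots> = (\<inter>) G1 ` sigma_sets (topspace T) {U. openin T U}"
      by (rule sigma_sets_Int[symmetric]) (use G1 m G1_sub top in auto)
    finally show ?thesis by (simp add: sets_restrict_space m)
  qed
  have level: "{w \<in> carrier G. \<Delta> w = r} \<in> sets \<mu>" for r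
    using borel_space(2)[OF m level_open[OF lc op]] .
  note countable_K = range_countable[OF lc op sc]
  let ?R = "restrict_space \<mu> G1"
  have sp_R: "space ?R = G1" using G1_sub by (simp add: space_restrict_space space_haar Int_absorb2)
  have em_R: "emeasure ?R A = emeasure \<mu> A" if "A \<in> sets ?R" for A
    using that G1 by (intro emeasure_restrict_space) (auto simp: sets_restrict_space)
  have G1_nonzero: "emeasure \<mu> G1 \<noteq> 0"
  proof
    assume zero: "emeasure \<mu> G1 = 0"
    have "emeasure \<mu> {w \<in> carrier G. \<Delta> w = k} = 0" if k: "k \<in> K1" for k
    proof -
      obtain s where s: "s \<in> carrier G" "k = \<Delta> s" using k by (auto simp: modular_range_def)
      have "{w \<in> carrier G. \<Delta> w = k} = (\<lambda>w. inv s \<otimes> w) -` G1 \<inter> space \<mu>"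
        using level_set_coset[OF s(1)] s(2) by (auto simp: space_haar)
      then show ?thesis using scales_left[of "inv s"] s(1) G1 zero by (simp add: scales_measure_def)
    qed
    then have "(\<Union>k\<in>K1. {w \<in> carrier G. \<Delta> w = k}) \<in> null_sets \<mu>"
      using level by (intro null_sets_UN'[OF countable_K]) auto
    then have "emeasure \<mu> (\<Union>k\<in>K1. {w \<in> carrier G. \<Delta> w = k}) = 0" by auto
    moreover have "(\<Union>k\<in>K1. {w \<in> carrier G. \<Delta> w = k}) = space \<mu>"
      by (auto simp: space_haar modular_range_def)
    ultimately show False using haar_nonzero by simp
  qed
  have hR: "haar_group (kernel_group G \<mu>) ?R"
  proof (intro haar_group.intro haar_group_axioms.intro kernel_is_group)
    show "space ?R = carrier (kernel_group G \<mu>)" by (simp add: sp_R)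
    show "sigma_finite_measure ?R"
      by (rule sigma_finite_measure_restrict_space[OF sigma_finite_haar G1])
    have "measurable (?R \<Otimes>\<^sub>M ?R) ?R = measurable (\<nu> \<Otimes>\<^sub>M \<nu>) \<nu>"
      by (intro measurable_cong_sets sets_pair_measure_cong sets_R)
    then show "(\<lambda>p. fst p \<otimes>\<^bsub>kernel_group G \<mu>\<^esub> snd p) \<in> measurable (?R \<Otimes>\<^sub>M ?R) ?R"
      using k.mult_measurable_pair by simp
    have "measurable ?R ?R = measurable \<nu> \<nu>" by (intro measurable_cong_sets sets_R)
    then show "(\<lambda>x. inv\<^bsub>kernel_group G \<mu>\<^esub> x) \<in> measurable ?R ?R" using k.inv_measurable by simp
    show "emeasure ?R (space ?R) \<noteq> 0" using G1_nonzero em_R[OF sets.top] by (simp add: sp_R)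
    fix g A assume g: "g \<in> carrier (kernel_group G \<mu>)" and A: "A \<in> sets ?R"
    have gA: "g <#\<^bsub>kernel_group G \<mu>\<^esub> A = g <# A" by (simp add: l_coset_def)
    have g': "g \<in> carrier G" using g by (auto simp: G1_iff)
    have A': "A \<in> sets \<mu>" using A G1 by (auto simp: sets_restrict_space)
    have "A \<in> sets \<nu>" using A sets_R by simp
    have gA': "g <# A \<in> sets ?R"
    proof -
      have "(\<lambda>x. inv\<^bsub>kernel_group G \<mu>\<^esub> g \<otimes>\<^bsub>kernel_group G \<mu>\<^esub> x) -` A \<inter> space \<nu> \<in> sets \<nu>"
        using k.translate_measurable(1)[OF k.inv_closed[OF g]] \<open>A \<in> sets \<nu>\<close> by (rule measurable_sets)
      then show ?thesis
        using k.left_translate_vimage[OF k.inv_closed[OF g] k.sets_carrier[OF \<open>A \<in> sets \<nu>\<close>]] g sets_R by (simp add: gA)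
    qed
    show "emeasure ?R (g <#\<^bsub>kernel_group G \<mu>\<^esub> A) = emeasure ?R A"
      unfolding gA em_R[OF gA'] em_R[OF A] by (rule left_invariant[OF g' A'])
  qed
  obtain c where c: "c > 0" "\<And>A. A \<in> sets \<nu> \<Longrightarrow> emeasure ?R A = ennreal c * emeasure \<nu> A"
    using haar_unique[OF hk hR sets_R] by blast
  have "kernel_section G \<mu> \<nu> \<sigma> c"
  proof (intro kernel_section.intro kernel_section_axioms.intro)
    show "haar_group G \<mu>" by unfold_locales
    show "emeasure \<mu> A = ennreal c * emeasure \<nu> A" if "A \<in> sets \<nu>" for A
      using c(2)[OF that] em_R[of A] that sets_R by simp
  qed (use hk sets_R c level countable_K sec in auto)
  then show thesis by (rule that)
qed

section \<open>The two decompositions of the Hilbert space of the group\<close>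

context kernel_section
begin

sublocale kernel: haar_group "kernel_group G \<mu>" \<nu>
  by (rule kernel_haar)

lemma section_carrier: "k \<in> K1 \<Longrightarrow> \<sigma> k \<in> carrier G"
  and section_modular: "k \<in> K1 \<Longrightarrow> \<Delta> (\<sigma> k) = k"
  and section_one: "\<sigma> 1 = \<one>"
  using normalized by (simp_all add: normalized_section_def)

lemma one_in_range: "1 \<in> K1"
  using modular_one by (force simp: modular_range_def)

lemma range_pos: "k \<in> K1 \<Longrightarrow> 0 < k"
  by (auto simp: modular_range_def modular_pos)

lemma modular_in_range: "y \<in> carrier G \<Longrightarrow> \<Delta> y \<in> K1"
  by (auto simp: modular_range_def)

lemma space_\<nu>: "space \<nu> = G1"
  using kernel.space_haar by simp

lemma G1_carrier: "w \<in> G1 \<Longrightarrow> w \<in> carrier G"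
  by (simp add: G1_iff)

lemma G1_sets: "G1 \<in> sets \<mu>"
proof -
  have "G1 = {w \<in> carrier G. \<Delta> w = 1}" by (auto simp: G1_iff)
  then show ?thesis using level_measurable[of 1] by simp
qed

lemma sets_\<nu>_iff: "A \<in> sets \<nu> \<longleftrightarrow> A \<in> sets \<mu> \<and> A \<subseteq> G1"
proof -
  have "A \<in> sets \<nu> \<longleftrightarrow> A \<in> sets (restrict_space \<mu> G1)" by (simp add: sets_\<nu>)
  also have "\<dots> \<longleftrightarrow> A \<subseteq> G1 \<and> A \<in> sets \<mu>" using G1_sets by (intro sets_restrict_space_iff) auto
  finally show ?thesis by auto
qed

lemma measurable_into_\<nu>:
  assumes "f \<in> measurable m \<mu>" "\<And>x. x \<in> space m \<Longrightarrow> f x \<in> G1"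
  shows "f \<in> measurable m \<nu>"
proof -
  have "f \<in> measurable m (restrict_space \<mu> G1)" using assms by (intro measurable_restrict_space2) auto
  then show ?thesis by (simp add: measurable_cong_sets[OF refl sets_\<nu>])
qed

lemma inclusion_measurable: "(\<lambda>w. w) \<in> measurable \<nu> \<mu>"
proof (rule measurableI)
  fix A assume "A \<in> sets \<mu>"
  then show "(\<lambda>w. w) -` A \<inter> space \<nu> \<in> sets \<nu>" using G1_sets by (auto simp: sets_\<nu>_iff space_\<nu>)
qed (simp add: space_\<nu> space_haar G1_iff)

lemma modular_measurable: "\<Delta> \<in> measurable \<mu> (count_space K1)"
proof -
  have "\<Delta> -` {r} \<inter> space \<mu> \<in> sets \<mu>" for r
    using level_measurable[of r] by (simp add: space_haar vimage_def Int_def conj_commute)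
  then show ?thesis
    using modular_in_range by (auto simp: measurable_count_space_eq_countable[OF countable_range] space_haar)
qed

lemma coset_part_measurable:
  assumes "\<And>k. k \<in> K1 \<Longrightarrow> f k \<in> measurable \<mu> \<mu>"
  shows "(\<lambda>y. f (\<Delta> y) y) \<in> measurable \<mu> \<mu>"
  by (rule measurable_compose_countable'[OF assms modular_measurable countable_range])

lemma fibre_in_\<nu>:
  assumes \<theta>: "\<theta> \<in> measurable \<mu> \<mu>" and A: "A \<in> sets \<mu>" and sub: "\<And>w. w \<in> carrier G \<Longrightarrow> \<theta> w \<in> A \<Longrightarrow> w \<in> G1"
  shows "emeasure \<mu> (\<theta> -` A \<inter> space \<mu>) = ennreal c * emeasure \<nu> (\<theta> -` A \<inter> space \<nu>)"
proof -
  have eq: "\<theta> -` A \<inter> space \<mu> = \<theta> -` A \<inter> space \<nu>"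
    using sub by (auto simp: space_haar space_\<nu> G1_carrier)
  moreover have "\<theta> -` A \<inter> space \<nu> \<in> sets \<nu>"
    using measurable_sets[OF \<theta> A] eq by (auto simp: sets_\<nu>_iff space_\<nu>)
  ultimately show ?thesis by (simp add: emeasure_kernel)
qed

text \<open>
  Left cosets carry the weight \<open>c\<close>, since left translations preserve \<open>\<mu>\<close>. On right cosets the weight is
  \<open>k * c\<close>, since right translation by \<open>\<sigma> k\<close> multiplies \<open>\<mu>\<close> by \<open>k\<close>.
\<close>

sublocale left: measure_fibration \<nu> \<mu> K1 \<Delta> "\<lambda>k w. \<sigma> k \<otimes> w" "\<lambda>y. inv (\<sigma> (\<Delta> y)) \<otimes> y" "\<lambda>_. c"
proof
  show "countable K1" by (rule countable_range)
  show "\<Delta> \<in> measurable \<mu> (count_space K1)" by (rule modular_measurable)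
  show "(\<lambda>w. \<sigma> k \<otimes> w) \<in> measurable \<nu> \<mu>" if "k \<in> K1" for k
    by (rule measurable_compose[OF inclusion_measurable translate_measurable(1)[OF section_carrier[OF that]]])
  show "(\<lambda>y. inv (\<sigma> (\<Delta> y)) \<otimes> y) \<in> measurable \<mu> \<nu>"
  proof (rule measurable_into_\<nu>)
    show "(\<lambda>y. inv (\<sigma> (\<Delta> y)) \<otimes> y) \<in> measurable \<mu> \<mu>"
      by (rule coset_part_measurable) (simp add: translate_measurable(1) section_carrier)
    fix y assume "y \<in> space \<mu>"
    then have y: "y \<in> carrier G" by (simp add: space_haar)
    note s = section_carrier[OF modular_in_range[OF y]] section_modular[OF modular_in_range[OF y]]
    show "inv (\<sigma> (\<Delta> y)) \<otimes> y \<in> G1"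
      using y s modular_pos[OF y] by (simp add: G1_iff modular_mult modular_inv)
  qed
  show "\<sigma> (\<Delta> y) \<otimes> (inv (\<sigma> (\<Delta> y)) \<otimes> y) = y" if "y \<in> space \<mu>" for y
    using that section_carrier[OF modular_in_range[of y]] by (simp add: space_haar m_assoc[symmetric])
  show mod: "\<Delta> (\<sigma> k \<otimes> w) = k" if "k \<in> K1" "w \<in> space \<nu>" for k w
    using that by (simp add: space_\<nu> G1_iff modular_mult section_carrier section_modular)
  show "inv (\<sigma> (\<Delta> (\<sigma> k \<otimes> w))) \<otimes> (\<sigma> k \<otimes> w) = w" if "k \<in> K1" "w \<in> space \<nu>" for k w
    using that by (simp add: mod section_carrier space_\<nu> G1_iff m_assoc[symmetric])
  show "0 < c" by (rule c_positive)
  fix k A assume k: "k \<in> K1" and A: "A \<in> sets \<mu>" and fib: "\<And>y. y \<in> A \<Longrightarrow> \<Delta> y = k"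
  have "emeasure \<mu> A = emeasure \<mu> ((\<lambda>w. \<sigma> k \<otimes> w) -` A \<inter> space \<mu>)"
    using scales_left[OF section_carrier[OF k]] A by (simp add: scales_measure_def)
  also have "\<dots> = ennreal c * emeasure \<nu> ((\<lambda>w. \<sigma> k \<otimes> w) -` A \<inter> space \<nu>)"
  proof (rule fibre_in_\<nu>[OF translate_measurable(1)[OF section_carrier[OF k]] A])
    fix w assume "w \<in> carrier G" "\<sigma> k \<otimes> w \<in> A"
    then show "w \<in> G1"
      using fib[of "\<sigma> k \<otimes> w"] range_pos[OF k]
      by (simp add: G1_iff modular_mult section_carrier section_modular k)
  qed
  finally show "emeasure \<mu> A = ennreal c * emeasure \<nu> ((\<lambda>w. \<sigma> k \<otimes> w) -` A \<inter> space \<nu>)" .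
qed

sublocale right: measure_fibration \<nu> \<mu> K1 \<Delta> "\<lambda>k w. w \<otimes> \<sigma> k" "\<lambda>y. y \<otimes> inv (\<sigma> (\<Delta> y))" "\<lambda>k. k * c"
proof
  show "countable K1" by (rule countable_range)
  show "\<Delta> \<in> measurable \<mu> (count_space K1)" by (rule modular_measurable)
  show "(\<lambda>w. w \<otimes> \<sigma> k) \<in> measurable \<nu> \<mu>" if "k \<in> K1" for k
    by (rule measurable_compose[OF inclusion_measurable translate_measurable(2)[OF section_carrier[OF that]]])
  show "(\<lambda>y. y \<otimes> inv (\<sigma> (\<Delta> y))) \<in> measurable \<mu> \<nu>"
  proof (rule measurable_into_\<nu>)
    show "(\<lambda>y. y \<otimes> inv (\<sigma> (\<Delta> y))) \<in> measurable \<mu> \<mu>"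
      by (rule coset_part_measurable) (simp add: translate_measurable(2) section_carrier)
    fix y assume "y \<in> space \<mu>"
    then have y: "y \<in> carrier G" by (simp add: space_haar)
    note s = section_carrier[OF modular_in_range[OF y]] section_modular[OF modular_in_range[OF y]]
    show "y \<otimes> inv (\<sigma> (\<Delta> y)) \<in> G1"
      using y s modular_pos[OF y] by (simp add: G1_iff modular_mult modular_inv)
  qed
  show "(y \<otimes> inv (\<sigma> (\<Delta> y))) \<otimes> \<sigma> (\<Delta> y) = y" if "y \<in> space \<mu>" for y
    using that section_carrier[OF modular_in_range[of y]] by (simp add: space_haar m_assoc)
  show mod: "\<Delta> (w \<otimes> \<sigma> k) = k" if "k \<in> K1" "w \<in> space \<nu>" for k w
    using that by (simp add: space_\<nu> G1_iff modular_mult section_carrier section_modular)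
  show "(w \<otimes> \<sigma> k) \<otimes> inv (\<sigma> (\<Delta> (w \<otimes> \<sigma> k))) = w" if "k \<in> K1" "w \<in> space \<nu>" for k w
    using that by (simp add: mod section_carrier space_\<nu> G1_iff m_assoc)
  show "0 < k * c" if "k \<in> K1" for k using c_positive range_pos[OF that] by simp
  fix k A assume k: "k \<in> K1" and A: "A \<in> sets \<mu>" and fib: "\<And>y. y \<in> A \<Longrightarrow> \<Delta> y = k"
  have "ennreal k * emeasure \<mu> ((\<lambda>w. w \<otimes> \<sigma> k) -` A \<inter> space \<mu>) = ennreal k * (ennreal (inverse k) * emeasure \<mu> A)"
    using scales_right[OF section_carrier[OF k]] A by (simp add: scales_measure_def section_modular[OF k])
  also have "\<dots> = emeasure \<mu> A"
    using range_pos[OF k] by (simp add: mult.assoc[symmetric] ennreal_mult[symmetric])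
  also have "emeasure \<mu> ((\<lambda>w. w \<otimes> \<sigma> k) -` A \<inter> space \<mu>) = ennreal c * emeasure \<nu> ((\<lambda>w. w \<otimes> \<sigma> k) -` A \<inter> space \<nu>)"
  proof (rule fibre_in_\<nu>[OF translate_measurable(2)[OF section_carrier[OF k]] A])
    fix w assume "w \<in> carrier G" "w \<otimes> \<sigma> k \<in> A"
    then show "w \<in> G1"
      using fib[of "w \<otimes> \<sigma> k"] range_pos[OF k]
      by (simp add: G1_iff modular_mult section_carrier section_modular k)
  qed
  finally show "emeasure \<mu> A = ennreal (k * c) * emeasure \<nu> ((\<lambda>w. w \<otimes> \<sigma> k) -` A \<inter> space \<nu>)"
    using range_pos[OF k] c_positive by (simp add: ennreal_mult mult.assoc)
qed

abbreviation \<Lambda>1 :: "'a \<Rightarrow> 'a l2_op" where "\<Lambda>1 \<equiv> left_regular (kernel_group G \<mu>) \<nu>"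
abbreviation E :: "'a l2 \<Rightarrow> 'a l2" where "E \<equiv> left.emb 1"
abbreviation S :: "'a l2 \<Rightarrow> 'a l2" where "S \<equiv> left.slice 1"

definition conj_operator :: "'a \<Rightarrow> 'a l2_op" where
  "conj_operator s = pullback \<nu> (\<lambda>w. inv s \<otimes> w \<otimes> s)"

lemma conj_G1: "s \<in> carrier G \<Longrightarrow> w \<in> G1 \<Longrightarrow> inv s \<otimes> w \<otimes> s \<in> G1"
  using modular_pos[of s] by (simp add: G1_iff modular_mult modular_inv)

lemma scales_conj:
  assumes s: "s \<in> carrier G"
  shows "scales_measure \<nu> (\<lambda>w. inv s \<otimes> w \<otimes> s) (inverse (\<Delta> s))"
  unfolding scales_measure_def
proof (intro conjI ballI)
  have m: "(\<lambda>w. inv s \<otimes> w \<otimes> s) \<in> measurable \<mu> \<mu>" using s by measurable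
  show "(\<lambda>w. inv s \<otimes> w \<otimes> s) \<in> measurable \<nu> \<nu>"
    by (rule measurable_into_\<nu>[OF measurable_compose[OF inclusion_measurable m]])
      (simp add: space_\<nu> conj_G1 s)
  show "0 < inverse (\<Delta> s)" using modular_pos[OF s] by simp
  fix A assume A: "A \<in> sets \<nu>"
  then have A': "A \<in> sets \<mu>" and A_sub: "A \<subseteq> G1" by (auto simp: sets_\<nu>_iff)
  have B: "(\<lambda>w. w \<otimes> s) -` A \<inter> space \<mu> \<in> sets \<mu>" by (rule measurable_sets[OF translate_measurable(2)[OF s] A'])
  have "ennreal c * emeasure \<nu> ((\<lambda>w. inv s \<otimes> w \<otimes> s) -` A \<inter> space \<nu>)
      = emeasure \<mu> ((\<lambda>w. inv s \<otimes> w \<otimes> s) -` A \<inter> space \<mu>)"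
  proof (rule fibre_in_\<nu>[OF m A', symmetric])
    fix w assume w: "w \<in> carrier G" "inv s \<otimes> w \<otimes> s \<in> A"
    then have "\<Delta> (inv s \<otimes> w \<otimes> s) = 1" using A_sub by (auto simp: G1_iff)
    then have "\<Delta> w * (inverse (\<Delta> s) * \<Delta> s) = 1"
      using w(1) s by (simp add: modular_mult modular_inv mult_ac)
    then show "w \<in> G1" using w(1) modular_pos[OF s] by (simp add: G1_iff)
  qed
  also have "(\<lambda>w. inv s \<otimes> w \<otimes> s) -` A \<inter> space \<mu> = (\<lambda>w. inv s \<otimes> w) -` ((\<lambda>w. w \<otimes> s) -` A \<inter> space \<mu>) \<inter> space \<mu>"
    using s by (auto simp: space_haar)
  also have "emeasure \<mu> \<dots> = emeasure \<mu> ((\<lambda>w. w \<otimes> s) -` A \<inter> space \<mu>)"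
    using scales_measure_emeasure[OF scales_left_inv[OF s] B] unfolding ennreal_1 mult_1_left .
  also have "\<dots> = ennreal (inverse (\<Delta> s)) * emeasure \<mu> A"
    by (rule scales_measure_emeasure[OF scales_right[OF s] A'])
  also have "\<dots> = ennreal c * (ennreal (inverse (\<Delta> s)) * emeasure \<nu> A)"
    by (simp add: emeasure_kernel[OF A] ac_simps)
  finally show "emeasure \<nu> ((\<lambda>w. inv s \<otimes> w \<otimes> s) -` A \<inter> space \<nu>) = ennreal (inverse (\<Delta> s)) * emeasure \<nu> A"
    using c_positive by (simp add: ennreal_mult_cancel_left)
qed

lemma conj_in: "s \<in> carrier G \<Longrightarrow> conj_operator s \<in> bounded_ops \<nu>"
  unfolding conj_operator_def by (rule pullback_in[OF scales_conj])

lemma conj_inverse: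
  assumes s: "s \<in> carrier G" and X: "X \<in> L2_space \<nu>"
  shows "conj_operator s (conj_operator (inv s) X) = X" "conj_operator (inv s) (conj_operator s X) = X"
proof -
  have *: "conj_operator a (conj_operator (inv a) X) = X" if a: "a \<in> carrier G" for a
    unfolding conj_operator_def pullback_pullback[OF scales_conj[OF a] scales_conj[OF inv_closed[OF a]] X]
  proof (rule pullback_ident[OF X])
    fix w assume "w \<in> space \<nu>"
    then have "w \<in> carrier G" by (simp add: space_\<nu> G1_carrier)
    moreover from this have "a \<otimes> (inv a \<otimes> w) = w" using a by (simp add: m_assoc[symmetric])
    ultimately show "inv (inv a) \<otimes> (inv a \<otimes> w \<otimes> a) \<otimes> inv a = w" using a by (simp add: m_assoc)
  qed
  show "conj_operator s (conj_operator (inv s) X) = X" by (rule *[OF s])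
  show "conj_operator (inv s) (conj_operator s X) = X" using *[of "inv s"] s by simp
qed

lemma \<Lambda>1_pullback: "h \<in> G1 \<Longrightarrow> \<Lambda>1 h = pullback \<nu> (\<lambda>w. inv h \<otimes> w)"
  by (simp add: kernel.left_regular_pullback kernel_inv)

lemma scales_\<Lambda>1: "h \<in> G1 \<Longrightarrow> scales_measure \<nu> (\<lambda>w. inv h \<otimes> w) 1"
  using kernel.scales_left_inv[of h] by (simp add: kernel_inv)

lemma conj_\<Lambda>1:
  assumes s: "s \<in> carrier G" and h: "h \<in> G1" and X: "X \<in> L2_space \<nu>"
  shows "conj_operator s (\<Lambda>1 h (conj_operator (inv s) X)) = \<Lambda>1 (s \<otimes> h \<otimes> inv s) X"
proof -
  have sh: "s \<otimes> h \<otimes> inv s \<in> G1" using conj_G1[of "inv s" h] s h by simp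
  have hc: "h \<in> carrier G" using h by (rule G1_carrier)
  define f where "f = L2_rep X"
  have f: "f \<in> L2_fun \<nu>" unfolding f_def by (rule L2_rep_in[OF X])
  have Xf: "X = L2_class \<nu> f" unfolding f_def by (rule L2_class_rep[OF X, symmetric])
  note c' = scales_conj[OF inv_closed[OF s]] and cs = scales_conj[OF s]
  note f1 = pullback_fun[OF c' f] note f2 = pullback_fun[OF scales_\<Lambda>1[OF h] f1] note f3 = pullback_fun[OF cs f2]
  note g = pullback_fun[OF scales_\<Lambda>1[OF sh] f]
  have "conj_operator s (\<Lambda>1 h (conj_operator (inv s) X))
      = L2_class \<nu> (\<lambda>w. f (inv (inv s) \<otimes> (inv h \<otimes> (inv s \<otimes> w \<otimes> s)) \<otimes> inv s))"
    unfolding Xf conj_operator_def \<Lambda>1_pullback[OF h] pullback_class[OF c' f]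
      pullback_class[OF scales_\<Lambda>1[OF h] f1] pullback_class[OF cs f2] ..
  also have "\<dots> = L2_class \<nu> (\<lambda>w. f (inv (s \<otimes> h \<otimes> inv s) \<otimes> w))"
  proof (rule L2_class_cong[OF f3 g], rule AE_I2)
    fix w assume "w \<in> space \<nu>"
    then have w: "w \<in> carrier G" by (simp add: space_\<nu> G1_carrier)
    have "inv (inv s) \<otimes> (inv h \<otimes> (inv s \<otimes> w \<otimes> s)) \<otimes> inv s = s \<otimes> inv h \<otimes> inv s \<otimes> w \<otimes> (s \<otimes> inv s)"
      using s hc w by (simp only: inv_inv m_assoc m_closed inv_closed)
    also have "\<dots> = inv (s \<otimes> h \<otimes> inv s) \<otimes> w"
      using s hc w by (simp add: inv_mult_group m_assoc)
    finally show "f (inv (inv s) \<otimes> (inv h \<otimes> (inv s \<otimes> w \<otimes> s)) \<otimes> inv s) = f (inv (s \<otimes> h \<otimes> inv s) \<otimes> w)" by simp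
  qed
  also have "\<dots> = \<Lambda>1 (s \<otimes> h \<otimes> inv s) X"
    unfolding Xf \<Lambda>1_pullback[OF sh] pullback_class[OF scales_\<Lambda>1[OF sh] f] ..
  finally show ?thesis .
qed

definition extend :: "('a \<Rightarrow> complex) \<Rightarrow> 'a \<Rightarrow> complex" where
  "extend f y = (if \<Delta> y = 1 then f y else 0)"

text \<open>
  On representatives the embedding of the fibre over 1 is extension by zero: as \<open>\<sigma> 1\<close> is the neutral
  element, no translation is involved.
\<close>

lemma E_class:
  assumes f: "f \<in> L2_fun \<nu>"
  shows "extend f \<in> L2_fun \<mu>" "E (L2_class \<nu> f) = L2_class \<mu> (extend f)"
proof -
  note e = left.emb_fun[OF one_in_range f]
  have eq: "(if \<Delta> y = 1 then f (inv (\<sigma> (\<Delta> y)) \<otimes> y) else 0) = extend f y" if "y \<in> space \<mu>" for y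
    using that by (simp add: extend_def section_one space_haar)
  have "extend f \<in> borel_measurable \<mu>"
    by (rule measurable_cong[THEN iffD1, OF _ L2_fun_measurable[OF e]]) (rule eq)
  then show ext: "extend f \<in> L2_fun \<mu>" by (rule L2_fun_cong_AE[OF e]) (simp add: eq)
  show "E (L2_class \<nu> f) = L2_class \<mu> (extend f)"
    unfolding left.emb_class[OF one_in_range f] by (rule L2_class_cong[OF e ext]) (simp add: eq)
qed

lemma S_class:
  assumes f: "f \<in> L2_fun \<mu>"
  shows "f \<in> L2_fun \<nu>" "S (L2_class \<mu> f) = L2_class \<nu> f"
proof -
  note e = left.slice_class[OF one_in_range f]
  have eq: "f (\<sigma> 1 \<otimes> w) = f w" if "w \<in> space \<nu>" for w
    using that by (simp add: section_one space_\<nu> G1_carrier)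
  have "f \<in> borel_measurable \<nu>"
    by (rule measurable_cong[THEN iffD1, OF _ L2_fun_measurable[OF e(1)]]) (rule eq)
  then show ext: "f \<in> L2_fun \<nu>" by (rule L2_fun_cong_AE[OF e(1)]) (simp add: eq)
  show "S (L2_class \<mu> f) = L2_class \<nu> f"
    unfolding e(2) by (rule L2_class_cong[OF e(1) ext]) (simp add: eq)
qed

lemmas E_in = left.emb_in[OF one_in_range]
lemmas S_in = left.slice_in[OF one_in_range]

lemma S_E: "X \<in> L2_space \<nu> \<Longrightarrow> S (E X) = X"
  using left.slice_emb[OF one_in_range one_in_range] by simp

lemma left_E:
  assumes h: "h \<in> G1" and X: "X \<in> L2_space \<nu>"
  shows "\<Lambda> h (E X) = E (\<Lambda>1 h X)"
proof -
  have hc: "h \<in> carrier G" using h by (rule G1_carrier)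
  note f = L2_rep_in[OF X] and Xf = L2_class_rep[OF X]
  note g = pullback_fun[OF scales_\<Lambda>1[OF h] f]
  have "\<Lambda> h (E X) = L2_class \<mu> (\<lambda>y. extend (L2_rep X) (inv h \<otimes> y))"
    using pullback_class[OF scales_left_inv[OF hc] E_class(1)[OF f]] E_class(2)[OF f] Xf
    by (simp add: left_regular_pullback)
  also have "\<dots> = L2_class \<mu> (extend (\<lambda>w. L2_rep X (inv h \<otimes> w)))"
    by (rule L2_class_cong[OF pullback_fun[OF scales_left_inv[OF hc] E_class(1)[OF f]] E_class(1)[OF g]], rule AE_I2)
      (use h in \<open>simp add: extend_def space_haar G1_iff modular_mult modular_inv\<close>)
  also have "\<dots> = E (\<Lambda>1 h X)"
    using E_class(2)[OF g] pullback_class[OF scales_\<Lambda>1[OF h] f] Xf by (simp add: \<Lambda>1_pullback[OF h])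
  finally show ?thesis .
qed

lemma left_E_section:
  assumes k: "k \<in> K1" and X: "X \<in> L2_space \<nu>"
  shows "\<Lambda> (\<sigma> k) (E X) = left.emb k X"
proof -
  note s = section_carrier[OF k] section_modular[OF k] and f = L2_rep_in[OF X] and Xf = L2_class_rep[OF X]
  have "\<Lambda> (\<sigma> k) (E X) = L2_class \<mu> (\<lambda>y. extend (L2_rep X) (inv (\<sigma> k) \<otimes> y))"
    using pullback_class[OF scales_left_inv[OF s(1)] E_class(1)[OF f]] E_class(2)[OF f] Xf
    by (simp add: left_regular_pullback)
  also have "\<dots> = left.emb k X"
    unfolding left.emb_def
    by (rule L2_class_cong[OF pullback_fun[OF scales_left_inv[OF s(1)] E_class(1)[OF f]] left.emb_fun[OF k f]], rule AE_I2)
      (use s range_pos[OF k] in \<open>auto simp: extend_def space_haar modular_mult modular_inv field_simps\<close>)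
  finally show ?thesis .
qed

lemma right_E_section:
  assumes k: "k \<in> K1" and X: "X \<in> L2_space \<nu>"
  shows "right_translation (\<sigma> k) (E X) = right.emb k X"
proof -
  note s = section_carrier[OF k] section_modular[OF k] and f = L2_rep_in[OF X] and Xf = L2_class_rep[OF X]
  have "right_translation (\<sigma> k) (E X) = L2_class \<mu> (\<lambda>y. extend (L2_rep X) (y \<otimes> inv (\<sigma> k)))"
    using pullback_class[OF scales_right_inv[OF s(1)] E_class(1)[OF f]] E_class(2)[OF f] Xf
    by (simp add: right_translation_def)
  also have "\<dots> = right.emb k X"
    unfolding right.emb_def
    by (rule L2_class_cong[OF pullback_fun[OF scales_right_inv[OF s(1)] E_class(1)[OF f]] right.emb_fun[OF k f]], rule AE_I2)
      (use s range_pos[OF k] in \<open>auto simp: extend_def space_haar modular_mult modular_inv field_simps\<close>)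
  finally show ?thesis .
qed

text \<open>
  Both sides are supported on the same coset, as the kernel is normal: \<open>f (s\<^sup>-\<^sup>1 y)\<close> is the value at
  \<open>y s\<^sup>-\<^sup>1\<close> of \<open>f\<close> composed with a conjugation.
\<close>

lemma left_E_conj:
  assumes s: "s \<in> carrier G" and X: "X \<in> L2_space \<nu>"
  shows "\<Lambda> s (E X) = right_translation s (E (conj_operator s X))"
proof -
  note f = L2_rep_in[OF X] and Xf = L2_class_rep[OF X]
  note g = pullback_fun[OF scales_conj[OF s] f]
  have "\<Lambda> s (E X) = L2_class \<mu> (\<lambda>y. extend (L2_rep X) (inv s \<otimes> y))"
    using pullback_class[OF scales_left_inv[OF s] E_class(1)[OF f]] E_class(2)[OF f] Xf
    by (simp add: left_regular_pullback)
  also have "\<dots> = L2_class \<mu> (\<lambda>y. extend (\<lambda>w. L2_rep X (inv s \<otimes> w \<otimes> s)) (y \<otimes> inv s))"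
    by (rule L2_class_cong[OF pullback_fun[OF scales_left_inv[OF s] E_class(1)[OF f]]
          pullback_fun[OF scales_right_inv[OF s] E_class(1)[OF g]]], rule AE_I2)
      (use s in \<open>simp add: extend_def space_haar modular_mult modular_inv m_assoc mult.commute\<close>)
  also have "\<dots> = right_translation s (E (conj_operator s X))"
    using pullback_class[OF scales_right_inv[OF s] E_class(1)[OF g]] E_class(2)[OF g] pullback_class[OF scales_conj[OF s] f] Xf
    by (simp add: right_translation_def conj_operator_def)
  finally show ?thesis .
qed

lemma S_left:
  assumes h: "h \<in> G1" and F: "F \<in> L2_space \<mu>"
  shows "S (\<Lambda> h F) = \<Lambda>1 h (S F)"
proof -
  have hc: "h \<in> carrier G" using h by (rule G1_carrier)
  note f = L2_rep_in[OF F] and Ff = L2_class_rep[OF F]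
  have "S (\<Lambda> h F) = L2_class \<nu> (\<lambda>w. L2_rep F (inv h \<otimes> w))"
    using S_class(2)[OF pullback_fun[OF scales_left_inv[OF hc] f]] pullback_class[OF scales_left_inv[OF hc] f] Ff
    by (simp add: left_regular_pullback)
  also have "\<dots> = \<Lambda>1 h (S F)"
    using S_class(2)[OF f] pullback_class[OF scales_\<Lambda>1[OF h] S_class(1)[OF f]] Ff by (simp add: \<Lambda>1_pullback[OF h])
  finally show ?thesis .
qed

lemma S_conj:
  assumes s: "s \<in> carrier G" and F: "F \<in> L2_space \<mu>"
  shows "S (right_translation (inv s) (\<Lambda> s F)) = conj_operator s (S F)"
proof -
  note f = L2_rep_in[OF F] and Ff = L2_class_rep[OF F] and is' = inv_closed[OF s]
  note g = pullback_fun[OF scales_left_inv[OF s] f] note g' = pullback_fun[OF scales_right_inv[OF is'] g]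
  note g2 = pullback_fun[OF scales_conj[OF s] S_class(1)[OF f]]
  have "right_translation (inv s) (\<Lambda> s F) = L2_class \<mu> (\<lambda>y. L2_rep F (inv s \<otimes> (y \<otimes> inv (inv s))))"
    using pullback_class[OF scales_left_inv[OF s] f] pullback_class[OF scales_right_inv[OF is'] g] Ff
    by (simp add: left_regular_pullback right_translation_def)
  then have "S (right_translation (inv s) (\<Lambda> s F)) = L2_class \<nu> (\<lambda>w. L2_rep F (inv s \<otimes> (w \<otimes> inv (inv s))))"
    using S_class(2)[OF g'] by simp
  also have "\<dots> = L2_class \<nu> (\<lambda>w. L2_rep F (inv s \<otimes> w \<otimes> s))"
    by (rule L2_class_cong[OF S_class(1)[OF g'] g2], rule AE_I2)
      (use s in \<open>simp add: space_\<nu> G1_carrier m_assoc\<close>)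
  also have "\<dots> = conj_operator s (S F)"
    using S_class(2)[OF f] pullback_class[OF scales_conj[OF s] S_class(1)[OF f]] Ff by (simp add: conj_operator_def)
  finally show ?thesis .
qed

end

context kernel_section
begin

lemma range_inverse:
  assumes "k \<in> K1"
  shows "inverse k \<in> K1"
proof -
  obtain g where "g \<in> carrier G" "k = \<Delta> g" using assms by (auto simp: modular_range_def)
  then show ?thesis using modular_in_range[of "inv g"] by (simp add: modular_inv)
qed

section \<open>The automorphisms of the cocycle action\<close>

abbreviation L :: "'a l2_op set" where "L \<equiv> left_operators"
abbreviation L1 :: "'a l2_op set" where "L1 \<equiv> kernel.left_operators"

lemma conj_L1:
  assumes s: "s \<in> carrier G" and T: "T \<in> L1"
  shows "op_mult \<nu> (conj_operator s) (op_mult \<nu> T (conj_operator (inv s))) \<in> L1"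
proof -
  obtain h where h: "h \<in> G1" "T = \<Lambda>1 h" using T by auto
  have sh: "s \<otimes> h \<otimes> inv s \<in> G1" using conj_G1[of "inv s" h] s h by simp
  have b: "\<Lambda>1 h \<in> bounded_ops \<nu>" "\<Lambda>1 (s \<otimes> h \<otimes> inv s) \<in> bounded_ops \<nu>" using h sh by (simp_all add: kernel.left_in)
  have "op_mult \<nu> (conj_operator s) (op_mult \<nu> (\<Lambda>1 h) (conj_operator (inv s))) = \<Lambda>1 (s \<otimes> h \<otimes> inv s)"
    by (rule bounded_ops_ext[of _ \<nu>]) (use s h b in \<open>simp_all add: op_mult_in conj_in conj_\<Lambda>1\<close>)
  then show ?thesis using sh h by simp
qed

text \<open>
  Conjugation of functions on the kernel by \<open>s\<close> is a multiple of a unitary that normalizes the left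
  translations. This gives existence; uniqueness is \<open>vn_automorphism_eqI\<close>.
\<close>

lemma section_automorphism_eq:
  assumes k: "k \<in> K1"
  defines "s \<equiv> \<sigma> (inverse k)" and "N \<equiv> group_vna (kernel_group G \<mu>) \<nu>"
  shows "section_automorphism G \<mu> \<nu> \<sigma> k
    = (\<lambda>T\<in>N. op_mult \<nu> (conj_operator (inv s)) (op_mult \<nu> T (conj_operator s)))"
proof -
  have "inverse k \<in> K1"
    using k by (rule range_inverse)
  then have s: "s \<in> carrier G" unfolding s_def by (rule section_carrier)
  note s_inv = inv_closed[OF s]
  have N: "N = commutant \<nu> (commutant \<nu> L1)" by (simp add: N_def group_vna_def)
  let ?a = "\<lambda>T\<in>N. op_mult \<nu> (conj_operator (inv s)) (op_mult \<nu> T (conj_operator s))"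
  have sim: "L2_inner \<nu> (conj_operator (inv s) X) (conj_operator (inv s) Y) = of_real (\<Delta> s) * L2_inner \<nu> X Y"
    if "X \<in> L2_space \<nu>" "Y \<in> L2_space \<nu>" for X Y
    unfolding conj_operator_def using pullback_inner[OF scales_conj[OF s_inv] that] s by (simp add: modular_inv)
  have a: "?a \<in> vn_automorphisms \<nu> N" "ultraweakly_continuous \<nu> N ?a"
    using conjugation_automorphism[OF conj_in[OF s_inv] conj_in[OF s] conj_inverse(2)[OF s] conj_inverse(1)[OF s] sim
        kernel.left_operators_bounded _ _ kernel.left_operators_adjoint N]
      conj_L1[OF s_inv] conj_L1[OF s] s by auto
  have gen: "?a (\<Lambda>1 h) = \<Lambda>1 (section_conj G \<sigma> k h)" if h: "h \<in> G1" for h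
  proof -
    have "\<Lambda>1 h \<in> N" unfolding N using subset_bicommutant[OF kernel.left_operators_bounded] h by auto
    moreover have sh: "inv s \<otimes> h \<otimes> inv (inv s) \<in> G1" using conj_G1[OF s h] s by simp
    have b: "\<Lambda>1 h \<in> bounded_ops \<nu>" "\<Lambda>1 (inv s \<otimes> h \<otimes> inv (inv s)) \<in> bounded_ops \<nu>"
      using h sh by (simp_all add: kernel.left_in)
    moreover have "op_mult \<nu> (conj_operator (inv s)) (op_mult \<nu> (\<Lambda>1 h) (conj_operator s)) = \<Lambda>1 (inv s \<otimes> h \<otimes> inv (inv s))"
      by (rule bounded_ops_ext[of _ \<nu>])
        (use s h b conj_\<Lambda>1[OF s_inv h] in \<open>simp_all add: op_mult_in conj_in\<close>)
    ultimately show ?thesis using s by (simp add: section_conj_def s_def)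
  qed
  show ?thesis
    unfolding section_automorphism_def N_def[symmetric]
  proof (rule the_equality)
    show "?a \<in> vn_automorphisms \<nu> N \<and> ultraweakly_continuous \<nu> N ?a \<and>
        (\<forall>h\<in>G1. ?a (\<Lambda>1 h) = \<Lambda>1 (section_conj G \<sigma> k h))"
      using a gen by blast
    fix b assume b: "b \<in> vn_automorphisms \<nu> N \<and> ultraweakly_continuous \<nu> N b \<and>
        (\<forall>h\<in>G1. b (\<Lambda>1 h) = \<Lambda>1 (section_conj G \<sigma> k h))"
    show "b = ?a"
    proof (rule vn_automorphism_eqI[OF kernel.sigma_finite_haar kernel.left_operators_bounded
          kernel.left_operators_adjoint kernel.op_id_left_operators N _ _ a])
      fix T assume "T \<in> L1"
      then obtain h where "h \<in> G1" "T = \<Lambda>1 h" by auto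
      then show "b T = ?a T" using b gen by metis
    qed (use b in auto)
  qed
qed

lemma fixed_iff_commutes:
  assumes k: "k \<in> K1" and T: "T \<in> group_vna (kernel_group G \<mu>) \<nu>"
  shows "section_automorphism G \<mu> \<nu> \<sigma> k T = T
    \<longleftrightarrow> (\<forall>X\<in>L2_space \<nu>. T (conj_operator (\<sigma> (inverse k)) X) = conj_operator (\<sigma> (inverse k)) (T X))"
proof -
  define s where "s = \<sigma> (inverse k)"
  have "inverse k \<in> K1"
    using k by (rule range_inverse)
  then have s: "s \<in> carrier G" unfolding s_def by (rule section_carrier)
  note s_inv = inv_closed[OF s]
  have T': "T \<in> bounded_ops \<nu>" using T commutant_subset unfolding group_vna_def by blast
  have eq: "section_automorphism G \<mu> \<nu> \<sigma> k T = op_mult \<nu> (conj_operator (inv s)) (op_mult \<nu> T (conj_operator s))"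
    using section_automorphism_eq[OF k] T by (simp add: s_def)
  show ?thesis
    unfolding eq s_def[symmetric]
  proof
    assume fixed: "op_mult \<nu> (conj_operator (inv s)) (op_mult \<nu> T (conj_operator s)) = T"
    show "\<forall>X\<in>L2_space \<nu>. T (conj_operator s X) = conj_operator s (T X)"
    proof
      fix X assume X: "X \<in> L2_space \<nu>"
      note TX = bounded_ops_in[OF T' bounded_ops_in[OF conj_in[OF s] X]]
      have "conj_operator (inv s) (T (conj_operator s X)) = T X"
        using arg_cong[OF fixed, of "\<lambda>T. T X"] X by simp
      then have "conj_operator s (conj_operator (inv s) (T (conj_operator s X))) = conj_operator s (T X)" by simp
      then show "T (conj_operator s X) = conj_operator s (T X)" using conj_inverse(1)[OF s TX] by simp
    qed
  next
    assume comm: "\<forall>X\<in>L2_space \<nu>. T (conj_operator s X) = conj_operator s (T X)"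
    show "op_mult \<nu> (conj_operator (inv s)) (op_mult \<nu> T (conj_operator s)) = T"
      by (rule bounded_ops_ext[of _ \<nu>])
        (use comm s T' in \<open>simp_all add: op_mult_in conj_in conj_inverse(2) bounded_ops_in[OF T']\<close>)
  qed
qed

section \<open>Comparison of the centers\<close>

definition invariant_center :: "'a l2_op set" where
  "invariant_center = {z \<in> commutant \<nu> (commutant \<nu> L1) \<inter> commutant \<nu> L1.
     \<forall>k\<in>K1. \<forall>X\<in>L2_space \<nu>. z (conj_operator (\<sigma> k) X) = conj_operator (\<sigma> k) (z X)}"

lemma fixed_center_eq:
  "{x \<in> vn_center \<nu> (group_vna (kernel_group G \<mu>) \<nu>). \<forall>k\<in>K1. section_automorphism G \<mu> \<nu> \<sigma> k x = x}
    = invariant_center"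
proof -
  have inv: "inverse k \<in> K1" if "k \<in> K1" for k
    using that by (rule range_inverse)
  have N: "group_vna (kernel_group G \<mu>) \<nu> = commutant \<nu> (commutant \<nu> L1)" by (simp add: group_vna_def)
  have "(\<forall>k\<in>K1. section_automorphism G \<mu> \<nu> \<sigma> k x = x)
      \<longleftrightarrow> (\<forall>k\<in>K1. \<forall>X\<in>L2_space \<nu>. x (conj_operator (\<sigma> k) X) = conj_operator (\<sigma> k) (x X))"
    if x: "x \<in> commutant \<nu> (commutant \<nu> L1)" for x
  proof -
    have "(\<forall>k\<in>K1. section_automorphism G \<mu> \<nu> \<sigma> k x = x)
      \<longleftrightarrow> (\<forall>k\<in>K1. \<forall>X\<in>L2_space \<nu>. x (conj_operator (\<sigma> (inverse k)) X) = conj_operator (\<sigma> (inverse k)) (x X))"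
      using fixed_iff_commutes[of _ x] x by (simp add: N)
    also have "\<dots> \<longleftrightarrow> (\<forall>k\<in>K1. \<forall>X\<in>L2_space \<nu>. x (conj_operator (\<sigma> k) X) = conj_operator (\<sigma> k) (x X))"
      using inv by (metis inverse_inverse_eq)
    finally show ?thesis .
  qed
  then show ?thesis
    unfolding N vn_center_bicommutant[OF kernel.left_operators_bounded] invariant_center_def by blast
qed

text \<open>
  Left translation by \<open>g\<close> permutes the left cosets, and between two of them it acts through an element
  \<open>h\<close> of the kernel, with which \<open>y\<close> commutes.
\<close>

lemma left_amp_commutant:
  assumes y: "y \<in> commutant \<nu> L1"
  shows "left.amp y \<in> commutant \<mu> L"
proof (rule commutantI[OF _ left_operators_bounded])
  have y': "y \<in> bounded_ops \<nu>" using y commutant_subset by blast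
  show amp: "left.amp y \<in> bounded_ops \<mu>" by (rule left.amp_in[OF y'])
  fix T F assume "T \<in> L" and F: "F \<in> L2_space \<mu>"
  then obtain g where g: "g \<in> carrier G" "T = \<Lambda> g" by auto
  have "op_mult \<mu> (left.amp y) (\<Lambda> g) = op_mult \<mu> (\<Lambda> g) (left.amp y)"
  proof (rule left.emb_operator_ext)
    fix k X assume k: "k \<in> K1" and X: "X \<in> L2_space \<nu>"
    note s = section_carrier[OF k] section_modular[OF k]
    define k' where "k' = \<Delta> (g \<otimes> \<sigma> k)"
    have k': "k' \<in> K1" unfolding k'_def by (rule modular_in_range) (use g s in simp)
    note s' = section_carrier[OF k'] section_modular[OF k']
    define h where "h = inv (\<sigma> k') \<otimes> (g \<otimes> \<sigma> k)"
    have h: "h \<in> G1"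
    proof -
      have "\<Delta> h = inverse k' * k'"
        using modular_mult[of "inv (\<sigma> k')" "g \<otimes> \<sigma> k"] g(1) s(1) s'
        unfolding h_def k'_def[symmetric] by (simp add: modular_inv)
      then show ?thesis using g(1) s(1) s'(1) range_pos[OF k'] by (simp add: G1_iff h_def)
    qed
    have hs: "g \<otimes> \<sigma> k = \<sigma> k' \<otimes> h" using g s s' by (simp add: h_def m_assoc[symmetric])
    have move: "\<Lambda> g (left.emb k Z) = left.emb k' (\<Lambda>1 h Z)" if Z: "Z \<in> L2_space \<nu>" for Z
    proof -
      have Z1: "\<Lambda>1 h Z \<in> L2_space \<nu>" using kernel.left_in[of h] h Z by (simp add: bounded_ops_in)
      have "\<Lambda> g (left.emb k Z) = \<Lambda> (\<sigma> k' \<otimes> h) (E Z)"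
        using left_left[OF g(1) s(1) E_in[OF Z]] by (simp add: left_E_section[OF k Z, symmetric] hs)
      also have "\<dots> = \<Lambda> (\<sigma> k') (E (\<Lambda>1 h Z))"
        using left_left[OF s'(1) G1_carrier[OF h] E_in[OF Z]] left_E[OF h Z] by simp
      finally show ?thesis by (simp add: left_E_section[OF k' Z1])
    qed
    have yX: "y X \<in> L2_space \<nu>" and hX: "\<Lambda>1 h X \<in> L2_space \<nu>"
      using kernel.left_in[of h] h X bounded_ops_in[OF y' X] by (simp_all add: bounded_ops_in)
    have "y (\<Lambda>1 h X) = \<Lambda>1 h (y X)" using commutantD[OF y _ X, of "\<Lambda>1 h"] h by simp
    then show "op_mult \<mu> (left.amp y) (\<Lambda> g) (left.emb k X) = op_mult \<mu> (\<Lambda> g) (left.amp y) (left.emb k X)"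
      by (simp add: left.emb_in[OF k X] move X yX left.amp_emb[OF y' k X] left.amp_emb[OF y' k' hX])
  qed (use amp g left_in in \<open>simp_all add: op_mult_in\<close>)
  from arg_cong[OF this, of "\<lambda>Z. Z F"] show "left.amp y (T F) = T (left.amp y F)" using F g by simp
qed

text \<open>
  Left translation by an element \<open>h\<close> of the kernel preserves each right coset and acts on all of them
  as \<open>\<Lambda>1 h\<close>, so it is the amplification of \<open>\<Lambda>1 h\<close>. An operator in the commutant of all left
  translations therefore has entries in the commutant of \<open>L1\<close>, with which \<open>z\<close> commutes.
\<close>

lemma right_amp_bicommutant:
  assumes z: "z \<in> commutant \<nu> (commutant \<nu> L1)"
  shows "right.amp z \<in> commutant \<mu> (commutant \<mu> L)"
proof (rule commutantI[OF _ commutant_subset])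
  have z': "z \<in> bounded_ops \<nu>" using z commutant_subset by blast
  show "right.amp z \<in> bounded_ops \<mu>" by (rule right.amp_in[OF z'])
  fix Y F assume Y: "Y \<in> commutant \<mu> L" and F: "F \<in> L2_space \<mu>"
  have Y': "Y \<in> bounded_ops \<mu>" using Y commutant_subset by blast
  have "Y (right.amp z F) = right.amp z (Y F)"
  proof (rule right.amp_bicommutant_commute[OF kernel.left_operators_bounded z Y' _ F])
    fix T F assume "T \<in> L1" and F: "F \<in> L2_space \<mu>"
    then obtain h where h: "h \<in> G1" "T = \<Lambda>1 h" by auto
    have hc: "h \<in> carrier G" using h by (simp add: G1_carrier)
    have b: "\<Lambda>1 h \<in> bounded_ops \<nu>" using h by (simp add: kernel.left_in)
    have "right.amp (\<Lambda>1 h) = \<Lambda> h"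
    proof (rule right.emb_operator_ext)
      fix k X assume k: "k \<in> K1" and X: "X \<in> L2_space \<nu>"
      note s = section_carrier[OF k]
      have "\<Lambda> h (right.emb k X) = right_translation (\<sigma> k) (\<Lambda> h (E X))"
        using left_right[OF hc s E_in[OF X]] by (simp add: right_E_section[OF k X])
      also have "\<dots> = right.emb k (\<Lambda>1 h X)"
        by (simp add: left_E[OF h(1) X] right_E_section[OF k bounded_ops_in[OF b X]])
      finally show "right.amp (\<Lambda>1 h) (right.emb k X) = \<Lambda> h (right.emb k X)"
        by (simp add: right.amp_emb[OF b k X])
    qed (use b hc in \<open>simp_all add: right.amp_in left_in\<close>)
    then show "Y (right.amp T F) = right.amp T (Y F)"
      using commutantD[OF Y _ F, of "\<Lambda> h"] h hc by simp
  qed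
  then show "right.amp z (Y F) = Y (right.amp z F)" by simp
qed

text \<open>
  The left and the right coset of \<open>\<sigma> k\<close> coincide, and their identifications with the kernel differ by
  conjugation by \<open>\<sigma> k\<close>.
\<close>

lemma left_amp_eq_right_amp:
  assumes z: "z \<in> bounded_ops \<nu>"
    and inv: "\<And>k X. k \<in> K1 \<Longrightarrow> X \<in> L2_space \<nu> \<Longrightarrow> z (conj_operator (\<sigma> k) X) = conj_operator (\<sigma> k) (z X)"
  shows "left.amp z = right.amp z"
proof (rule left.emb_operator_ext[OF left.amp_in[OF z] right.amp_in[OF z]])
  fix k X assume k: "k \<in> K1" and X: "X \<in> L2_space \<nu>"
  note s = section_carrier[OF k]
  have eq: "left.emb k Z = right.emb k (conj_operator (\<sigma> k) Z)" if Z: "Z \<in> L2_space \<nu>" for Z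
    using left_E_conj[OF s Z] left_E_section[OF k Z] right_E_section[OF k bounded_ops_in[OF conj_in[OF s] Z]] by simp
  show "left.amp z (left.emb k X) = right.amp z (left.emb k X)"
    using left.amp_emb[OF z k X] right.amp_emb[OF z k bounded_ops_in[OF conj_in[OF s] X]]
      eq[OF X] eq[OF bounded_ops_in[OF z X]] inv[OF k X] by simp
qed

definition corner :: "'a l2_op \<Rightarrow> 'a l2_op" where
  "corner x = (\<lambda>X\<in>L2_space \<nu>. S (x (E X)))"

lemma corner_in:
  assumes x: "x \<in> bounded_ops \<mu>"
  shows "corner x \<in> bounded_ops \<nu>"
proof -
  note xE = bounded_ops_in[OF x E_in] and x'E = bounded_ops_in[OF op_adjoint_in[OF x] E_in]
  obtain C where C: "C \<ge> 0" "\<And>X. X \<in> L2_space \<mu> \<Longrightarrow> L2_norm \<mu> (x X) \<le> C * L2_norm \<mu> X"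
    using bounded_ops_bound[OF x] by blast
  show ?thesis
  proof (rule bounded_opsI[where S = "\<lambda>Z. S (op_adjoint \<mu> x (E Z))" and C = C])
    fix X assume X: "X \<in> L2_space \<nu>"
    have "c * (L2_norm \<nu> (S (x (E X))))\<^sup>2 \<le> (L2_norm \<mu> (x (E X)))\<^sup>2"
      by (rule left.norm_slice_le[OF one_in_range xE[OF X]])
    also have "\<dots> \<le> (C * L2_norm \<mu> (E X))\<^sup>2"
      by (rule power_mono[OF C(2)[OF E_in[OF X]] L2_norm_nonneg])
    also have "\<dots> = c * (C * L2_norm \<nu> X)\<^sup>2"
      by (simp add: power_mult_distrib left.emb_norm[OF one_in_range X])
    finally have "(L2_norm \<nu> (S (x (E X))))\<^sup>2 \<le> (C * L2_norm \<nu> X)\<^sup>2"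
      by (rule mult_left_le_imp_le[OF _ c_positive])
    then have "L2_norm \<nu> (S (x (E X))) \<le> C * L2_norm \<nu> X"
      by (rule power2_le_imp_le) (simp add: C(1))
    then show "L2_norm \<nu> (corner x X) \<le> C * L2_norm \<nu> X" using X by (simp add: corner_def)
  next
    fix X Z assume X: "X \<in> L2_space \<nu>" and Z: "Z \<in> L2_space \<nu>"
    have "of_real c * L2_inner \<nu> Z (S (x (E X))) = L2_inner \<mu> (E Z) (x (E X))"
      by (rule left.inner_emb_left[OF one_in_range xE[OF X] Z, symmetric])
    also have "\<dots> = L2_inner \<mu> (op_adjoint \<mu> x (E Z)) (E X)"
      by (rule op_adjoint_inner[OF x E_in[OF Z] E_in[OF X], symmetric])
    also have "\<dots> = of_real c * L2_inner \<nu> (S (op_adjoint \<mu> x (E Z))) X"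
      by (rule left.inner_emb_right[OF one_in_range x'E[OF Z] X])
    finally show "L2_inner \<nu> Z (corner x X) = L2_inner \<nu> (S (op_adjoint \<mu> x (E Z))) X"
      using c_positive X by (simp add: corner_def)
  qed (simp_all add: corner_def S_in xE x'E)
qed

text \<open>
  \<open>x\<close> commutes with the amplification of every \<open>y\<close> in the commutant of \<open>L1\<close>, with the left translations
  by the kernel, and with the product of left translation by \<open>\<sigma> k\<close> and right translation by its inverse.
  All of these preserve the functions supported on the kernel, so the relations pass to the corner.
\<close>

lemma corner_invariant_center:
  assumes x: "x \<in> commutant \<mu> (commutant \<mu> L)" and x': "x \<in> commutant \<mu> L"
  shows "corner x \<in> invariant_center"
proof -
  have xb: "x \<in> bounded_ops \<mu>" using x' commutant_subset by blast
  note xE = bounded_ops_in[OF xb E_in]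
  have bi: "corner x \<in> commutant \<nu> (commutant \<nu> L1)"
  proof (rule commutantI[OF corner_in[OF xb] commutant_subset])
    fix y X assume y: "y \<in> commutant \<nu> L1" and X: "X \<in> L2_space \<nu>"
    have y': "y \<in> bounded_ops \<nu>" using y commutant_subset by blast
    note yX = bounded_ops_in[OF y' X]
    have "S (x (E (y X))) = S (x (left.amp y (E X)))" by (simp add: left.amp_emb[OF y' one_in_range X])
    also have "\<dots> = S (left.amp y (x (E X)))"
      using commutantD[OF x left_amp_commutant[OF y] E_in[OF X]] by simp
    also have "\<dots> = y (S (x (E X)))" by (rule left.slice_amp[OF y' xE[OF X] one_in_range])
    finally show "corner x (y X) = y (corner x X)" using X yX by (simp add: corner_def)
  qed
  have co: "corner x \<in> commutant \<nu> L1"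
  proof (rule commutantI[OF corner_in[OF xb] kernel.left_operators_bounded])
    fix T X assume "T \<in> L1" and X: "X \<in> L2_space \<nu>"
    then obtain h where h: "h \<in> G1" "T = \<Lambda>1 h" by auto
    have hX: "\<Lambda>1 h X \<in> L2_space \<nu>" using kernel.left_in[of h] h X by (simp add: bounded_ops_in)
    have "S (x (E (\<Lambda>1 h X))) = S (x (\<Lambda> h (E X)))" by (simp add: left_E[OF h(1) X])
    also have "\<dots> = S (\<Lambda> h (x (E X)))"
      using commutantD[OF x' _ E_in[OF X], of "\<Lambda> h"] h by (simp add: G1_carrier)
    also have "\<dots> = \<Lambda>1 h (S (x (E X)))" by (rule S_left[OF h(1) xE[OF X]])
    finally show "corner x (T X) = T (corner x X)" using X hX h by (simp add: corner_def)
  qed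
  have "corner x (conj_operator (\<sigma> k) X) = conj_operator (\<sigma> k) (corner x X)"
    if k: "k \<in> K1" and X: "X \<in> L2_space \<nu>" for k X
  proof -
    note s = section_carrier[OF k] note s_inv = inv_closed[OF s]
    note cX = bounded_ops_in[OF conj_in[OF s] X] and LE = bounded_ops_in[OF left_in[OF s] E_in[OF X]]
    have "E (conj_operator (\<sigma> k) X) = right_translation (inv (\<sigma> k)) (\<Lambda> (\<sigma> k) (E X))"
      using left_E_conj[OF s X] right_inverse(2)[OF s E_in[OF cX]] by simp
    then have "S (x (E (conj_operator (\<sigma> k) X))) = S (x (right_translation (inv (\<sigma> k)) (\<Lambda> (\<sigma> k) (E X))))" by simp
    also have "\<dots> = S (right_translation (inv (\<sigma> k)) (\<Lambda> (\<sigma> k) (x (E X))))"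
      using commutantD[OF x right_commutant[OF s_inv] LE] commutantD[OF x' _ E_in[OF X], of "\<Lambda> (\<sigma> k)"] s by simp
    also have "\<dots> = conj_operator (\<sigma> k) (S (x (E X)))" by (rule S_conj[OF s xE[OF X]])
    finally show ?thesis using X cX by (simp add: corner_def)
  qed
  then show ?thesis using bi co by (simp add: invariant_center_def)
qed

text \<open>
  A central element maps functions supported on the kernel to functions supported on the kernel,
  so nothing is lost by passing to the corner.
\<close>

lemma central_E:
  assumes x: "x \<in> commutant \<mu> (commutant \<mu> L)" and x': "x \<in> commutant \<mu> L" and X: "X \<in> L2_space \<nu>"
  shows "x (E X) = E (corner x X)"
proof (rule left.slices_ext)
  have xb: "x \<in> bounded_ops \<mu>" using x' commutant_subset by blast
  note EX = E_in[OF X] and xE = bounded_ops_in[OF xb E_in[OF X]]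
  have cX: "corner x X = S (x (E X))" using X by (simp add: corner_def)
  show "x (E X) \<in> L2_space \<mu>" by (rule xE)
  show "E (corner x X) \<in> L2_space \<mu>" by (rule E_in[OF bounded_ops_in[OF corner_in[OF xb] X]])
  fix k assume k: "k \<in> K1"
  show "left.slice k (x (E X)) = left.slice k (E (corner x X))"
  proof (cases "k = 1")
    case True
    then show ?thesis by (simp add: cX S_E S_in xE)
  next
    case False
    have x_left: "\<forall>g\<in>carrier G. \<forall>X\<in>L2_space \<mu>. x (\<Lambda> g X) = \<Lambda> g (x X)"
      using commutantD[OF x'] by blast
    have x_right: "\<forall>g\<in>carrier G. \<forall>X\<in>L2_space \<mu>. x (right_translation g X) = right_translation g (x X)"
      using commutantD[OF x] right_commutant by blast
    have kernel_eq: "{w \<in> space \<mu>. \<Delta> w = 1} = G1" by (auto simp: space_haar G1_iff)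
    have "emeasure \<mu> G1 = ennreal c * emeasure \<nu> (space \<nu>)"
      using emeasure_kernel[OF sets.top] by (simp add: space_\<nu>)
    then have nz: "emeasure \<mu> {w \<in> space \<mu>. \<Delta> w = 1} \<noteq> 0"
      unfolding kernel_eq using c_positive kernel.haar_nonzero by simp
    have supp: "AE w in \<mu>. \<Delta> w \<noteq> 1 \<longrightarrow> L2_rep (E X) w = 0"
      using L2_rep_class[OF E_class(1)[OF L2_rep_in[OF X]]]
      unfolding E_class(2)[OF L2_rep_in[OF X], symmetric] L2_class_rep[OF X]
      by eventually_elim (simp add: extend_def)
    have "AE w in \<mu>. \<Delta> w = k \<longrightarrow> L2_rep (x (E X)) w = 0"
      by (rule central_preserves_level_sets[OF xb x_left x_right _ nz EX supp])
        (use level_measurable False in \<open>auto simp: space_haar\<close>)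
    from left.AE_fibre[OF k this] have "AE w in \<nu>. L2_rep (x (E X)) (\<sigma> k \<otimes> w) = 0"
      using AE_space by eventually_elim (simp add: left.\<kappa>_e[OF k])
    then have "left.slice k (x (E X)) = L2_zero \<nu>"
      unfolding left.slice_def L2_zero_def by (intro L2_class_cong left.slice_fun[OF k xE]) simp_all
    then show ?thesis
      using left.slice_emb[OF one_in_range k bounded_ops_in[OF corner_in[OF xb] X]] False by simp
  qed
qed

lemma E_scale: "X \<in> L2_space \<nu> \<Longrightarrow> E (L2_scale \<nu> a X) = L2_scale \<mu> a (E X)"
  by (rule L2_ext_inner[of _ \<mu>])
    (simp_all add: E_in left.inner_emb_right[OF one_in_range] L2_inner_scale_right S_in)

theorem ergodic_iff_factor:
  "centrally_ergodic K1 \<nu> (group_vna (kernel_group G \<mu>) \<nu>) (section_cocycle_action G \<mu> \<nu> \<sigma>)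
    \<longleftrightarrow> vn_factor \<mu> (group_vna G \<mu>)"
proof -
  have erg: "centrally_ergodic K1 \<nu> (group_vna (kernel_group G \<mu>) \<nu>) (section_cocycle_action G \<mu> \<nu> \<sigma>)
      \<longleftrightarrow> invariant_center = op_scalars \<nu>"
    by (simp add: centrally_ergodic_def section_cocycle_action_def fixed_center_eq)
  have fac: "vn_factor \<mu> (group_vna G \<mu>) \<longleftrightarrow> commutant \<mu> (commutant \<mu> L) \<inter> commutant \<mu> L = op_scalars \<mu>"
    unfolding vn_factor_def group_vna_def
    using bicommutant_von_neumann_algebra[OF left_operators_bounded left_operators_adjoint]
      vn_center_bicommutant[OF left_operators_bounded] by simp
  have scal: "op_scalars \<mu> \<subseteq> commutant \<mu> (commutant \<mu> L) \<inter> commutant \<mu> L"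
    using op_scalars_subset_commutant[OF commutant_subset] op_scalars_subset_commutant[OF left_operators_bounded] by blast
  have scal1: "op_scalars \<nu> \<subseteq> invariant_center"
  proof
    fix z assume z: "z \<in> op_scalars \<nu>"
    then obtain a where a: "z = op_scale \<nu> a (op_id \<nu>)" by (auto simp: op_scalars_def)
    have "z (conj_operator (\<sigma> k) X) = conj_operator (\<sigma> k) (z X)" if "k \<in> K1" "X \<in> L2_space \<nu>" for k X
      using conj_in[OF section_carrier[OF that(1)]] that(2)
      by (simp add: a bounded_ops_in bounded_ops_scale)
    then show "z \<in> invariant_center"
      using z op_scalars_subset_commutant[OF commutant_subset] op_scalars_subset_commutant[OF kernel.left_operators_bounded]
      unfolding invariant_center_def by blast
  qed
  show ?thesis
    unfolding erg fac
  proof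
    assume ergodic: "invariant_center = op_scalars \<nu>"
    have "x \<in> op_scalars \<mu>" if x: "x \<in> commutant \<mu> (commutant \<mu> L)" and x': "x \<in> commutant \<mu> L" for x
    proof -
      have xb: "x \<in> bounded_ops \<mu>" using x' commutant_subset by blast
      obtain a where a: "corner x = op_scale \<nu> a (op_id \<nu>)"
        using corner_invariant_center[OF x x'] ergodic by (auto simp: op_scalars_def)
      have "x = op_scale \<mu> a (op_id \<mu>)"
      proof (rule left.emb_operator_ext[OF xb op_scale_in[OF op_id_in]])
        fix k X assume k: "k \<in> K1" and X: "X \<in> L2_space \<nu>"
        note s = section_carrier[OF k]
        have "x (left.emb k X) = \<Lambda> (\<sigma> k) (x (E X))"
          using commutantD[OF x' _ E_in[OF X], of "\<Lambda> (\<sigma> k)"] s by (simp add: left_E_section[OF k X])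
        also have "\<dots> = \<Lambda> (\<sigma> k) (L2_scale \<mu> a (E X))"
          using central_E[OF x x' X] X by (simp add: a E_scale)
        also have "\<dots> = L2_scale \<mu> a (left.emb k X)"
          by (simp add: bounded_ops_scale[OF left_in[OF s] E_in[OF X]] left_E_section[OF k X])
        finally show "x (left.emb k X) = op_scale \<mu> a (op_id \<mu>) (left.emb k X)"
          by (simp add: left.emb_in[OF k X])
      qed
      then show ?thesis by (simp add: op_scalars_def)
    qed
    then show "commutant \<mu> (commutant \<mu> L) \<inter> commutant \<mu> L = op_scalars \<mu>" using scal by blast
  next
    assume factor: "commutant \<mu> (commutant \<mu> L) \<inter> commutant \<mu> L = op_scalars \<mu>"
    have "z \<in> op_scalars \<nu>" if z: "z \<in> invariant_center" for z
    proof -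
      have zb: "z \<in> bounded_ops \<nu>" using z commutant_subset unfolding invariant_center_def by blast
      have "left.amp z = right.amp z"
        by (rule left_amp_eq_right_amp[OF zb]) (use z in \<open>auto simp: invariant_center_def\<close>)
      then have "left.amp z \<in> commutant \<mu> (commutant \<mu> L) \<inter> commutant \<mu> L"
        using left_amp_commutant[of z] right_amp_bicommutant[of z] z unfolding invariant_center_def by auto
      then obtain a where a: "left.amp z = op_scale \<mu> a (op_id \<mu>)"
        unfolding factor by (auto simp: op_scalars_def)
      have "z = op_scale \<nu> a (op_id \<nu>)"
      proof (rule bounded_ops_ext[OF zb op_scale_in[OF op_id_in]])
        fix X assume X: "X \<in> L2_space \<nu>"
        have "z X = S (left.amp z (E X))"
          by (simp add: left.amp_emb[OF zb one_in_range X] S_E bounded_ops_in[OF zb X])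
        also have "\<dots> = S (E (L2_scale \<nu> a X))"
          unfolding a using X by (simp add: E_in E_scale)
        also have "\<dots> = L2_scale \<nu> a X" using X by (simp add: S_E)
        finally show "z X = op_scale \<nu> a (op_id \<nu>) X" using X by simp
      qed
      then show ?thesis by (simp add: op_scalars_def)
    qed
    then show "invariant_center = op_scalars \<nu>" using scal1 by blast
  qed
qed

end

theorem theorem4p6:
  fixes G :: "('g, 'b) monoid_scheme" and T :: "'g topology" and \<mu> \<nu> :: "'g measure"
    and \<sigma> :: "real \<Rightarrow> 'g"
  assumes "almost_unimodular_group G T \<mu>"
    and "second_countable T"
    and "left_haar_measure (kernel_group G \<mu>) (kernel_topology G T \<mu>) \<nu>"
    and "normalized_section G \<mu> \<sigma>"
  shows "centrally_ergodic (modular_range G \<mu>) \<nu> (group_vna (kernel_group G \<mu>) \<nu>)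
           (section_cocycle_action G \<mu> \<nu> \<sigma>)
         \<longleftrightarrow> vn_factor \<mu> (group_vna G \<mu>)"
proof -
  obtain c where "kernel_section G \<mu> \<nu> \<sigma> c"
    using kernel_section_almost_unimodular[OF assms] .
  then show ?thesis by (rule kernel_section.ergodic_iff_factor)
qed

end
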